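(* Let $\frac{2n}{n+2}<p<\infty$ (and $p>1$). Assume that $|F|\in L^p_{\mathrm{loc}}(\Omega_T)$ and that $u\in L^p_{\mathrm{loc}}(0,T;W^{1,p}_{\mathrm{loc}}(\Omega;\mathbb{R}^N))$ is a weak solution to $u_t-\operatorname{div}\mathcal{A}(z,\nabla u)=-\operatorname{div}|F|^{p-2}F$ in $\Omega_T$. Moreover, assume that there exist a parabolic cylinder $2Q=Q^\lambda_{2\rho}\Subset\Omega_T$, an exponent $1<q<p$ satisfying $\max\{2,p\}<\frac{q(n+2)}{n+p-q}$ and a constant $\gamma>1$ such that $$\gamma^{-1}\lambda\le\left(\frac1{|\alpha Q|}\iint_{\alpha Q}(|\nabla u|+|F|)^q\,dz\right)^{\frac1q}\le\lambda$$ for any $\alpha$ with $1\le\alpha\le2$. Then there exists a constant $c=c(n,N,p,q,\nu,L,\gamma)$ such that $$\left(\frac1{|Q|}\iint_{Q}|\nabla u|^p\,dz\right)^{\frac1p}\le c\left(\frac1{|2Q|}\iint_{2Q}|\nabla u|^q\,dz\right)^{\frac1q}+c\left(\frac1{|2Q|}\iint_{2Q}|F|^p\,dz\right)^{\frac1p}.$$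
   Context: $\Omega\subset\mathbb{R}^n$, $n\ge1$, is a bounded open domain, $T>0$, $\Omega_T=\Omega\times(0,T)$, $N\ge1$, $1<p<\infty$, $0<\nu<L<\infty$. $\mathcal{A}:\Omega_T\times\mathbb{R}^{Nn}\to\mathbb{R}^{Nn}$ is a Carathéodory vector field ($\mathcal{A}(\cdot,\xi)$ measurable for every $\xi$, $\mathcal{A}(z,\cdot)$ continuous for a.e. $z$) with $\nu|\xi|^p\le\mathcal{A}(z,\xi)\cdot\xi$ and $|\mathcal{A}(z,\xi)|\le L|\xi|^{p-1}$ for a.e. $z\in\Omega_T$ and every $\xi\in\mathbb{R}^{Nn}$. $F:\Omega_T\to\mathbb{R}^{Nn}$ is measurable. We write $z=(x,t)$, $dz=dx\,dt$, and $\nabla$ is the gradient in $x$. $u\in L^p_{\mathrm{loc}}(0,T;W^{1,p}_{\mathrm{loc}}(\Omega;\mathbb{R}^N))$ means that for all $\Omega'\Subset\Omega$ and $0<t_1<t_2<T$ one has $u(\cdot,t)\in W^{1,p}(\Omega';\mathbb{R}^N)$ for a.e. $t\in(t_1,t_2)$ and $\int_{t_1}^{t_2}\int_{\Omega'}(|u|^p+|\nabla u|^p)\,dx\,dt<\infty$. Such a $u$ is a weak solution if $\iint_{\Omega_T}(-u\cdot\varphi_t+\mathcal{A}(z,\nabla u)\cdot\nabla\varphi)\,dz=\iint_{\Omega_T}|F|^{p-2}F\cdot\nabla\varphi\,dz$ for every $\varphi\in C_0^\infty(\Omega_T;\mathbb{R}^N)$. The (intrinsic) parabolic cylinder of radius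 $\rho>0$ with scaling factor $\lambda>0$ centered at $(x_0,t_0)$ is $Q^\lambda_\rho=B_\rho(x_0)\times(t_0-\lambda^{2-p}\rho^2,t_0+\lambda^{2-p}\rho^2)$; with $Q=Q_\rho^\lambda$, $\alpha Q=Q^\lambda_{\alpha\rho}$ (same center, same $\lambda$). $2Q\Subset\Omega_T$ means that the closure of $2Q$ is a compact subset of $\Omega_T$. *)

theory Defs
  imports "HOL-Analysis.Analysis"
begin

text \<open>
  Space-time points are \<open>z = (x, t)\<close> in \<open>(real^'n) \<times> real\<close>. Elements of \<open>R^{Nn}\<close> are matrices
  \<open>real^'n^'m\<close> with \<open>N = CARD('m)\<close> rows; \<open>norm\<close> and \<open>\<bullet>\<close> on this type are the Euclidean (Frobenius)
  norm and inner product. Measurability is Lebesgue measurability.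
\<close>

definition compactly_contained :: "'a::topological_space set \<Rightarrow> 'a set \<Rightarrow> bool" where
  "compactly_contained U V \<longleftrightarrow> compact (closure U) \<and> closure U \<subseteq> V"

primrec Ck :: "nat \<Rightarrow> ('a::euclidean_space \<Rightarrow> 'b::real_normed_vector) \<Rightarrow> bool" where
  "Ck 0 f \<longleftrightarrow> continuous_on UNIV f"
| "Ck (Suc k) f \<longleftrightarrow> (\<forall>x. f differentiable (at x)) \<and> (\<forall>v. Ck k (\<lambda>x. frechet_derivative f (at x) v))"

text \<open>\<open>C_0^\<infinity>(U)\<close>; its members are regarded as functions on the whole space, extended by zero.\<close>

definition test_functions :: "'a::euclidean_space set \<Rightarrow> ('a \<Rightarrow> 'b::real_normed_vector) set" where
  "test_functions U = {\<phi>. (\<forall>k. Ck k \<phi>) \<and> compactly_contained {x. \<phi> x \<noteq> 0} U}"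

definition Lp_on :: "real \<Rightarrow> 'a::euclidean_space set \<Rightarrow> ('a \<Rightarrow> 'b::euclidean_space) \<Rightarrow> bool" where
  "Lp_on p S f \<longleftrightarrow> f \<in> borel_measurable (lebesgue_on S)
     \<and> set_integrable lebesgue S (\<lambda>x. norm (f x) powr p)"

definition Lp_loc :: "real \<Rightarrow> 'a::euclidean_space set \<Rightarrow> ('a \<Rightarrow> 'b::euclidean_space) \<Rightarrow> bool" where
  "Lp_loc p S f \<longleftrightarrow> (\<forall>K. compact K \<and> K \<subseteq> S \<longrightarrow> Lp_on p K f)"

definition weak_gradient ::
    "(real^'n) set \<Rightarrow> (real^'n \<Rightarrow> real^'m) \<Rightarrow> (real^'n \<Rightarrow> real^'n^'m) \<Rightarrow> bool" where
  "weak_gradient U f Df \<longleftrightarrow> Lp_loc 1 U f \<and> Lp_loc 1 U Df \<and>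
     (\<forall>\<psi> \<in> test_functions U. \<forall>i j.
        (LINT x:U|lebesgue. f x $ i * frechet_derivative \<psi> (at x) (axis j 1))
          = - (LINT x:U|lebesgue. Df x $ i $ j * \<psi> x))"

definition W1p :: "real \<Rightarrow> (real^'n) set \<Rightarrow> (real^'n \<Rightarrow> real^'m) \<Rightarrow> bool" where
  "W1p p U f \<longleftrightarrow> Lp_on p U f \<and> (\<exists>Df. weak_gradient U f Df \<and> Lp_on p U Df)"

abbreviation space_time :: "(real^'n) set \<Rightarrow> real \<Rightarrow> ((real^'n) \<times> real) set" where
  "space_time \<Omega> T \<equiv> \<Omega> \<times> {0<..<T}"

text \<open>\<open>Du\<close> is a measurable representative of the gradient of \<open>u\<close> in \<open>x\<close>, which is unique up to
  null sets.\<close>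

definition spatial_gradient :: "(real^'n) set \<Rightarrow> real \<Rightarrow> ((real^'n) \<times> real \<Rightarrow> real^'m)
    \<Rightarrow> ((real^'n) \<times> real \<Rightarrow> real^'n^'m) \<Rightarrow> bool" where
  "spatial_gradient \<Omega> T u Du \<longleftrightarrow> Du \<in> borel_measurable (lebesgue_on (space_time \<Omega> T))
     \<and> (AE t in lebesgue_on {0<..<T}. weak_gradient \<Omega> (\<lambda>x. u (x, t)) (\<lambda>x. Du (x, t)))"

text \<open>\<open>u \<in> L^p_loc(0,T; W^{1,p}_loc(\<Omega>; R^N))\<close> with \<open>Du\<close> as its spatial gradient.\<close>

definition Lp_loc_W1p_loc :: "real \<Rightarrow> (real^'n) set \<Rightarrow> real \<Rightarrow> ((real^'n) \<times> real \<Rightarrow> real^'m)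
    \<Rightarrow> ((real^'n) \<times> real \<Rightarrow> real^'n^'m) \<Rightarrow> bool" where
  "Lp_loc_W1p_loc p \<Omega> T u Du \<longleftrightarrow>
     u \<in> borel_measurable (lebesgue_on (space_time \<Omega> T)) \<and> spatial_gradient \<Omega> T u Du \<and>
     (\<forall>\<Omega>' t\<^sub>1 t\<^sub>2. open \<Omega>' \<and> compactly_contained \<Omega>' \<Omega> \<and> 0 < t\<^sub>1 \<and> t\<^sub>1 < t\<^sub>2 \<and> t\<^sub>2 < T \<longrightarrow>
        (AE t in lebesgue_on {t\<^sub>1<..<t\<^sub>2}. W1p p \<Omega>' (\<lambda>x. u (x, t))) \<and>
        set_integrable lebesgue (\<Omega>' \<times> {t\<^sub>1<..<t\<^sub>2})
          (\<lambda>z. norm (u z) powr p + norm (Du z) powr p))"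

definition caratheodory :: "'a::euclidean_space set \<Rightarrow> ('a \<Rightarrow> 'b::euclidean_space \<Rightarrow> 'b) \<Rightarrow> bool" where
  "caratheodory S A \<longleftrightarrow> (\<forall>\<xi>. (\<lambda>z. A z \<xi>) \<in> borel_measurable (lebesgue_on S))
     \<and> (AE z in lebesgue_on S. continuous_on UNIV (A z))"

definition p_growth ::
    "real \<Rightarrow> real \<Rightarrow> real \<Rightarrow> 'a::euclidean_space set \<Rightarrow> ('a \<Rightarrow> 'b::euclidean_space \<Rightarrow> 'b) \<Rightarrow> bool" where
  "p_growth p \<nu> L S A \<longleftrightarrow> (AE z in lebesgue_on S. \<forall>\<xi>.
     \<nu> * norm \<xi> powr p \<le> A z \<xi> \<bullet> \<xi> \<and> norm (A z \<xi>) \<le> L * norm \<xi> powr (p - 1))"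

definition time_deriv :: "((real^'n) \<times> real \<Rightarrow> real^'m) \<Rightarrow> (real^'n) \<times> real \<Rightarrow> real^'m" where
  "time_deriv \<phi> z = vector_derivative (\<lambda>s. \<phi> (fst z, s)) (at (snd z))"

definition space_grad :: "((real^'n) \<times> real \<Rightarrow> real^'m) \<Rightarrow> (real^'n) \<times> real \<Rightarrow> real^'n^'m" where
  "space_grad \<phi> z = jacobian (\<lambda>y. \<phi> (y, snd z)) (at (fst z))"

text \<open>Weak form of \<open>u_t - div A(z, Du) = - div (|F|^{p-2} F)\<close>. The class of \<open>u\<close> is not part of it;
  if \<open>Lp_loc_W1p_loc p \<Omega> T u Du\<close>, \<open>Lp_loc p (space_time \<Omega> T) F\<close>, \<open>caratheodory\<close> and \<open>p_growth\<close>
  hold, then both integrands are integrable.\<close>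

definition weak_solution :: "real \<Rightarrow> (real^'n) set \<Rightarrow> real
    \<Rightarrow> ((real^'n) \<times> real \<Rightarrow> real^'n^'m \<Rightarrow> real^'n^'m) \<Rightarrow> ((real^'n) \<times> real \<Rightarrow> real^'n^'m)
    \<Rightarrow> ((real^'n) \<times> real \<Rightarrow> real^'m) \<Rightarrow> ((real^'n) \<times> real \<Rightarrow> real^'n^'m) \<Rightarrow> bool" where
  "weak_solution p \<Omega> T A F u Du \<longleftrightarrow> (\<forall>\<phi> \<in> test_functions (space_time \<Omega> T).
     (LINT z:space_time \<Omega> T|lebesgue. - (u z \<bullet> time_deriv \<phi> z) + A z (Du z) \<bullet> space_grad \<phi> z)
       = (LINT z:space_time \<Omega> T|lebesgue.
            (norm (F z) powr (p - 2) *\<^sub>R F z) \<bullet> space_grad \<phi> z))"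

definition cylinder ::
    "real \<Rightarrow> real \<Rightarrow> real^'n \<Rightarrow> real \<Rightarrow> real \<Rightarrow> ((real^'n) \<times> real) set" where
  "cylinder p lam x\<^sub>0 t\<^sub>0 \<rho> =
     ball x\<^sub>0 \<rho> \<times> {t\<^sub>0 - lam powr (2 - p) * \<rho>\<^sup>2 <..< t\<^sub>0 + lam powr (2 - p) * \<rho>\<^sup>2}"

definition avg :: "'a::euclidean_space set \<Rightarrow> ('a \<Rightarrow> real) \<Rightarrow> real" where
  "avg S f = (1 / measure lebesgue S) * (LINT z:S|lebesgue. f z)"

end

theory Submission
  imports Defs
begin

text \<open>
  Write \<open>Q\<close> for the cylinder of radius \<open>\<rho>\<close> and \<open>\<lambda>\<close> for its scaling factor. The lower bound of the
  intrinsic hypothesis, the triangle inequality and Jensen's inequality for \<open>|F|\<close> bound \<open>\<lambda>\<close> by a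
  multiple of the right-hand side of the theorem. So it suffices to bound the average of \<open>|Du|^p\<close>
  over \<open>Q\<close> by a multiple of \<open>\<lambda>^p\<close> plus the average of \<open>|F|^p\<close> over \<open>2Q\<close>. The parabolic change of
  variables \<open>(y, s) \<mapsto> (x0 + \<rho> y, t0 + \<lambda>^{2-p} \<rho>^2 s)\<close>, with \<open>Du\<close> divided by \<open>\<lambda>\<close>, reduces this to a
  statement on standard cylinders (\<open>unit_cylinder_estimate\<close>): if \<open>D\<close> is the spatial gradient of a
  solution and \<open>\<integral> |D|^q\<close> is at most a fixed \<open>M\<close> on the cylinder of radius 2, then the integral of
  \<open>|D|^p\<close> over the cylinder of radius 1 is at most \<open>C (1 + \<integral> f^p)\<close>.

  That statement is a Caccioppoli estimate. The lower order terms on its right-hand side are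
  powers of the oscillation of the solution. On each time slice they are interpolated between the
  energy and a Sobolev-Poincare norm, and only the \<open>L^q\<close> norm of the gradient enters the latter.
  Let \<open>m = max 2 p\<close>. The hypothesis on \<open>q\<close> contains the two conditions for this to close
  (\<open>reverse_Holder_exponents\<close>): \<open>n (m - q) < 2 q\<close> makes the Sobolev exponent subcritical, and
  \<open>m - q < 2\<close> makes the energy appear to a power \<open>(m - q) / 2\<close> below one, so that Young's
  inequality absorbs it.

  Two devices keep the argument elementary. From the solution one subtracts its spatial mean, at
  each time, with respect to the same weight \<open>\<eta>\<close> that localises the energy. The derivative of this
  mean is then orthogonal to the oscillation, so that no bound for the oscillation of means in
  time and no parabolic Poincare inequality is needed (\<open>energy_deriv\<close>). Secondly, the equation is
  tested only with translates of a smooth kernel. The resulting mollifications satisfy a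
  conservation law \<open>v_t = div H\<close> pointwise (\<open>mollify_conservation_law\<close>); the energy estimate is a
  computation with smooth functions (\<open>absorbed_energy_estimate\<close>), and the structure of the
  equation is used only after the kernel has been contracted to a point (\<open>mollify_pairing_limit\<close>).
\<close>

section \<open>Integral inequalities and integrals depending on a parameter\<close>

text \<open>
  Hoelder's inequality with exponents \<open>1/\<theta>\<close> and \<open>1/(1-\<theta>)\<close>, in the form that interpolation uses. It
  is the pointwise weighted inequality of Young, applied to \<open>f\<close> and \<open>g\<close> divided by their
  integrals.
\<close>

lemma Holder_integral:
  fixes f g :: "'a \<Rightarrow> real"
  assumes \<theta>: "0 < \<theta>" "\<theta> < 1" and nn: "\<And>x. 0 \<le> f x" "\<And>x. 0 \<le> g x"
    and f: "integrable M f" and g: "integrable M g"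
  shows "integrable M (\<lambda>x. f x powr \<theta> * g x powr (1 - \<theta>))" (is "integrable M ?h")
    and "(\<integral>x. f x powr \<theta> * g x powr (1 - \<theta>) \<partial>M) \<le> (\<integral>x. f x \<partial>M) powr \<theta> * (\<integral>x. g x \<partial>M) powr (1 - \<theta>)"
proof -
  have young: "a powr \<theta> * b powr (1 - \<theta>) \<le> \<theta> * a + (1 - \<theta>) * b" if "0 \<le> a" "0 \<le> b" for a b :: real
  proof (cases "a = 0 \<or> b = 0")
    case True then show ?thesis using \<theta> that by auto
  next
    case False then show ?thesis using Youngs_inequality_0[of \<theta> "1 - \<theta>" a b] \<theta> that by auto
  qed
  have [measurable]: "f \<in> borel_measurable M" "g \<in> borel_measurable M" using f g by auto
  show int: "integrable M ?h"
  proof (rule Bochner_Integration.integrable_bound)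
    show "integrable M (\<lambda>x. \<theta> * f x + (1 - \<theta>) * g x)" using f g by auto
    show "AE x in M. norm (?h x) \<le> norm (\<theta> * f x + (1 - \<theta>) * g x)"
      using young[OF nn(1) nn(2)] \<theta> nn by (intro AE_I2) (simp add: abs_of_nonneg add_nonneg_nonneg)
  qed simp
  define A where "A = integral\<^sup>L M f"
  define B where "B = integral\<^sup>L M g"
  have AB: "0 \<le> A" "0 \<le> B" unfolding A_def B_def using nn by auto
  show "integral\<^sup>L M ?h \<le> integral\<^sup>L M f powr \<theta> * integral\<^sup>L M g powr (1 - \<theta>)"
  proof (cases "A = 0 \<or> B = 0")
    case True
    then have "AE x in M. ?h x = 0"
    proof
      assume "A = 0"
      then have "AE x in M. f x = 0" unfolding A_def using integral_nonneg_eq_0_iff_AE[OF f] nn by auto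
      then show ?thesis by eventually_elim (use \<theta> in auto)
    next
      assume "B = 0"
      then have "AE x in M. g x = 0" unfolding B_def using integral_nonneg_eq_0_iff_AE[OF g] nn by auto
      then show ?thesis by eventually_elim (use \<theta> in auto)
    qed
    then have "integral\<^sup>L M ?h = 0" by (rule integral_eq_zero_AE)
    then show ?thesis by simp
  next
    case False
    then have pos: "A > 0" "B > 0" using AB by auto
    have "integral\<^sup>L M ?h \<le> (\<integral>x. A powr \<theta> * B powr (1 - \<theta>) * (\<theta> * (f x / A) + (1 - \<theta>) * (g x / B)) \<partial>M)"
    proof (rule integral_mono[OF int])
      show "integrable M (\<lambda>x. A powr \<theta> * B powr (1 - \<theta>) * (\<theta> * (f x / A) + (1 - \<theta>) * (g x / B)))"
        using f g by auto
      fix x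
      have "?h x = A powr \<theta> * B powr (1 - \<theta>) * ((f x / A) powr \<theta> * (g x / B) powr (1 - \<theta>))"
        using pos nn by (simp add: powr_divide)
      also have "\<dots> \<le> A powr \<theta> * B powr (1 - \<theta>) * (\<theta> * (f x / A) + (1 - \<theta>) * (g x / B))"
        by (intro mult_left_mono young) (use pos nn in auto)
      finally show "?h x \<le> A powr \<theta> * B powr (1 - \<theta>) * (\<theta> * (f x / A) + (1 - \<theta>) * (g x / B))" .
    qed
    also have "\<dots> = A powr \<theta> * B powr (1 - \<theta>) * (\<theta> * (A / A) + (1 - \<theta>) * (B / B))"
      using f g by (simp add: A_def B_def)
    also have "\<dots> = A powr \<theta> * B powr (1 - \<theta>)" using pos by simp
    finally show ?thesis by (simp add: A_def B_def)
  qed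
qed

text \<open>
  Jensen's inequality for the power \<open>r\<close> and a weight \<open>k\<close> of arbitrary total mass. It is Hoelder's
  inequality for \<open>k g^r\<close> and \<open>k\<close>.
\<close>

lemma Jensen_powr:
  fixes k g :: "'a \<Rightarrow> real"
  assumes r: "1 \<le> r" and nn: "\<And>x. 0 \<le> k x" "\<And>x. 0 \<le> g x"
    and k: "integrable M k" and kg: "integrable M (\<lambda>x. k x * g x powr r)"
  shows "integrable M (\<lambda>x. k x * g x)"
    and "(\<integral>x. k x * g x \<partial>M) powr r \<le> (\<integral>x. k x \<partial>M) powr (r - 1) * (\<integral>x. k x * g x powr r \<partial>M)"
proof -
  have *: "integrable M (\<lambda>x. k x * g x) \<and> (\<integral>x. k x * g x \<partial>M) powr r \<le> (\<integral>x. k x \<partial>M) powr (r - 1) * (\<integral>x. k x * g x powr r \<partial>M)"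
  proof (cases "r = 1")
    case True
    have "(\<integral>x. k x * g x \<partial>M) \<ge> 0" using nn by simp
    moreover have "(\<integral>x. k x * g x \<partial>M) = 0" if "(\<integral>x. k x \<partial>M) = 0"
    proof -
      have "AE x in M. k x = 0" using integral_nonneg_eq_0_iff_AE[OF k] nn that by auto
      then have "AE x in M. k x * g x = 0" by auto
      then show ?thesis by (simp add: integral_eq_zero_AE)
    qed
    ultimately show ?thesis using True kg nn by auto
  next
    case False
    then have r1: "1 < r" using r by simp
    have th: "0 < 1/r" "1/r < 1" using r1 by auto
    have eq: "(k x * g x powr r) powr (1/r) * k x powr (1 - 1/r) = k x * g x" for x
    proof -
      have "(k x * g x powr r) powr (1/r) * k x powr (1 - 1/r) = (k x powr (1/r) * k x powr (1 - 1/r)) * g x"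
        using nn[of x] r1 by (simp add: powr_mult powr_powr)
      also have "k x powr (1/r) * k x powr (1 - 1/r) = k x"
        using nn[of x] by (simp flip: powr_add)
      finally show ?thesis .
    qed
    note H = Holder_integral[OF th _ _ kg k, unfolded eq]
    have 1: "integrable M (\<lambda>x. k x * g x)" using nn by (intro H(1)) auto
    have "(\<integral>x. k x * g x \<partial>M) \<le> (\<integral>x. k x * g x powr r \<partial>M) powr (1/r) * (\<integral>x. k x \<partial>M) powr (1 - 1/r)"
      using nn by (intro H(2)) auto
    then have "(\<integral>x. k x * g x \<partial>M) powr r \<le> ((\<integral>x. k x * g x powr r \<partial>M) powr (1/r) * (\<integral>x. k x \<partial>M) powr (1 - 1/r)) powr r"
      using r nn by (intro powr_mono2) auto
    also have "\<dots> = (\<integral>x. k x \<partial>M) powr (r - 1) * (\<integral>x. k x * g x powr r \<partial>M)"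
    proof -
      have "(1 - 1/r) * r = r - 1" using r1 by (simp add: field_simps)
      then show ?thesis using r1 nn by (simp add: powr_mult powr_powr)
    qed
    finally show ?thesis using 1 by blast
  qed
  then show "integrable M (\<lambda>x. k x * g x)"
    and "(\<integral>x. k x * g x \<partial>M) powr r \<le> (\<integral>x. k x \<partial>M) powr (r - 1) * (\<integral>x. k x * g x powr r \<partial>M)" by auto
qed

text \<open>
  Differentiation under the integral sign with a Frechet derivative. The difference quotients are
  dominated because of the mean value inequality on the ball.
\<close>

lemma has_derivative_integral_param:
  fixes k :: "'a::euclidean_space \<Rightarrow> 'c \<Rightarrow> 'b::{banach,second_countable_topology}"
  assumes \<delta>: "0 < \<delta>"
    and der: "\<And>z y. z \<in> ball z0 \<delta> \<Longrightarrow> y \<in> space M \<Longrightarrow> ((\<lambda>z. k z y) has_derivative k' z y) (at z)"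
    and bd: "\<And>z y v. z \<in> ball z0 \<delta> \<Longrightarrow> y \<in> space M \<Longrightarrow> norm (k' z y v) \<le> g y * norm v"
    and int: "\<And>z. z \<in> ball z0 \<delta> \<Longrightarrow> integrable M (k z)"
    and g: "integrable M g"
  shows "integrable M (\<lambda>y. k' z0 y v)"
    and "((\<lambda>z. \<integral>y. k z y \<partial>M) has_derivative (\<lambda>v. \<integral>y. k' z0 y v \<partial>M)) (at z0)"
proof -
  have z0: "z0 \<in> ball z0 \<delta>" using \<delta> by simp
  have lin: "y \<in> space M \<Longrightarrow> bounded_linear (k' z0 y)" for y using der[OF z0] by (rule has_derivative_bounded_linear)
  have quot: "(\<lambda>i. (k (X i) y - k z0 y - k' z0 y (X i - z0)) /\<^sub>R norm (X i - z0)) \<longlonglongrightarrow> 0"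
    if "X \<longlonglongrightarrow> z0" "\<forall>i. X i \<noteq> z0" "y \<in> space M" for X y
  proof -
    have "((\<lambda>x. (k x y - k z0 y - k' z0 y (x - z0)) /\<^sub>R norm (x - z0)) \<longlongrightarrow> 0) (at z0)"
      using der[OF z0 that(3)] unfolding has_derivative_at_within by (simp add: divide_inverse diff_diff_eq)
    then show ?thesis using that unfolding tendsto_at_iff_sequentially by (auto simp: o_def)
  qed
  \<comment> \<open>The derivative is measurable as a limit of difference quotients in direction v.\<close>
  have meas: "(\<lambda>y. k' z0 y v) \<in> borel_measurable M" for v
  proof (cases "v = 0")
    case True
    have "(\<lambda>y. k' z0 y v) \<in> borel_measurable M \<longleftrightarrow> (\<lambda>y. 0::'b) \<in> borel_measurable M"
      by (rule measurable_cong) (use True lin in \<open>auto simp: linear_simps\<close>)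
    then show ?thesis by simp
  next
    case False
    define s where "s = \<delta> / (2 * norm v)"
    have s: "s > 0" using False \<delta> by (simp add: s_def)
    define X where "X n = z0 + (s * inverse (real (Suc n))) *\<^sub>R v" for n
    have Xb: "X n \<in> ball z0 \<delta>" for n
    proof -
      have "norm ((s * inverse (real (Suc n))) *\<^sub>R v) = \<delta> / 2 * inverse (real (Suc n))"
        using False \<delta> by (simp add: s_def divide_simps)
      also have "\<dots> \<le> \<delta> / 2 * 1" using \<delta> by (intro mult_left_mono) (auto simp: divide_simps)
      finally show ?thesis using \<delta> by (simp add: X_def dist_norm)
    qed
    show ?thesis
    proof (rule borel_measurable_LIMSEQ_metric)
      fix n show "(\<lambda>y. (k (X n) y - k z0 y) /\<^sub>R (s * inverse (real (Suc n)))) \<in> borel_measurable M"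
        using int[OF Xb[of n]] int[OF z0] by (intro borel_measurable_scaleR borel_measurable_diff) auto
    next
      fix y assume y: "y \<in> space M"
      have "(\<lambda>n. s * inverse (real (Suc n))) \<longlonglongrightarrow> s * 0"
        by (intro tendsto_mult tendsto_const LIMSEQ_inverse_real_of_nat)
      then have t0: "(\<lambda>n. s * inverse (real (Suc n))) \<longlonglongrightarrow> 0" by simp
      then have "X \<longlonglongrightarrow> z0 + 0 *\<^sub>R v" unfolding X_def by (intro tendsto_intros)
      then have Xl: "X \<longlonglongrightarrow> z0" by simp
      have "(\<lambda>i. (k (X i) y - k z0 y - k' z0 y (X i - z0)) /\<^sub>R norm (X i - z0)) \<longlonglongrightarrow> 0"
        by (rule quot[OF Xl _ y]) (use s False in \<open>simp add: X_def\<close>)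
      then have "(\<lambda>i. norm v *\<^sub>R ((k (X i) y - k z0 y - k' z0 y (X i - z0)) /\<^sub>R norm (X i - z0)) + k' z0 y v) \<longlonglongrightarrow> norm v *\<^sub>R 0 + k' z0 y v"
        by (intro tendsto_intros)
      moreover have "norm v *\<^sub>R ((k (X i) y - k z0 y - k' z0 y (X i - z0)) /\<^sub>R norm (X i - z0)) + k' z0 y v
          = (k (X i) y - k z0 y) /\<^sub>R (s * inverse (real (Suc i)))" for i
      proof -
        define t where "t = s * inverse (real (Suc i))"
        have t: "t > 0" using s by (simp add: t_def)
        have "X i - z0 = t *\<^sub>R v" by (simp add: X_def t_def)
        then have "k' z0 y (X i - z0) = t *\<^sub>R k' z0 y v" "norm (X i - z0) = t * norm v"
          using lin[OF y] t by (auto simp: linear_simps)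
        then show ?thesis using t False unfolding t_def[symmetric]
          by (simp add: algebra_simps)
      qed
      ultimately show "(\<lambda>n. (k (X n) y - k z0 y) /\<^sub>R (s * inverse (real (Suc n)))) \<longlonglongrightarrow> k' z0 y v" by simp
    qed
  qed
  show int': "integrable M (\<lambda>y. k' z0 y v)" for v
    by (rule Bochner_Integration.integrable_bound[where f="\<lambda>y. g y * norm v"])
       (use g meas bd[OF z0] in \<open>auto intro!: AE_I2 intro: order_trans[OF _ abs_ge_self]\<close>)
  show "((\<lambda>z. \<integral>y. k z y \<partial>M) has_derivative (\<lambda>v. \<integral>y. k' z0 y v \<partial>M)) (at z0)"
    unfolding has_derivative_at_within
  proof
    show "bounded_linear (\<lambda>v. \<integral>y. k' z0 y v \<partial>M)"
    proof (rule bounded_linear_intro[where K="integral\<^sup>L M g"])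
      fix v w show "(\<integral>y. k' z0 y (v + w) \<partial>M) = (\<integral>y. k' z0 y v \<partial>M) + (\<integral>y. k' z0 y w \<partial>M)"
        by (subst Bochner_Integration.integral_add[symmetric])
           (auto intro!: int' Bochner_Integration.integral_cong simp: linear_simps lin)
    next
      fix c v show "(\<integral>y. k' z0 y (c *\<^sub>R v) \<partial>M) = c *\<^sub>R (\<integral>y. k' z0 y v \<partial>M)"
        using Bochner_Integration.integral_cong[OF refl, of M "\<lambda>y. k' z0 y (c *\<^sub>R v)" "\<lambda>y. c *\<^sub>R k' z0 y v"]
        by (simp add: linear_simps lin)
    next
      fix v
      have "norm (\<integral>y. k' z0 y v \<partial>M) \<le> (\<integral>y. g y * norm v \<partial>M)"
        by (rule order_trans[OF integral_norm_bound], rule integral_mono) (use int' g bd[OF z0] in auto)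
      then show "norm (\<integral>y. k' z0 y v \<partial>M) \<le> norm v * integral\<^sup>L M g" by (simp add: mult.commute)
    qed
    show "((\<lambda>x. ((\<integral>y. k x y \<partial>M) - (\<integral>y. k z0 y \<partial>M) - (\<integral>y. k' z0 y (x - z0) \<partial>M)) /\<^sub>R norm (x - z0)) \<longlongrightarrow> 0) (at z0)"
      unfolding tendsto_at_iff_sequentially o_def
    proof (intro allI impI)
      fix X assume X: "\<forall>i. X i \<in> UNIV - {z0}" "X \<longlonglongrightarrow> z0"
      obtain N where N: "\<And>i. i \<ge> N \<Longrightarrow> X i \<in> ball z0 \<delta>"
        using X(2) \<delta> unfolding lim_sequentially by (metis dist_commute mem_ball)
      define Y where "Y i = X (i + N)" for i
      have Y: "Y i \<in> ball z0 \<delta>" "Y i \<noteq> z0" for i using N X(1) by (auto simp: Y_def)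
      have Ylim: "Y \<longlonglongrightarrow> z0" unfolding Y_def using X(2) by (rule LIMSEQ_ignore_initial_segment)
      define E where "E i y = (k (Y i) y - k z0 y - k' z0 y (Y i - z0)) /\<^sub>R norm (Y i - z0)" for i y
      have "(\<lambda>i. \<integral>y. E i y \<partial>M) \<longlonglongrightarrow> (\<integral>y. 0 \<partial>M)"
      proof (rule integral_dominated_convergence[where w="\<lambda>y. 2 * g y"])
        show "(\<lambda>x. 0) \<in> borel_measurable M" by simp
        show "E i \<in> borel_measurable M" for i unfolding E_def using int[OF Y(1)[of i]] int[OF z0] int'[of "Y i - z0"] by auto
        show "integrable M (\<lambda>y. 2 * g y)" using g by simp
        show "AE y in M. (\<lambda>i. E i y) \<longlonglongrightarrow> 0" unfolding E_def using Ylim Y(2) by (intro AE_I2 quot) auto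
        fix i show "AE y in M. norm (E i y) \<le> 2 * g y"
        proof (rule AE_I2)
          fix y assume y: "y \<in> space M"
          have "norm (k (Y i) y - k z0 y) \<le> g y * norm (Y i - z0)"
          proof (rule differentiable_bound[OF convex_ball[of z0 \<delta>] _ _ Y(1) z0])
            fix x assume "x \<in> ball z0 \<delta>"
            then show "((\<lambda>x. k x y) has_derivative k' x y) (at x within ball z0 \<delta>)"
              "onorm (k' x y) \<le> g y"
              using der[OF _ y] bd[OF _ y] by (auto intro: has_derivative_at_withinI intro!: onorm_le)
          qed
          moreover have "norm (k' z0 y (Y i - z0)) \<le> g y * norm (Y i - z0)" by (rule bd[OF z0 y])
          ultimately have "norm (k (Y i) y - k z0 y - k' z0 y (Y i - z0)) \<le> 2 * g y * norm (Y i - z0)"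
            by (intro order_trans[OF norm_triangle_ineq4]) auto
          then show "norm (E i y) \<le> 2 * g y" unfolding E_def using Y(2)[of i] by (simp add: divide_simps)
        qed
      qed
      moreover have "(\<integral>y. E i y \<partial>M) = ((\<integral>y. k (Y i) y \<partial>M) - (\<integral>y. k z0 y \<partial>M) - (\<integral>y. k' z0 y (Y i - z0) \<partial>M)) /\<^sub>R norm (Y i - z0)" for i
        unfolding E_def using int[OF Y(1)[of i]] int[OF z0] int'[of "Y i - z0"] by simp
      ultimately have "(\<lambda>i. ((\<integral>y. k (Y i) y \<partial>M) - (\<integral>y. k z0 y \<partial>M) - (\<integral>y. k' z0 y (Y i - z0) \<partial>M)) /\<^sub>R norm (Y i - z0)) \<longlonglongrightarrow> 0"
        by simp
      then show "(\<lambda>i. ((\<integral>y. k (X i) y \<partial>M) - (\<integral>y. k z0 y \<partial>M) - (\<integral>y. k' z0 y (X i - z0) \<partial>M)) /\<^sub>R norm (X i - z0)) \<longlonglongrightarrow> 0"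
        unfolding Y_def by (rule LIMSEQ_offset)
    qed
  qed
qed

lemma isCont_integral_param:
  fixes k :: "'a::euclidean_space \<Rightarrow> 'c \<Rightarrow> 'b::{banach,second_countable_topology}"
  assumes \<delta>: "0 < \<delta>"
    and cont: "\<And>y. y \<in> space M \<Longrightarrow> isCont (\<lambda>z. k z y) z0"
    and bd: "\<And>z y. z \<in> ball z0 \<delta> \<Longrightarrow> y \<in> space M \<Longrightarrow> norm (k z y) \<le> g y"
    and meas: "\<And>z. k z \<in> borel_measurable M"
    and g: "integrable M g"
  shows "isCont (\<lambda>z. \<integral>y. k z y \<partial>M) z0"
  unfolding continuous_at_sequentially
proof (intro allI impI)
  fix X assume X: "X \<longlonglongrightarrow> z0"
  obtain N where N: "\<And>i. i \<ge> N \<Longrightarrow> X i \<in> ball z0 \<delta>"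
    using X \<delta> unfolding lim_sequentially by (metis dist_commute mem_ball)
  have Ylim: "(\<lambda>i. X (i + N)) \<longlonglongrightarrow> z0" using X by (rule LIMSEQ_ignore_initial_segment)
  have "(\<lambda>i. \<integral>y. k (X (i + N)) y \<partial>M) \<longlonglongrightarrow> (\<integral>y. k z0 y \<partial>M)"
  proof (rule integral_dominated_convergence[where w=g])
    show "AE y in M. (\<lambda>i. k (X (i + N)) y) \<longlonglongrightarrow> k z0 y"
      using cont Ylim by (intro AE_I2 isCont_tendsto_compose[where g="\<lambda>z. k z _"]) auto
  qed (use meas g bd N in auto)
  then show "((\<lambda>z. \<integral>y. k z y \<partial>M) \<circ> X) \<longlonglongrightarrow> (\<integral>y. k z0 y \<partial>M)"
    unfolding o_def by (rule LIMSEQ_offset)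
qed

lemma lborel_integral_affine:
  fixes f :: "'a::euclidean_space \<Rightarrow> 'b::{banach,second_countable_topology}"
  assumes [measurable]: "f \<in> borel_measurable borel" and c: "c \<noteq> 0"
  shows "(\<integral>x. f (t + c *\<^sub>R x) \<partial>lborel) = (1 / \<bar>c\<bar> ^ DIM('a)) *\<^sub>R (\<integral>x. f x \<partial>lborel)"
    and "integrable lborel (\<lambda>x. f (t + c *\<^sub>R x)) \<longleftrightarrow> integrable lborel f"
proof -
  have "(\<integral>x. f x \<partial>lborel) = (\<integral>x. f x \<partial>density (distr lborel borel (\<lambda>x. t + c *\<^sub>R x)) (\<lambda>_. \<bar>c\<bar>^DIM('a)))"
    using lborel_affine[OF c, of t] by simp
  also have "\<dots> = \<bar>c\<bar> ^ DIM('a) *\<^sub>R (\<integral>x. f (t + c *\<^sub>R x) \<partial>lborel)"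
    by (subst integral_density) (auto simp: integral_distr)
  finally show "(\<integral>x. f (t + c *\<^sub>R x) \<partial>lborel) = (1 / \<bar>c\<bar> ^ DIM('a)) *\<^sub>R (\<integral>x. f x \<partial>lborel)"
    using c by simp
  have "integrable lborel f \<longleftrightarrow> integrable (density (distr lborel borel (\<lambda>x. t + c *\<^sub>R x)) (\<lambda>_. \<bar>c\<bar>^DIM('a))) f"
    using lborel_affine[OF c, of t] by simp
  also have "\<dots> \<longleftrightarrow> integrable lborel (\<lambda>x. f (t + c *\<^sub>R x))"
  proof -
    have "integrable lborel (\<lambda>x. f (t + c *\<^sub>R x))" if "integrable lborel (\<lambda>x. \<bar>c\<bar> ^ DIM('a) *\<^sub>R f (t + c *\<^sub>R x))"
      using integrable_scaleR_right[OF that, of "1 / \<bar>c\<bar> ^ DIM('a)"] c by simp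
    then show ?thesis by (subst integrable_density) (auto simp: integrable_distr_eq)
  qed
  finally show "integrable lborel (\<lambda>x. f (t + c *\<^sub>R x)) \<longleftrightarrow> integrable lborel f" ..
qed

lemma lborel_integral_diff:
  fixes f :: "'a::euclidean_space \<Rightarrow> 'b::{banach,second_countable_topology}"
  assumes "f \<in> borel_measurable borel"
  shows "(\<integral>x. f (t - x) \<partial>lborel) = (\<integral>x. f x \<partial>lborel)"
    and "integrable lborel (\<lambda>x. f (t - x)) \<longleftrightarrow> integrable lborel f"
  using lborel_integral_affine[OF assms, of "-1" t] by auto

section \<open>Mollification\<close>

text \<open>
  The function \<open>s^{-j} exp (-1/s)\<close> on the positive half-line, extended by zero. The exponent \<open>j\<close>
  is a parameter because differentiation leads from one such function to a linear combination of
  others.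
\<close>

definition bump_profile :: "nat \<Rightarrow> real \<Rightarrow> real" where
  "bump_profile j s = (if 0 < s then inverse s ^ j * exp (- inverse s) else 0)"

lemma bump_profile_nonneg: "0 \<le> bump_profile j s"
  by (simp add: bump_profile_def)

lemma bump_profile_tendsto_0: "(bump_profile j \<longlongrightarrow> 0) (at 0)"
proof (rule filterlim_split_at)
  have "((\<lambda>x. inverse x ^ j / exp (inverse x)) \<longlongrightarrow> (0::real)) (at_right 0)"
    by (rule filterlim_compose[OF tendsto_power_div_exp_0 filterlim_inverse_at_top_right])
  moreover have "eventually (\<lambda>x. inverse x ^ j / exp (inverse x) = bump_profile j x) (at_right 0)"
    using eventually_at_right_less[of "0::real"] by eventually_elim (simp add: bump_profile_def exp_minus divide_inverse)
  ultimately show "(bump_profile j \<longlongrightarrow> 0) (at_right 0)" by (rule Lim_transform_eventually)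
  have "eventually (\<lambda>x. x < 0) (at_left (0::real))" by (auto simp: eventually_at_filter)
  then have "eventually (\<lambda>x. 0 = bump_profile j x) (at_left 0)"
    by eventually_elim (simp add: bump_profile_def)
  then show "(bump_profile j \<longlongrightarrow> 0) (at_left 0)" by (rule Lim_transform_eventually[rotated]) simp
qed

lemma bump_profile_deriv:
  "(bump_profile j has_real_derivative bump_profile (j + 2) s - real j * bump_profile (j + 1) s) (at s)"
proof -
  consider "s > 0" | "s < 0" | "s = 0" by linarith
  then show ?thesis
  proof cases
    case 1
    have "((\<lambda>s. inverse s ^ j * exp (- inverse s)) has_real_derivative
        real j * inverse s ^ (j - 1) * (- (inverse s * inverse s)) * exp (- inverse s)
        + inverse s ^ j * (exp (- inverse s) * (inverse s * inverse s))) (at s)"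
      using 1 by (auto intro!: derivative_eq_intros simp: algebra_simps)
    moreover have "real j * inverse s ^ (j - 1) * (- (inverse s * inverse s)) * exp (- inverse s)
        + inverse s ^ j * (exp (- inverse s) * (inverse s * inverse s)) = bump_profile (j + 2) s - real j * bump_profile (j + 1) s"
      using 1 by (cases j) (simp_all add: bump_profile_def algebra_simps)
    moreover have "eventually (\<lambda>s. inverse s ^ j * exp (- inverse s) = bump_profile j s) (nhds s)"
      using 1 by (auto simp: eventually_nhds bump_profile_def intro!: exI[of _ "{0<..}"])
    ultimately show ?thesis using DERIV_cong_ev by force
  next
    case 2
    have "eventually (\<lambda>s. 0 = bump_profile j s) (nhds s)"
      using 2 by (auto simp: eventually_nhds bump_profile_def intro!: exI[of _ "{..<0}"])
    moreover have "((\<lambda>s. 0::real) has_real_derivative 0) (at s)" by simp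
    moreover have "bump_profile (j + 2) s - real j * bump_profile (j + 1) s = 0" using 2 by (simp add: bump_profile_def)
    ultimately show ?thesis using DERIV_cong_ev[of s s "\<lambda>s. 0::real" "bump_profile j" 0] by simp
  next
    case 3
    have "(\<lambda>h. (bump_profile j (0 + h) - bump_profile j 0) / h) = bump_profile (j + 1)"
      by (auto simp: bump_profile_def fun_eq_iff divide_inverse)
    then have "(bump_profile j has_real_derivative 0) (at 0)"
      using bump_profile_tendsto_0[of "j + 1"] by (simp add: DERIV_def)
    then show ?thesis using 3 by (simp add: bump_profile_def)
  qed
qed

text \<open>
  A class of functions that contains the standard bump \<open>exp (-1 / (1 - |z|^2))\<close> on the unit ball
  and is closed under directional derivatives. Smoothness of all its members follows by induction
  on the order of differentiability.
\<close>

inductive bump_algebra :: "('a::euclidean_space \<Rightarrow> real) \<Rightarrow> bool" where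
  profile: "bump_algebra (\<lambda>z. bump_profile j (1 - z \<bullet> z))"
| linear: "bump_algebra f \<Longrightarrow> bump_algebra (\<lambda>z. (z \<bullet> v) * f z)"
| scale: "bump_algebra f \<Longrightarrow> bump_algebra (\<lambda>z. c * f z)"
| add: "bump_algebra f \<Longrightarrow> bump_algebra g \<Longrightarrow> bump_algebra (\<lambda>z. f z + g z)"

lemma bump_algebra_deriv:
  fixes f :: "'a::euclidean_space \<Rightarrow> real"
  assumes "bump_algebra f"
  shows "\<exists>f'. (\<forall>z. (f has_derivative f' z) (at z)) \<and> (\<forall>v. bump_algebra (\<lambda>z. f' z v))"
  using assms
proof induction
  case (profile j)
  let ?f' = "\<lambda>(z::'a) v. (bump_profile (j + 2) (1 - z \<bullet> z) - real j * bump_profile (j + 1) (1 - z \<bullet> z)) * (- 2 * (z \<bullet> v))"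
  have "((\<lambda>z. bump_profile j (1 - z \<bullet> z)) has_derivative ?f' z) (at z)" for z :: 'a
  proof -
    have "((\<lambda>z::'a. 1 - z \<bullet> z) has_derivative (\<lambda>v. - 2 * (z \<bullet> v))) (at z)"
      by (auto intro!: derivative_eq_intros simp: inner_commute)
    from has_derivative_compose[OF this bump_profile_deriv[of j "1 - z \<bullet> z", unfolded has_field_derivative_def]]
    show ?thesis by simp
  qed
  moreover have "bump_algebra (\<lambda>z. ?f' z v)" for v
  proof -
    have "bump_algebra (\<lambda>z. (z \<bullet> v) * (-2 * bump_profile (j + 2) (1 - z \<bullet> z) + 2 * real j * bump_profile (j + 1) (1 - z \<bullet> z)))"
      by (intro bump_algebra.intros)
    moreover have "(\<lambda>z. (z \<bullet> v) * (-2 * bump_profile (j + 2) (1 - z \<bullet> z) + 2 * real j * bump_profile (j + 1) (1 - z \<bullet> z))) = (\<lambda>z. ?f' z v)"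
      by (simp add: fun_eq_iff algebra_simps)
    ultimately show ?thesis by simp
  qed
  ultimately show ?case by (intro exI[of _ ?f']) blast
next
  case (linear f w)
  then obtain f' where f': "\<And>z. (f has_derivative f' z) (at z)" "\<And>v. bump_algebra (\<lambda>z. f' z v)" by blast
  have "((\<lambda>z. (z \<bullet> w) * f z) has_derivative (\<lambda>v. (z \<bullet> w) * f' z v + (v \<bullet> w) * f z)) (at z)" for z
    by (auto intro!: derivative_eq_intros f'(1))
  moreover have "bump_algebra (\<lambda>z. (z \<bullet> w) * f' z v + (v \<bullet> w) * f z)" for v
    using f'(2) linear by (intro bump_algebra.intros)
  ultimately show ?case by (intro exI[of _ "\<lambda>z v. (z \<bullet> w) * f' z v + (v \<bullet> w) * f z"]) blast
next
  case (scale f c)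
  then obtain f' where f': "\<And>z. (f has_derivative f' z) (at z)" "\<And>v. bump_algebra (\<lambda>z. f' z v)" by blast
  have "((\<lambda>z. c * f z) has_derivative (\<lambda>v. c * f' z v)) (at z)" for z
    by (auto intro!: derivative_eq_intros f'(1))
  moreover have "bump_algebra (\<lambda>z. c * f' z v)" for v
    using f'(2) by (intro bump_algebra.intros)
  ultimately show ?case by (intro exI[of _ "\<lambda>z v. c * f' z v"]) blast
next
  case (add f g)
  then obtain f' g' where f': "\<And>z. (f has_derivative f' z) (at z)" "\<And>v. bump_algebra (\<lambda>z. f' z v)"
    and g': "\<And>z. (g has_derivative g' z) (at z)" "\<And>v. bump_algebra (\<lambda>z. g' z v)" by blast
  have "((\<lambda>z. f z + g z) has_derivative (\<lambda>v. f' z v + g' z v)) (at z)" for z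
    by (auto intro!: derivative_eq_intros f'(1) g'(1))
  moreover have "bump_algebra (\<lambda>z. f' z v + g' z v)" for v
    using f'(2) g'(2) by (intro bump_algebra.intros)
  ultimately show ?case by (intro exI[of _ "\<lambda>z v. f' z v + g' z v"]) blast
qed

lemma bump_algebra_Ck: "bump_algebra f \<Longrightarrow> Ck k f"
proof (induction k arbitrary: f)
  case 0
  then obtain f' where "\<And>z. (f has_derivative f' z) (at z)" using bump_algebra_deriv by blast
  then show ?case by (auto intro!: continuous_at_imp_continuous_on has_derivative_continuous)
next
  case (Suc k)
  then obtain f' where f': "\<And>z. (f has_derivative f' z) (at z)" "\<And>v. bump_algebra (\<lambda>z. f' z v)" using bump_algebra_deriv by blast
  then have "frechet_derivative f (at z) = f' z" for z by (metis frechet_derivative_at)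
  then show ?case using f' Suc.IH by (auto simp: differentiable_def)
qed

lemma Ck_affine:
  fixes f :: "'a::euclidean_space \<Rightarrow> 'b::real_normed_vector" and l :: "'c::euclidean_space \<Rightarrow> 'a"
  assumes l: "bounded_linear l"
  shows "Ck k f \<Longrightarrow> Ck k (\<lambda>x. f (c + l x))"
proof (induction k arbitrary: f)
  case 0
  then show ?case by (auto intro!: continuous_intros bounded_linear.continuous_on[OF l] intro: continuous_on_compose2[of UNIV f])
next
  case (Suc k)
  have d: "((\<lambda>x. f (c + l x)) has_derivative (\<lambda>v. frechet_derivative f (at (c + l x)) (l v))) (at x)" for x
    by (rule has_derivative_compose[of "\<lambda>x. c + l x" l x UNIV f])
       (use Suc.prems frechet_derivative_works in \<open>auto intro!: derivative_eq_intros bounded_linear.has_derivative[OF l]\<close>)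
  then have e: "frechet_derivative (\<lambda>x. f (c + l x)) (at x) = (\<lambda>v. frechet_derivative f (at (c + l x)) (l v))" for x
    by (metis frechet_derivative_at)
  have "Ck k (\<lambda>x. frechet_derivative f (at (c + l x)) (l v))" for v
    using Suc.IH[of "\<lambda>x. frechet_derivative f (at x) (l v)"] Suc.prems by simp
  then show ?case using d by (auto simp: differentiable_def e)
qed

lemma Ck_scaleR_const:
  fixes f :: "'a::euclidean_space \<Rightarrow> real"
  shows "Ck k f \<Longrightarrow> Ck k (\<lambda>x. f x *\<^sub>R (b::'b::real_normed_vector))"
proof (induction k arbitrary: f)
  case 0
  then show ?case by (auto intro!: continuous_intros)
next
  case (Suc k)
  have d: "((\<lambda>x. f x *\<^sub>R b) has_derivative (\<lambda>v. frechet_derivative f (at x) v *\<^sub>R b)) (at x)" for x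
    using Suc.prems frechet_derivative_works by (auto intro!: derivative_eq_intros)
  then have "frechet_derivative (\<lambda>x. f x *\<^sub>R b) (at x) = (\<lambda>v. frechet_derivative f (at x) v *\<^sub>R b)" for x
    by (metis frechet_derivative_at)
  then show ?case using Suc d by (auto simp: differentiable_def)
qed

definition mollifier :: "real \<Rightarrow> ('a::euclidean_space \<Rightarrow> real) \<Rightarrow> bool" where
  "mollifier \<epsilon> J \<longleftrightarrow> (\<forall>k. Ck k J) \<and> (\<forall>z. 0 \<le> J z) \<and> (\<forall>z. J z \<noteq> 0 \<longrightarrow> norm z < \<epsilon>) \<and> (\<integral>z. J z \<partial>lborel) = 1"

lemma continuous_bounded_support_integrable:
  fixes f :: "'a::euclidean_space \<Rightarrow> 'b::euclidean_space"
  assumes "continuous_on UNIV f" and "\<And>z. f z \<noteq> 0 \<Longrightarrow> norm z \<le> R"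
  shows "integrable lborel f"
proof -
  have "integrable lborel (\<lambda>z. indicator (cball 0 R) z *\<^sub>R f z)"
    by (rule borel_integrable_compact) (use assms in \<open>auto intro: continuous_on_subset\<close>)
  moreover have "(\<lambda>z. indicator (cball 0 R) z *\<^sub>R f z) = f" using assms(2) by (force simp: fun_eq_iff indicator_def)
  ultimately show ?thesis by simp
qed

lemma continuous_bounded_support_bounded:
  fixes f :: "'a::euclidean_space \<Rightarrow> 'b::euclidean_space"
  assumes "continuous_on UNIV f" and "\<And>z. f z \<noteq> 0 \<Longrightarrow> norm z \<le> R"
  obtains C where "\<And>z. norm (f z) \<le> C" "0 \<le> C"
proof -
  have "compact (f ` cball 0 R)" using assms by (intro compact_continuous_image) (auto intro: continuous_on_subset)
  then obtain C where C: "\<And>z. z \<in> cball 0 R \<Longrightarrow> norm (f z) \<le> C" using compact_imp_bounded bounded_iff by (metis image_eqI)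
  have "norm (f z) \<le> max C 0" for z
    using C[of z] assms(2)[of z] by (cases "f z = 0") auto
  then show ?thesis using that by (meson max.cobounded2)
qed

text \<open>
  The standard bump, rescaled to a ball of radius \<open>\<epsilon>\<close> and divided by its integral.
\<close>

lemma mollifier_exists:
  assumes \<epsilon>: "0 < \<epsilon>"
  obtains J :: "'a::euclidean_space \<Rightarrow> real" where "mollifier \<epsilon> J"
proof -
  let ?b = "\<lambda>z::'a. bump_profile 0 (1 - z \<bullet> z)"
  let ?f = "\<lambda>z. ?b (inverse \<epsilon> *\<^sub>R z)"
  have fC: "Ck k ?f" for k
    using Ck_affine[OF bounded_linear_scaleR_right bump_algebra_Ck[OF bump_algebra.profile], of k 0 0 "inverse \<epsilon>"]
    by (simp only: add_0)
  have cont: "continuous_on UNIV ?f" using fC[of 0] by simp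
  have supp: "norm z < \<epsilon>" if "?f z \<noteq> 0" for z
  proof -
    have "(inverse \<epsilon> *\<^sub>R z) \<bullet> (inverse \<epsilon> *\<^sub>R z) < 1" using that by (auto simp: bump_profile_def split: if_splits)
    then have "norm (inverse \<epsilon> *\<^sub>R z) < 1" by (metis dot_square_norm norm_ge_zero one_power2 power2_less_imp_less zero_le_one)
    then show ?thesis using \<epsilon> by (simp add: field_simps)
  qed
  have int: "integrable lborel ?f"
    by (rule continuous_bounded_support_integrable[OF cont, of \<epsilon>]) (use supp in fastforce)
  define A where "A = integral\<^sup>L lborel ?f"
  have "A > 0"
  proof -
    have "A \<noteq> 0"
    proof
      assume "A = 0"
      then have ae: "AE z in lborel. ?f z = 0"
        using integral_nonneg_eq_0_iff_AE[OF int] bump_profile_nonneg unfolding A_def by auto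
      have nb: "z \<notin> ball 0 \<epsilon>" if "?f z = 0" for z
      proof
        assume "z \<in> ball 0 \<epsilon>"
        then have "norm (inverse \<epsilon> *\<^sub>R z) < 1" using \<epsilon> by (simp add: field_simps)
        then have "(inverse \<epsilon> *\<^sub>R z) \<bullet> (inverse \<epsilon> *\<^sub>R z) < 1"
          using power_strict_mono[of "norm (inverse \<epsilon> *\<^sub>R z)" 1 2] by (simp only: dot_square_norm norm_ge_zero one_power2 zero_less_numeral)
        then show False using that by (simp add: bump_profile_def)
      qed
      have "AE z::'a in lborel. z \<notin> ball 0 \<epsilon>" using ae by (rule eventually_mono) (rule nb)
      then have "emeasure lborel (ball (0::'a) \<epsilon>) = 0" by (subst (asm) AE_iff_measurable[where N="ball 0 \<epsilon>"]) auto
      then show False using \<epsilon> content_ball_pos[of \<epsilon> "0::'a"] by (simp add: measure_def)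
    qed
    moreover have "A \<ge> 0" unfolding A_def using bump_profile_nonneg by (intro integral_nonneg_AE) auto
    ultimately show ?thesis by simp
  qed
  have "mollifier \<epsilon> (\<lambda>z. ?f z * inverse A)"
    unfolding mollifier_def
  proof (intro conjI allI impI)
    show "Ck k (\<lambda>z. ?f z * inverse A)" for k
      using Ck_scaleR_const[OF fC, of k "inverse A"] by (simp only: real_scaleR_def)
    show "0 \<le> ?f z * inverse A" for z using bump_profile_nonneg \<open>A > 0\<close> by simp
    show "norm z < \<epsilon>" if "?f z * inverse A \<noteq> 0" for z using supp[of z] that by auto
    have "(\<integral>z. ?f z * inverse A \<partial>lborel) = A * inverse A" unfolding A_def by (rule integral_mult_left_zero)
    then show "(\<integral>z. ?f z * inverse A \<partial>lborel) = 1" using \<open>A > 0\<close> by simp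
  qed
  then show ?thesis by (rule that)
qed

definition mollify :: "('a::euclidean_space \<Rightarrow> real) \<Rightarrow> ('a \<Rightarrow> 'b::euclidean_space) \<Rightarrow> 'a \<Rightarrow> 'b" where
  "mollify J f z = (\<integral>y. J (z - y) *\<^sub>R f y \<partial>lborel)"

lemma mollify_integrand_integrable:
  fixes J :: "'a::euclidean_space \<Rightarrow> real" and f :: "'a \<Rightarrow> 'b::euclidean_space"
  assumes J: "continuous_on UNIV J" "\<And>x. \<bar>J x\<bar> \<le> C" and f: "integrable lborel f"
  shows "integrable lborel (\<lambda>y. J (z - y) *\<^sub>R f y)"
proof (rule Bochner_Integration.integrable_bound[where f="\<lambda>y. C * norm (f y)"])
  have [measurable]: "J \<in> borel_measurable borel" using J(1) by (rule borel_measurable_continuous_onI)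
  have [measurable]: "f \<in> borel_measurable lborel" using f by simp
  show "(\<lambda>y. J (z - y) *\<^sub>R f y) \<in> borel_measurable lborel" by simp
  show "AE y in lborel. norm (J (z - y) *\<^sub>R f y) \<le> norm (C * norm (f y))"
  proof (rule AE_I2)
    fix y
    have "\<bar>J (z - y)\<bar> * norm (f y) \<le> C * norm (f y)" using J(2) by (intro mult_right_mono) auto
    then show "norm (J (z - y) *\<^sub>R f y) \<le> norm (C * norm (f y))" by auto
  qed
qed (use f in auto)

lemma mollify_continuous:
  fixes J :: "'a::euclidean_space \<Rightarrow> real" and f :: "'a \<Rightarrow> 'b::euclidean_space"
  assumes J: "continuous_on UNIV J" "\<And>x. \<bar>J x\<bar> \<le> C" and f: "integrable lborel f"
  shows "continuous_on UNIV (mollify J f)"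
proof (rule continuous_at_imp_continuous_on, intro ballI)
  fix z
  have [measurable]: "J \<in> borel_measurable borel" using J(1) by (rule borel_measurable_continuous_onI)
  have [measurable]: "f \<in> borel_measurable lborel" using f by simp
  show "isCont (mollify J f) z" unfolding mollify_def
  proof (rule isCont_integral_param[where \<delta>=1 and g="\<lambda>y. C * norm (f y)"])
    show "isCont (\<lambda>z. J (z - y) *\<^sub>R f y) z" for y
      using J(1) by (intro continuous_intros isCont_o2[of _ "\<lambda>z. z - y" J]) (auto simp: continuous_on_eq_continuous_at)
    show "norm (J (z - y) *\<^sub>R f y) \<le> C * norm (f y)" for z y
      using J(2) by (auto intro: mult_right_mono)
  qed (use f in auto)
qed

text \<open>
  The derivatives fall on the kernel, so that mollification of a merely integrable function is
  smooth.
\<close>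

lemma mollify_has_derivative:
  fixes J :: "'a::euclidean_space \<Rightarrow> real" and f :: "'a \<Rightarrow> 'b::euclidean_space"
  assumes J: "\<And>x. (J has_derivative J' x) (at x)" "\<And>x. \<bar>J x\<bar> \<le> C" "\<And>x v. \<bar>J' x v\<bar> \<le> C' * norm v"
    and f: "integrable lborel f"
  shows "(mollify J f has_derivative (\<lambda>v. mollify (\<lambda>x. J' x v) f z)) (at z)"
  unfolding mollify_def
proof (rule has_derivative_integral_param[where \<delta>=1 and g="\<lambda>y. C' * norm (f y)"])
  have cont: "continuous_on UNIV J" using J(1) by (auto intro!: continuous_at_imp_continuous_on has_derivative_continuous)
  show "((\<lambda>z. J (z - y) *\<^sub>R f y) has_derivative (\<lambda>v. J' (z - y) v *\<^sub>R f y)) (at z)" for z y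
  proof -
    have "((\<lambda>z. J (z - y)) has_derivative (\<lambda>v. J' (z - y) v)) (at z)"
      by (rule has_derivative_compose[OF _ J(1)]) (auto intro!: derivative_eq_intros)
    then show ?thesis by (auto intro!: derivative_eq_intros)
  qed
  show "norm (J' (z - y) v *\<^sub>R f y) \<le> C' * norm (f y) * norm v" for z y v
    using mult_right_mono[OF J(3)[of "z - y" v], of "norm (f y)"] by (simp add: mult_ac)
  show "integrable lborel (\<lambda>y. J (z - y) *\<^sub>R f y)" for z by (rule mollify_integrand_integrable[OF cont J(2) f])
qed (use f in auto)

lemma mollifierD:
  assumes "mollifier \<epsilon> J"
  shows "continuous_on UNIV J" "0 \<le> J z" "J z \<noteq> 0 \<Longrightarrow> norm z < \<epsilon>" "(\<integral>z. J z \<partial>lborel) = 1"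
    "integrable lborel J" "Ck k J"
proof -
  show c: "continuous_on UNIV J" using assms unfolding mollifier_def by (metis Ck.simps(1))
  show "0 \<le> J z" "J z \<noteq> 0 \<Longrightarrow> norm z < \<epsilon>" "(\<integral>z. J z \<partial>lborel) = 1" "Ck k J" using assms unfolding mollifier_def by auto
  show "integrable lborel J"
    by (rule continuous_bounded_support_integrable[OF c, of \<epsilon>]) (use assms in \<open>force simp: mollifier_def\<close>)
qed

lemma mollifier_derivative_bounds:
  fixes J :: "'a::euclidean_space \<Rightarrow> real"
  assumes J: "mollifier \<epsilon> J"
  obtains C where "\<And>x. (J has_derivative frechet_derivative J (at x)) (at x)" "\<And>x. \<bar>J x\<bar> \<le> C"
    "\<And>x v. \<bar>frechet_derivative J (at x) v\<bar> \<le> C * norm v"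
    "\<And>v. continuous_on UNIV (\<lambda>x. frechet_derivative J (at x) v)"
proof -
  let ?J' = "\<lambda>x. frechet_derivative J (at x)"
  have C1: "Ck (Suc 0) J" using J by (simp add: mollifier_def)
  have der: "(J has_derivative ?J' x) (at x)" for x using C1 by (simp add: frechet_derivative_works)
  have cont: "continuous_on UNIV (\<lambda>x. ?J' x v)" for v using C1 by simp
  have supp: "norm x \<le> \<epsilon>" if "?J' x v \<noteq> 0" for x v
  proof (rule ccontr)
    assume n: "\<not> norm x \<le> \<epsilon>"
    have "(J has_derivative (\<lambda>v. 0)) (at x)"
    proof (rule has_derivative_transform_within_open[of "\<lambda>_. 0" _ x UNIV "- cball 0 \<epsilon>"])
      show "0 = J y" if "y \<in> - cball 0 \<epsilon>" for y using mollifierD(3)[OF J, of y] that by auto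
    qed (use n in auto)
    then have "?J' x = (\<lambda>v. 0)" by (metis frechet_derivative_at)
    then show False using that by simp
  qed
  obtain C0 where C0: "\<And>x. norm (J x) \<le> C0"
    using continuous_bounded_support_bounded[OF mollifierD(1)[OF J], of \<epsilon>] mollifierD(3)[OF J] by (metis less_imp_le)
  have "\<exists>c\<ge>0. \<forall>x. norm (?J' x b) \<le> c" for b
    by (rule continuous_bounded_support_bounded[OF cont, of b \<epsilon>]) (use supp in auto)
  then obtain c where c: "\<And>x b. \<bar>?J' x b\<bar> \<le> c b" "\<And>b. c b \<ge> 0" unfolding real_norm_def by metis
  define C where "C = (\<Sum>b\<in>Basis. c b)"
  have bd: "\<bar>?J' x v\<bar> \<le> C * norm v" for x v
  proof -
    have "?J' x v = ?J' x (\<Sum>b\<in>Basis. (v \<bullet> b) *\<^sub>R b)" by (simp add: euclidean_representation)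
    also have "\<dots> = (\<Sum>b\<in>Basis. (v \<bullet> b) * ?J' x b)"
      using has_derivative_linear[OF der[of x]] by (simp add: linear_sum linear_scale)
    also have "\<bar>\<dots>\<bar> \<le> (\<Sum>b\<in>Basis. \<bar>v \<bullet> b\<bar> * \<bar>?J' x b\<bar>)" by (rule order_trans[OF sum_abs]) (simp add: abs_mult)
    also have "\<dots> \<le> (\<Sum>b\<in>Basis. norm v * c b)" using c by (intro sum_mono mult_mono Basis_le_norm) auto
    finally show ?thesis by (simp add: C_def sum_distrib_left mult.commute)
  qed
  show ?thesis
  proof (rule that[of "max C0 C"])
    show "\<bar>?J' x v\<bar> \<le> max C0 C * norm v" for x v
      by (rule order_trans[OF bd]) (auto intro: mult_right_mono)
    show "\<bar>J x\<bar> \<le> max C0 C" for x using C0[of x] by auto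
  qed (use der cont in auto)
qed

text \<open>
  By Fubini, since the kernel has mass one in either variable.
\<close>

lemma mollify_L1:
  fixes f :: "'a::euclidean_space \<Rightarrow> 'b::euclidean_space"
  assumes J: "mollifier \<epsilon> J" and f: "integrable lborel f"
  shows "integrable lborel (mollify J f)"
    and "(\<integral>z. norm (mollify J f z) \<partial>lborel) \<le> (\<integral>y. norm (f y) \<partial>lborel)"
proof -
  obtain C where C: "\<And>x. \<bar>J x\<bar> \<le> C" using mollifier_derivative_bounds[OF J] by metis
  have [measurable]: "J \<in> borel_measurable borel" using mollifierD(1)[OF J] by (rule borel_measurable_continuous_onI)
  have [measurable]: "f \<in> borel_measurable borel" using f by simp
  have one: "(\<integral>z. J (z - y) \<partial>lborel) = 1" "integrable lborel (\<lambda>z. J (z - y))" for y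
    using lborel_integral_affine[of J 1 "-y"] mollifierD(4,5)[OF J] by auto
  have sl: "integrable lborel (\<lambda>z. J (z - y) *\<^sub>R f y)" for y using one(2) by auto
  have nrm: "(\<integral>z. norm (J (z - y) *\<^sub>R f y) \<partial>lborel) = norm (f y)" for y
    using one(1) mollifierD(2)[OF J] by simp
  have P: "integrable (lborel \<Otimes>\<^sub>M lborel) (\<lambda>(y, z). J (z - y) *\<^sub>R f y)"
  proof (rule lborel_pair.Fubini_integrable)
    show "integrable lborel (\<lambda>y. \<integral>z. norm (case (y, z) of (y, z) \<Rightarrow> J (z - y) *\<^sub>R f y) \<partial>lborel)"
      using f by (simp only: prod.case nrm integrable_norm)
  qed (use sl in auto)
  note S = lborel_pair.integrable_snd[OF P] lborel_pair.integral_snd[OF P]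
  show "integrable lborel (mollify J f)" using S(1) unfolding mollify_def .
  have "integrable (lborel \<Otimes>\<^sub>M lborel) (\<lambda>z. norm (case z of (y, z) \<Rightarrow> J (z - y) *\<^sub>R f y))" using P by (rule integrable_norm)
  then have Pn: "integrable (lborel \<Otimes>\<^sub>M lborel) (\<lambda>(y, z). norm (J (z - y) *\<^sub>R f y))" by (simp only: split_def)
  have "(\<integral>z. norm (mollify J f z) \<partial>lborel) \<le> (\<integral>z. (\<integral>y. norm (J (z - y) *\<^sub>R f y) \<partial>lborel) \<partial>lborel)"
    unfolding mollify_def using lborel_pair.integrable_snd[OF Pn] S(1)
    by (intro integral_mono integral_norm_bound integrable_norm) auto
  also have "\<dots> = (\<integral>y. (\<integral>z. norm (J (z - y) *\<^sub>R f y) \<partial>lborel) \<partial>lborel)"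
    using lborel_pair.integral_snd[OF Pn] lborel_pair.integral_fst[OF Pn] by simp
  also have "\<dots> = (\<integral>y. norm (f y) \<partial>lborel)" by (simp only: nrm)
  finally show "(\<integral>z. norm (mollify J f z) \<partial>lborel) \<le> (\<integral>y. norm (f y) \<partial>lborel)" .
qed

text \<open>
  The kernel is a probability density in \<open>y\<close>, so this is Jensen's inequality. It is what makes
  bounds for \<open>L^q\<close> and \<open>L^{p'}\<close> norms survive mollification.
\<close>

lemma mollify_Jensen:
  fixes f :: "'a::euclidean_space \<Rightarrow> 'b::euclidean_space"
  assumes J: "mollifier \<epsilon> J" and r: "1 \<le> r" and f: "integrable lborel f" "integrable lborel (\<lambda>y. norm (f y) powr r)"
  shows "norm (mollify J f z) powr r \<le> mollify J (\<lambda>y. norm (f y) powr r) z"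
proof -
  obtain C where C: "\<And>x. \<bar>J x\<bar> \<le> C" using mollifier_derivative_bounds[OF J] by metis
  have [measurable]: "J \<in> borel_measurable borel" using mollifierD(1)[OF J] by (rule borel_measurable_continuous_onI)
  have J1: "(\<integral>y. J (z - y) \<partial>lborel) = 1" "integrable lborel (\<lambda>y. J (z - y))"
    using lborel_integral_diff[of J z] mollifierD(4,5)[OF J] by auto
  have "norm (mollify J f z) \<le> (\<integral>y. norm (J (z - y) *\<^sub>R f y) \<partial>lborel)" unfolding mollify_def by (rule integral_norm_bound)
  also have "\<dots> = (\<integral>y. J (z - y) * norm (f y) \<partial>lborel)" using mollifierD(2)[OF J] by simp
  finally have "norm (mollify J f z) powr r \<le> (\<integral>y. J (z - y) * norm (f y) \<partial>lborel) powr r" using r by (intro powr_mono2) auto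
  also have "\<dots> \<le> (\<integral>y. J (z - y) \<partial>lborel) powr (r - 1) * (\<integral>y. J (z - y) * norm (f y) powr r \<partial>lborel)"
    using mollify_integrand_integrable[OF mollifierD(1)[OF J] C f(2)] mollifierD(2)[OF J] J1
    by (intro Jensen_powr(2) r) auto
  finally show ?thesis using J1 by (simp add: mollify_def)
qed

text \<open>
  Continuous functions of bounded support are dense in \<open>L^1\<close>. The function is truncated, both in
  size and in space, with a truncation that depends continuously on the value. After the
  truncation, a sequence of continuous functions that converges almost everywhere is dominated.
\<close>

lemma L1_approx_continuous:
  fixes f :: "'a::euclidean_space \<Rightarrow> 'b::euclidean_space"
  assumes f: "integrable lborel f" and e: "0 < e"
  obtains g R where "continuous_on UNIV g" "\<And>z. g z \<noteq> 0 \<Longrightarrow> norm z \<le> R" "integrable lborel g"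
    "(\<integral>z. norm (f z - g z) \<partial>lborel) < e"
proof -
  have [measurable]: "f \<in> borel_measurable borel" using f by simp
  define T where "T N y z = (max 0 (min 1 (real (Suc N) - norm z)) * (real (Suc N) / max (real (Suc N)) (norm y))) *\<^sub>R y"
    for N and y :: 'b and z :: 'a
  have Tn: "norm (T N y z) \<le> norm y" "norm (T N y z) \<le> real (Suc N)" "norm z > real (Suc N) \<Longrightarrow> T N y z = 0" for N y z
  proof -
    let ?m = "max (real (Suc N)) (norm y)"
    have m: "?m > 0" by auto
    have a: "norm (T N y z) \<le> 1 * (real (Suc N) / ?m) * norm y"
      unfolding T_def using m by (auto simp: abs_mult intro!: mult_right_mono divide_right_mono)
    have "real (Suc N) / ?m \<le> 1" using m by simp
    from mult_right_mono[OF this, of "norm y"] show "norm (T N y z) \<le> norm y" using a by simp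
    have "real (Suc N) / ?m * norm y \<le> real (Suc N)" using m by (simp add: divide_simps del: of_nat_Suc)
    then show "norm (T N y z) \<le> real (Suc N)" using a by simp
    show "norm z > real (Suc N) \<Longrightarrow> T N y z = 0" unfolding T_def by simp
  qed
  have Tc: "continuous_on UNIV (\<lambda>z. T N (h z) z)" if "continuous_on UNIV h" for N and h :: "'a \<Rightarrow> 'b"
    unfolding T_def using that by (intro continuous_intros) (auto simp: max_def)
  have Tlim: "(\<lambda>n. T N (y n) z) \<longlonglongrightarrow> T N l z" if "y \<longlonglongrightarrow> l" for N y l z
    unfolding T_def using that by (intro tendsto_intros) (auto simp: max_def)
  have Tm [measurable]: "(\<lambda>z. T N (f z) z) \<in> borel_measurable borel" for N unfolding T_def by measurable
  have "(\<lambda>N. \<integral>z. norm (f z - T N (f z) z) \<partial>lborel) \<longlonglongrightarrow> (\<integral>z. 0 \<partial>(lborel::'a measure))"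
  proof (rule integral_dominated_convergence[where w="\<lambda>z. 2 * norm (f z)"])
    show "AE z in lborel. (\<lambda>N. norm (f z - T N (f z) z)) \<longlonglongrightarrow> 0"
    proof (rule AE_I2)
      fix z
      obtain N0 where N0: "real N0 \<ge> max (norm z) (norm (f z))" using real_arch_simple by blast
      have "norm (f z - T N (f z) z) = 0" if "N \<ge> N0" for N
      proof -
        have "real N0 \<le> real N" using that by simp
        then have "norm z \<le> real N" "norm (f z) \<le> real N" using N0 by linarith+
        then show ?thesis by (simp add: T_def)
      qed
      then show "(\<lambda>N. norm (f z - T N (f z) z)) \<longlonglongrightarrow> 0"
        by (intro tendsto_eventually) (auto simp: eventually_sequentially)
    qed
    show "AE z in lborel. norm (norm (f z - T N (f z) z)) \<le> 2 * norm (f z)" for N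
      using Tn(1)[of N "f _" ] by (intro AE_I2) (auto intro!: order_trans[OF norm_triangle_ineq4])
  qed (use f in auto)
  then obtain N where N: "(\<integral>z. norm (f z - T N (f z) z) \<partial>lborel) < e/2"
    using e order_tendstoD(2)[of _ 0 sequentially "e/2"] by (auto simp: eventually_sequentially)
  \<comment> \<open>Lebesgue measurability provides continuous functions h n with limit f off a negligible
      set. Their truncations converge in mean to the truncation of f.\<close>
  have "f measurable_on UNIV" by (rule lebesgue_measurable_imp_measurable_on) (auto intro: measurable_completion)
  then obtain Z h where Z: "negligible Z" and h: "\<And>n. continuous_on UNIV (h n)" "\<And>x. x \<notin> Z \<Longrightarrow> (\<lambda>n. h n x) \<longlonglongrightarrow> f x"
    unfolding measurable_on_def by (simp, metis)
  have hm[measurable]: "h n \<in> borel_measurable borel" for n using h(1) by (rule borel_measurable_continuous_onI)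
  let ?B = "cball (0::'a) (real (Suc N))"
  let ?D = "\<lambda>n z. norm (T N (f z) z - T N (h n z) z)"
  have Thm: "(\<lambda>z. T N (h n z) z) \<in> borel_measurable borel" for n using Tc[OF h(1)] by (rule borel_measurable_continuous_onI)
  then have Dm: "?D n \<in> borel_measurable borel" for n using Tm by measurable
  have "(\<lambda>n. \<integral>z. ?D n z \<partial>lebesgue) \<longlonglongrightarrow> (\<integral>z. 0 \<partial>(lebesgue::'a measure))"
  proof (rule integral_dominated_convergence[where w="\<lambda>z. 2 * real (Suc N) * indicator ?B z"])
    have "AE z in lebesgue. z \<notin> Z" using Z negligible_iff_null_sets AE_not_in by blast
    then show "AE z in lebesgue. (\<lambda>n. ?D n z) \<longlonglongrightarrow> 0"
    proof eventually_elim
      case (elim z)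
      have "(\<lambda>n. ?D n z) \<longlonglongrightarrow> norm (T N (f z) z - T N (f z) z)"
        by (intro tendsto_intros Tlim h(2) elim)
      then show ?case by simp
    qed
    show "integrable lebesgue (\<lambda>z. 2 * real (Suc N) * indicator ?B z)"
      by (rule integrable_mult_right, rule integrable_real_indicator) (use emeasure_lborel_cball_finite in \<open>auto simp: less_top\<close>)
    show "AE z in lebesgue. norm (?D n z) \<le> 2 * real (Suc N) * indicator ?B z" for n
    proof (rule AE_I2)
      fix z
      show "norm (?D n z) \<le> 2 * real (Suc N) * indicator ?B z"
      proof (cases "z \<in> ?B")
        case True
        have "?D n z \<le> real (Suc N) + real (Suc N)"
          by (rule order_trans[OF norm_triangle_ineq4 add_mono[OF Tn(2) Tn(2)]])
        then show ?thesis using True by simp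
      next
        case False
        then show ?thesis using Tn(3)[of N z] by simp
      qed
    qed
  qed (use Dm in \<open>auto intro: measurable_completion\<close>)
  moreover have "(\<integral>z. ?D n z \<partial>lebesgue) = (\<integral>z. ?D n z \<partial>lborel)" for n
    by (rule integral_completion) (use Dm in auto)
  ultimately have "(\<lambda>n. \<integral>z. ?D n z \<partial>lborel) \<longlonglongrightarrow> 0" by simp
  then obtain n where n: "(\<integral>z. ?D n z \<partial>lborel) < e/2"
    using e order_tendstoD(2)[of _ 0 sequentially "e/2"] by (auto simp: eventually_sequentially)
  have gi: "integrable lborel (\<lambda>z. T N (h n z) z)"
    by (rule continuous_bounded_support_integrable[OF Tc[OF h(1)], of _ _ "real (Suc N)"]) (use Tn(3) in force)
  have ti: "integrable lborel (\<lambda>z. T N (f z) z)"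
    by (rule Bochner_Integration.integrable_bound[OF f]) (use Tn(1) in auto)
  show ?thesis
  proof (rule that[OF Tc[OF h(1)] _ gi])
    show "norm z \<le> real (Suc N)" if "T N (h n z) z \<noteq> 0" for z using Tn(3) that by force
    have "(\<integral>z. norm (f z - T N (h n z) z) \<partial>lborel) \<le> (\<integral>z. norm (f z - T N (f z) z) + ?D n z \<partial>lborel)"
    proof (rule integral_mono)
      show "norm (f z - T N (h n z) z) \<le> norm (f z - T N (f z) z) + ?D n z" for z
        using norm_triangle_ineq[of "f z - T N (f z) z" "T N (f z) z - T N (h n z) z"] by simp
    qed (use f gi ti in auto)
    also have "\<dots> < e" using f gi ti N n by simp
    finally show "(\<integral>z. norm (f z - T N (h n z) z) \<partial>lborel) < e" .
  qed
qed

lemma mollify_diff: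
  fixes f g :: "'a::euclidean_space \<Rightarrow> 'b::euclidean_space"
  assumes J: "mollifier \<epsilon> J" and f: "integrable lborel f" and g: "integrable lborel g"
  shows "mollify J (\<lambda>y. f y - g y) z = mollify J f z - mollify J g z"
proof -
  obtain C where C: "\<And>x. \<bar>J x\<bar> \<le> C" using mollifier_derivative_bounds[OF J] by metis
  show ?thesis unfolding mollify_def
    using mollify_integrand_integrable[OF mollifierD(1)[OF J] C f] mollify_integrand_integrable[OF mollifierD(1)[OF J] C g]
    by (simp add: scaleR_diff_right)
qed

text \<open>
  For a continuous function of bounded support this is uniform continuity. The general case
  follows by density, because mollification is a contraction of \<open>L^1\<close>.
\<close>

lemma mollify_tendsto_L1:
  fixes f :: "'a::euclidean_space \<Rightarrow> 'b::euclidean_space"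
  assumes f: "integrable lborel f" and e: "0 < e"
  obtains \<delta> where "0 < \<delta>" "\<And>\<epsilon> J. 0 < \<epsilon> \<Longrightarrow> \<epsilon> < \<delta> \<Longrightarrow> mollifier \<epsilon> J \<Longrightarrow> (\<integral>z. norm (mollify J f z - f z) \<partial>lborel) < e"
proof -
  obtain g R where g: "continuous_on UNIV g" "\<And>z. g z \<noteq> 0 \<Longrightarrow> norm z \<le> R" "integrable lborel g"
    "(\<integral>z. norm (f z - g z) \<partial>lborel) < e/4" using L1_approx_continuous[OF f, of "e/4"] e by auto
  let ?B = "cball (0::'a) (R + 2)"
  define A where "A = measure lborel ?B"
  have A: "0 \<le> A" by (simp add: A_def)
  have "uniformly_continuous_on ?B g" using g(1) by (intro compact_uniformly_continuous) (auto intro: continuous_on_subset)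
  moreover have e': "0 < e / (4 * (A + 1))" using e A by simp
  ultimately obtain d where d: "0 < d" "\<And>x y. x \<in> ?B \<Longrightarrow> y \<in> ?B \<Longrightarrow> dist y x < d \<Longrightarrow> dist (g y) (g x) < e / (4 * (A + 1))"
    unfolding uniformly_continuous_on_def by metis
  show ?thesis
  proof (rule that[of "min d 1"])
    show "0 < min d 1" using d by simp
    fix \<epsilon> and J :: "'a \<Rightarrow> real" assume eps: "0 < \<epsilon>" "\<epsilon> < min d 1" and J: "mollifier \<epsilon> J"
    obtain C where C: "\<And>x. \<bar>J x\<bar> \<le> C" using mollifier_derivative_bounds[OF J] by metis
    have [measurable]: "J \<in> borel_measurable borel" using mollifierD(1)[OF J] by (rule borel_measurable_continuous_onI)
    have J1: "(\<integral>y. J (z - y) \<partial>lborel) = 1" "integrable lborel (\<lambda>y. J (z - y))" for z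
      using lborel_integral_diff[of J z] mollifierD(4,5)[OF J] by auto
    note ii = mollify_integrand_integrable[OF mollifierD(1)[OF J] C]
    have pt: "norm (mollify J g z - g z) \<le> e / (4 * (A + 1)) * indicator ?B z" for z
    proof -
      have close: "norm (J (z - y) *\<^sub>R (g y - g z)) \<le> J (z - y) * (e / (4 * (A + 1)) * indicator ?B z)" for y
      proof (cases "J (z - y) = 0")
        case True then show ?thesis by simp
      next
        case False
        then have lt: "norm (z - y) < \<epsilon>" using mollifierD(3)[OF J] by auto
        have "norm (g y - g z) \<le> e / (4 * (A + 1)) * indicator ?B z"
        proof (cases "g y = 0 \<and> g z = 0")
          case True then show ?thesis using e' by (simp add: indicator_def)
        next
          case False
          then have "norm y \<le> R \<or> norm z \<le> R" using g(2) by blast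
          moreover have "norm z \<le> norm y + norm (z - y)" "norm y \<le> norm z + norm (z - y)"
            by (metis add.commute diff_add_cancel norm_triangle_ineq, metis norm_minus_commute add.commute diff_add_cancel norm_triangle_ineq)
          ultimately have "norm y \<le> R + 2" "norm z \<le> R + 2" using lt eps by auto
          then have "dist (g y) (g z) < e / (4 * (A + 1))" using lt eps
            by (intro d(2)) (auto simp: dist_norm norm_minus_commute)
          then show ?thesis using \<open>norm z \<le> R + 2\<close> by (simp add: dist_norm)
        qed
        then show ?thesis using mollifierD(2)[OF J, of "z - y"] by (metis abs_of_nonneg norm_scaleR mult_left_mono)
      qed
      have "mollify J g z - g z = mollify J g z - (\<integral>y. J (z - y) *\<^sub>R g z \<partial>lborel)" using J1 by simp
      also have "\<dots> = (\<integral>y. J (z - y) *\<^sub>R (g y - g z) \<partial>lborel)"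
        unfolding mollify_def using ii[OF g(3)] J1 by (simp add: scaleR_diff_right)
      finally have "norm (mollify J g z - g z) \<le> (\<integral>y. norm (J (z - y) *\<^sub>R (g y - g z)) \<partial>lborel)"
        by (simp only: integral_norm_bound)
      also have "\<dots> \<le> (\<integral>y. J (z - y) * (e / (4 * (A + 1)) * indicator ?B z) \<partial>lborel)"
      proof (rule integral_mono[OF _ _ close])
        show "integrable lborel (\<lambda>y. norm (J (z - y) *\<^sub>R (g y - g z)))"
          using ii[OF g(3)] J1 by (intro integrable_norm) (simp add: scaleR_diff_right)
      qed (use J1 in auto)
      also have "\<dots> = e / (4 * (A + 1)) * indicator ?B z" using J1 by simp
      finally show ?thesis .
    qed
    have B: "integrable lborel (\<lambda>z. e / (4 * (A + 1)) * indicator ?B z)"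
      by (rule integrable_mult_right, rule integrable_real_indicator) (use emeasure_lborel_cball_finite in \<open>auto simp: less_top\<close>)
    have mi: "integrable lborel (mollify J f)" "integrable lborel (mollify J g)" using mollify_L1(1)[OF J] f g(3) by auto
    have "(\<integral>z. norm (mollify J g z - g z) \<partial>lborel) \<le> (\<integral>z. e / (4 * (A + 1)) * indicator ?B z \<partial>lborel)"
      using mi g(3) B by (intro integral_mono pt) auto
    also have "\<dots> = e / (4 * (A + 1)) * A" by (simp add: A_def)
    also have "\<dots> \<le> e / 4" using A e by (simp add: field_simps)
    finally have 2: "(\<integral>z. norm (mollify J g z - g z) \<partial>lborel) \<le> e / 4" .
    have "(\<integral>z. norm (mollify J (\<lambda>y. f y - g y) z) \<partial>lborel) \<le> (\<integral>z. norm (f z - g z) \<partial>lborel)"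
      using f g(3) by (intro mollify_L1(2)[OF J]) auto
    then have 1: "(\<integral>z. norm (mollify J f z - mollify J g z) \<partial>lborel) < e / 4"
      using g(4) by (simp add: mollify_diff[OF J f g(3)])
    have "(\<integral>z. norm (mollify J f z - f z) \<partial>lborel) \<le> (\<integral>z. norm (mollify J f z - mollify J g z) + norm (mollify J g z - g z) + norm (f z - g z) \<partial>lborel)"
    proof (rule integral_mono)
      fix z
      have "mollify J f z - f z = (mollify J f z - mollify J g z) + (mollify J g z - g z) - (f z - g z)" by simp
      then show "norm (mollify J f z - f z) \<le> norm (mollify J f z - mollify J g z) + norm (mollify J g z - g z) + norm (f z - g z)"
        by (metis norm_triangle_ineq norm_triangle_ineq4 add_right_mono order_trans)
    qed (use f g(3) mi in auto)
    also have "\<dots> < e" using 1 2 g(4) f g(3) mi e by simp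
    finally show "(\<integral>z. norm (mollify J f z - f z) \<partial>lborel) < e" .
  qed
qed

section \<open>A subcritical Sobolev-Poincare inequality on a ball\<close>

lemma integrable_powr_unit_interval:
  fixes a :: real
  assumes "-1 < a"
  shows "integrable lborel (\<lambda>s. indicator {0<..1} s * s powr a)"
proof -
  have "(\<lambda>s. s powr a) integrable_on {0..1}" using has_integral_powr_from_0[OF assms, of 1] by auto
  then have "(\<lambda>s. s powr a) absolutely_integrable_on {0..1}" by (rule nonnegative_absolutely_integrable_1) simp
  then have "integrable lebesgue (\<lambda>s. indicator {0..1} s *\<^sub>R s powr a)" by (simp add: set_integrable_def)
  moreover have "(\<lambda>s. indicator {0..1} s *\<^sub>R s powr a) = (\<lambda>s. indicator {0<..1} s * s powr a)"
    by (auto simp: fun_eq_iff indicator_def)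
  ultimately show ?thesis by (simp add: integrable_completion)
qed

lemma integrable_bounded_finite_support:
  fixes f :: "'a \<Rightarrow> real"
  assumes "f \<in> borel_measurable M" "S \<in> sets M" "emeasure M S < \<infinity>" "\<And>x. \<bar>f x\<bar> \<le> K * indicator S x"
  shows "integrable M f"
proof (rule Bochner_Integration.integrable_bound[where f="\<lambda>x. K * indicator S x"])
  show "integrable M (\<lambda>x. K * indicator S x)" using assms by (intro integrable_mult_right integrable_real_indicator) auto
  show "AE x in M. norm (f x) \<le> norm (K * indicator S x)" using assms(4) by (intro AE_I2) (auto intro: order_trans[OF _ abs_ge_self])
qed fact

lemma indicator_Times_le:
  fixes K :: real
  assumes "\<bar>a\<bar> \<le> K * indicator (X \<times> Y) (x, y)" "0 \<le> K"
  shows "\<bar>a\<bar> \<le> K * indicator X x" "\<bar>a\<bar> \<le> K * indicator Y y"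
  using assms by (cases "x \<in> X"; cases "y \<in> Y"; simp)+

lemma norm_diff_le_line_integral:
  fixes v :: "'a::euclidean_space \<Rightarrow> 'b::euclidean_space"
  assumes der: "\<And>x. (v has_derivative v' x) (at x)" and g: "continuous_on UNIV g"
    and bd: "\<And>x h. norm (v' x h) \<le> g x * norm h"
  shows "norm (v y - v x) \<le> norm (y - x) * (\<integral>s. indicator {0<..1} s * g (x + s *\<^sub>R (y - x)) \<partial>lborel)"
proof -
  let ?G = "\<lambda>s. g (x + s *\<^sub>R (y - x))"
  have Gc: "continuous_on UNIV ?G" by (intro continuous_on_compose2[OF g] continuous_intros) auto
  let ?\<phi> = "\<lambda>s. norm (y - x) * integral {0..s} ?G"
  have "norm (v (x + 1 *\<^sub>R (y - x)) - v (x + 0 *\<^sub>R (y - x))) \<le> ?\<phi> 1 - ?\<phi> 0"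
  proof (rule differentiable_bound_general[where f="\<lambda>s. v (x + s *\<^sub>R (y - x))" and \<phi>="?\<phi>" and a=0 and b="1::real"
        and f'="\<lambda>s. v' (x + s *\<^sub>R (y - x)) (y - x)" and \<phi>'="\<lambda>s. norm (y - x) * ?G s"])
    have vc: "continuous_on UNIV v" using der by (auto intro!: continuous_at_imp_continuous_on has_derivative_continuous)
    show "continuous_on {0..1} (\<lambda>s. v (x + s *\<^sub>R (y - x)))" by (intro continuous_on_compose2[OF vc] continuous_intros) auto
    show "continuous_on {0..1} ?\<phi>"
      by (intro continuous_intros indefinite_integral_continuous_1 integrable_continuous_interval continuous_on_subset[OF Gc]) auto
    fix s :: real assume s: "0 < s" "s < 1"
    have "((\<lambda>s. v (x + s *\<^sub>R (y - x))) has_derivative (\<lambda>t. v' (x + s *\<^sub>R (y - x)) (t *\<^sub>R (y - x)))) (at s)"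
      by (rule has_derivative_compose[OF _ der]) (auto intro!: derivative_eq_intros)
    then show "((\<lambda>s. v (x + s *\<^sub>R (y - x))) has_vector_derivative v' (x + s *\<^sub>R (y - x)) (y - x)) (at s)"
      unfolding has_vector_derivative_def using has_derivative_linear[OF der] by (simp add: linear_scale)
    have "((\<lambda>s. integral {0..s} ?G) has_real_derivative ?G s) (at s within {0..1})"
      by (rule integral_has_real_derivative) (use s in \<open>auto intro: continuous_on_subset[OF Gc]\<close>)
    then have "((\<lambda>s. integral {0..s} ?G) has_real_derivative ?G s) (at s)" using s by (simp add: at_within_Icc_at)
    then show "(?\<phi> has_vector_derivative norm (y - x) * ?G s) (at s)"
      by (auto intro!: derivative_eq_intros simp: has_real_derivative_iff_has_vector_derivative[symmetric])
    show "norm (v' (x + s *\<^sub>R (y - x)) (y - x)) \<le> norm (y - x) * ?G s" using bd by (simp add: mult.commute)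
  qed simp
  then have "norm (v y - v x) \<le> norm (y - x) * integral {0..1} ?G" by simp
  also have "integral {0..1} ?G = (\<integral>s. indicator {0..1} s *\<^sub>R ?G s \<partial>lborel)"
    using set_borel_integral_eq_integral(2)[of "{0..1}" ?G]
      borel_integrable_atLeastAtMost'[of 0 1 ?G] continuous_on_subset[OF Gc]
    by (simp add: set_lebesgue_integral_def)
  also have "\<dots> = (\<integral>s. indicator {0<..1} s * ?G s \<partial>lborel)"
  proof (rule integral_cong_AE)
    show "AE s in lborel. indicator {0..1} s *\<^sub>R ?G s = indicator {0<..1} s * ?G s"
      using AE_lborel_singleton[of 0] by eventually_elim (auto simp: indicator_def)
  qed (use borel_measurable_continuous_onI[OF Gc] in auto)
  finally show ?thesis .
qed

text \<open>
  The inequality between the \<open>L^r\<close> norm of \<open>v\<close> minus a weighted mean and the \<open>L^q\<close> norm of its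
  gradient, below the critical exponent. Because the exponent is subcritical, neither Riesz
  potentials nor a maximal function are needed. With \<open>e(x, s, y) = x + s (y - x)\<close>, averaging
  \<open>|v x - v y| \<le> |x - y| \<integral> g (e(x, s, y)) ds\<close> over \<open>y\<close> bounds \<open>|v x - a|\<close> by \<open>C1 \<integral> P(x, s) ds\<close>,
  where \<open>P(x, s)\<close> is the integral of \<open>g (e(x, s, y))\<close> over \<open>y\<close> in the ball.

  Two bounds for \<open>A(s, x) = \<integral> g (e(x, s, y))^q dy\<close> are available. The substitution in \<open>y\<close> gives
  \<open>A(s, x) \<le> s^{-n} \<Gamma>\<close> with \<open>\<Gamma> = \<integral> g^q\<close>. Its integral over \<open>x\<close> is at most
  \<open>C \<Gamma>\<close>, uniformly in \<open>s\<close>. Interpolating between them, \<open>\<integral> P(x, s)^r dx\<close> is at most a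
  multiple of \<open>s^{-n (r/q - 1)} \<Gamma>^{r/q}\<close>. This singularity at \<open>s = 0\<close> is integrable after
  Jensen's inequality in \<open>s\<close> with the weight \<open>s^{-\<beta>}\<close>, for \<open>\<beta> < 1\<close> close to 1, exactly if
  \<open>n (1/q - 1/r) < 1\<close>.
\<close>

lemma Sobolev_Poincare_subcritical:
  fixes \<eta> :: "'a::euclidean_space \<Rightarrow> real" and R q r :: real
  assumes R: "0 < R" and q: "1 < q" and qr: "q < r" and sub: "real DIM('a) * (1/q - 1/r) < 1"
    and \<eta>: "continuous_on UNIV \<eta>" "\<And>x. 0 \<le> \<eta> x" "\<And>x. \<eta> x \<noteq> 0 \<Longrightarrow> norm x \<le> R" "0 < (\<integral>x. \<eta> x \<partial>lborel)"
  obtains C where "0 \<le> C"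
    "\<forall>(v :: 'a \<Rightarrow> 'b::euclidean_space) v' g. (\<forall>x. (v has_derivative v' x) (at x)) \<longrightarrow> continuous_on UNIV g \<longrightarrow>
       (\<forall>x h. norm (v' x h) \<le> g x * norm h) \<longrightarrow> (\<forall>x. 0 \<le> g x) \<longrightarrow>
       (\<integral>x. indicator (cball 0 R) x * norm (v x - (\<integral>y. \<eta> y *\<^sub>R v y \<partial>lborel) /\<^sub>R (\<integral>y. \<eta> y \<partial>lborel)) powr r \<partial>lborel)
         \<le> C * (\<integral>x. indicator (cball 0 R) x * g x powr q \<partial>lborel) powr (r / q)"
proof -
  let ?n = "real DIM('a)"
  let ?B = "cball (0::'a) R"
  define b where "b = measure lborel ?B"
  define c where "c = (\<integral>x. \<eta> x \<partial>lborel)"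
  have Bsets [measurable]: "?B \<in> sets borel" by simp
  have c: "0 < c" using \<eta>(4) by (simp add: c_def)
  have b: "0 \<le> b" by (simp add: b_def)
  have Bfin: "emeasure lborel ?B < \<infinity>" by (rule emeasure_lborel_cball_finite)
  have Bint: "integrable lborel (\<lambda>x. indicator ?B x :: real)" by (intro integrable_real_indicator) (use Bfin in auto)
  have "compact (\<eta> ` ?B)" using \<eta>(1) by (intro compact_continuous_image) (auto intro: continuous_on_subset)
  then obtain N0 where N0: "\<And>x. x \<in> ?B \<Longrightarrow> norm (\<eta> x) \<le> N0" using compact_imp_bounded bounded_iff by (metis image_eqI)
  define N where "N = max N0 0"
  have N: "\<eta> x \<le> N * indicator ?B x" "0 \<le> N" for x
    using N0[of x] \<eta>(2,3)[of x] by (auto simp: N_def indicator_def)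
  have r: "1 < r" "1 \<le> r" "0 < r" using q qr by auto
  \<comment> \<open>The distance to the critical exponent. It is positive by the subcriticality assumption,
      and \<open>\<beta>\<close> is chosen so close to 1 that both powers of s below are integrable at 0.\<close>
  define d where "d = r - ?n * (r / q - 1)"
  have d: "d > 0"
  proof -
    have "r * (?n * (1/q - 1/r)) < r * 1" using sub r by (intro mult_strict_left_mono) auto
    moreover have "r * (?n * (1/q - 1/r)) = ?n * (r / q - 1)" using r q by (simp add: field_simps)
    ultimately show ?thesis by (simp add: d_def)
  qed
  define \<beta> where "\<beta> = 1 - min (1/2) (d / (2 * r))"
  have mpos: "0 < min (1/2) (d / (2 * r))" using d r by simp
  have \<beta>: "0 \<le> \<beta>" "\<beta> < 1" using mpos d r by (auto simp: \<beta>_def min_def)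
  have "min (1/2) (d / (2 * r)) * (r - 1) < d"
  proof -
    have "min (1/2) (d / (2 * r)) * (r - 1) \<le> d / (2 * r) * (r - 1)" using r by (intro mult_right_mono) auto
    also have "\<dots> < d" using d r by (simp add: field_simps add_pos_pos)
    finally show ?thesis .
  qed
  then have expo: "-1 < \<beta> * (r - 1) - ?n * (r / q - 1)"
    by (simp add: \<beta>_def d_def algebra_simps)
  define \<kappa> where "\<kappa> = (\<integral>s. indicator {0<..1} s * s powr (- \<beta>) \<partial>lborel)"
  define \<sigma> where "\<sigma> = (\<integral>s. indicator {0<..1} s * s powr (\<beta> * (r - 1) - ?n * (r / q - 1)) \<partial>lborel)"
  have \<kappa>i: "integrable lborel (\<lambda>s. indicator {0<..1} s * s powr (- \<beta>))" by (rule integrable_powr_unit_interval) (use \<beta> in auto)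
  have \<sigma>i: "integrable lborel (\<lambda>s. indicator {0<..1} s * s powr (\<beta> * (r - 1) - ?n * (r / q - 1)))"
    by (rule integrable_powr_unit_interval) (use expo in auto)
  have \<kappa>\<sigma>: "0 \<le> \<kappa>" "0 \<le> \<sigma>" by (simp_all add: \<kappa>_def \<sigma>_def)
  define C1 where "C1 = 2 * R * N / c"
  define C where "C = C1 powr r * (\<kappa> powr (r - 1) * (b powr ((q - 1) * (r / q)) * (b * 2 ^ DIM('a)) * \<sigma>))"
  show ?thesis
  proof (rule that[of C])
    show "0 \<le> C" using b \<kappa>\<sigma> by (simp add: C_def)
  next
    show "\<forall>(v :: 'a \<Rightarrow> 'b) v' g. (\<forall>x. (v has_derivative v' x) (at x)) \<longrightarrow> continuous_on UNIV g \<longrightarrow>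
       (\<forall>x h. norm (v' x h) \<le> g x * norm h) \<longrightarrow> (\<forall>x. 0 \<le> g x) \<longrightarrow>
       (\<integral>x. indicator (cball 0 R) x * norm (v x - (\<integral>y. \<eta> y *\<^sub>R v y \<partial>lborel) /\<^sub>R (\<integral>y. \<eta> y \<partial>lborel)) powr r \<partial>lborel)
         \<le> C * (\<integral>x. indicator (cball 0 R) x * g x powr q \<partial>lborel) powr (r / q)"
    proof (intro allI impI)
      fix v :: "'a \<Rightarrow> 'b" and v' g
      assume "\<forall>x. (v has_derivative v' x) (at x)" and g: "continuous_on UNIV g"
        and "\<forall>x h. norm (v' x h) \<le> g x * norm h" and "\<forall>x. 0 \<le> g x"
      then have der: "\<And>x. (v has_derivative v' x) (at x)" and bd: "\<And>x h. norm (v' x h) \<le> g x * norm h" and g0: "\<And>x. 0 \<le> g x"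
        by auto
      have [measurable]: "g \<in> borel_measurable borel" using g by (rule borel_measurable_continuous_onI)
      have [measurable]: "\<eta> \<in> borel_measurable borel" using \<eta>(1) by (rule borel_measurable_continuous_onI)
      have vc: "continuous_on UNIV v" using der by (auto intro!: continuous_at_imp_continuous_on has_derivative_continuous)
      have [measurable]: "v \<in> borel_measurable borel" using vc by (rule borel_measurable_continuous_onI)
      have "compact (g ` ?B)" using g by (intro compact_continuous_image) (auto intro: continuous_on_subset)
      then obtain G0 where G0: "\<And>x. x \<in> ?B \<Longrightarrow> norm (g x) \<le> G0" using compact_imp_bounded bounded_iff by (metis image_eqI)
      define G where "G = max G0 0"
      have G: "x \<in> ?B \<Longrightarrow> g x \<le> G" "0 \<le> G" for x using G0[of x] by (auto simp: G_def)
      define \<Gamma> where "\<Gamma> = (\<integral>x. indicator ?B x * g x powr q \<partial>lborel)"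
      have \<Gamma>: "0 \<le> \<Gamma>" by (simp add: \<Gamma>_def)
      let ?e = "\<lambda>x s y. x + s *\<^sub>R (y - x)"
      have eB: "?e x s y \<in> ?B" if "x \<in> ?B" "y \<in> ?B" "s \<in> {0<..1}" for x y s
      proof -
        have "(1 - s) *\<^sub>R x + s *\<^sub>R y \<in> ?B" using that by (intro convexD_alt[OF convex_cball]) auto
        then show ?thesis by (simp add: algebra_simps)
      qed
      define F where "F x s y = indicator ?B x * indicator {0<..1::real} s * indicator ?B y * g (?e x s y)" for x s y
      have F: "0 \<le> F x s y" "\<bar>F x s y\<bar> \<le> G * indicator ?B y" "\<bar>F x s y\<bar> \<le> G * indicator ({0<..1} \<times> ?B) (s,y)" for x s y
        using g0[of "?e x s y"] G(1)[OF eB[of x y s]] G(2) by (auto simp: F_def indicator_def)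
      have Fm [measurable]: "(\<lambda>(x, s, y). F x s y) \<in> borel_measurable (lborel \<Otimes>\<^sub>M lborel \<Otimes>\<^sub>M lborel)"
        "F x s \<in> borel_measurable lborel" for x s
        unfolding F_def by measurable
      have Fi: "integrable lborel (F x s)" for x s
        by (rule integrable_bounded_finite_support[OF _ _ Bfin F(2)]) auto
      define P where "P x s = (\<integral>y. F x s y \<partial>lborel)" for x s
      have Pm [measurable]: "(\<lambda>(x, s). P x s) \<in> borel_measurable (lborel \<Otimes>\<^sub>M lborel)" "P x \<in> borel_measurable lborel" for x
        unfolding P_def F_def by measurable
      have P: "0 \<le> P x s" "P x s \<le> G * b" "P x s = P x s * indicator ?B x * indicator {0<..1} s" for x s
      proof -
        show "0 \<le> P x s" unfolding P_def using F(1) by simp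
        have "P x s \<le> (\<integral>y. G * indicator ?B y \<partial>lborel)" unfolding P_def
          using Fi F(2)[of x s] Bint by (intro integral_mono) (auto simp: abs_le_iff)
        then show "P x s \<le> G * b" by (simp add: b_def)
        show "P x s = P x s * indicator ?B x * indicator {0<..1} s" unfolding P_def F_def by (auto simp: indicator_def)
      qed
      \<comment> \<open>The difference of v and its mean a is estimated by averages of g over contracted
          balls.\<close>
      define a where "a = (\<integral>y. \<eta> y *\<^sub>R v y \<partial>lborel) /\<^sub>R c"
      have \<eta>i: "integrable lborel \<eta>" using \<eta>(4) not_integrable_integral_eq by force
      have \<eta>vi: "integrable lborel (\<lambda>y. \<eta> y *\<^sub>R v y)"
      proof -
        have "integrable lborel (\<lambda>y. indicator ?B y *\<^sub>R (\<eta> y *\<^sub>R v y))"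
          by (rule borel_integrable_compact) (auto intro!: continuous_intros continuous_on_subset[OF vc] continuous_on_subset[OF \<eta>(1)])
        moreover have "(\<lambda>y. indicator ?B y *\<^sub>R (\<eta> y *\<^sub>R v y)) = (\<lambda>y. \<eta> y *\<^sub>R v y)"
          using \<eta>(3) by (force simp: fun_eq_iff indicator_def)
        ultimately show ?thesis by simp
      qed
      have pair: "integrable (lborel \<Otimes>\<^sub>M lborel) (\<lambda>(s, y). F x s y)" for x
      proof (rule integrable_bounded_finite_support[of _ _ "{0<..1} \<times> ?B" G])
        show "(\<lambda>(s, y). F x s y) \<in> borel_measurable (lborel \<Otimes>\<^sub>M lborel)" unfolding F_def by measurable
        show "emeasure (lborel \<Otimes>\<^sub>M lborel) ({0<..1::real} \<times> ?B) < \<infinity>"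
          using Bfin by (subst lborel.emeasure_pair_measure_Times) (auto simp: ennreal_mult_less_top)
        show "\<bar>case z of (s, y) \<Rightarrow> F x s y\<bar> \<le> G * indicator ({0<..1} \<times> ?B) z" for z
          using F(3) by (cases z) auto
      qed (auto intro!: pair_measureI)
      have I: "norm (v x - a) \<le> C1 * (\<integral>s. P x s \<partial>lborel)" if x: "x \<in> ?B" for x
      proof -
        have "v x - a = (\<integral>y. \<eta> y *\<^sub>R (v x - v y) \<partial>lborel) /\<^sub>R c"
          using \<eta>i \<eta>vi c by (simp add: scaleR_diff_right a_def c_def)
        then have "norm (v x - a) \<le> (\<integral>y. norm (\<eta> y *\<^sub>R (v x - v y)) \<partial>lborel) / c"
          using c integral_norm_bound[of lborel "\<lambda>y. \<eta> y *\<^sub>R (v x - v y)"] by (simp add: divide_simps)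
        also have "(\<integral>y. norm (\<eta> y *\<^sub>R (v x - v y)) \<partial>lborel) \<le> (\<integral>y. 2 * R * N * (\<integral>s. F x s y \<partial>lborel) \<partial>lborel)"
        proof (rule integral_mono)
          show "integrable lborel (\<lambda>y. norm (\<eta> y *\<^sub>R (v x - v y)))" using \<eta>i \<eta>vi by (intro integrable_norm) (simp add: scaleR_diff_right)
          show "integrable lborel (\<lambda>y. 2 * R * N * (\<integral>s. F x s y \<partial>lborel))" using lborel_pair.integrable_snd[OF pair] by simp
          fix y
          show "norm (\<eta> y *\<^sub>R (v x - v y)) \<le> 2 * R * N * (\<integral>s. F x s y \<partial>lborel)"
          proof (cases "y \<in> ?B")
            case True
            have FF: "(\<integral>s. F x s y \<partial>lborel) = (\<integral>s. indicator {0<..1} s * g (?e x s y) \<partial>lborel)" using True x by (simp add: F_def)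
            have nn: "0 \<le> (\<integral>s. indicator {0<..1} s * g (?e x s y) \<partial>lborel)" using g0 by simp
            have "norm (v y - v x) \<le> norm (y - x) * (\<integral>s. indicator {0<..1} s * g (?e x s y) \<partial>lborel)"
              by (rule norm_diff_le_line_integral[OF der g bd])
            also have "\<dots> \<le> 2 * R * (\<integral>s. indicator {0<..1} s * g (?e x s y) \<partial>lborel)"
              using nn x True norm_triangle_ineq4[of y x] by (intro mult_right_mono) auto
            finally have "norm (v x - v y) \<le> 2 * R * (\<integral>s. F x s y \<partial>lborel)" by (simp add: FF norm_minus_commute)
            then have "\<eta> y * norm (v x - v y) \<le> N * (2 * R * (\<integral>s. F x s y \<partial>lborel))"
              using N(1)[of y] N(2) \<eta>(2)[of y] True by (intro mult_mono) auto
            then show ?thesis using \<eta>(2)[of y] by (simp add: mult_ac)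
          next
            case False
            then have "\<eta> y = 0" using \<eta>(3) by force
            then show ?thesis using R N F(1) by simp
          qed
        qed
        also have "(\<integral>y. 2 * R * N * (\<integral>s. F x s y \<partial>lborel) \<partial>lborel) = 2 * R * N * (\<integral>s. P x s \<partial>lborel)"
          using lborel_pair.integral_snd[OF pair[of x]] lborel_pair.integral_fst[OF pair[of x]] by (simp add: P_def)
        finally show ?thesis using c by (simp add: C1_def divide_right_mono)
      qed
      \<comment> \<open>Jensen's inequality in s with the weight \<open>s^{-\<beta>}\<close> of finite mass \<open>\<kappa>\<close>.\<close>
      define W where "W x s = s powr (\<beta> * (r - 1)) * P x s powr r" for x s
      have W: "0 \<le> W x s" "\<bar>W x s\<bar> \<le> (G * b) powr r * indicator (?B \<times> {0<..1}) (x, s)" for x s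
      proof -
        show "0 \<le> W x s" by (simp add: W_def)
        show "\<bar>W x s\<bar> \<le> (G * b) powr r * indicator (?B \<times> {0<..1}) (x, s)"
        proof (cases "x \<in> ?B \<and> s \<in> {0<..1}")
          case True
          have "W x s \<le> 1 * (G * b) powr r" unfolding W_def
            using True P(1,2)[of x s] \<beta> r by (intro mult_mono powr_mono2 powr_le1) auto
          then show ?thesis using True by (simp add: W_def)
        next
          case False
          then have "P x s = 0" using P(3)[of x s] by (metis indicator_simps(2) mult_zero_left mult_zero_right)
          then show ?thesis using r by (simp add: W_def)
        qed
      qed
      have Wm [measurable]: "(\<lambda>(x, s). W x s) \<in> borel_measurable (lborel \<Otimes>\<^sub>M lborel)" "W x \<in> borel_measurable lborel" for x
        unfolding W_def by measurable
      have Wpair: "integrable (lborel \<Otimes>\<^sub>M lborel) (\<lambda>(x, s). W x s)"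
      proof (rule integrable_bounded_finite_support[of _ _ "?B \<times> {0<..1}" "(G * b) powr r"])
        show "emeasure (lborel \<Otimes>\<^sub>M lborel) (?B \<times> {0<..1::real}) < \<infinity>"
          using Bfin by (subst lborel.emeasure_pair_measure_Times) (auto simp: ennreal_mult_less_top)
        show "\<bar>case z of (x, s) \<Rightarrow> W x s\<bar> \<le> (G * b) powr r * indicator (?B \<times> {0<..1}) z" for z
          using W(2) by (cases z) auto
      qed (auto intro!: pair_measureI)
      have Wi: "integrable lborel (W x)" for x
        by (rule integrable_bounded_finite_support[of _ _ "{0<..1}" "(G * b) powr r"]) (use indicator_Times_le(2)[OF W(2)[of x]] in auto)
      have J: "(\<integral>s. P x s \<partial>lborel) powr r \<le> \<kappa> powr (r - 1) * (\<integral>s. W x s \<partial>lborel)" for x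
      proof -
        have e1: "indicator {0<..1} s * s powr (- \<beta>) * (s powr \<beta> * P x s) = P x s" for s
          using P(3)[of x s] by (cases "s \<in> {0<..1}") (auto simp: powr_minus)
        have e2: "indicator {0<..1} s * s powr (- \<beta>) * (s powr \<beta> * P x s) powr r = W x s" for s
        proof (cases "s \<in> {0<..1}")
          case True
          have "s powr (- \<beta>) * s powr (\<beta> * r) = s powr (\<beta> * (r - 1))" by (simp add: algebra_simps flip: powr_add)
          then show ?thesis using True P(1)[of x s] by (simp add: W_def powr_mult powr_powr)
        next
          case False
          then have "P x s = 0" using P(3)[of x s] by simp
          then show ?thesis using False r by (simp add: W_def)
        qed
        have "(\<integral>s. indicator {0<..1} s * s powr (- \<beta>) * (s powr \<beta> * P x s) \<partial>lborel) powr r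
            \<le> \<kappa> powr (r - 1) * (\<integral>s. indicator {0<..1} s * s powr (- \<beta>) * (s powr \<beta> * P x s) powr r \<partial>lborel)"
          unfolding \<kappa>_def by (rule Jensen_powr(2)) (use r P(1) \<kappa>i Wi in \<open>auto simp: e2\<close>)
        then show ?thesis by (simp only: e1 e2)
      qed
      \<comment> \<open>The two bounds A1 (pointwise in x) and A2 (after integration over x).\<close>
      define A where "A s x = (\<integral>y. indicator ?B x * indicator ?B y * g (?e x s y) powr q \<partial>lborel)" for s x
      have Abd: "\<bar>indicator ?B x * indicator ?B y * g (?e x s y) powr q\<bar> \<le> G powr q * indicator (?B \<times> ?B) (x, y)"
        if "s \<in> {0<..1}" for x s y
        using g0[of "?e x s y"] G(1)[OF eB[of x y s]] G(2) that q by (auto simp: indicator_def intro!: powr_mono2)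
      have Apair: "integrable (lborel \<Otimes>\<^sub>M lborel) (\<lambda>(x, y). indicator ?B x * indicator ?B y * g (?e x s y) powr q)"
        if s: "s \<in> {0<..1}" for s
      proof (rule integrable_bounded_finite_support[of _ _ "?B \<times> ?B" "G powr q"])
        show "emeasure (lborel \<Otimes>\<^sub>M lborel) (?B \<times> ?B) < \<infinity>"
          using Bfin by (subst lborel.emeasure_pair_measure_Times) (auto simp: ennreal_mult_less_top)
        show "\<bar>case z of (x, y) \<Rightarrow> indicator ?B x * indicator ?B y * g (?e x s y) powr q\<bar> \<le> G powr q * indicator (?B \<times> ?B) z" for z
          using Abd[OF s] by (cases z) auto
      qed (auto intro!: pair_measureI)
      have Gam_i: "integrable lborel (\<lambda>z. indicator ?B z * g z powr q)"
        by (rule integrable_bounded_finite_support[OF _ _ Bfin, of _ "G powr q"]) (use g0 G q in \<open>auto simp: indicator_def intro!: powr_mono2\<close>)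
      have Ai: "integrable lborel (\<lambda>y. indicator ?B x * indicator ?B y * g (?e x s y) powr q)" if "s \<in> {0<..1}" for x s
        by (rule integrable_bounded_finite_support[OF _ _ Bfin, of _ "G powr q"]) (use indicator_Times_le(2)[OF Abd[OF that, of x]] in auto)
      have aff: "(\<integral>y. indicator ?B (t + k *\<^sub>R y) * g (t + k *\<^sub>R y) powr q \<partial>lborel) = (1 / k ^ DIM('a)) * \<Gamma>"
        "integrable lborel (\<lambda>y. indicator ?B (t + k *\<^sub>R y) * g (t + k *\<^sub>R y) powr q)" if "k > 0" for t k
        using lborel_integral_affine[of "\<lambda>z. indicator ?B z * g z powr q" k t] that Gam_i by (auto simp: \<Gamma>_def)
      have A1: "A s x \<le> (1 / s ^ DIM('a)) * \<Gamma> * indicator ?B x" if s: "s \<in> {0<..1}" for s x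
      proof (cases "x \<in> ?B")
        case True
        have e: "?e x s y = (1 - s) *\<^sub>R x + s *\<^sub>R y" for y by (simp add: algebra_simps)
        have "A s x \<le> (\<integral>y. indicator ?B ((1 - s) *\<^sub>R x + s *\<^sub>R y) * g ((1 - s) *\<^sub>R x + s *\<^sub>R y) powr q \<partial>lborel)"
          unfolding A_def
        proof (rule integral_mono[OF Ai[OF s]])
          fix y show "indicator ?B x * indicator ?B y * g (?e x s y) powr q \<le> indicator ?B ((1 - s) *\<^sub>R x + s *\<^sub>R y) * g ((1 - s) *\<^sub>R x + s *\<^sub>R y) powr q"
            unfolding e[symmetric] using eB[of x y s] s by (auto simp: indicator_def simp del: mem_cball)
        qed (use aff(2) s in auto)
        then show ?thesis using aff(1)[of s] s True by simp
    next
        case False then show ?thesis by (simp add: A_def)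
      qed
      have A0: "0 \<le> A s x" for s x by (simp add: A_def)
      have Axi: "integrable lborel (A s)" if "s \<in> {0<..1}" for s
        using lborel_pair.integrable_fst[OF Apair[OF that]] by (simp add: A_def[abs_def])
      have A2: "(\<integral>x. A s x \<partial>lborel) \<le> b * 2 ^ DIM('a) * \<Gamma>" if s: "s \<in> {0<..1}" for s
      \<comment> \<open>For \<open>s \<ge> 1/2\<close> the pointwise bound is good enough. For \<open>s < 1/2\<close> the map
          \<open>x \<mapsto> e(x, s, y)\<close> contracts only by the factor \<open>1 - s \<ge> 1/2\<close>, so one substitutes in x
          and not in y.\<close>
      proof (cases "s \<ge> 1/2")
        case True
        have "1 / s ^ DIM('a) = (1 / s) ^ DIM('a)" by (simp add: power_one_over)
        also have "\<dots> \<le> 2 ^ DIM('a)" using True by (intro power_mono) (auto simp: field_simps)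
        finally have le: "1 / s ^ DIM('a) \<le> 2 ^ DIM('a)" .
        have "(\<integral>x. A s x \<partial>lborel) \<le> (\<integral>x. (1 / s ^ DIM('a)) * \<Gamma> * indicator ?B x \<partial>lborel)"
          using Axi[OF s] Bint by (intro integral_mono A1 s) auto
        also have "\<dots> = (1 / s ^ DIM('a)) * \<Gamma> * b" by (simp add: b_def)
        also have "\<dots> \<le> 2 ^ DIM('a) * \<Gamma> * b" using le \<Gamma> b by (intro mult_right_mono) auto
        finally show ?thesis by (simp add: mult_ac)
    next
        case False
        have e: "?e x s y = s *\<^sub>R y + (1 - s) *\<^sub>R x" for x y :: 'a by (simp add: algebra_simps)
        have "1 / (1 - s) ^ DIM('a) = (1 / (1 - s)) ^ DIM('a)" by (simp add: power_one_over)
        also have "\<dots> \<le> 2 ^ DIM('a)" using False by (intro power_mono) (auto simp: field_simps)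
        finally have le: "1 / (1 - s) ^ DIM('a) \<le> 2 ^ DIM('a)" .
        have "(\<integral>x. A s x \<partial>lborel) = (\<integral>y. (\<integral>x. indicator ?B x * indicator ?B y * g (?e x s y) powr q \<partial>lborel) \<partial>lborel)"
          unfolding A_def using lborel_pair.integral_fst[OF Apair[OF s]] lborel_pair.integral_snd[OF Apair[OF s]] by simp
        also have "\<dots> \<le> (\<integral>y. indicator ?B y * ((1 / (1 - s) ^ DIM('a)) * \<Gamma>) \<partial>lborel)"
        proof (rule integral_mono)
          show "integrable lborel (\<lambda>y. \<integral>x. indicator ?B x * indicator ?B y * g (?e x s y) powr q \<partial>lborel)"
            using lborel_pair.integrable_snd[OF Apair[OF s]] by simp
          show "integrable lborel (\<lambda>y. indicator ?B y * ((1 / (1 - s) ^ DIM('a)) * \<Gamma>))" using Bint by auto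
          fix y
          show "(\<integral>x. indicator ?B x * indicator ?B y * g (?e x s y) powr q \<partial>lborel) \<le> indicator ?B y * ((1 / (1 - s) ^ DIM('a)) * \<Gamma>)"
          proof (cases "y \<in> ?B")
            case True
            have "(\<integral>x. indicator ?B x * indicator ?B y * g (?e x s y) powr q \<partial>lborel)
                \<le> (\<integral>x. indicator ?B (s *\<^sub>R y + (1 - s) *\<^sub>R x) * g (s *\<^sub>R y + (1 - s) *\<^sub>R x) powr q \<partial>lborel)"
            proof (rule integral_mono)
              show "integrable lborel (\<lambda>x. indicator ?B x * indicator ?B y * g (?e x s y) powr q)"
                by (rule integrable_bounded_finite_support[OF _ _ Bfin, of _ "G powr q"]) (use indicator_Times_le(1)[OF Abd[OF s, of _ y]] in auto)
              fix x show "indicator ?B x * indicator ?B y * g (?e x s y) powr q \<le> indicator ?B (s *\<^sub>R y + (1 - s) *\<^sub>R x) * g (s *\<^sub>R y + (1 - s) *\<^sub>R x) powr q"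
                unfolding e[symmetric] using eB[of x y s] s by (auto simp: indicator_def simp del: mem_cball)
            qed (use aff(2) False in auto)
            then show ?thesis using aff(1)[of "1 - s"] False True by simp
          qed simp
        qed
        also have "\<dots> = b * ((1 / (1 - s) ^ DIM('a)) * \<Gamma>)" by (simp add: b_def)
        also have "\<dots> \<le> b * (2 ^ DIM('a) * \<Gamma>)" using le \<Gamma> b by (intro mult_left_mono mult_right_mono) auto
        finally show ?thesis by (simp add: mult_ac)
      qed
      \<comment> \<open>Interpolation: \<open>A^{r/q} = A^{r/q - 1} A\<close>, with A1 for the first factor. The second
          factor is kept for the integration over x.\<close>
      have PA: "P x s powr r \<le> b powr ((q - 1) * (r / q)) * (s powr (- ?n * (r / q - 1)) * \<Gamma> powr (r / q - 1)) * A s x"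
        if s: "s \<in> {0<..1}" for x s
      proof (cases "x \<in> ?B")
        case True
        have k: "(\<lambda>y. indicator ?B y * g (?e x s y) powr q) = (\<lambda>y. indicator ?B x * indicator ?B y * g (?e x s y) powr q)"
          using True by simp
        have "(\<integral>y. indicator ?B y * g (?e x s y) \<partial>lborel) powr q \<le> (\<integral>y. indicator ?B y \<partial>lborel) powr (q - 1) * (\<integral>y. indicator ?B y * g (?e x s y) powr q \<partial>lborel)"
          by (rule Jensen_powr(2)) (use q g0 Bint Ai[OF s, of x] in \<open>auto simp: k\<close>)
        moreover have "P x s = (\<integral>y. indicator ?B y * g (?e x s y) \<partial>lborel)" using True s by (simp add: P_def F_def)
        moreover have "A s x = (\<integral>y. indicator ?B y * g (?e x s y) powr q \<partial>lborel)" using True by (simp add: A_def)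
        moreover have "(\<integral>y. indicator ?B y \<partial>lborel) = b" by (simp add: b_def)
        ultimately have PqA: "P x s powr q \<le> b powr (q - 1) * A s x" by simp
        have "P x s powr r = (P x s powr q) powr (r / q)" using q by (simp add: powr_powr)
        also have "\<dots> \<le> (b powr (q - 1) * A s x) powr (r / q)" using PqA q r by (intro powr_mono2) auto
        also have "\<dots> = b powr ((q - 1) * (r / q)) * A s x powr (r / q)"
          using A0 by (simp add: powr_mult powr_powr)
        finally have PrA: "P x s powr r \<le> b powr ((q - 1) * (r / q)) * A s x powr (r / q)" .
        have "A s x powr (r / q) = A s x powr (r / q - 1) * A s x"
        proof (cases "A s x = 0")
          case False
          then have "A s x powr (r / q - 1) * A s x powr 1 = A s x powr (r / q - 1 + 1)" by (simp only: powr_add)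
          then show ?thesis using A0[of s x] by simp
        qed (use q r in auto)
        also have "\<dots> \<le> (s powr (- ?n * (r / q - 1)) * \<Gamma> powr (r / q - 1)) * A s x"
        proof (intro mult_right_mono A0)
          have "A s x powr (r / q - 1) \<le> ((1 / s ^ DIM('a)) * \<Gamma>) powr (r / q - 1)"
            using A1[OF s, of x] True A0 q qr by (intro powr_mono2) (auto simp: field_simps)
          also have "\<dots> = (1 / s ^ DIM('a)) powr (r / q - 1) * \<Gamma> powr (r / q - 1)" by (rule powr_mult)
          also have "1 / s ^ DIM('a) = s powr (- ?n)" using s by (simp add: powr_minus powr_realpow divide_inverse)
          finally show "A s x powr (r / q - 1) \<le> s powr (- ?n * (r / q - 1)) * \<Gamma> powr (r / q - 1)" by (simp add: powr_powr)
        qed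
        finally have "A s x powr (r / q) \<le> (s powr (- ?n * (r / q - 1)) * \<Gamma> powr (r / q - 1)) * A s x" .
        from order_trans[OF PrA mult_left_mono[OF this]] show ?thesis by (simp only: mult.assoc powr_ge_zero)
    next
        case False
        then have "P x s = 0" using P(3)[of x s] by simp
        then show ?thesis using r A0 by simp
      qed
      let ?K = "b powr ((q - 1) * (r / q)) * (b * 2 ^ DIM('a)) * \<Gamma> powr (r / q)"
      have slice: "(\<integral>x. W x s \<partial>lborel) \<le> ?K * (indicator {0<..1} s * s powr (\<beta> * (r - 1) - ?n * (r / q - 1)))" for s
      proof (cases "s \<in> {0<..1}")
        case True
        let ?k = "s powr (\<beta> * (r - 1)) * (b powr ((q - 1) * (r / q)) * (s powr (- ?n * (r / q - 1)) * \<Gamma> powr (r / q - 1)))"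
        have "(\<integral>x. W x s \<partial>lborel) \<le> (\<integral>x. ?k * A s x \<partial>lborel)"
        proof (rule integral_mono)
          show "integrable lborel (\<lambda>x. W x s)"
            by (rule integrable_bounded_finite_support[OF _ _ Bfin, of _ "(G * b) powr r"]) (use indicator_Times_le(1)[OF W(2)[of _ s]] in auto)
          show "W x s \<le> ?k * A s x" for x
            using mult_left_mono[OF PA[OF True, of x], of "s powr (\<beta> * (r - 1))"] by (simp add: W_def mult_ac)
        qed (use Axi[OF True] in auto)
        also have "\<dots> = ?k * (\<integral>x. A s x \<partial>lborel)" by simp
        also have "\<dots> \<le> ?k * (b * 2 ^ DIM('a) * \<Gamma>)" by (intro mult_left_mono A2 True) auto
        also have "\<dots> = ?K * (s powr (\<beta> * (r - 1) - ?n * (r / q - 1)))"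
        proof -
          have "s powr (\<beta> * (r - 1) - ?n * (r / q - 1)) = s powr (\<beta> * (r - 1)) * s powr (- ?n * (r / q - 1))"
            by (simp flip: powr_add)
          moreover have "\<Gamma> powr (r / q) = \<Gamma> powr (r / q - 1) * \<Gamma>"
          proof (cases "\<Gamma> = 0")
            case False
            then have "\<Gamma> powr (r / q - 1) * \<Gamma> powr 1 = \<Gamma> powr (r / q - 1 + 1)" by (simp only: powr_add)
            then show ?thesis using \<Gamma> by simp
          qed (use q r in auto)
          ultimately show ?thesis by (simp only: mult_ac)
        qed
        finally show ?thesis using True by simp
    next
        case False
        then have "W x s = 0" for x using P(3)[of x s] r by (simp add: W_def)
        then show ?thesis using False by simp
      qed
      have ImW: "indicator ?B x * norm (v x - a) powr r \<le> C1 powr r * (\<kappa> powr (r - 1) * (\<integral>s. W x s \<partial>lborel))" for x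
      proof (cases "x \<in> ?B")
        case True
        have C1: "0 \<le> C1" using R N c by (simp add: C1_def)
        have "norm (v x - a) powr r \<le> (C1 * (\<integral>s. P x s \<partial>lborel)) powr r" using I[OF True] r by (intro powr_mono2) auto
        also have "\<dots> = C1 powr r * (\<integral>s. P x s \<partial>lborel) powr r" using C1 P(1) by (simp add: powr_mult)
        also have "\<dots> \<le> C1 powr r * (\<kappa> powr (r - 1) * (\<integral>s. W x s \<partial>lborel))" by (intro mult_left_mono J) auto
        finally show ?thesis using True by simp
    next
        case False then show ?thesis using W(1) by simp
      qed
      have "integrable lborel (\<lambda>x. indicator ?B x *\<^sub>R (norm (v x - a) powr r))"
        by (rule borel_integrable_compact) (auto intro!: continuous_intros continuous_on_subset[OF vc] continuous_on_powr' simp: r less_imp_le[OF r(3)])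
      then have "(\<integral>x. indicator ?B x * norm (v x - a) powr r \<partial>lborel) \<le> (\<integral>x. C1 powr r * (\<kappa> powr (r - 1) * (\<integral>s. W x s \<partial>lborel)) \<partial>lborel)"
        using lborel_pair.integrable_fst[OF Wpair] by (intro integral_mono ImW) auto
      also have "\<dots> = C1 powr r * (\<kappa> powr (r - 1) * (\<integral>x. (\<integral>s. W x s \<partial>lborel) \<partial>lborel))" by simp
      also have "(\<integral>x. (\<integral>s. W x s \<partial>lborel) \<partial>lborel) = (\<integral>s. (\<integral>x. W x s \<partial>lborel) \<partial>lborel)"
        using lborel_pair.integral_fst[OF Wpair] lborel_pair.integral_snd[OF Wpair] by simp
      also have "C1 powr r * (\<kappa> powr (r - 1) * (\<integral>s. (\<integral>x. W x s \<partial>lborel) \<partial>lborel))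
         \<le> C1 powr r * (\<kappa> powr (r - 1) * (\<integral>s. ?K * (indicator {0<..1} s * s powr (\<beta> * (r - 1) - ?n * (r / q - 1))) \<partial>lborel))"
        using lborel_pair.integrable_snd[OF Wpair] \<sigma>i
        by (intro mult_left_mono integral_mono slice integrable_mult_right) auto
      also have "\<dots> = C * \<Gamma> powr (r / q)"
        by (simp only: Bochner_Integration.integral_mult_right_zero \<sigma>_def[symmetric]) (simp add: C_def mult_ac)
      finally show "(\<integral>x. indicator ?B x * norm (v x - (\<integral>y. \<eta> y *\<^sub>R v y \<partial>lborel) /\<^sub>R (\<integral>y. \<eta> y \<partial>lborel)) powr r \<partial>lborel)
           \<le> C * (\<integral>x. indicator ?B x * g x powr q \<partial>lborel) powr (r / q)"
        by (simp add: a_def c_def \<Gamma>_def)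
    qed
  qed
qed

section \<open>The energy identity for smooth conservation laws\<close>

lemma has_derivative_zero_outside_support:
  fixes f :: "'a::euclidean_space \<Rightarrow> 'b::real_normed_vector"
  assumes "(f has_derivative f') (at x)" "\<And>x. f x \<noteq> 0 \<Longrightarrow> norm x \<le> R" "R < norm x"
  shows "f' = (\<lambda>_. 0)"
proof -
  have "(f has_derivative (\<lambda>v. 0)) (at x)"
  proof (rule has_derivative_transform_within_open[of "\<lambda>_. 0" _ x UNIV "- cball 0 R"])
    show "0 = f y" if "y \<in> - cball 0 R" for y using assms(2)[of y] that by auto
  qed (use assms in auto)
  then show ?thesis using assms(1) has_derivative_unique by blast
qed

text \<open>
  Integration by parts without boundary terms. Translations in direction \<open>e\<close> preserve the
  integral, and its derivative along them is the integral of the derivative.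
\<close>

lemma integral_directional_derivative_eq_0:
  fixes f :: "'a::euclidean_space \<Rightarrow> real"
  assumes der: "\<And>x. (f has_derivative f' x) (at x)" and cont: "continuous_on UNIV (\<lambda>x. f' x e)"
    and supp: "\<And>x. f x \<noteq> 0 \<Longrightarrow> norm x \<le> R"
  shows "integrable lborel (\<lambda>x. f' x e)" "(\<integral>x. f' x e \<partial>lborel) = 0"
proof -
  have supp': "norm x \<le> R" if "f' x e \<noteq> 0" for x
    using has_derivative_zero_outside_support[OF der[of x] supp] that by force
  show int: "integrable lborel (\<lambda>x. f' x e)" by (rule continuous_bounded_support_integrable[OF cont supp'])
  obtain C where C: "\<And>x. norm (f' x e) \<le> C" "0 \<le> C" using continuous_bounded_support_bounded[OF cont supp'] by blast
  have fc: "continuous_on UNIV f" using der by (auto intro!: continuous_at_imp_continuous_on has_derivative_continuous)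
  have fi: "integrable lborel f" by (rule continuous_bounded_support_integrable[OF fc supp])
  have fm: "f \<in> borel_measurable borel" using fi by simp
  have tr: "(\<integral>x. f (x + t *\<^sub>R e) \<partial>lborel) = (\<integral>x. f x \<partial>lborel)" "integrable lborel (\<lambda>x. f (x + t *\<^sub>R e))" for t
    using lborel_integral_affine[OF fm, of 1 "t *\<^sub>R e"] fi by (auto simp: add.commute)
  have "((\<lambda>t. \<integral>x. f (x + t *\<^sub>R e) \<partial>lborel) has_derivative (\<lambda>s. \<integral>x. f' (x + 0 *\<^sub>R e) (s *\<^sub>R e) \<partial>lborel)) (at (0::real))"
  proof (rule has_derivative_integral_param[where \<delta>=1 and g="\<lambda>x. C * indicator (cball 0 (R + norm e)) x" and k'="\<lambda>t x s. f' (x + t *\<^sub>R e) (s *\<^sub>R e)"])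
    show "((\<lambda>t. f (x + t *\<^sub>R e)) has_derivative (\<lambda>s. f' (x + t *\<^sub>R e) (s *\<^sub>R e))) (at t)" for t x
      by (rule has_derivative_compose[OF _ der]) (auto intro!: derivative_eq_intros)
    fix t s :: real and x assume "t \<in> ball 0 1"
    then have t: "\<bar>t\<bar> \<le> 1" by simp
    have eq: "f' (x + t *\<^sub>R e) (s *\<^sub>R e) = s * f' (x + t *\<^sub>R e) e"
      using has_derivative_linear[OF der] by (simp add: linear_scale)
    show "norm (f' (x + t *\<^sub>R e) (s *\<^sub>R e)) \<le> C * indicator (cball 0 (R + norm e)) x * norm s"
    proof (cases "norm (x + t *\<^sub>R e) \<le> R")
      case True
      have "norm x \<le> norm (x + t *\<^sub>R e) + norm (t *\<^sub>R e)" using norm_triangle_ineq4[of "x + t *\<^sub>R e" "t *\<^sub>R e"] by simp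
      also have "\<dots> \<le> R + 1 * norm e" using True t by (intro add_mono) (auto intro!: mult_left_le_one_le)
      finally have "indicator (cball 0 (R + norm e)) x = (1::real)" by simp
      then show ?thesis using mult_left_mono[OF C(1)[of "x + t *\<^sub>R e"], of "\<bar>s\<bar>"] by (simp add: eq abs_mult mult.commute)
    next
      case False
      then have "f' (x + t *\<^sub>R e) e = 0" using supp' by blast
      then show ?thesis using C by (simp add: eq)
    qed
  next
    show "integrable lborel (\<lambda>x. C * indicator (cball 0 (R + norm e)) x)"
      by (rule integrable_mult_right, rule integrable_real_indicator) (use emeasure_lborel_cball_finite in \<open>auto simp: less_top\<close>)
  qed (use tr in auto)
  then have "((\<lambda>t::real. \<integral>x. f x \<partial>lborel) has_derivative (\<lambda>s. \<integral>x. f' x (s *\<^sub>R e) \<partial>lborel)) (at 0)" by (simp only: tr) simp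
  moreover have "((\<lambda>t::real. \<integral>x. f x \<partial>lborel) has_derivative (\<lambda>s. 0)) (at 0)" by simp
  ultimately have "(\<lambda>s. \<integral>x. f' x (s *\<^sub>R e) \<partial>lborel) = (\<lambda>s. 0)" by (rule has_derivative_unique)
  from fun_cong[OF this, of 1] show "(\<integral>x. f' x e \<partial>lborel) = 0" by simp
qed

lemma integrable_const_cball: "integrable lborel (\<lambda>x::'a::euclidean_space. C * indicator (cball 0 R) x :: real)"
  by (rule integrable_mult_right, rule integrable_real_indicator) (use emeasure_lborel_cball_finite in \<open>auto simp: less_top\<close>)

lemma slice_bound_supported:
  fixes \<phi> :: "('a::euclidean_space) \<times> real \<Rightarrow> 'b::euclidean_space"
  assumes \<phi>: "continuous_on UNIV \<phi>" and supp: "\<forall>x t. \<phi> (x, t) \<noteq> 0 \<longrightarrow> norm x \<le> R"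
  obtains C where "\<And>x t. t \<in> ball t0 1 \<Longrightarrow> norm (\<phi> (x, t)) \<le> C * indicator (cball 0 R) x"
proof -
  have "compact (\<phi> ` (cball 0 R \<times> cball t0 1))"
    by (intro compact_continuous_image compact_Times compact_cball continuous_on_subset[OF \<phi>]) auto
  then have "bounded (\<phi> ` (cball 0 R \<times> cball t0 1))" by (rule compact_imp_bounded)
  then obtain C where C: "\<And>z. z \<in> cball 0 R \<times> cball t0 1 \<Longrightarrow> norm (\<phi> z) \<le> C"
    unfolding bounded_iff by blast
  have "norm (\<phi> (x, t)) \<le> C * indicator (cball 0 R) x" if "t \<in> ball t0 1" for x t
  proof (cases "norm x \<le> R")
    case True then show ?thesis using C[of "(x, t)"] that by simp
  next
    case False
    then have "\<phi> (x, t) = 0" using supp by blast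
    then show ?thesis using False by simp
  qed
  then show ?thesis using that by blast
qed

lemma slice_integrable_supported:
  fixes \<phi> :: "('a::euclidean_space) \<times> real \<Rightarrow> 'b::euclidean_space"
  assumes \<phi>: "continuous_on UNIV \<phi>" and supp: "\<forall>x t. \<phi> (x, t) \<noteq> 0 \<longrightarrow> norm x \<le> R"
  shows "integrable lborel (\<lambda>x. \<phi> (x, t))"
proof (rule continuous_bounded_support_integrable[of _ R])
  show "continuous_on UNIV (\<lambda>x. \<phi> (x, t))" by (intro continuous_intros continuous_on_compose2[OF \<phi>]) auto
qed (use supp in auto)

lemma continuous_slice_integral_supported:
  fixes \<phi> :: "('a::euclidean_space) \<times> real \<Rightarrow> 'b::euclidean_space"
  assumes \<phi>: "continuous_on UNIV \<phi>" and supp: "\<forall>x t. \<phi> (x, t) \<noteq> 0 \<longrightarrow> norm x \<le> R"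
  shows "continuous_on UNIV (\<lambda>t. \<integral>x. \<phi> (x, t) \<partial>lborel)"
proof (rule continuous_at_imp_continuous_on, intro ballI)
  fix t0 :: real
  obtain C where C: "\<And>x t. t \<in> ball t0 1 \<Longrightarrow> norm (\<phi> (x, t)) \<le> C * indicator (cball 0 R) x"
    using slice_bound_supported[OF \<phi> supp] by blast
  show "isCont (\<lambda>t. \<integral>x. \<phi> (x, t) \<partial>lborel) t0"
  proof (rule isCont_integral_param[where \<delta>=1 and g="\<lambda>x. C * indicator (cball 0 R) x"])
    show "isCont (\<lambda>t. \<phi> (x, t)) t0" for x
    proof -
      have "continuous_on UNIV (\<lambda>t. \<phi> (x, t))" by (intro continuous_on_compose2[OF \<phi>] continuous_intros) auto
      then show ?thesis by (auto simp: continuous_on_eq_continuous_at)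
    qed
    show "(\<lambda>x. \<phi> (x, t)) \<in> borel_measurable lborel" for t
      using slice_integrable_supported[OF \<phi> supp] by (rule borel_measurable_integrable)
  qed (use C integrable_const_cball in auto)
qed

lemma weighted_continuous_supported:
  fixes \<phi> :: "('a::euclidean_space) \<times> real \<Rightarrow> 'b::euclidean_space" and \<eta> :: "'a \<Rightarrow> real"
  assumes \<phi>: "continuous_on UNIV \<phi>" and \<eta>: "continuous_on UNIV \<eta>" and supp: "\<And>x. \<eta> x \<noteq> 0 \<Longrightarrow> norm x \<le> R"
  shows "continuous_on UNIV (\<lambda>z. \<eta> (fst z) *\<^sub>R \<phi> z)" "\<forall>x t. \<eta> (fst (x, t)) *\<^sub>R \<phi> (x, t) \<noteq> 0 \<longrightarrow> norm x \<le> R"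
proof -
  have "continuous_on UNIV (\<lambda>z::'a \<times> real. \<eta> (fst z))" by (rule continuous_on_compose2[OF \<eta>]) (auto intro: continuous_intros)
  then show "continuous_on UNIV (\<lambda>z. \<eta> (fst z) *\<^sub>R \<phi> z)" using \<phi> by (intro continuous_intros)
qed (use supp in auto)

lemma slice_bound:
  fixes \<phi> :: "('a::euclidean_space) \<times> real \<Rightarrow> 'b::euclidean_space" and \<eta> :: "'a \<Rightarrow> real"
  assumes \<phi>: "continuous_on UNIV \<phi>" and \<eta>: "continuous_on UNIV \<eta>" and supp: "\<And>x. \<eta> x \<noteq> 0 \<Longrightarrow> norm x \<le> R"
  obtains C where "\<And>x t. t \<in> ball t0 1 \<Longrightarrow> norm (\<eta> x *\<^sub>R \<phi> (x, t)) \<le> C * indicator (cball 0 R) x"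
  using slice_bound_supported[OF weighted_continuous_supported[OF assms], of t0] by (metis fst_conv)

lemma slice_integrable:
  fixes \<phi> :: "('a::euclidean_space) \<times> real \<Rightarrow> 'b::euclidean_space" and \<eta> :: "'a \<Rightarrow> real"
  assumes \<phi>: "continuous_on UNIV \<phi>" and \<eta>: "continuous_on UNIV \<eta>" and supp: "\<And>x. \<eta> x \<noteq> 0 \<Longrightarrow> norm x \<le> R"
  shows "integrable lborel (\<lambda>x. \<eta> x *\<^sub>R \<phi> (x, t))"
  using slice_integrable_supported[OF weighted_continuous_supported[OF assms]] by simp

lemma continuous_slice_integral:
  fixes \<phi> :: "('a::euclidean_space) \<times> real \<Rightarrow> 'b::euclidean_space" and \<eta> :: "'a \<Rightarrow> real"
  assumes \<phi>: "continuous_on UNIV \<phi>" and \<eta>: "continuous_on UNIV \<eta>" and supp: "\<And>x. \<eta> x \<noteq> 0 \<Longrightarrow> norm x \<le> R"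
  shows "continuous_on UNIV (\<lambda>t. \<integral>x. \<eta> x *\<^sub>R \<phi> (x, t) \<partial>lborel)"
  using continuous_slice_integral_supported[OF weighted_continuous_supported[OF assms]] by simp

text \<open>
  The weight has bounded support. So the derivative of the integrand is, for times near \<open>t\<close>,
  bounded by a multiple of the indicator of a ball.
\<close>

lemma has_vector_derivative_slice_integral:
  fixes \<phi> :: "('a::euclidean_space) \<times> real \<Rightarrow> 'b::euclidean_space" and \<eta> :: "'a \<Rightarrow> real"
  assumes der: "\<And>z. (\<phi> has_derivative \<phi>' z) (at z)" and cont: "continuous_on UNIV (\<lambda>z. \<phi>' z (0, 1))"
    and \<eta>: "continuous_on UNIV \<eta>" and supp: "\<And>x. \<eta> x \<noteq> 0 \<Longrightarrow> norm x \<le> R"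
  shows "((\<lambda>t. \<integral>x. \<eta> x *\<^sub>R \<phi> (x, t) \<partial>lborel) has_vector_derivative (\<integral>x. \<eta> x *\<^sub>R \<phi>' (x, t) (0, 1) \<partial>lborel)) (at t)"
proof -
  have \<phi>: "continuous_on UNIV \<phi>" using der by (auto intro!: continuous_at_imp_continuous_on has_derivative_continuous)
  obtain C where C: "\<And>x s. s \<in> ball t 1 \<Longrightarrow> norm (\<eta> x *\<^sub>R \<phi>' (x, s) (0, 1)) \<le> C * indicator (cball 0 R) x"
    using slice_bound[OF cont \<eta> supp] by blast
  have "((\<lambda>t. \<integral>x. \<eta> x *\<^sub>R \<phi> (x, t) \<partial>lborel) has_derivative (\<lambda>s. \<integral>x. s *\<^sub>R (\<eta> x *\<^sub>R \<phi>' (x, t) (0, 1)) \<partial>lborel)) (at t)"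
  proof (rule has_derivative_integral_param[where \<delta>=1 and g="\<lambda>x. C * indicator (cball 0 R) x" and k'="\<lambda>t x s. s *\<^sub>R (\<eta> x *\<^sub>R \<phi>' (x, t) (0, 1))"])
    fix s x
    have "((\<lambda>t. \<phi> (x, t)) has_derivative (\<lambda>r. \<phi>' (x, s) (0, r))) (at s)"
      by (rule has_derivative_compose[OF _ der]) (auto intro!: derivative_eq_intros)
    moreover have "(\<lambda>r. \<phi>' (x, s) (0, r)) = (\<lambda>r. r *\<^sub>R \<phi>' (x, s) (0, 1))"
    proof
      fix r show "\<phi>' (x, s) (0, r) = r *\<^sub>R \<phi>' (x, s) (0, 1)"
        using linear_scale[OF has_derivative_linear[OF der], of "(x, s)" r "(0, 1)"] by simp
    qed
    ultimately have "((\<lambda>t. \<phi> (x, t)) has_derivative (\<lambda>r. r *\<^sub>R \<phi>' (x, s) (0, 1))) (at s)" by simp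
    from has_derivative_scaleR_right[OF this, of "\<eta> x"]
    show "((\<lambda>t. \<eta> x *\<^sub>R \<phi> (x, t)) has_derivative (\<lambda>r. r *\<^sub>R (\<eta> x *\<^sub>R \<phi>' (x, s) (0, 1)))) (at s)"
      by (simp add: mult.commute)
  next
    fix s r :: real and x :: 'a assume "s \<in> ball t 1"
    from mult_left_mono[OF C[OF this, of x], of "\<bar>r\<bar>"]
    show "norm (r *\<^sub>R (\<eta> x *\<^sub>R \<phi>' (x, s) (0, 1))) \<le> C * indicator (cball 0 R) x * norm r" by (simp add: mult_ac abs_mult)
    show "integrable lborel (\<lambda>x. \<eta> x *\<^sub>R \<phi> (x, s))" by (rule slice_integrable[OF \<phi> \<eta> supp])
  next
    show "integrable lborel (\<lambda>x::'a. C * indicator (cball 0 R) x)" by (rule integrable_const_cball)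
  qed simp
  moreover have "(\<integral>x. s *\<^sub>R (\<eta> x *\<^sub>R \<phi>' (x, t) (0, 1)) \<partial>lborel) = s *\<^sub>R (\<integral>x. \<eta> x *\<^sub>R \<phi>' (x, t) (0, 1) \<partial>lborel)" for s
    using slice_integrable[OF cont \<eta> supp] by (simp del: scaleR_scaleR)
  ultimately show ?thesis by (simp only: has_vector_derivative_def)
qed

text \<open>
  The derivative in the space variables only, written as a matrix: \<open>v'\<close> is meant to be the Frechet
  derivative of \<open>v\<close> in space-time.
\<close>

definition space_jacobian :: "((real^'n) \<times> real \<Rightarrow> (real^'n) \<times> real \<Rightarrow> real^'m) \<Rightarrow> (real^'n) \<times> real \<Rightarrow> real^'n^'m" where
  "space_jacobian v' z = (\<chi> i j. v' z (axis j 1, 0) $ i)"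

text \<open>
  The equation \<open>v_t = div H\<close> holds classically on \<open>K\<close>, the divergence being taken row by row.
  Outside of \<open>K\<close> the functions are smooth but unrelated: mollifications are defined everywhere,
  and satisfy the equation only where the kernel does not reach the boundary.
\<close>

locale smooth_conservation_law =
  fixes v :: "(real^'n::finite) \<times> real \<Rightarrow> real^'m::finite" and v' :: "(real^'n) \<times> real \<Rightarrow> (real^'n) \<times> real \<Rightarrow> real^'m"
    and H :: "(real^'n) \<times> real \<Rightarrow> real^'n^'m" and H' :: "(real^'n) \<times> real \<Rightarrow> (real^'n) \<times> real \<Rightarrow> real^'n^'m"
    and K :: "((real^'n) \<times> real) set"
  assumes v_deriv: "\<And>z. (v has_derivative v' z) (at z)" and v'_cont: "\<And>h. continuous_on UNIV (\<lambda>z. v' z h)"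
    and H_deriv: "\<And>z. (H has_derivative H' z) (at z)" and H'_cont: "\<And>h. continuous_on UNIV (\<lambda>z. H' z h)"
    and law: "\<And>z i. z \<in> K \<Longrightarrow> v' z (0, 1) $ i = (\<Sum>j\<in>UNIV. H' z (axis j 1, 0) $ i $ j)"
begin

lemma v_cont: "continuous_on UNIV v" and H_cont: "continuous_on UNIV H"
  using v_deriv H_deriv by (auto intro!: continuous_at_imp_continuous_on has_derivative_continuous)

lemma grad_cont: "continuous_on UNIV (space_jacobian v')"
  unfolding space_jacobian_def by (intro continuous_on_vec_lambda continuous_intros v'_cont)

end

definition weighted_mean :: "('a::euclidean_space \<Rightarrow> real) \<Rightarrow> ('a \<Rightarrow> 'b::euclidean_space) \<Rightarrow> 'b" where
  "weighted_mean \<eta> f = (\<integral>x. \<eta> x *\<^sub>R f x \<partial>lborel) /\<^sub>R (\<integral>x. \<eta> x \<partial>lborel)"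

text \<open>
  A spatial weight \<open>\<eta>\<close>, supported in the ball of radius \<open>R\<close>, that serves two purposes: it
  localises the energy and it defines the spatial means.
\<close>

locale weighted_conservation_law = smooth_conservation_law v v' H H' K
  for v :: "(real^'n::finite) \<times> real \<Rightarrow> real^'m::finite" and v' H H' K +
  fixes \<eta> :: "real^'n \<Rightarrow> real" and \<eta>' R
  assumes \<eta>_deriv: "\<And>x. (\<eta> has_derivative \<eta>' x) (at x)" and \<eta>'_cont: "\<And>h. continuous_on UNIV (\<lambda>x. \<eta>' x h)"
    and \<eta>_nonneg: "\<And>x. 0 \<le> \<eta> x" and \<eta>_supp: "\<And>x. \<eta> x \<noteq> 0 \<Longrightarrow> norm x \<le> R"
    and \<eta>_pos: "0 < (\<integral>x. \<eta> x \<partial>lborel)"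
begin

definition "mean t = weighted_mean \<eta> (\<lambda>x. v (x, t))"
definition "osc z = v z - mean (snd z)"
definition "energy t = (\<integral>x. \<eta> x * (norm (osc (x, t)))\<^sup>2 \<partial>lborel)"
definition "flux z = (\<Sum>i\<in>UNIV. \<Sum>j\<in>UNIV. H z $ i $ j * osc z $ i * \<eta>' (fst z) (axis j 1))"

lemma \<eta>_cont: "continuous_on UNIV \<eta>"
  using \<eta>_deriv by (auto intro!: continuous_at_imp_continuous_on has_derivative_continuous)

lemma \<eta>_integrable: "integrable lborel \<eta>"
  by (rule continuous_bounded_support_integrable[OF \<eta>_cont \<eta>_supp])

lemma mean_cont: "continuous_on UNIV mean"
  unfolding mean_def weighted_mean_def
  by (intro continuous_intros continuous_slice_integral[OF v_cont \<eta>_cont \<eta>_supp])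

lemma osc_cont: "continuous_on UNIV osc"
  unfolding osc_def by (intro continuous_intros v_cont continuous_on_compose2[OF mean_cont]) auto

lemma \<eta>'_supp: "\<eta>' x h \<noteq> 0 \<Longrightarrow> norm x \<le> R"
proof (rule ccontr)
  assume "\<eta>' x h \<noteq> 0" "\<not> norm x \<le> R"
  moreover from this(2) have "\<eta>' x = (\<lambda>_. 0)"
    by (intro has_derivative_zero_outside_support[OF \<eta>_deriv, where R=R]) (use \<eta>_supp in auto)
  ultimately show False by simp
qed

lemma flux_cont: "continuous_on UNIV flux"
  unfolding flux_def by (intro continuous_intros H_cont osc_cont continuous_on_compose2[OF \<eta>'_cont]) auto

lemma energy_nonneg: "0 \<le> energy t"
  unfolding energy_def using \<eta>_nonneg by simp

lemma energy_cont: "continuous_on UNIV energy"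
proof -
  have "continuous_on UNIV (\<lambda>z. (norm (osc z))\<^sup>2)" by (intro continuous_intros osc_cont)
  from continuous_slice_integral[OF this \<eta>_cont \<eta>_supp] show ?thesis by (simp add: energy_def[abs_def])
qed

text \<open>
  Testing with \<open>\<eta> (v - a)\<close>, where \<open>a\<close> is the mean of \<open>v\<close> at time \<open>t\<close> with weight \<open>\<eta>\<close>. The energy
  equals \<open>\<integral> \<eta> |v|^2 - c |a|^2\<close> with \<open>c = \<integral> \<eta>\<close>. In its derivative the term \<open>- 2 c a \<bullet> a'\<close> is the
  pairing of \<open>v_t\<close> with \<open>- 2 \<eta> a\<close>, so that \<open>a'\<close> need not be estimated. Integration by parts in
  space then turns \<open>div H\<close> into \<open>- H\<close> paired with the gradient of \<open>\<eta> (v - a)\<close>.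
\<close>

lemma energy_deriv:
  assumes K: "cball 0 R \<times> {t} \<subseteq> K"
  shows "(energy has_real_derivative - 2 * (\<integral>x. \<eta> x * (H (x, t) \<bullet> space_jacobian v' (x, t)) + flux (x, t) \<partial>lborel)) (at t)"
proof -
  define c where "c = (\<integral>x. \<eta> x \<partial>lborel)"
  have c: "0 < c" using \<eta>_pos by (simp add: c_def)
  have vi: "integrable lborel (\<lambda>x. \<eta> x *\<^sub>R v (x, s))" for s by (rule slice_integrable[OF v_cont \<eta>_cont \<eta>_supp])
  have vvc: "continuous_on UNIV (\<lambda>z. v z \<bullet> v z)" by (intro continuous_intros v_cont)
  have vvi: "integrable lborel (\<lambda>x. \<eta> x *\<^sub>R (v (x, s) \<bullet> v (x, s)))" for s by (rule slice_integrable[OF vvc \<eta>_cont \<eta>_supp])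
  have mean: "(\<integral>x. \<eta> x *\<^sub>R v (x, s) \<partial>lborel) = c *\<^sub>R mean s" for s
    using c by (simp add: mean_def weighted_mean_def c_def)
  have en: "energy s = (\<integral>x. \<eta> x *\<^sub>R (v (x, s) \<bullet> v (x, s)) \<partial>lborel) - c * (mean s \<bullet> mean s)" for s
  proof -
    have "energy s = (\<integral>x. \<eta> x *\<^sub>R (v (x, s) \<bullet> v (x, s)) - 2 * ((\<eta> x *\<^sub>R v (x, s)) \<bullet> mean s) + \<eta> x * (mean s \<bullet> mean s) \<partial>lborel)"
      unfolding energy_def osc_def
      by (intro Bochner_Integration.integral_cong refl) (simp add: power2_norm_eq_inner inner_diff inner_commute algebra_simps)
    also have "\<dots> = (\<integral>x. \<eta> x *\<^sub>R (v (x, s) \<bullet> v (x, s)) \<partial>lborel) - 2 * (\<integral>x. (\<eta> x *\<^sub>R v (x, s)) \<bullet> mean s \<partial>lborel) + c * (mean s \<bullet> mean s)"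
      using vi[of s, THEN integrable_inner_left] vvi[of s] \<eta>_integrable by (simp add: c_def del: inner_scaleR_left)
    also have "(\<integral>x. (\<eta> x *\<^sub>R v (x, s)) \<bullet> mean s \<partial>lborel) = (c *\<^sub>R mean s) \<bullet> mean s"
      using integral_inner_left[of "mean s" lborel "\<lambda>x. \<eta> x *\<^sub>R v (x, s)"] vi[of s] by (simp only: mean)
    finally show ?thesis by simp
  qed
  have vt: "((\<lambda>s. \<integral>x. \<eta> x *\<^sub>R v (x, s) \<partial>lborel) has_vector_derivative (\<integral>x. \<eta> x *\<^sub>R v' (x, t) (0, 1) \<partial>lborel)) (at t)"
    by (rule has_vector_derivative_slice_integral[OF v_deriv v'_cont \<eta>_cont \<eta>_supp])
  have vvd: "((\<lambda>z. v z \<bullet> v z) has_derivative (\<lambda>h. 2 * (v z \<bullet> v' z h))) (at z)" for z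
    by (auto intro!: derivative_eq_intros v_deriv simp: inner_commute)
  have vvt: "((\<lambda>s. \<integral>x. \<eta> x *\<^sub>R (v (x, s) \<bullet> v (x, s)) \<partial>lborel) has_vector_derivative (\<integral>x. \<eta> x *\<^sub>R (2 * (v (x, t) \<bullet> v' (x, t) (0, 1))) \<partial>lborel)) (at t)"
    by (rule has_vector_derivative_slice_integral[OF vvd _ \<eta>_cont \<eta>_supp]) (intro continuous_intros v_cont v'_cont)
  let ?I = "\<integral>x. \<eta> x *\<^sub>R v' (x, t) (0, 1) \<partial>lborel"
  have md: "(mean has_vector_derivative ?I /\<^sub>R c) (at t)"
    unfolding mean_def weighted_mean_def c_def[symmetric] by (auto intro!: derivative_eq_intros vt)
  have mmd: "((\<lambda>s. mean s \<bullet> mean s) has_real_derivative 2 * (mean t \<bullet> (?I /\<^sub>R c))) (at t)"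
    using md unfolding has_vector_derivative_def has_field_derivative_def
    by (auto intro!: derivative_eq_intros simp: inner_commute fun_eq_iff algebra_simps)
  have "(energy has_real_derivative (\<integral>x. \<eta> x *\<^sub>R (2 * (v (x, t) \<bullet> v' (x, t) (0, 1))) \<partial>lborel) - c * (2 * (mean t \<bullet> (?I /\<^sub>R c)))) (at t)"
    unfolding en[abs_def]
    using vvt mmd unfolding has_real_derivative_iff_has_vector_derivative[symmetric]
    by (auto intro!: derivative_eq_intros)
  also have "c * (2 * (mean t \<bullet> (?I /\<^sub>R c))) = 2 * (?I \<bullet> mean t)" using c by (simp add: inner_commute)
  also have "(\<integral>x. \<eta> x *\<^sub>R (2 * (v (x, t) \<bullet> v' (x, t) (0, 1))) \<partial>lborel) - 2 * (?I \<bullet> mean t)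
      = 2 * (\<integral>x. \<eta> x * (v' (x, t) (0, 1) \<bullet> osc (x, t)) \<partial>lborel)"
  proof -
    have i1: "integrable lborel (\<lambda>x. \<eta> x *\<^sub>R v' (x, t) (0, 1))" by (rule slice_integrable[OF v'_cont \<eta>_cont \<eta>_supp])
    have "continuous_on UNIV (\<lambda>z. v z \<bullet> v' z (0, 1))" by (intro continuous_intros v_cont v'_cont)
    from slice_integrable[OF this \<eta>_cont \<eta>_supp] have i2: "integrable lborel (\<lambda>x. \<eta> x * (v (x, t) \<bullet> v' (x, t) (0, 1)))" by simp
    have "(\<integral>x. \<eta> x * (v' (x, t) (0, 1) \<bullet> osc (x, t)) \<partial>lborel) = (\<integral>x. \<eta> x * (v (x, t) \<bullet> v' (x, t) (0, 1)) - (\<eta> x *\<^sub>R v' (x, t) (0, 1)) \<bullet> mean t \<partial>lborel)"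
      by (intro Bochner_Integration.integral_cong refl) (simp add: osc_def inner_diff inner_commute algebra_simps)
    also have "\<dots> = (\<integral>x. \<eta> x * (v (x, t) \<bullet> v' (x, t) (0, 1)) \<partial>lborel) - ?I \<bullet> mean t"
      using i1[THEN integrable_inner_left, of "mean t"] i2 integral_inner_left[of "mean t" lborel "\<lambda>x. \<eta> x *\<^sub>R v' (x, t) (0, 1)"] i1
      by (simp del: inner_scaleR_left)
    finally have "(\<integral>x. \<eta> x * (v' (x, t) (0, 1) \<bullet> osc (x, t)) \<partial>lborel) = (\<integral>x. \<eta> x * (v (x, t) \<bullet> v' (x, t) (0, 1)) \<partial>lborel) - ?I \<bullet> mean t" .
    moreover have "(\<integral>x. \<eta> x *\<^sub>R (2 * (v (x, t) \<bullet> v' (x, t) (0, 1))) \<partial>lborel) = 2 * (\<integral>x. \<eta> x * (v (x, t) \<bullet> v' (x, t) (0, 1)) \<partial>lborel)"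
      by (simp flip: Bochner_Integration.integral_mult_right_zero add: mult_ac)
    ultimately show ?thesis by simp
  qed
  also have "(\<integral>x. \<eta> x * (v' (x, t) (0, 1) \<bullet> osc (x, t)) \<partial>lborel) = - (\<integral>x. \<eta> x * (H (x, t) \<bullet> space_jacobian v' (x, t)) + flux (x, t) \<partial>lborel)"
  proof -
    \<comment> \<open>The entries of \<open>H\<close> times those of \<open>\<eta> (v - a)\<close>. Their derivatives in direction j
        integrate to zero, and sum up to \<open>\<eta> v_t \<bullet> (v - a)\<close>, by the equation, plus the terms of
        the claim.\<close>
    define f where "f i j x = H (x, t) $ i $ j * (osc (x, t) $ i * \<eta> x)" for i j x
    define f' where "f' i j x h = H (x, t) $ i $ j * (osc (x, t) $ i * \<eta>' x h + v' (x, t) (h, 0) $ i * \<eta> x) + H' (x, t) (h, 0) $ i $ j * (osc (x, t) $ i * \<eta> x)" for i j x h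
    have slice: "continuous_on UNIV (\<lambda>x. h (x, t))" if "continuous_on UNIV h" for h :: "(real^'n) \<times> real \<Rightarrow> 'z::topological_space"
      by (intro continuous_on_compose2[OF that] continuous_intros) auto
    have fd: "(f i j has_derivative f' i j x) (at x)" for i j x
    proof -
      have p: "((\<lambda>x. (x, t)) has_derivative (\<lambda>h. (h, 0))) (at x)" by (auto intro!: derivative_eq_intros)
      have 1: "((\<lambda>x. v (x, t)) has_derivative (\<lambda>h. v' (x, t) (h, 0))) (at x)" by (rule has_derivative_compose[OF p v_deriv])
      have 2: "((\<lambda>x. H (x, t)) has_derivative (\<lambda>h. H' (x, t) (h, 0))) (at x)" by (rule has_derivative_compose[OF p H_deriv])
      have 3: "((\<lambda>x. osc (x, t) $ i) has_derivative (\<lambda>h. v' (x, t) (h, 0) $ i)) (at x)"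
        unfolding osc_def using has_derivative_diff[OF 1 has_derivative_const[of "mean t"]]
        by (intro bounded_linear.has_derivative[OF bounded_linear_vec_nth]) simp
      have 4: "((\<lambda>x. H (x, t) $ i $ j) has_derivative (\<lambda>h. H' (x, t) (h, 0) $ i $ j)) (at x)"
        by (intro bounded_linear.has_derivative[OF bounded_linear_vec_nth] 2)
      show ?thesis unfolding f_def f'_def by (rule has_derivative_mult[OF 4 has_derivative_mult[OF 3 \<eta>_deriv]])
    qed
    have f'c: "continuous_on UNIV (\<lambda>x. f' i j x (axis j 1))" for i j
      unfolding f'_def
      by (intro continuous_intros \<eta>_cont \<eta>'_cont slice[OF H_cont] slice[OF osc_cont] slice[OF v'_cont] slice[OF H'_cont])
    have fs: "norm x \<le> R" if "f i j x \<noteq> 0" for i j x using that \<eta>_supp by (auto simp: f_def)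
    note Z = integral_directional_derivative_eq_0[OF fd f'c fs]
    have "0 = (\<Sum>i\<in>UNIV. \<Sum>j\<in>UNIV. \<integral>x. f' i j x (axis j 1) \<partial>lborel)" by (simp add: Z(2))
    also have "\<dots> = (\<integral>x. (\<Sum>i\<in>UNIV. \<Sum>j\<in>UNIV. f' i j x (axis j 1)) \<partial>lborel)"
      by (simp add: Z(1))
    also have "\<dots> = (\<integral>x. \<eta> x * (v' (x, t) (0, 1) \<bullet> osc (x, t)) + (\<eta> x * (H (x, t) \<bullet> space_jacobian v' (x, t)) + flux (x, t)) \<partial>lborel)"
    proof (intro Bochner_Integration.integral_cong refl)
      fix x
      have law': "\<eta> x * (v' (x, t) (0, 1) \<bullet> osc (x, t)) = \<eta> x * (\<Sum>i\<in>UNIV. (\<Sum>j\<in>UNIV. H' (x, t) (axis j 1, 0) $ i $ j) * osc (x, t) $ i)"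
      proof (cases "\<eta> x = 0")
        case False
        then have "(x, t) \<in> K" using \<eta>_supp[of x] K by auto
        then show ?thesis by (simp add: inner_vec_def law)
      qed simp
      show "(\<Sum>i\<in>UNIV. \<Sum>j\<in>UNIV. f' i j x (axis j 1)) = \<eta> x * (v' (x, t) (0, 1) \<bullet> osc (x, t)) + (\<eta> x * (H (x, t) \<bullet> space_jacobian v' (x, t)) + flux (x, t))"
        unfolding law' unfolding f'_def flux_def space_jacobian_def inner_vec_def
        by (simp add: sum_distrib_left sum_distrib_right algebra_simps sum.distrib)
    qed
    also have "\<dots> = (\<integral>x. \<eta> x * (v' (x, t) (0, 1) \<bullet> osc (x, t)) \<partial>lborel) + (\<integral>x. \<eta> x * (H (x, t) \<bullet> space_jacobian v' (x, t)) + flux (x, t) \<partial>lborel)"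
    proof (rule Bochner_Integration.integral_add)
      have "continuous_on UNIV (\<lambda>z. v' z (0, 1) \<bullet> osc z)" by (intro continuous_intros osc_cont v'_cont)
      from slice_integrable[OF this \<eta>_cont \<eta>_supp] show "integrable lborel (\<lambda>x. \<eta> x * (v' (x, t) (0, 1) \<bullet> osc (x, t)))" by simp
      show "integrable lborel (\<lambda>x. \<eta> x * (H (x, t) \<bullet> space_jacobian v' (x, t)) + flux (x, t))"
      proof (rule continuous_bounded_support_integrable[of _ R])
        show "continuous_on UNIV (\<lambda>x. \<eta> x * (H (x, t) \<bullet> space_jacobian v' (x, t)) + flux (x, t))"
          by (intro continuous_intros \<eta>_cont slice[OF H_cont] slice[OF grad_cont] slice[OF flux_cont])
        fix x assume ne: "\<eta> x * (H (x, t) \<bullet> space_jacobian v' (x, t)) + flux (x, t) \<noteq> 0"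
        show "norm x \<le> R"
        proof (rule ccontr)
          assume "\<not> norm x \<le> R"
          then have "\<eta> x = 0" "\<And>h. \<eta>' x h = 0" using \<eta>_supp \<eta>'_supp by blast+
          then show False using ne by (simp add: flux_def)
        qed
      qed
    qed
    finally show ?thesis by simp
  qed
  finally show ?thesis by simp
qed

end

lemma continuous_on_powr_const:
  fixes f :: "'a::topological_space \<Rightarrow> real"
  assumes "continuous_on S f" "\<And>x. x \<in> S \<Longrightarrow> 0 \<le> f x" "0 < a"
  shows "continuous_on S (\<lambda>x. f x powr a)"
  using assms by (intro continuous_on_powr' continuous_on_const) auto

lemma cylinder_integrable:
  fixes f :: "('a::euclidean_space) \<times> real \<Rightarrow> real"
  assumes f: "continuous_on UNIV f"
  shows "integrable lborel (\<lambda>z. indicator (cball 0 R \<times> {a..b}) z * f z)"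
proof -
  have "integrable lborel (\<lambda>z. indicator (cball 0 R \<times> {a..b}) z *\<^sub>R f z)"
    by (rule borel_integrable_compact) (auto intro!: compact_Times continuous_on_subset[OF f])
  then show ?thesis by simp
qed

lemma cylinder_integral:
  fixes f :: "('a::euclidean_space) \<times> real \<Rightarrow> real"
  assumes f: "continuous_on UNIV f"
  shows "integrable lborel (\<lambda>t. indicator {a..b} t * (\<integral>x. indicator (cball 0 R) x * f (x, t) \<partial>lborel))"
    and "(\<integral>t. indicator {a..b} t * (\<integral>x. indicator (cball 0 R) x * f (x, t) \<partial>lborel) \<partial>lborel)
      = (\<integral>z. indicator (cball 0 R \<times> {a..b}) z * f z \<partial>lborel)"
proof -
  have i: "integrable (lborel \<Otimes>\<^sub>M lborel) (\<lambda>(x, t). indicator (cball 0 R \<times> {a..b}) (x, t) * f (x, t))"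
    using cylinder_integrable[OF f, of R a b] by (simp add: lborel_prod split_def)
  have e: "(\<integral>x. indicator (cball 0 R \<times> {a..b}) (x, t) * f (x, t) \<partial>lborel) = indicator {a..b} t * (\<integral>x. indicator (cball 0 R) x * f (x, t) \<partial>lborel)" for t
    by (simp add: indicator_times mult_ac flip: Bochner_Integration.integral_mult_right_zero)
  show "integrable lborel (\<lambda>t. indicator {a..b} t * (\<integral>x. indicator (cball 0 R) x * f (x, t) \<partial>lborel))"
    using lborel_pair.integrable_snd[OF i] by (simp only: e)
  show "(\<integral>t. indicator {a..b} t * (\<integral>x. indicator (cball 0 R) x * f (x, t) \<partial>lborel) \<partial>lborel)
      = (\<integral>z. indicator (cball 0 R \<times> {a..b}) z * f z \<partial>lborel)"
    using lborel_pair.integral_snd[OF i] by (simp only: e lborel_prod) (simp add: split_def)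
qed

context weighted_conservation_law
begin

text \<open>
  Integration in time with the additional weight \<open>(t - a)^k\<close>, which removes the energy at the
  initial time.
\<close>

lemma energy_identity:
  assumes K: "cball 0 R \<times> {a..s} \<subseteq> K" and as: "a \<le> s" and k: "1 \<le> k"
  shows "(s - a) ^ k * energy s
    = (\<integral>z. indicator (cball 0 R \<times> {a..s}) z * (real k * (snd z - a) ^ (k - 1) * (\<eta> (fst z) * (norm (osc z))\<^sup>2)
        - 2 * (snd z - a) ^ k * (\<eta> (fst z) * (H z \<bullet> space_jacobian v' z) + flux z)) \<partial>lborel)"
proof -
  let ?g = "\<lambda>z. \<eta> (fst z) * (H z \<bullet> space_jacobian v' z) + flux z"
  let ?e = "\<lambda>z. \<eta> (fst z) * (norm (osc z))\<^sup>2"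
  let ?I = "\<lambda>t. \<integral>x. ?g (x, t) \<partial>lborel"
  let ?F = "\<lambda>z. real k * (snd z - a) ^ (k - 1) * ?e z - 2 * (snd z - a) ^ k * ?g z"
  have \<eta>f: "continuous_on UNIV (\<lambda>z::(real^'n) \<times> real. \<eta> (fst z))" by (rule continuous_on_compose2[OF \<eta>_cont]) (auto intro: continuous_intros)
  have gc: "continuous_on UNIV ?g" by (intro continuous_intros \<eta>f H_cont grad_cont flux_cont)
  have ec: "continuous_on UNIV ?e" by (intro continuous_intros \<eta>f osc_cont)
  have gs: "\<forall>x t. ?g (x, t) \<noteq> 0 \<longrightarrow> norm x \<le> R"
  proof (intro allI impI, rule ccontr)
    fix x t assume ne: "?g (x, t) \<noteq> 0" and "\<not> norm x \<le> R"
    then have "\<eta> x = 0" "\<And>h. \<eta>' x h = 0" using \<eta>_supp \<eta>'_supp by blast+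
    then show False using ne by (simp add: flux_def)
  qed
  have es: "\<forall>x t. ?e (x, t) \<noteq> 0 \<longrightarrow> norm x \<le> R" using \<eta>_supp by auto
  have Ic: "continuous_on UNIV ?I" by (rule continuous_slice_integral_supported[OF gc gs])
  let ?f = "\<lambda>t. real k * (t - a) ^ (k - 1) * energy t - 2 * (t - a) ^ k * ?I t"
  have "(\<integral>t. ?f t * indicator {a..s} t \<partial>lborel) = (s - a) ^ k * energy s - (a - a) ^ k * energy a"
  proof (rule integral_FTC_Icc_real[OF as])
    fix t assume t: "a \<le> t" "t \<le> s"
    have "(energy has_real_derivative - 2 * ?I t) (at t)" using energy_deriv[of t] K t by (auto simp: subset_iff)
    moreover have "((\<lambda>t. (t - a) ^ k) has_real_derivative real k * (t - a) ^ (k - 1)) (at t)"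
      by (auto intro!: derivative_eq_intros)
    ultimately have "((\<lambda>t. (t - a) ^ k * energy t) has_real_derivative real k * (t - a) ^ (k - 1) * energy t + (- 2 * ?I t) * (t - a) ^ k) (at t)"
      by (intro DERIV_mult)
    then show "((\<lambda>t. (t - a) ^ k * energy t) has_real_derivative ?f t) (at t)" by (simp add: algebra_simps)
    have "continuous_on UNIV ?f" by (intro continuous_intros energy_cont Ic)
    then show "isCont ?f t" by (simp add: continuous_on_eq_continuous_at)
  qed
  then have "(s - a) ^ k * energy s = (\<integral>t. indicator {a..s} t * ?f t \<partial>lborel)" using k by (simp add: mult.commute)
  also have "\<dots> = (\<integral>t. indicator {a..s} t * (\<integral>x. indicator (cball 0 R) x * ?F (x, t) \<partial>lborel) \<partial>lborel)"
  proof (intro Bochner_Integration.integral_cong refl)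
    fix t
    have "(\<integral>x. indicator (cball 0 R) x * ?F (x, t) \<partial>lborel) = (\<integral>x. real k * (t - a) ^ (k - 1) * ?e (x, t) - 2 * (t - a) ^ k * ?g (x, t) \<partial>lborel)"
    proof (intro Bochner_Integration.integral_cong refl)
      fix x
      show "indicator (cball 0 R) x * ?F (x, t) = real k * (t - a) ^ (k - 1) * ?e (x, t) - 2 * (t - a) ^ k * ?g (x, t)"
      proof (cases "norm x \<le> R")
        case False
        then have "?g (x, t) = 0" "?e (x, t) = 0" using gs es by blast+
        then show ?thesis using False by simp
      qed simp
    qed
    also have "\<dots> = ?f t"
      using slice_integrable_supported[OF ec es, of t] slice_integrable_supported[OF gc gs, of t]
      by (simp add: energy_def)
    finally show "indicator {a..s} t * ?f t = indicator {a..s} t * (\<integral>x. indicator (cball 0 R) x * ?F (x, t) \<partial>lborel)" by simp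
  qed
  also have "\<dots> = (\<integral>z. indicator (cball 0 R \<times> {a..s}) z * ?F z \<partial>lborel)"
    by (rule cylinder_integral(2)) (intro continuous_intros ec gc)
  finally show ?thesis .
qed

lemma osc_slice: "osc (x, t) = v (x, t) - (\<integral>y. \<eta> y *\<^sub>R v (y, t) \<partial>lborel) /\<^sub>R (\<integral>y. \<eta> y \<partial>lborel)"
  by (simp add: osc_def mean_def weighted_mean_def)

lemma norm_flux_le:
  assumes "\<And>j. \<bar>\<eta>' (fst z) (axis j 1)\<bar> \<le> B"
  shows "\<bar>flux z\<bar> \<le> real CARD('m) * real CARD('n) * (norm (H z) * norm (osc z) * B)"
proof -
  have comp: "\<bar>H z $ i $ j\<bar> \<le> norm (H z)" for i j
    by (metis Finite_Cartesian_Product.norm_nth_le component_le_norm_cart order_trans)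
  have "\<bar>flux z\<bar> \<le> (\<Sum>i\<in>UNIV. \<Sum>j\<in>UNIV. \<bar>H z $ i $ j * osc z $ i * \<eta>' (fst z) (axis j 1)\<bar>)"
    unfolding flux_def by (rule order_trans[OF sum_abs]) (intro sum_mono sum_abs)
  also have "\<dots> \<le> (\<Sum>i\<in>(UNIV::'m set). \<Sum>j\<in>(UNIV::'n set). norm (H z) * norm (osc z) * B)"
    unfolding abs_mult
    by (intro sum_mono mult_mono comp assms component_le_norm_cart) auto
  finally show ?thesis by simp
qed

end

lemma (in smooth_conservation_law) norm_space_derivative_le:
  "norm (v' z (h, 0)) \<le> real CARD('m) * real CARD('n) * norm (space_jacobian v' z) * norm h"
proof -
  have "linear (\<lambda>h. v' z (h, 0))"
    using linear_compose[of "\<lambda>h. (h, 0)" "v' z"] has_derivative_linear[OF v_deriv[of z]]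
    by (simp add: o_def linear_iff)
  then have "v' z (h, 0) = (\<Sum>j\<in>UNIV. (h $ j) *\<^sub>R v' z (axis j 1, 0))"
    using basis_expansion[of h] linear_sum[of "\<lambda>h. v' z (h, 0)" "\<lambda>j. h $ j *\<^sub>R axis j 1" UNIV] linear_scale[of "\<lambda>h. v' z (h, 0)"]
    by (simp add: scalar_mult_eq_scaleR)
  then have c: "v' z (h, 0) $ i = (\<Sum>j\<in>UNIV. h $ j * space_jacobian v' z $ i $ j)" for i
    by (simp add: space_jacobian_def)
  have comp: "\<bar>space_jacobian v' z $ i $ j\<bar> \<le> norm (space_jacobian v' z)" for i j
    by (metis Finite_Cartesian_Product.norm_nth_le component_le_norm_cart order_trans)
  have "norm (v' z (h, 0)) \<le> (\<Sum>i\<in>UNIV. \<bar>v' z (h, 0) $ i\<bar>)" by (rule norm_le_l1_cart)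
  also have "\<dots> \<le> (\<Sum>i\<in>(UNIV::'m set). \<Sum>j\<in>(UNIV::'n set). norm h * norm (space_jacobian v' z))"
    unfolding c by (intro sum_mono order_trans[OF sum_abs]) (auto simp: abs_mult intro!: mult_mono comp component_le_norm_cart)
  finally show ?thesis by (simp add: mult_ac)
qed

section \<open>Absorption of the lower order terms\<close>

text \<open>
  The spatial weight is a power of this paraboloid, which vanishes outside of the ball of radius
  3/2. Its powers are convenient because the gradient of the \<open>k\<close>-th one is bounded by a multiple
  of the \<open>(k-1)\<close>-st.
\<close>

definition cutoff :: "'a::real_inner \<Rightarrow> real" where "cutoff x = max 0 (9/4 - x \<bullet> x)"

lemma cutoff_bounds: "0 \<le> cutoff x" "cutoff x \<le> 9/4" using inner_ge_zero[of x] unfolding cutoff_def by linarith+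

lemma cutoff_support: "cutoff x \<noteq> 0 \<Longrightarrow> norm x \<le> 3/2"
proof -
  assume "cutoff x \<noteq> 0"
  then have "x \<bullet> x \<le> (3/2)\<^sup>2" by (simp add: cutoff_def max_def power2_eq_square split: if_splits)
  then show ?thesis unfolding norm_le_square by simp
qed

lemma continuous_cutoff: "continuous_on S (cutoff :: 'a::real_inner \<Rightarrow> real)"
  unfolding cutoff_def by (intro continuous_intros)

lemma max_power_deriv:
  assumes k: "2 \<le> k"
  shows "((\<lambda>s::real. max 0 s ^ k) has_real_derivative real k * max 0 s ^ (k - 1)) (at s)"
proof -
  consider "s > 0" | "s < 0" | "s = 0" by linarith
  then show ?thesis
  proof cases
    case 1
    have "((\<lambda>s. s ^ k) has_real_derivative real k * max 0 s ^ (k - 1)) (at s)" using 1 by (auto intro!: derivative_eq_intros)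
    moreover have "eventually (\<lambda>s. s ^ k = max 0 s ^ k) (nhds s)"
      using 1 by (auto simp: eventually_nhds intro!: exI[of _ "{0<..}"])
    ultimately show ?thesis using DERIV_cong_ev by force
  next
    case 2
    have "((\<lambda>s. 0) has_real_derivative real k * max 0 s ^ (k - 1)) (at s)" using 2 k by (simp add: power_0_left)
    moreover have "eventually (\<lambda>s. 0 = max 0 s ^ k) (nhds s)"
      using 2 k by (auto simp: eventually_nhds intro!: exI[of _ "{..<0}"])
    ultimately show ?thesis using DERIV_cong_ev[of s s "\<lambda>_. 0"] by force
  next
    case 3
    have "((\<lambda>h. max 0 h ^ k / h) \<longlongrightarrow> 0) (at (0::real))"
    proof (rule Lim_null_comparison)
      show "((\<lambda>h. \<bar>h\<bar>) \<longlongrightarrow> 0) (at (0::real))" using tendsto_rabs_zero[OF tendsto_ident_at] .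
      show "eventually (\<lambda>h. norm (max 0 h ^ k / h) \<le> \<bar>h\<bar>) (at (0::real))"
        unfolding eventually_at
      proof (intro exI[of _ 1] conjI ballI impI)
        fix h :: real assume h: "h \<noteq> 0 \<and> dist h 0 < 1"
        show "norm (max 0 h ^ k / h) \<le> \<bar>h\<bar>"
        proof (cases "h > 0")
          case True
          have "h ^ k \<le> h ^ 2" using True h k by (intro power_decreasing) auto
          then show ?thesis using True by (simp add: field_simps power2_eq_square)
        qed (use k in \<open>simp add: max_def power_0_left\<close>)
      qed simp
    qed
    then show ?thesis using 3 k by (simp add: DERIV_def power_0_left)
  qed
qed

lemma cutoff_power_deriv:
  fixes x :: "'a::euclidean_space"
  assumes k: "2 \<le> k"
  shows "((\<lambda>x. cutoff x ^ k) has_derivative (\<lambda>h. real k * cutoff x ^ (k - 1) * (- 2 * (x \<bullet> h)))) (at x)"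
proof -
  have "((\<lambda>x::'a. 9/4 - x \<bullet> x) has_derivative (\<lambda>h. - 2 * (x \<bullet> h))) (at x)"
    by (auto intro!: derivative_eq_intros simp: inner_commute)
  from has_derivative_compose[OF this max_power_deriv[OF k, unfolded has_field_derivative_def]]
  show ?thesis by (simp add: cutoff_def)
qed

lemma cutoff_power_integral_pos:
  assumes k: "1 \<le> k"
  shows "integrable lborel (\<lambda>x::'a::euclidean_space. cutoff x ^ k)" "0 < (\<integral>x. cutoff x ^ k \<partial>(lborel :: 'a measure))"
proof -
  have supp: "norm x \<le> 3/2" if "cutoff x ^ k \<noteq> 0" for x :: 'a using that cutoff_support[of x] k by (auto simp: power_0_left)
  show i: "integrable lborel (\<lambda>x::'a. cutoff x ^ k)"
    by (rule continuous_bounded_support_integrable[OF _ supp]) (intro continuous_intros continuous_cutoff)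
  \<comment> \<open>On the unit ball the paraboloid is at least 5/4.\<close>
  have "measure lborel (ball (0::'a) 1) = (\<integral>x. indicator (ball (0::'a) 1) x \<partial>lborel)" by simp
  also have "\<dots> \<le> (\<integral>x. cutoff x ^ k \<partial>(lborel :: 'a measure))"
  proof (rule integral_mono)
    show "integrable lborel (indicator (ball (0::'a) 1) :: 'a \<Rightarrow> real)"
      by (rule integrable_real_indicator) (use emeasure_lborel_ball_finite in auto)
    show "indicator (ball 0 1) x \<le> cutoff x ^ k" for x :: 'a
    proof (cases "x \<in> ball 0 1")
      case True
      then have "(norm x)\<^sup>2 \<le> 1\<^sup>2" by (intro power_mono) auto
      then have "1 \<le> cutoff x" by (simp add: cutoff_def dot_square_norm)
      then show ?thesis using True by (simp add: one_le_power)
    qed (simp add: cutoff_bounds)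
  qed (rule i)
  finally show "0 < (\<integral>x. cutoff x ^ k \<partial>(lborel :: 'a measure))"
    using content_ball_pos[of 1 "0::'a"] by linarith
qed

lemma powr_le_one_plus:
  assumes "0 \<le> w" "0 \<le> a" "a \<le> (b::real)"
  shows "w powr a \<le> 1 + w powr b"
proof (cases "w \<le> 1")
  case True
  then have "w powr a \<le> 1" using assms by (simp add: powr_le1)
  then show ?thesis using powr_ge_zero[of w b] by linarith
next
  case False
  then have "w powr a \<le> w powr b" using assms by (intro powr_mono) auto
  then show ?thesis by simp
qed

text \<open>
  Here \<open>\<xi>\<close> and \<open>\<tau>\<close> are the values of the spatial and the temporal cutoff, \<open>h\<close> is the size of the
  flux and \<open>w\<close> that of the oscillation. Both lower order terms of the energy identity are bounded
  by a small multiple of the \<open>p'\<close>-th power of the flux, with the full weight \<open>(\<xi> \<tau>)^k\<close>, and by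
  \<open>w^m\<close> with the weaker weight \<open>(\<xi> \<tau>)^{k-p}\<close>. Young's inequality loses \<open>p\<close> powers of the cutoff
  since one power is lost to its gradient.
\<close>

lemma lower_order_pointwise:
  fixes p m \<delta> N :: real and k :: nat
  assumes p: "1 < p" and m: "2 \<le> m" "p \<le> m" and k: "2 \<le> k" "p < real k" and \<delta>: "0 < \<delta>" and N: "0 \<le> N"
  obtains C where "0 \<le> C"
    "\<forall>\<xi> \<tau> h w. 0 \<le> \<xi> \<longrightarrow> \<xi> \<le> 9/4 \<longrightarrow> 0 \<le> \<tau> \<longrightarrow> \<tau> \<le> 3 \<longrightarrow> 0 \<le> h \<longrightarrow> 0 \<le> w \<longrightarrow>
      real k * \<tau> ^ (k - 1) * (\<xi> ^ k * w\<^sup>2) + \<tau> ^ k * (N * (h * w * \<xi> ^ (k - 1)))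
        \<le> \<delta> * ((\<xi> * \<tau>) ^ k * h powr (p / (p - 1))) + C * (1 + w powr m * (\<xi> * \<tau>) powr (real k - p))"
proof -
  define p' where "p' = p / (p - 1)"
  have p': "1 < p'" "1/p' + 1/p = 1" using p by (auto simp: p'_def field_simps)
  define e where "e = \<delta> powr (1/p')"
  have e: "0 < e" "e powr p' = \<delta>" using \<delta> p' by (auto simp: e_def powr_powr)
  \<comment> \<open>The largest value of \<open>(\<xi> \<tau>)^{k-p}\<close>, as \<open>\<xi> \<tau> \<le> (9/4) * 3\<close>.\<close>
  define X where "X = (27/4) powr (real k - p)"
  define C1 where "C1 = real k * (3 powr (p - 1) * (9/4) powr p)"
  define C2 where "C2 = (N / e) powr p * 3 powr p"
  have C12: "0 \<le> C1" "0 \<le> C2" "0 \<le> X" by (auto simp: C1_def C2_def X_def)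
  define C where "C = (C1 + C2) * (1 + X)"
  show ?thesis
  proof (rule that[of C])
    show "0 \<le> C" using C12 by (simp add: C_def)
    show "\<forall>\<xi> \<tau> h w. 0 \<le> \<xi> \<longrightarrow> \<xi> \<le> 9/4 \<longrightarrow> 0 \<le> \<tau> \<longrightarrow> \<tau> \<le> 3 \<longrightarrow> 0 \<le> h \<longrightarrow> 0 \<le> w \<longrightarrow>
      real k * \<tau> ^ (k - 1) * (\<xi> ^ k * w\<^sup>2) + \<tau> ^ k * (N * (h * w * \<xi> ^ (k - 1)))
        \<le> \<delta> * ((\<xi> * \<tau>) ^ k * h powr (p / (p - 1))) + C * (1 + w powr m * (\<xi> * \<tau>) powr (real k - p))"
    proof (intro allI impI)
      fix \<xi> \<tau> h w :: real
      assume b: "0 \<le> \<xi>" "\<xi> \<le> 9/4" "0 \<le> \<tau>" "\<tau> \<le> 3" "0 \<le> h" "0 \<le> w"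
      let ?Z = "w powr m * (\<xi> * \<tau>) powr (real k - p)"
      have Z: "0 \<le> ?Z" by simp
      show "real k * \<tau> ^ (k - 1) * (\<xi> ^ k * w\<^sup>2) + \<tau> ^ k * (N * (h * w * \<xi> ^ (k - 1)))
          \<le> \<delta> * ((\<xi> * \<tau>) ^ k * h powr (p / (p - 1))) + C * (1 + ?Z)"
      proof (cases "\<xi> = 0 \<or> \<tau> = 0")
        case True
        then have "real k * \<tau> ^ (k - 1) * (\<xi> ^ k * w\<^sup>2) = 0" "\<tau> ^ k * (N * (h * w * \<xi> ^ (k - 1))) = 0"
          using k by (auto simp: power_0_left)
        moreover have "0 \<le> \<delta> * ((\<xi> * \<tau>) ^ k * h powr (p / (p - 1))) + C * (1 + ?Z)"
          using b \<delta> Z \<open>0 \<le> C\<close> by (intro add_nonneg_nonneg mult_nonneg_nonneg) auto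
        ultimately show ?thesis by linarith
    next
        case False
        then have pos: "0 < \<xi>" "0 < \<tau>" using b by auto
        define \<omega> where "\<omega> = \<xi> * \<tau>"
        have \<omega>: "0 < \<omega>" "\<omega> \<le> 27/4" using pos b mult_mono[of \<xi> "9/4" \<tau> 3] by (auto simp: \<omega>_def)
        have \<omega>X: "\<omega> powr (real k - p) \<le> X" unfolding X_def using \<omega> k by (intro powr_mono2) auto
        have \<omega>Z: "\<omega> powr (real k - p) * w powr a \<le> (1 + X) * (1 + ?Z)" if "0 \<le> a" "a \<le> m" for a
        proof -
          have "\<omega> powr (real k - p) * w powr a \<le> \<omega> powr (real k - p) * (1 + w powr m)"
            using powr_le_one_plus[OF b(6) that] by (intro mult_left_mono) auto
          also have "\<dots> = \<omega> powr (real k - p) + ?Z" by (simp add: \<omega>_def algebra_simps)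
          also have "\<dots> \<le> X + ?Z" using \<omega>X by simp
          also have "\<dots> \<le> (1 + X) * (1 + ?Z)" using C12(3) Z by (simp add: algebra_simps)
          finally show ?thesis .
        qed
        have T1: "real k * \<tau> ^ (k - 1) * (\<xi> ^ k * w\<^sup>2) \<le> C1 * ((1 + X) * (1 + ?Z))"
        proof -
          have "\<tau> ^ (k - 1) = \<tau> powr (real k - p) * \<tau> powr (p - 1)"
            using pos k by (simp add: powr_realpow[symmetric] of_nat_diff flip: powr_add)
          moreover have "\<xi> ^ k = \<xi> powr (real k - p) * \<xi> powr p"
            using pos by (simp add: powr_realpow[symmetric] flip: powr_add)
          ultimately have "\<tau> ^ (k - 1) * \<xi> ^ k = \<omega> powr (real k - p) * (\<tau> powr (p - 1) * \<xi> powr p)"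
            using pos by (simp add: \<omega>_def powr_mult)
          also have "\<dots> \<le> \<omega> powr (real k - p) * (3 powr (p - 1) * (9/4) powr p)"
            using b p by (intro mult_left_mono mult_mono powr_mono2) auto
          finally have "real k * (\<tau> ^ (k - 1) * \<xi> ^ k) \<le> C1 * \<omega> powr (real k - p)"
            unfolding C1_def by (simp add: mult_left_mono mult_ac)
          then have "real k * (\<tau> ^ (k - 1) * \<xi> ^ k) * w powr 2 \<le> C1 * \<omega> powr (real k - p) * w powr 2" by (rule mult_right_mono) auto
          also have "\<dots> \<le> C1 * ((1 + X) * (1 + ?Z))"
            using \<omega>Z[of 2] m C12 by (simp add: mult.assoc mult_left_mono)
          finally show ?thesis using b by (simp add: mult_ac)
        qed
        have T2: "\<tau> ^ k * (N * (h * w * \<xi> ^ (k - 1))) \<le> \<delta> * (\<omega> ^ k * h powr p') + C2 * ((1 + X) * (1 + ?Z))"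
        proof -
          \<comment> \<open>Young's inequality for \<open>a c\<close>. The powers are distributed such that \<open>a^{p'}\<close>
              carries the weight \<open>\<omega>^k\<close>; what remains for c follows from
              \<open>k/p' + (k-p)/p = k - 1\<close>.\<close>
          define a where "a = e * h * \<omega> powr (real k / p')"
          define c where "c = N / e * w * (\<xi> powr ((real k - p) / p) * \<tau> powr (real k / p))"
          have ac: "0 \<le> a" "0 \<le> c" using e b N by (auto simp: a_def c_def)
          have "\<xi> powr (real k / p') * \<xi> powr ((real k - p) / p) = \<xi> powr (real k * (1 / p' + 1 / p) - 1)"
            using p by (simp add: field_simps flip: powr_add)
          also have "\<dots> = \<xi> ^ (k - 1)" using pos k p' by (simp add: powr_realpow[symmetric] of_nat_diff)
          finally have 1: "\<xi> powr (real k / p') * \<xi> powr ((real k - p) / p) = \<xi> ^ (k - 1)" .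
          have "\<tau> powr (real k / p') * \<tau> powr (real k / p) = \<tau> powr (real k * (1 / p' + 1 / p))"
            by (simp add: field_simps flip: powr_add)
          also have "\<dots> = \<tau> ^ k" using pos p' by (simp add: powr_realpow)
          finally have 2: "\<tau> powr (real k / p') * \<tau> powr (real k / p) = \<tau> ^ k" .
          have "a * c = N * h * w * (\<xi> powr (real k / p') * \<xi> powr ((real k - p) / p)) * (\<tau> powr (real k / p') * \<tau> powr (real k / p))"
            using e pos by (simp add: a_def c_def \<omega>_def powr_mult)
          also have "\<dots> = \<tau> ^ k * (N * (h * w * \<xi> ^ (k - 1)))" by (simp only: 1 2) (simp add: mult_ac)
          finally have "\<tau> ^ k * (N * (h * w * \<xi> ^ (k - 1))) = a * c" ..
          also have "\<dots> \<le> a powr p' / p' + c powr p / p" by (rule Youngs_inequality) (use p p' ac in auto)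
          also have "\<dots> \<le> a powr p' + c powr p"
            using p p' by (intro add_mono) (auto simp: divide_le_eq intro!: mult_left_mono[of 1 _ "_ powr _", simplified])
          also have "a powr p' = \<delta> * (\<omega> ^ k * h powr p')"
            using e b \<omega> p' by (simp add: a_def powr_mult powr_powr powr_realpow)
          also have "c powr p \<le> C2 * (\<omega> powr (real k - p) * w powr p)"
          proof -
            have "c powr p = (N / e) powr p * w powr p * (\<xi> powr (real k - p) * \<tau> powr real k)"
              using e b N p by (simp add: c_def powr_mult powr_divide powr_powr)
            also have "\<tau> powr real k = \<tau> powr (real k - p) * \<tau> powr p" by (simp flip: powr_add)
            also have "(N / e) powr p * w powr p * (\<xi> powr (real k - p) * (\<tau> powr (real k - p) * \<tau> powr p))
                = ((N / e) powr p * w powr p * \<omega> powr (real k - p)) * \<tau> powr p"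
              using pos by (simp add: \<omega>_def powr_mult)
            also have "\<dots> \<le> ((N / e) powr p * w powr p * \<omega> powr (real k - p)) * 3 powr p"
              using b p by (intro mult_left_mono powr_mono2) auto
            finally show ?thesis by (simp add: C2_def mult_ac)
          qed
          also have "C2 * (\<omega> powr (real k - p) * w powr p) \<le> C2 * ((1 + X) * (1 + ?Z))"
            using \<omega>Z[of p] m p C12 by (intro mult_left_mono) auto
          finally show ?thesis by simp
        qed
        show ?thesis using T1 T2 by (simp add: C_def p'_def \<omega>_def algebra_simps)
      qed
    qed
  qed
qed

text \<open>
  A closed cylinder that contains the unit cylinder \<open>ball 0 1 \<times> {-1<..<1}\<close> for \<open>s = 1\<close>, and stays
  away from the boundary of the cylinder of radius 2.
\<close>

definition cyl :: "real \<Rightarrow> ((real^'n) \<times> real) set" where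
  "cyl s = cball 0 (3/2) \<times> {-2..s}"

definition weight :: "nat \<Rightarrow> (real^'n) \<times> real \<Rightarrow> real" where
  "weight k z = (cutoff (fst z) * (snd z + 2)) ^ k"

text \<open>
  Twice the pairing of the flux with the gradient, minus what Young's inequality borrows from it.
  For a flux with \<open>p\<close>-growth and coercivity it is, for small \<open>\<delta>\<close>, at least a multiple of \<open>|X|^p\<close>
  up to the data.
\<close>

definition dissipation :: "real \<Rightarrow> real \<Rightarrow> real^'n^'m \<Rightarrow> real^'n^'m \<Rightarrow> real" where
  "dissipation p \<delta> P X = 2 * (P \<bullet> X) - \<delta> * norm P powr (p / (p - 1))"

text \<open>
  Let \<open>S(t)\<close> be the energy with its weight \<open>(t + 2)^k\<close>, let \<open>\<Phi>(t)\<close> be the weighted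
  dissipation up to time \<open>t\<close> and let \<open>s\<close> be a time at which \<open>S\<close> is maximal. The lower order terms
  are bounded by \<open>C + D S(s)^{(m-q)/2}\<close>, hence by \<open>C' + S(s)/2\<close>. The energy inequality at time \<open>s\<close>
  controls the maximal energy, and the one at time 1 the whole dissipation. As no sign of the
  dissipation is known at this stage, both appear in the conclusion: their sum is where \<open>S(s)\<close>
  cancels.

  The third condition on \<open>k\<close> provides for the weights: interpolation needs \<open>(\<xi> \<tau>)^{k (m-q)/2}\<close>,
  and \<open>(\<xi> \<tau>)^{k-p}\<close> is what is there.
\<close>

lemma absorbed_energy_estimate:
  fixes p q m \<delta> M :: real and k :: nat
  assumes p: "1 < p" and q: "1 < q" and m: "2 \<le> m" "p \<le> m" and mq: "q < m" "m - q < 2" "real CARD('n) * (m - q) < 2 * q"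
    and k: "2 \<le> k" "p < real k" "2 * p \<le> real k * (2 - (m - q))" and \<delta>: "0 < \<delta>" and M: "0 \<le> M"
  obtains C where "\<forall>(v :: (real^'n::finite) \<times> real \<Rightarrow> real^'m::finite) v' H H'.
    smooth_conservation_law v v' H H' (cyl 1) \<longrightarrow>
    (\<integral>z. indicator (cyl 1) z * norm (space_jacobian v' z) powr q \<partial>lborel) \<le> M \<longrightarrow>
    (\<exists>s\<in>{-2..1}. (\<integral>z. indicator (cyl 1) z * (weight k z * dissipation p \<delta> (H z) (space_jacobian v' z)) \<partial>lborel)
      + (\<integral>z. indicator (cyl s) z * (weight k z * dissipation p \<delta> (H z) (space_jacobian v' z)) \<partial>lborel) \<le> C)"
proof -
  define N where "N = real CARD('m) * real CARD('n)"
  have N: "0 \<le> N" by (simp add: N_def)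
  \<comment> \<open>The Sobolev exponent r and the interpolation parameter \<open>\<theta>\<close> solve \<open>\<theta> r + 2 (1 - \<theta>) = m\<close> and
      \<open>\<theta> r = q\<close>. Because of the latter, the integral of \<open>|Dv|^q\<close> over a slice appears to the
      first power, and can be integrated in time.\<close>
  define r where "r = 2 * q / (2 + q - m)"
  define \<theta> where "\<theta> = (2 + q - m) / 2"
  have den: "0 < 2 + q - m" using mq by simp
  have \<theta>: "0 < \<theta>" "\<theta> < 1" "1 - \<theta> = (m - q) / 2" "\<theta> * r = q" "\<theta> = q / r"
    using mq den q by (auto simp: \<theta>_def r_def field_simps)
  have qr: "q < r" using mq q den by (simp add: r_def field_simps)
  have sub: "real DIM(real^'n) * (1/q - 1/r) < 1"
  proof -
    have "1/q - 1/r = (m - q) / (2 * q)" using q den by (simp add: r_def field_simps)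
    then have "real DIM(real^'n) * (1/q - 1/r) = real CARD('n) * (m - q) / (2 * q)" by simp
    then show ?thesis using mq q by (simp add: divide_less_eq)
  qed
  let ?\<eta> = "\<lambda>x::real^'n. cutoff x ^ k"
  let ?B = "cball (0::real^'n) (3/2)"
  have \<eta>c: "continuous_on UNIV ?\<eta>" by (intro continuous_intros continuous_cutoff)
  have \<eta>s: "norm x \<le> 3/2" if "?\<eta> x \<noteq> 0" for x using that cutoff_support[of x] k by (auto simp: power_0_left)
  have k1: "1 \<le> k" using k by simp
  have R: "0 < (3/2::real)" by simp
  have \<eta>0: "0 \<le> ?\<eta> x" for x by (simp add: cutoff_bounds)
  obtain C0 where C0: "0 \<le> C0" and SP0:
    "\<forall>(w :: real^'n \<Rightarrow> real^'m) w' g. (\<forall>x. (w has_derivative w' x) (at x)) \<longrightarrow> continuous_on UNIV g \<longrightarrow>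
       (\<forall>x h. norm (w' x h) \<le> g x * norm h) \<longrightarrow> (\<forall>x. 0 \<le> g x) \<longrightarrow>
       (\<integral>x. indicator ?B x * norm (w x - (\<integral>y. ?\<eta> y *\<^sub>R w y \<partial>lborel) /\<^sub>R (\<integral>y. ?\<eta> y \<partial>lborel)) powr r \<partial>lborel)
         \<le> C0 * (\<integral>x. indicator ?B x * g x powr q \<partial>lborel) powr (r / q)"
  proof (rule Sobolev_Poincare_subcritical[OF R q qr sub \<eta>c \<eta>0 _ cutoff_power_integral_pos(2)[OF k1]])
    show "norm x \<le> 3/2" if "?\<eta> x \<noteq> 0" for x using \<eta>s[OF that] .
  qed (rule that)
  have NK: "0 \<le> 2 * (N * (3 * real k))" using N by simp
  obtain C4 where C4: "0 \<le> C4" and pw: "\<forall>\<xi> \<tau> h w. 0 \<le> \<xi> \<longrightarrow> \<xi> \<le> 9/4 \<longrightarrow> 0 \<le> \<tau> \<longrightarrow> \<tau> \<le> 3 \<longrightarrow> 0 \<le> h \<longrightarrow> 0 \<le> w \<longrightarrow>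
      real k * \<tau> ^ (k - 1) * (\<xi> ^ k * w\<^sup>2) + \<tau> ^ k * (2 * (N * (3 * real k)) * (h * w * \<xi> ^ (k - 1)))
        \<le> \<delta> * ((\<xi> * \<tau>) ^ k * h powr (p / (p - 1))) + C4 * (1 + w powr m * (\<xi> * \<tau>) powr (real k - p))"
    by (rule lower_order_pointwise[OF p m k(1,2) \<delta> NK]) (rule that)
  define X where "X = (27/4) powr (real k * \<theta> - p)"
  have kp: "p \<le> real k * \<theta>" using k(3) by (simp add: \<theta>_def field_simps)
  define C6 where "C6 = X * (C0 powr \<theta> * N powr q)"
  have C6: "0 \<le> C6" by (simp add: C6_def X_def)
  define Q where "Q = measure lborel (cyl 1 :: ((real^'n) \<times> real) set)"
  define A where "A = C4 * Q"
  define D where "D = C4 * (C6 * M)"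
  define C8 where "C8 = (D * 2 powr (1 - \<theta>)) powr (1/\<theta>)"
  show ?thesis
  proof (rule that[of "2 * A + 2 * C8"], intro allI impI)
    fix v :: "(real^'n) \<times> real \<Rightarrow> real^'m" and v' H H'
    assume law: "smooth_conservation_law v v' H H' (cyl 1)"
      and Mb: "(\<integral>z. indicator (cyl 1) z * norm (space_jacobian v' z) powr q \<partial>lborel) \<le> M"
    let ?\<eta>' = "\<lambda>(x::real^'n) h. real k * cutoff x ^ (k - 1) * (- 2 * (x \<bullet> h))"
    interpret weighted_conservation_law v v' H H' "cyl 1" ?\<eta> ?\<eta>' "3/2"
    proof (intro weighted_conservation_law.intro law weighted_conservation_law_axioms.intro)
      show "continuous_on UNIV (\<lambda>x. ?\<eta>' x h)" for h by (intro continuous_intros continuous_cutoff)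
    qed (use cutoff_power_deriv[OF k(1)] \<eta>0 \<eta>s cutoff_power_integral_pos(2)[OF k1] in auto)
    let ?J = "space_jacobian v'"
    define \<Phi> where "\<Phi> s = (\<integral>z. indicator (cyl s) z * (weight k z * dissipation p \<delta> (H z) (?J z)) \<partial>lborel)" for s
    define S where "S t = (t + 2) ^ k * energy t" for t
    define om where "om z = cutoff (fst z) * (snd z + 2)" for z :: "(real^'n) \<times> real"
    \<comment> \<open>The lower order density. The maximum makes it continuous also for times before -2.\<close>
    define L where "L z = norm (osc z) powr m * max 0 (om z) powr (real k - p)" for z
    have fstc: "continuous_on UNIV (\<lambda>z::(real^'n) \<times> real. cutoff (fst z))"
      by (rule continuous_on_compose2[OF continuous_cutoff]) (auto intro: continuous_intros)
    have omc: "continuous_on UNIV om" unfolding om_def by (intro continuous_intros fstc)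
    have Lc: "continuous_on UNIV L" unfolding L_def
      by (intro continuous_intros continuous_on_powr_const osc_cont omc) (use m k in auto)
    have p'pos: "0 < p / (p - 1)" using p by simp
    have disc: "continuous_on UNIV (\<lambda>z. weight k z * dissipation p \<delta> (H z) (?J z))"
      unfolding weight_def dissipation_def
      by (intro continuous_intros fstc H_cont grad_cont continuous_on_powr_const p'pos) auto
    have ci: "integrable lborel (\<lambda>z. indicator (cyl s) z * f z)" if "continuous_on UNIV f" for s and f :: "(real^'n) \<times> real \<Rightarrow> real"
      unfolding cyl_def by (rule cylinder_integrable[OF that])
    have cm: "(\<integral>z. indicator (cyl s) z * f z \<partial>lborel) \<le> (\<integral>z. indicator (cyl 1) z * f z \<partial>lborel)"
      if "continuous_on UNIV f" "s \<le> 1" "\<And>z. 0 \<le> f z" for s and f :: "(real^'n) \<times> real \<Rightarrow> real"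
      using that by (intro integral_mono ci mult_right_mono) (auto simp: cyl_def indicator_def)
    \<comment> \<open>The energy identity up to time s, with \<open>lower_order_pointwise\<close> applied to its lower
        order terms.\<close>
    have E1: "S s \<le> - \<Phi> s + A + C4 * (\<integral>z. indicator (cyl 1) z * L z \<partial>lborel)" if s: "s \<in> {-2..1}" for s
    proof -
      let ?F = "\<lambda>z. real k * (snd z - - 2) ^ (k - 1) * (?\<eta> (fst z) * (norm (osc z))\<^sup>2)
        - 2 * (snd z - - 2) ^ k * (?\<eta> (fst z) * (H z \<bullet> ?J z) + flux z)"
      have Fc: "continuous_on UNIV ?F" by (intro continuous_intros fstc osc_cont H_cont grad_cont flux_cont)
      have "S s = (s - - 2) ^ k * energy s" by (simp add: S_def)
      also have "\<dots> = (\<integral>z. indicator (cyl s) z * ?F z \<partial>lborel)" unfolding cyl_def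
        by (rule energy_identity) (use s k in \<open>auto simp: cyl_def\<close>)
      also have "\<dots> \<le> (\<integral>z. indicator (cyl s) z * (- (weight k z * dissipation p \<delta> (H z) (?J z)) + C4 * (1 + L z)) \<partial>lborel)"
      proof (rule integral_mono)
        show "integrable lborel (\<lambda>z. indicator (cyl s) z * ?F z)" by (rule ci[OF Fc])
        show "integrable lborel (\<lambda>z. indicator (cyl s) z * (- (weight k z * dissipation p \<delta> (H z) (?J z)) + C4 * (1 + L z)))"
          by (rule ci) (intro continuous_intros disc Lc)
        fix z :: "(real^'n) \<times> real"
        show "indicator (cyl s) z * ?F z \<le> indicator (cyl s) z * (- (weight k z * dissipation p \<delta> (H z) (?J z)) + C4 * (1 + L z))"
        proof (cases "z \<in> cyl s")
          case True
          define \<xi> where "\<xi> = cutoff (fst z)"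
          define \<tau> where "\<tau> = snd z + 2"
          have b: "0 \<le> \<xi>" "\<xi> \<le> 9/4" "0 \<le> \<tau>" "\<tau> \<le> 3" using True s cutoff_bounds by (auto simp: \<xi>_def \<tau>_def cyl_def)
          have nx: "norm (fst z) \<le> 3/2" using True by (auto simp: cyl_def)
          have "\<bar>flux z\<bar> \<le> N * (norm (H z) * norm (osc z) * (3 * real k * \<xi> ^ (k - 1)))"
            unfolding N_def
          proof (rule norm_flux_le)
            fix j
            have "\<bar>fst z \<bullet> axis j 1\<bar> \<le> 3/2" using component_le_norm_cart[of "fst z" j] nx by (simp add: inner_axis)
            then have "real k * \<xi> ^ (k - 1) * (2 * \<bar>fst z \<bullet> axis j 1\<bar>) \<le> real k * \<xi> ^ (k - 1) * 3"
              using b by (intro mult_left_mono) auto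
            then show "\<bar>?\<eta>' (fst z) (axis j 1)\<bar> \<le> 3 * real k * \<xi> ^ (k - 1)"
              using b by (simp add: abs_mult \<xi>_def mult_ac)
          qed
          then have f1: "2 * \<tau> ^ k * \<bar>flux z\<bar> \<le> 2 * \<tau> ^ k * (N * (norm (H z) * norm (osc z) * (3 * real k * \<xi> ^ (k - 1))))"
            using b by (intro mult_left_mono) auto
          have f2: "- (2 * \<tau> ^ k * flux z) \<le> 2 * \<tau> ^ k * \<bar>flux z\<bar>"
            using b abs_ge_minus_self[of "2 * \<tau> ^ k * flux z"] by (simp add: abs_mult)
          have f3: "2 * \<tau> ^ k * (N * (norm (H z) * norm (osc z) * (3 * real k * \<xi> ^ (k - 1))))
              = \<tau> ^ k * (2 * (N * (3 * real k)) * (norm (H z) * norm (osc z) * \<xi> ^ (k - 1)))" by (simp only: mult_ac)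
          have Leq: "L z = norm (osc z) powr m * (\<xi> * \<tau>) powr (real k - p)"
            using b by (simp add: L_def om_def \<xi>_def \<tau>_def)
          note f4 = pw[rule_format, OF b norm_ge_zero norm_ge_zero, of "osc z" "H z"]
          have chain: "a0 - fl \<le> d0" if "fa \<le> x0" "- fl \<le> fa" "x0 = y0" "a0 + y0 \<le> d0" for a0 fl fa x0 y0 d0 :: real
            using that by linarith
          have "real k * \<tau> ^ (k - 1) * (\<xi> ^ k * (norm (osc z))\<^sup>2) - 2 * \<tau> ^ k * flux z
              \<le> \<delta> * ((\<xi> * \<tau>) ^ k * norm (H z) powr (p / (p - 1))) + C4 * (1 + L z)"
            unfolding Leq by (rule chain[OF f1 f2 f3 f4])
          then have f5: "real k * \<tau> ^ (k - 1) * (\<xi> ^ k * (norm (osc z))\<^sup>2) - 2 * \<tau> ^ k * flux z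
              \<le> \<delta> * ((\<xi> ^ k * \<tau> ^ k) * norm (H z) powr (p / (p - 1))) + C4 * (1 + L z)" by (simp only: power_mult_distrib)
          have regroup: "a0 - 2 * y0 * (x0 * d0 + fl) \<le> - ((x0 * y0) * (2 * d0 - \<delta> * h0)) + r0"
            if "a0 - 2 * y0 * fl \<le> \<delta> * ((x0 * y0) * h0) + r0" for a0 y0 x0 d0 fl h0 r0 :: real
            using that by (simp add: algebra_simps)
          have sh: "snd z - - 2 = \<tau>" by (simp add: \<tau>_def)
          have wt: "weight k z = \<xi> ^ k * \<tau> ^ k" by (simp only: weight_def power_mult_distrib \<xi>_def \<tau>_def)
          have "?F z \<le> - (weight k z * dissipation p \<delta> (H z) (?J z)) + C4 * (1 + L z)"
            unfolding sh wt dissipation_def using regroup[OF f5] by (simp only: \<xi>_def)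
          then show ?thesis using True by simp
        qed simp
      qed
      also have "\<dots> = - \<Phi> s + C4 * (\<integral>z. indicator (cyl s) z * (1 + L z) \<partial>lborel)"
      proof -
        have i1: "integrable lborel (\<lambda>z. indicator (cyl s) z * (weight k z * dissipation p \<delta> (H z) (?J z)))" by (rule ci[OF disc])
        have i2: "integrable lborel (\<lambda>z. indicator (cyl s) z * (1 + L z))" by (rule ci) (intro continuous_intros Lc)
        have "(\<integral>z. indicator (cyl s) z * (- (weight k z * dissipation p \<delta> (H z) (?J z)) + C4 * (1 + L z)) \<partial>lborel)
          = (\<integral>z. C4 * (indicator (cyl s) z * (1 + L z)) - indicator (cyl s) z * (weight k z * dissipation p \<delta> (H z) (?J z)) \<partial>lborel)"
          by (intro Bochner_Integration.integral_cong refl) (simp add: algebra_simps)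
        also have "\<dots> = C4 * (\<integral>z. indicator (cyl s) z * (1 + L z) \<partial>lborel) - \<Phi> s"
          unfolding \<Phi>_def using i1 i2 by (subst Bochner_Integration.integral_diff) auto
        finally show ?thesis by simp
      qed
      also have "\<dots> \<le> - \<Phi> s + C4 * (\<integral>z. indicator (cyl 1) z * (1 + L z) \<partial>lborel)"
      proof (intro add_left_mono mult_left_mono C4)
        show "(\<integral>z. indicator (cyl s) z * (1 + L z) \<partial>lborel) \<le> (\<integral>z. indicator (cyl 1) z * (1 + L z) \<partial>lborel)"
        proof (rule cm)
          show "continuous_on UNIV (\<lambda>z. 1 + L z)" by (intro continuous_intros Lc)
          show "0 \<le> 1 + L z" for z by (simp add: L_def)
        qed (use s in auto)
      qed
      also have "(\<integral>z. indicator (cyl 1) z * (1 + L z) \<partial>lborel) = Q + (\<integral>z. indicator (cyl 1) z * L z \<partial>lborel)"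
      proof -
        have "integrable lborel (\<lambda>z::(real^'n) \<times> real. indicator (cyl 1) z * 1 :: real)" by (rule ci) simp
        then show ?thesis using ci[OF Lc, of 1] by (simp add: distrib_left Q_def)
      qed
      finally show ?thesis by (simp add: A_def algebra_simps)
    qed
    have "continuous_on {-2..1} S" unfolding S_def by (intro continuous_intros continuous_on_subset[OF energy_cont]) auto
    then obtain s where s: "s \<in> {-2..1}" and smax: "\<And>t. t \<in> {-2..1} \<Longrightarrow> S t \<le> S s"
      using continuous_attains_sup[of "{-2..1::real}" S] by auto
    have S0: "0 \<le> S t" if "t \<in> {-2..1}" for t using that energy_nonneg by (simp add: S_def)
    \<comment> \<open>Interpolation on a time slice between the energy, which is at most \<open>S s\<close>, and the \<open>L^r\<close>
        norm, to which the Sobolev-Poincare inequality applies.\<close>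
    have slice: "(\<integral>x. indicator ?B x * L (x, t) \<partial>lborel) \<le> C6 * S s powr (1 - \<theta>) * (\<integral>x. indicator ?B x * norm (?J (x, t)) powr q \<partial>lborel)"
      if t: "t \<in> {-2..1}" for t
    proof -
      let ?f = "\<lambda>x. indicator ?B x * norm (osc (x, t)) powr r"
      let ?g = "\<lambda>x. (t + 2) ^ k * (?\<eta> x * (norm (osc (x, t)))\<^sup>2)"
      have sl: "continuous_on UNIV (\<lambda>x. h (x, t))" if "continuous_on UNIV h" for h :: "(real^'n) \<times> real \<Rightarrow> 'z::topological_space"
        by (intro continuous_on_compose2[OF that] continuous_intros) auto
      have bi: "integrable lborel (\<lambda>x. indicator ?B x * h x)" if "continuous_on UNIV h" for h :: "real^'n \<Rightarrow> real"
        using borel_integrable_compact[of ?B h] continuous_on_subset[OF that] by simp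
      have r0: "0 < r" using q qr by simp
      have fi: "integrable lborel ?f" by (intro bi continuous_on_powr_const continuous_intros sl osc_cont r0) auto
      have g0: "integrable lborel (\<lambda>x. ?\<eta> x * (norm (osc (x, t)))\<^sup>2)"
        using slice_integrable[OF _ \<eta>c \<eta>s, of "\<lambda>z. (norm (osc z))\<^sup>2" t] by (simp add: continuous_intros osc_cont)
      then have gi: "integrable lborel ?g" by simp
      have gS: "(\<integral>x. ?g x \<partial>lborel) = S t" using g0 by (simp add: S_def energy_def)
      have nn: "0 \<le> ?f x" "0 \<le> ?g x" for x using t cutoff_bounds(1)[of x] by (auto intro!: mult_nonneg_nonneg)
      have H1: "integrable lborel (\<lambda>x. ?f x powr \<theta> * ?g x powr (1 - \<theta>))" by (rule Holder_integral(1)[OF \<theta>(1,2) nn fi gi])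
      have H2: "(\<integral>x. ?f x powr \<theta> * ?g x powr (1 - \<theta>) \<partial>lborel) \<le> (\<integral>x. ?f x \<partial>lborel) powr \<theta> * S t powr (1 - \<theta>)"
        using Holder_integral(2)[OF \<theta>(1,2) nn fi gi] by (simp only: gS)
      have "(\<integral>x. indicator ?B x * L (x, t) \<partial>lborel) \<le> (\<integral>x. X * (?f x powr \<theta> * ?g x powr (1 - \<theta>)) \<partial>lborel)"
      proof (rule integral_mono)
        show "integrable lborel (\<lambda>x. indicator ?B x * L (x, t))" by (intro bi sl Lc)
        fix x
        show "indicator ?B x * L (x, t) \<le> X * (?f x powr \<theta> * ?g x powr (1 - \<theta>))"
        proof (cases "x \<in> ?B \<and> osc (x, t) \<noteq> 0 \<and> om (x, t) > 0")
          case True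
          let ?w = "norm (osc (x, t))"
          let ?o = "om (x, t)"
          have w: "0 < ?w" using True by simp
          have o: "0 < ?o" "?o \<le> 27/4"
            using True t cutoff_bounds[of x] mult_mono[of "cutoff x" "9/4" "t + 2" 3] by (auto simp: om_def)
          have "?f x powr \<theta> = ?w powr q" using True \<theta>(4) by (simp add: powr_powr mult.commute)
          moreover have "?g x = ?o powr real k * ?w powr 2"
            unfolding powr_realpow[OF o(1)] using w by (simp add: om_def power_mult_distrib mult_ac)
          then have "?g x powr (1 - \<theta>) = ?o powr (real k * (1 - \<theta>)) * ?w powr (2 * (1 - \<theta>))"
            by (simp only: powr_mult powr_powr)
          moreover have "2 * (1 - \<theta>) = m - q" using \<theta>(3) by simp
          ultimately have "?f x powr \<theta> * ?g x powr (1 - \<theta>) = ?w powr m * ?o powr (real k * (1 - \<theta>))"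
            by (simp add: mult_ac flip: powr_add)
          moreover have "?o powr (real k - p) = ?o powr (real k * \<theta> - p) * ?o powr (real k * (1 - \<theta>))"
            by (simp add: algebra_simps flip: powr_add)
          moreover have "?o powr (real k * \<theta> - p) \<le> X" unfolding X_def using o kp by (intro powr_mono2) auto
          ultimately show ?thesis using True o w
            by (simp add: L_def mult_ac mult_left_mono)
        next
          case False
          then have "x \<notin> ?B \<or> osc (x, t) = 0 \<or> om (x, t) \<le> 0" by auto
          then have "indicator ?B x * L (x, t) = 0" using m by (auto simp: L_def)
          moreover have "0 \<le> X * (?f x powr \<theta> * ?g x powr (1 - \<theta>))"
            unfolding X_def by (intro mult_nonneg_nonneg powr_ge_zero)
          ultimately show ?thesis by (simp only:)
        qed
      qed (use H1 in simp)
      also have "\<dots> \<le> X * ((\<integral>x. ?f x \<partial>lborel) powr \<theta> * S t powr (1 - \<theta>))"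
        using H2 by (simp add: X_def mult_left_mono)
      also have "\<dots> \<le> X * ((C0 powr \<theta> * (N powr q * (\<integral>x. indicator ?B x * norm (?J (x, t)) powr q \<partial>lborel))) * S s powr (1 - \<theta>))"
      proof (intro mult_left_mono mult_mono)
        have "(\<integral>x. ?f x \<partial>lborel) \<le> C0 * (\<integral>x. indicator ?B x * (N * norm (?J (x, t))) powr q \<partial>lborel) powr (r / q)"
          unfolding osc_slice
        proof (rule SP0[rule_format])
          show "((\<lambda>x. v (x, t)) has_derivative (\<lambda>h. v' (x, t) (h, 0))) (at x)" for x
            by (rule has_derivative_compose[OF _ v_deriv]) (auto intro!: derivative_eq_intros)
          show "continuous_on UNIV (\<lambda>x. N * norm (?J (x, t)))" by (intro continuous_intros sl grad_cont)
          show "norm (v' (x, t) (h, 0)) \<le> N * norm (?J (x, t)) * norm h" for x h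
            using norm_space_derivative_le[of "(x, t)" h] by (simp add: N_def)
        qed (use N in auto)
        also have "(\<integral>x. indicator ?B x * (N * norm (?J (x, t))) powr q \<partial>lborel) = N powr q * (\<integral>x. indicator ?B x * norm (?J (x, t)) powr q \<partial>lborel)"
          using N by (simp add: powr_mult mult_ac flip: Bochner_Integration.integral_mult_right_zero)
        finally have "(\<integral>x. ?f x \<partial>lborel) powr \<theta> \<le> (C0 * (N powr q * (\<integral>x. indicator ?B x * norm (?J (x, t)) powr q \<partial>lborel)) powr (r / q)) powr \<theta>"
          using \<theta> nn by (intro powr_mono2) auto
        also have "\<dots> = C0 powr \<theta> * (N powr q * (\<integral>x. indicator ?B x * norm (?J (x, t)) powr q \<partial>lborel))"
        proof -
          have "r / q * \<theta> = 1" using \<theta>(5) q r0 by simp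
          moreover have "0 \<le> N powr q * (\<integral>x. indicator ?B x * norm (?J (x, t)) powr q \<partial>lborel)" by simp
          ultimately show ?thesis by (simp only: powr_mult[of C0] powr_powr powr_one)
        qed
        finally show "(\<integral>x. ?f x \<partial>lborel) powr \<theta> \<le> C0 powr \<theta> * (N powr q * (\<integral>x. indicator ?B x * norm (?J (x, t)) powr q \<partial>lborel))" .
        show "S t powr (1 - \<theta>) \<le> S s powr (1 - \<theta>)" using smax[OF t] S0[OF t] \<theta> by (intro powr_mono2) auto
      qed (auto simp: X_def)
      finally show ?thesis by (simp add: C6_def mult_ac)
    qed
    have E2: "C4 * (\<integral>z. indicator (cyl 1) z * L z \<partial>lborel) \<le> D * S s powr (1 - \<theta>)"
    proof -
      have Jq: "continuous_on UNIV (\<lambda>z. norm (?J z) powr q)" by (intro continuous_on_powr_const continuous_intros grad_cont) (use q in auto)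
      have "(\<integral>z. indicator (cyl 1) z * L z \<partial>lborel) = (\<integral>t. indicator {-2..1} t * (\<integral>x. indicator ?B x * L (x, t) \<partial>lborel) \<partial>lborel)"
        unfolding cyl_def by (rule cylinder_integral(2)[OF Lc, symmetric])
      also have "\<dots> \<le> (\<integral>t. C6 * S s powr (1 - \<theta>) * (indicator {-2..1} t * (\<integral>x. indicator ?B x * norm (?J (x, t)) powr q \<partial>lborel)) \<partial>lborel)"
      proof (rule integral_mono[OF cylinder_integral(1)[OF Lc]])
        show "integrable lborel (\<lambda>t. C6 * S s powr (1 - \<theta>) * (indicator {-2..1} t * (\<integral>x. indicator ?B x * norm (?J (x, t)) powr q \<partial>lborel)))"
          using cylinder_integral(1)[OF Jq, of "-2" 1 "3/2"] by simp
        fix t :: real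
        show "indicator {-2..1} t * (\<integral>x. indicator ?B x * L (x, t) \<partial>lborel)
            \<le> C6 * S s powr (1 - \<theta>) * (indicator {-2..1} t * (\<integral>x. indicator ?B x * norm (?J (x, t)) powr q \<partial>lborel))"
          using slice[of t] by (cases "t \<in> {-2..1}") auto
      qed
      also have "\<dots> = C6 * S s powr (1 - \<theta>) * (\<integral>z. indicator (cyl 1) z * norm (?J z) powr q \<partial>lborel)"
        using cylinder_integral(2)[OF Jq, of "-2" 1 "3/2"] by (simp add: cyl_def)
      also have "\<dots> \<le> C6 * S s powr (1 - \<theta>) * M" using Mb C6 by (intro mult_left_mono) auto
      finally have "C4 * (\<integral>z. indicator (cyl 1) z * L z \<partial>lborel) \<le> C4 * (C6 * S s powr (1 - \<theta>) * M)" using C4 by (intro mult_left_mono)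
      then show ?thesis by (simp add: D_def mult_ac)
    qed
    \<comment> \<open>Young's inequality; this is where \<open>1 - \<theta> = (m - q)/2\<close> has to be less than 1.\<close>
    have E3: "D * S s powr (1 - \<theta>) \<le> C8 + S s / 2"
    proof (cases "D = 0 \<or> S s = 0")
      case True
      then have "D * S s powr (1 - \<theta>) = 0" by auto
      moreover have "0 \<le> C8" by (simp add: C8_def)
      ultimately show ?thesis using S0[OF s] by linarith
    next
      case False
      have D0: "0 \<le> D" using C4 C6 M by (simp add: D_def)
      then have pos: "0 < D" "0 < S s" using False S0[OF s] by auto
      have "C8 powr \<theta> * (S s / 2) powr (1 - \<theta>) \<le> \<theta> * C8 + (1 - \<theta>) * (S s / 2)"
        by (rule Youngs_inequality_0) (use \<theta> pos in \<open>auto simp: C8_def\<close>)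
      also have "\<dots> \<le> 1 * C8 + 1 * (S s / 2)" using \<theta> pos by (intro add_mono mult_right_mono) (auto simp: C8_def)
      also have "C8 powr \<theta> = D * 2 powr (1 - \<theta>)" using \<theta>(1) pos by (simp add: C8_def powr_powr)
      also have "D * 2 powr (1 - \<theta>) * (S s / 2) powr (1 - \<theta>) = D * S s powr (1 - \<theta>)" using pos by (simp add: powr_divide)
      finally show ?thesis by simp
    qed
    have "S s \<le> - \<Phi> s + A + (C8 + S s / 2)" using E1[OF s] E2 E3 by linarith
    moreover have "S 1 \<le> - \<Phi> 1 + A + (C8 + S s / 2)" using E1[of 1] E2 E3 by simp
    moreover have "0 \<le> S 1" by (rule S0) simp
    ultimately have "\<Phi> 1 + \<Phi> s \<le> 2 * A + 2 * C8" by linarith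
    then show "\<exists>s\<in>{-2..1}. (\<integral>z. indicator (cyl 1) z * (weight k z * dissipation p \<delta> (H z) (?J z)) \<partial>lborel)
      + (\<integral>z. indicator (cyl s) z * (weight k z * dissipation p \<delta> (H z) (?J z)) \<partial>lborel) \<le> 2 * A + 2 * C8"
      using s unfolding \<Phi>_def by blast
  qed
qed

section \<open>The estimate on the unit cylinder\<close>

lemma mollify_fst_snd:
  fixes f :: "'a::euclidean_space \<Rightarrow> 'b::euclidean_space \<times> 'c::euclidean_space"
  assumes J: "mollifier \<epsilon> J" and f: "integrable lborel f"
  shows "mollify J (\<lambda>y. fst (f y)) z = fst (mollify J f z)" "mollify J (\<lambda>y. snd (f y)) z = snd (mollify J f z)"
proof -
  obtain C where C: "\<And>x. \<bar>J x\<bar> \<le> C" using mollifier_derivative_bounds[OF J] by metis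
  note i = mollify_integrand_integrable[OF mollifierD(1)[OF J] C f, of z]
  show "mollify J (\<lambda>y. fst (f y)) z = fst (mollify J f z)" "mollify J (\<lambda>y. snd (f y)) z = snd (mollify J f z)"
    unfolding mollify_def
    using integral_bounded_linear[OF bounded_linear_fst i] integral_bounded_linear[OF bounded_linear_snd i] by simp_all
qed

lemma integrable_Pair:
  fixes f :: "'a \<Rightarrow> 'b::euclidean_space" and g :: "'a \<Rightarrow> 'c::euclidean_space"
  assumes f: "integrable M f" and g: "integrable M g"
  shows "integrable M (\<lambda>x. (f x, g x))"
proof -
  have "integrable M (\<lambda>x. (f x, 0::'c) + (0::'b, g x))"
    using integrable_bounded_linear[OF bounded_linear_Pair[OF bounded_linear_ident bounded_linear_zero] f]
      integrable_bounded_linear[OF bounded_linear_Pair[OF bounded_linear_zero bounded_linear_ident] g]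
    by (intro Bochner_Integration.integrable_add) auto
  then show ?thesis by simp
qed

lemma norm_inner_le_powr_sum:
  fixes P X :: "'b::real_inner"
  assumes p: "1 < p"
  shows "\<bar>P \<bullet> X\<bar> \<le> norm P powr (p / (p - 1)) + norm X powr p"
proof -
  let ?p' = "p / (p - 1)"
  have p': "1 < ?p'" "1/?p' + 1/p = 1" using p by (auto simp: field_simps)
  have "\<bar>P \<bullet> X\<bar> \<le> norm P * norm X" by (rule Cauchy_Schwarz_ineq2)
  also have "\<dots> \<le> norm P powr ?p' / ?p' + norm X powr p / p" by (rule Youngs_inequality) (use p p' in auto)
  also have "\<dots> \<le> norm P powr ?p' + norm X powr p"
    using p p' frac_le[of "norm P powr ?p'" "norm P powr ?p'" 1 ?p'] frac_le[of "norm X powr p" "norm X powr p" 1 p]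
    by (intro add_mono) auto
  finally show ?thesis .
qed

text \<open>
  Mollifications are known to converge in \<open>L^1\<close>, which does not suffice for the product \<open>G \<bullet> D\<close>.
  But along a sequence that converges almost everywhere the integrands are bounded by the
  mollification of \<open>|G|^{p'} + |D|^p\<close>, which converges in \<open>L^1\<close>; this is enough for dominated
  convergence.
\<close>

lemma mollify_pairing_limit:
  fixes G D :: "'a::euclidean_space \<Rightarrow> 'b::euclidean_space"
  assumes p: "1 < p" and G: "integrable lborel G" "integrable lborel (\<lambda>z. norm (G z) powr (p / (p - 1)))"
    and D: "integrable lborel D" "integrable lborel (\<lambda>z. norm (D z) powr p)" and e: "0 < e" and \<epsilon>0: "0 < \<epsilon>0"
  obtains \<epsilon> J where "0 < \<epsilon>" "\<epsilon> < \<epsilon>0" "mollifier \<epsilon> J"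
    "integrable lborel (\<lambda>z. \<bar>mollify J G z \<bullet> mollify J D z - G z \<bullet> D z\<bar>)"
    "(\<integral>z. \<bar>mollify J G z \<bullet> mollify J D z - G z \<bullet> D z\<bar> \<partial>lborel) < e"
    "(\<integral>z. \<bar>mollify J (\<lambda>z. norm (G z) powr (p / (p - 1))) z - norm (G z) powr (p / (p - 1))\<bar> \<partial>lborel) < e"
proof -
  let ?p' = "p / (p - 1)"
  have p': "1 \<le> ?p'" using p by simp
  define g where "g z = norm (G z) powr ?p'" for z
  define d where "d z = norm (D z) powr p" for z
  \<comment> \<open>All four functions have to be mollified with the same kernel. Hence they are bundled into
      one vector-valued function.\<close>
  define F where "F z = ((G z, D z), (g z, d z))" for z
  have gi: "integrable lborel g" and di: "integrable lborel d" using G(2) D(2) by (simp_all add: g_def[abs_def] d_def[abs_def])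
  have Fi: "integrable lborel F" unfolding F_def by (intro integrable_Pair G D gi di)
  have "\<forall>n. \<exists>J. \<exists>\<epsilon>. 0 < \<epsilon> \<and> \<epsilon> < \<epsilon>0 \<and> mollifier \<epsilon> J \<and> (\<integral>z. norm (mollify J F z - F z) \<partial>lborel) < inverse (real (Suc n))"
  proof
    fix n
    obtain \<delta> where \<delta>: "0 < \<delta>" "\<And>\<epsilon> J. 0 < \<epsilon> \<Longrightarrow> \<epsilon> < \<delta> \<Longrightarrow> mollifier \<epsilon> J \<Longrightarrow> (\<integral>z. norm (mollify J F z - F z) \<partial>lborel) < inverse (real (Suc n))"
      using mollify_tendsto_L1[OF Fi, of "inverse (real (Suc n))"] by auto
    let ?\<epsilon> = "min \<delta> \<epsilon>0 / 2"
    have pos: "0 < ?\<epsilon>" "?\<epsilon> < \<delta>" "?\<epsilon> < \<epsilon>0" using \<delta>(1) \<epsilon>0 by auto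
    obtain J :: "'a \<Rightarrow> real" where "mollifier ?\<epsilon> J" using mollifier_exists[OF pos(1)] by blast
    then show "\<exists>J. \<exists>\<epsilon>. 0 < \<epsilon> \<and> \<epsilon> < \<epsilon>0 \<and> mollifier \<epsilon> J \<and> (\<integral>z. norm (mollify J F z - F z) \<partial>lborel) < inverse (real (Suc n))"
      using \<delta>(2) pos by blast
  qed
  from choice[OF this] obtain J0 :: "nat \<Rightarrow> 'a \<Rightarrow> real" where
    "\<forall>n. \<exists>\<epsilon>. 0 < \<epsilon> \<and> \<epsilon> < \<epsilon>0 \<and> mollifier \<epsilon> (J0 n) \<and> (\<integral>z. norm (mollify (J0 n) F z - F z) \<partial>lborel) < inverse (real (Suc n))"
    by (rule exE)
  from choice[OF this] obtain \<epsilon>f where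
    "\<forall>n. 0 < \<epsilon>f n \<and> \<epsilon>f n < \<epsilon>0 \<and> mollifier (\<epsilon>f n) (J0 n) \<and> (\<integral>z. norm (mollify (J0 n) F z - F z) \<partial>lborel) < inverse (real (Suc n))"
    by (rule exE)
  then have J0: "\<And>n. 0 < \<epsilon>f n" "\<And>n. \<epsilon>f n < \<epsilon>0" "\<And>n. mollifier (\<epsilon>f n) (J0 n)"
    "\<And>n. (\<integral>z. norm (mollify (J0 n) F z - F z) \<partial>lborel) < inverse (real (Suc n))" by simp_all
  have lim0: "(\<lambda>n. \<integral>z. norm (mollify (J0 n) F z - F z) \<partial>lborel) \<longlonglongrightarrow> 0"
  proof (rule tendsto_sandwich[OF _ _ tendsto_const LIMSEQ_inverse_real_of_nat])
    show "eventually (\<lambda>n. (\<integral>z. norm (mollify (J0 n) F z - F z) \<partial>lborel) \<le> inverse (real (Suc n))) sequentially"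
      using J0(4) by (intro always_eventually allI less_imp_le)
  qed auto
  have int0: "integrable lborel (\<lambda>z. mollify (J0 n) F z - F z)" for n using mollify_L1(1)[OF J0(3) Fi] Fi by auto
  obtain r :: "nat \<Rightarrow> nat" where r: "strict_mono r" and ae: "AE z in lborel. (\<lambda>n. mollify (J0 (r n)) F z - F z) \<longlonglongrightarrow> 0"
    using tendsto_L1_AE_subseq[OF int0 lim0] by blast
  define J where "J n = J0 (r n)" for n
  have J: "mollifier (\<epsilon>f (r n)) (J n)" for n using J0(3) by (simp add: J_def)
  have lim: "(\<lambda>n. \<integral>z. norm (mollify (J n) F z - F z) \<partial>lborel) \<longlonglongrightarrow> 0"
    unfolding J_def using LIMSEQ_subseq_LIMSEQ[OF lim0 r] by (simp add: o_def)
  have Ji: "integrable lborel (\<lambda>z. mollify (J n) F z - F z)" for n using int0 by (simp add: J_def)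
  have c1: "integrable lborel (\<lambda>z. fst (F z))" "integrable lborel (\<lambda>z. snd (F z))"
    unfolding F_def by (simp_all add: integrable_Pair G D gi di)
  have comp: "mollify (J n) F z = ((mollify (J n) G z, mollify (J n) D z), (mollify (J n) g z, mollify (J n) d z))" for n z
  proof -
    have e: "(\<lambda>y. fst (fst (F y))) = G" "(\<lambda>y. snd (fst (F y))) = D" "(\<lambda>y. fst (snd (F y))) = g" "(\<lambda>y. snd (snd (F y))) = d"
      by (simp_all add: F_def)
    have "mollify (J n) G z = fst (fst (mollify (J n) F z))" "mollify (J n) D z = snd (fst (mollify (J n) F z))"
      "mollify (J n) g z = fst (snd (mollify (J n) F z))" "mollify (J n) d z = snd (snd (mollify (J n) F z))"
      using mollify_fst_snd[OF J c1(1), of n z, unfolded e] mollify_fst_snd[OF J c1(2), of n z, unfolded e]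
      unfolding mollify_fst_snd[OF J Fi] by blast+
    then show ?thesis by (simp only: prod.collapse)
  qed
  have compd: "norm (mollify (J n) g z - g z) \<le> norm (mollify (J n) F z - F z)" "norm (mollify (J n) d z - d z) \<le> norm (mollify (J n) F z - F z)" for n z
  proof -
    let ?X = "mollify (J n) F z - F z"
    have "norm (fst (snd ?X)) \<le> norm ?X" "norm (snd (snd ?X)) \<le> norm ?X"
      using dist_snd_le[of ?X 0] dist_fst_le[of "snd ?X" 0] dist_snd_le[of "snd ?X" 0] by (simp_all only: snd_zero fst_zero dist_0_norm dist_norm diff_0_right)
    then show "norm (mollify (J n) g z - g z) \<le> norm ?X" "norm (mollify (J n) d z - d z) \<le> norm ?X"
      by (simp_all add: comp F_def)
  qed
  define a where "a n z = \<bar>mollify (J n) G z \<bullet> mollify (J n) D z - G z \<bullet> D z\<bar>" for n z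
  define b where "b n z = norm (mollify (J n) g z - g z) + norm (mollify (J n) d z - d z)" for n z
  note mi = mollify_L1(1)[OF J G(1)] mollify_L1(1)[OF J D(1)] mollify_L1(1)[OF J gi] mollify_L1(1)[OF J di]
  have meas: "mollify (J n) G \<in> borel_measurable lborel" "mollify (J n) D \<in> borel_measurable lborel" "G \<in> borel_measurable lborel" "D \<in> borel_measurable lborel" for n
    using mi G D by auto
  have am: "a n \<in> borel_measurable lborel" for n unfolding a_def using meas(1,2)[of n] meas(3,4) by simp
  have bi: "integrable lborel (b n)" for n unfolding b_def using mi gi di by auto
  \<comment> \<open>The error a n has the bound b n, which tends to 0 in mean, plus a fixed integrable
      function. So dominated convergence applies to the positive part of \<open>a n - b n\<close>.\<close>
  have ab: "a n z \<le> b n z + 2 * (g z + d z)" for n z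
  proof -
    have "\<bar>mollify (J n) G z \<bullet> mollify (J n) D z\<bar> \<le> mollify (J n) g z + mollify (J n) d z"
      using norm_inner_le_powr_sum[OF p, of "mollify (J n) G z" "mollify (J n) D z"]
        mollify_Jensen[OF J p' G, of n z] mollify_Jensen[OF J _ D, of n z] p by (simp add: g_def[abs_def] d_def[abs_def])
    moreover have "\<bar>G z \<bullet> D z\<bar> \<le> g z + d z" using norm_inner_le_powr_sum[OF p, of "G z" "D z"] by (simp add: g_def d_def)
    moreover have "mollify (J n) g z \<le> \<bar>mollify (J n) g z - g z\<bar> + g z" "mollify (J n) d z \<le> \<bar>mollify (J n) d z - d z\<bar> + d z" by simp_all
    moreover note abs_triangle_ineq4[of "mollify (J n) G z \<bullet> mollify (J n) D z" "G z \<bullet> D z"]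
    ultimately show ?thesis unfolding a_def b_def real_norm_def by argo
  qed
  have a0: "0 \<le> a n z" "0 \<le> b n z" "0 \<le> g z" "0 \<le> d z" for n z by (auto simp: a_def b_def g_def d_def)
  have ai: "integrable lborel (a n)" for n
    by (rule Bochner_Integration.integrable_bound[where f="\<lambda>z. b n z + 2 * (g z + d z)"])
       (use bi gi di am ab a0 in \<open>auto intro!: AE_I2 intro: order_trans[OF ab abs_ge_self]\<close>)
  have "(\<lambda>n. \<integral>z. max 0 (a n z - b n z) \<partial>lborel) \<longlonglongrightarrow> (\<integral>z. 0 \<partial>(lborel :: 'a measure))"
  proof (rule integral_dominated_convergence[where w="\<lambda>z. 2 * (g z + d z)"])
    show "AE z in lborel. (\<lambda>n. max 0 (a n z - b n z)) \<longlonglongrightarrow> 0"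
      using ae
    proof eventually_elim
      case (elim z)
      then have "(\<lambda>n. mollify (J n) F z - F z + F z) \<longlonglongrightarrow> 0 + F z" unfolding J_def by (intro tendsto_intros)
      then have *: "(\<lambda>n. mollify (J n) F z) \<longlonglongrightarrow> F z" by simp
      have "(\<lambda>n. fst (fst (mollify (J n) F z))) \<longlonglongrightarrow> fst (fst (F z))" "(\<lambda>n. snd (fst (mollify (J n) F z))) \<longlonglongrightarrow> snd (fst (F z))"
        by (intro tendsto_intros *)+
      then have "(\<lambda>n. mollify (J n) G z) \<longlonglongrightarrow> G z" "(\<lambda>n. mollify (J n) D z) \<longlonglongrightarrow> D z" by (simp_all add: comp F_def)
      then have "(\<lambda>n. a n z) \<longlonglongrightarrow> \<bar>G z \<bullet> D z - G z \<bullet> D z\<bar>" unfolding a_def by (intro tendsto_intros)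
      then have az: "(\<lambda>n. a n z) \<longlonglongrightarrow> 0" by simp
      show ?case
      proof (rule tendsto_sandwich[OF _ _ tendsto_const az])
        show "eventually (\<lambda>n. max 0 (a n z - b n z) \<le> a n z) sequentially" using a0 by (intro always_eventually) auto
      qed auto
    qed
    show "(\<lambda>z. max 0 (a n z - b n z)) \<in> borel_measurable lborel" for n using am[of n] bi[of n] by auto
    show "AE z in lborel. norm (max 0 (a n z - b n z)) \<le> 2 * (g z + d z)" for n
    proof (rule AE_I2)
      fix z show "norm (max 0 (a n z - b n z)) \<le> 2 * (g z + d z)"
        using ab[of n z] a0(3)[of z] a0(4)[of z] by simp
    qed
  qed (use gi di in auto)
  then have l1: "(\<lambda>n. \<integral>z. max 0 (a n z - b n z) \<partial>lborel) \<longlonglongrightarrow> 0" by simp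
  have e3: "0 < e/3" using e by simp
  have "eventually (\<lambda>n. (\<integral>z. max 0 (a n z - b n z) \<partial>lborel) < e/3 \<and> (\<integral>z. norm (mollify (J n) F z - F z) \<partial>lborel) < e/3) sequentially"
    by (rule eventually_conj[OF order_tendstoD(2)[OF l1 e3] order_tendstoD(2)[OF lim e3]])
  then obtain n where n1: "(\<integral>z. max 0 (a n z - b n z) \<partial>lborel) < e/3" and n2: "(\<integral>z. norm (mollify (J n) F z - F z) \<partial>lborel) < e/3"
    unfolding eventually_sequentially by blast
  have nF: "integrable lborel (\<lambda>z. norm (mollify (J n) F z - F z))" using Ji by (rule integrable_norm)
  have ble: "(\<integral>z. b n z \<partial>lborel) \<le> (\<integral>z. 2 * norm (mollify (J n) F z - F z) \<partial>lborel)"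
  proof (rule integral_mono[OF bi])
    show "integrable lborel (\<lambda>z. 2 * norm (mollify (J n) F z - F z))" using nF by simp
    show "b n z \<le> 2 * norm (mollify (J n) F z - F z)" for z using compd[of n z] by (simp add: b_def)
  qed
  have "(\<integral>z. a n z \<partial>lborel) \<le> (\<integral>z. max 0 (a n z - b n z) + b n z \<partial>lborel)"
    using ai bi by (intro integral_mono) auto
  also have "\<dots> = (\<integral>z. max 0 (a n z - b n z) \<partial>lborel) + (\<integral>z. b n z \<partial>lborel)" using ai bi by (intro Bochner_Integration.integral_add) auto
  also have "\<dots> < e" using n1 n2 ble by simp
  finally have A: "(\<integral>z. a n z \<partial>lborel) < e" .
  have "(\<integral>z. norm (mollify (J n) g z - g z) \<partial>lborel) \<le> (\<integral>z. norm (mollify (J n) F z - F z) \<partial>lborel)"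
    using mi gi compd nF by (intro integral_mono) auto
  then have B: "(\<integral>z. \<bar>mollify (J n) g z - g z\<bar> \<partial>lborel) < e" using n2 e by simp
  show ?thesis
    by (rule that[OF J0(1)[of "r n"] J0(2)[of "r n"] J[of n]])
       (use A B ai[of n] in \<open>simp_all add: a_def[abs_def] g_def[abs_def]\<close>)
qed

text \<open>
  The parabolic cylinder of scaling factor 1 about the origin.
\<close>

definition std_cylinder :: "real \<Rightarrow> ((real^'n) \<times> real) set" where
  "std_cylinder r = ball 0 r \<times> {- (r\<^sup>2) <..< r\<^sup>2}"

definition distributional_gradient :: "((real^'n) \<times> real) set \<Rightarrow> ((real^'n) \<times> real \<Rightarrow> real^'m) \<Rightarrow> ((real^'n) \<times> real \<Rightarrow> real^'n^'m) \<Rightarrow> bool" where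
  "distributional_gradient Q U D \<longleftrightarrow> (\<forall>\<psi>\<in>test_functions Q. \<forall>i j.
     (\<integral>z. U z $ i * frechet_derivative \<psi> (at z) (axis j 1, 0) \<partial>lborel) = - (\<integral>z. D z $ i $ j * \<psi> z \<partial>lborel))"

text \<open>
  The equation \<open>U_t = div G\<close> in \<open>Q\<close>, in the sense of distributions and row by row.
\<close>

definition distributional_flux :: "((real^'n) \<times> real) set \<Rightarrow> ((real^'n) \<times> real \<Rightarrow> real^'m) \<Rightarrow> ((real^'n) \<times> real \<Rightarrow> real^'n^'m) \<Rightarrow> bool" where
  "distributional_flux Q U G \<longleftrightarrow> (\<forall>\<psi>\<in>test_functions Q. \<forall>i.
     (\<integral>z. U z $ i * frechet_derivative \<psi> (at z) (0, 1) \<partial>lborel)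
       = (\<integral>z. (\<Sum>j\<in>UNIV. G z $ i $ j * frechet_derivative \<psi> (at z) (axis j 1, 0)) \<partial>lborel))"

lemma mollifier_shift:
  fixes J :: "'a::euclidean_space \<Rightarrow> real"
  assumes J: "mollifier \<epsilon> J" and sub: "cball z \<epsilon> \<subseteq> Q"
  shows "(\<lambda>y. J (z - y)) \<in> test_functions Q"
    and "frechet_derivative (\<lambda>y. J (z - y)) (at y) h = - frechet_derivative J (at (z - y)) h"
proof -
  have "Ck k (\<lambda>y. J (z + - y))" for k
    by (rule Ck_affine[of uminus]) (use mollifierD(6)[OF J] bounded_linear_minus[OF bounded_linear_ident] in auto)
  moreover have s: "{y. J (z - y) \<noteq> 0} \<subseteq> cball z \<epsilon>"
    using mollifierD(3)[OF J] by (auto simp: dist_norm less_imp_le)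
  then have "closure {y. J (z - y) \<noteq> 0} \<subseteq> cball z \<epsilon>" by (rule closure_minimal) simp
  moreover from this have "compact (closure {y. J (z - y) \<noteq> 0})"
    by (meson bounded_cball bounded_subset closed_closure compact_eq_bounded_closed)
  ultimately show "(\<lambda>y. J (z - y)) \<in> test_functions Q"
    using sub by (auto simp: test_functions_def compactly_contained_def)
  have "(J has_derivative frechet_derivative J (at (z - y))) (at (z - y))"
    using mollifier_derivative_bounds[OF J] by metis
  then have "((\<lambda>y. J (z - y)) has_derivative (\<lambda>h. frechet_derivative J (at (z - y)) (- h))) (at y)"
    by (rule has_derivative_compose[rotated]) (auto intro!: derivative_eq_intros)
  moreover have "frechet_derivative J (at (z - y)) (- h) = - frechet_derivative J (at (z - y)) h" for h
    using has_derivative_linear[OF \<open>(J has_derivative _) _\<close>] by (simp add: linear_neg)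
  ultimately show "frechet_derivative (\<lambda>y. J (z - y)) (at y) h = - frechet_derivative J (at (z - y)) h"
    by (metis frechet_derivative_at)
qed

text \<open>
  At a point \<open>z\<close> whose closed \<open>\<epsilon>\<close>-neighbourhood lies in \<open>Q\<close>, the function \<open>y \<mapsto> J (z - y)\<close> is a
  test function. Inserting it into the distributional identities gives the pointwise equation for
  the mollifications, and shows that the mollification of \<open>D\<close> is the gradient of that of \<open>U\<close>.
\<close>

lemma mollify_conservation_law:
  fixes U :: "(real^'n::finite) \<times> real \<Rightarrow> real^'m::finite" and D G :: "(real^'n) \<times> real \<Rightarrow> real^'n^'m"
  assumes J: "mollifier \<epsilon> J" and U: "integrable lborel U" and D: "integrable lborel D" and G: "integrable lborel G"
    and grad: "distributional_gradient Q U D" and flux: "distributional_flux Q U G"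
    and room: "\<And>z. z \<in> K \<Longrightarrow> cball z \<epsilon> \<subseteq> Q"
  defines "V' \<equiv> \<lambda>z h. mollify (\<lambda>x. frechet_derivative J (at x) h) U z"
    and "H' \<equiv> \<lambda>z h. mollify (\<lambda>x. frechet_derivative J (at x) h) G z"
  shows "smooth_conservation_law (mollify J U) V' (mollify J G) H' K"
    and "z \<in> K \<Longrightarrow> space_jacobian V' z = mollify J D z"
proof -
  let ?J' = "\<lambda>x. frechet_derivative J (at x)"
  obtain C where C: "\<And>x. (J has_derivative ?J' x) (at x)" "\<And>x. \<bar>J x\<bar> \<le> C" "\<And>x v. \<bar>?J' x v\<bar> \<le> C * norm v"
    "\<And>v. continuous_on UNIV (\<lambda>x. ?J' x v)"
    using mollifier_derivative_bounds[OF J] by metis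
  have ii: "integrable lborel (\<lambda>y. ?J' (z - y) h *\<^sub>R f y)" if "integrable lborel f" for z h and f :: "(real^'n) \<times> real \<Rightarrow> 'z::euclidean_space"
    by (rule mollify_integrand_integrable[OF C(4) C(3) that])
  have U_i: "V' z h $ i = (\<integral>y. ?J' (z - y) h * U y $ i \<partial>lborel)" for z h i
    unfolding V'_def mollify_def using integral_bounded_linear[OF bounded_linear_vec_nth ii[OF U, of z h], of i] by simp
  have G_ij: "H' z h $ i $ j = (\<integral>y. ?J' (z - y) h * G y $ i $ j \<partial>lborel)" "integrable lborel (\<lambda>y. ?J' (z - y) h * G y $ i $ j)" for z h i j
  proof -
    have bl: "bounded_linear (\<lambda>X::real^'n^'m. X $ i $ j)"
      by (rule bounded_linear_compose[OF bounded_linear_vec_nth bounded_linear_vec_nth])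
    show "H' z h $ i $ j = (\<integral>y. ?J' (z - y) h * G y $ i $ j \<partial>lborel)"
      unfolding H'_def mollify_def using integral_bounded_linear[OF bl ii[OF G, of z h]] by simp
    show "integrable lborel (\<lambda>y. ?J' (z - y) h * G y $ i $ j)"
      using integrable_bounded_linear[OF bl ii[OF G, of z h]] by simp
  qed
  show "smooth_conservation_law (mollify J U) V' (mollify J G) H' K"
  proof
    show "(mollify J U has_derivative V' z) (at z)" for z unfolding V'_def by (rule mollify_has_derivative[OF C(1-3) U])
    show "(mollify J G has_derivative H' z) (at z)" for z unfolding H'_def by (rule mollify_has_derivative[OF C(1-3) G])
    show "continuous_on UNIV (\<lambda>z. V' z h)" for h unfolding V'_def by (rule mollify_continuous[OF C(4) C(3) U])
    show "continuous_on UNIV (\<lambda>z. H' z h)" for h unfolding H'_def by (rule mollify_continuous[OF C(4) C(3) G])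
    fix z i assume z: "z \<in> K"
    note t = mollifier_shift[OF J room[OF z]]
    have "(\<integral>y. U y $ i * - ?J' (z - y) (0, 1) \<partial>lborel) = (\<integral>y. (\<Sum>j\<in>UNIV. G y $ i $ j * - ?J' (z - y) (axis j 1, 0)) \<partial>lborel)"
      using flux t(1) unfolding distributional_flux_def by (simp only: t(2)[symmetric])
    moreover have "(\<integral>y. U y $ i * - ?J' (z - y) (0, 1) \<partial>lborel) = - V' z (0, 1) $ i"
      by (simp add: U_i mult.commute)
    moreover have "(\<integral>y. (\<Sum>j\<in>UNIV. G y $ i $ j * - ?J' (z - y) (axis j 1, 0)) \<partial>lborel) = - (\<Sum>j\<in>UNIV. H' z (axis j 1, 0) $ i $ j)"
      unfolding G_ij(1) using G_ij(2) by (simp add: mult.commute sum_negf)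
    ultimately show "V' z (0, 1) $ i = (\<Sum>j\<in>UNIV. H' z (axis j 1, 0) $ i $ j)" by simp
  qed
  assume z: "z \<in> K"
  note t = mollifier_shift[OF J room[OF z]]
  show "space_jacobian V' z = mollify J D z"
  proof (intro vec_eq_iff[THEN iffD2] allI)
    fix i j
    have bl: "bounded_linear (\<lambda>X::real^'n^'m. X $ i $ j)"
      by (rule bounded_linear_compose[OF bounded_linear_vec_nth bounded_linear_vec_nth])
    have "mollify J D z $ i $ j = (\<integral>y. D y $ i $ j * J (z - y) \<partial>lborel)"
      unfolding mollify_def using integral_bounded_linear[OF bl mollify_integrand_integrable[OF mollifierD(1)[OF J] C(2) D, of z]]
      by (simp add: mult.commute)
    also have "\<dots> = - (\<integral>y. U y $ i * - ?J' (z - y) (axis j 1, 0) \<partial>lborel)"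
      using grad t(1) unfolding distributional_gradient_def by (simp only: t(2)[symmetric])
    also have "\<dots> = V' z (axis j 1, 0) $ i" by (simp add: U_i mult.commute)
    finally show "space_jacobian V' z $ i $ j = mollify J D z $ i $ j" by (simp add: space_jacobian_def)
  qed
qed

lemma cyl_room:
  fixes z :: "(real^'n::finite) \<times> real"
  assumes z: "z \<in> cyl 1" and e: "\<epsilon> \<le> 1/4"
  shows "cball z \<epsilon> \<subseteq> std_cylinder 2"
proof
  fix y assume "y \<in> cball z \<epsilon>"
  then have d: "dist (fst y) (fst z) \<le> 1/4" "dist (snd y) (snd z) \<le> 1/4"
    using dist_fst_le[of y z] dist_snd_le[of y z] e by (auto simp: dist_commute)
  have "norm (fst y) \<le> norm (fst z) + dist (fst y) (fst z)" by (metis add.commute diff_add_cancel dist_norm norm_triangle_ineq)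
  then have "norm (fst y) < 2" using d z by (auto simp: cyl_def)
  moreover have "\<bar>snd y - snd z\<bar> \<le> 1/4" "-2 \<le> snd z" "snd z \<le> 1" using d z by (auto simp: cyl_def dist_real_def)
  then have "- 4 < snd y" "snd y < 4" by linarith+
  ultimately show "y \<in> std_cylinder 2" by (cases y) (simp add: std_cylinder_def)
qed

text \<open>
  A distributional solution of \<open>U_t = div G\<close> on the cylinder of radius 2, with \<open>D\<close> as its gradient
  and data \<open>f\<close>. Of the nonlinearity only coercivity and growth of the flux \<open>G\<close> along this
  particular solution are kept. The functions are globally integrable as they are meant to be
  extended by zero.
\<close>

definition unit_flow :: "real \<Rightarrow> real \<Rightarrow> real \<Rightarrow> real \<Rightarrow> real \<Rightarrow> ((real^'n) \<times> real \<Rightarrow> real^'m)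
    \<Rightarrow> ((real^'n) \<times> real \<Rightarrow> real^'n^'m) \<Rightarrow> ((real^'n) \<times> real \<Rightarrow> real^'n^'m) \<Rightarrow> ((real^'n) \<times> real \<Rightarrow> real) \<Rightarrow> bool" where
  "unit_flow p q c0 c1 M U D G f \<longleftrightarrow>
     integrable lborel U \<and> integrable lborel D \<and> integrable lborel G
     \<and> integrable lborel (\<lambda>z. norm (D z) powr p) \<and> integrable lborel (\<lambda>z. norm (D z) powr q)
     \<and> integrable lborel (\<lambda>z. norm (G z) powr (p / (p - 1))) \<and> integrable lborel (\<lambda>z. f z powr p)
     \<and> (AE z in lborel. c0 * norm (D z) powr p \<le> G z \<bullet> D z + c1 * f z powr p)
     \<and> (AE z in lborel. norm (G z) powr (p / (p - 1)) \<le> c1 * (norm (D z) powr p + f z powr p))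
     \<and> distributional_gradient (std_cylinder 2) U D \<and> distributional_flux (std_cylinder 2) U G
     \<and> (\<integral>z. norm (D z) powr q \<partial>lborel) \<le> M"

text \<open>
  The energy estimate is applied to mollifications of \<open>U\<close> and \<open>G\<close>. By \<open>mollify_pairing_limit\<close>
  their dissipation differs from that of \<open>G\<close> and \<open>D\<close> by an arbitrarily small error in \<open>L^1\<close>. For
  \<open>G\<close> and \<open>D\<close>, coercivity gives \<open>2 c0 |D|^p\<close>, and by the choice of \<open>\<delta>\<close> at most half of it is lost
  to the growth bound. So the dissipation up to the time of maximal energy is nonnegative up to
  the data, and what remains is the bound for the dissipation on the whole cylinder.
\<close>

lemma unit_cylinder_estimate:
  fixes p q c0 c1 M :: real
  assumes p: "1 < p" and q: "1 < q" "q < p"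
    and gap: "max 2 p - q < 2" "real CARD('n::finite) * (max 2 p - q) < 2 * q"
    and c: "0 < c0" "0 \<le> c1" and M: "0 \<le> M"
  obtains C where "0 \<le> C"
    "\<forall>(U :: (real^'n) \<times> real \<Rightarrow> real^'m::finite) D G f. unit_flow p q c0 c1 M U D G f \<longrightarrow>
      (\<integral>z. indicator (std_cylinder 1) z * norm (D z) powr p \<partial>lborel) \<le> C * (1 + (\<integral>z. f z powr p \<partial>lborel))"
proof -
  define m where "m = max 2 p"
  have m: "2 \<le> m" "p \<le> m" "q < m" using q by (auto simp: m_def)
  have gap': "m - q < 2" "real CARD('n) * (m - q) < 2 * q" using gap by (simp_all add: m_def)
  obtain k :: nat where k: "max (max 2 (p + 1)) (2 * p / (2 - (m - q))) \<le> real k" using real_arch_simple by blast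
  have k': "2 \<le> k" "p < real k" "2 * p \<le> real k * (2 - (m - q))"
    using k gap' by (auto simp: divide_le_eq)
  \<comment> \<open>With \<open>\<delta> c1 \<le> c0\<close> the growth bound for the flux costs at most \<open>c0 (|D|^p + f^p)\<close>.\<close>
  define \<delta> where "\<delta> = c0 / (c1 + 1)"
  have \<delta>: "0 < \<delta>" "\<delta> * c1 \<le> c0" using c by (auto simp: \<delta>_def field_simps)
  obtain C0 where C0: "\<forall>(v :: (real^'n) \<times> real \<Rightarrow> real^'m) v' H H'.
    smooth_conservation_law v v' H H' (cyl 1) \<longrightarrow>
    (\<integral>z. indicator (cyl 1) z * norm (space_jacobian v' z) powr q \<partial>lborel) \<le> M \<longrightarrow>
    (\<exists>s\<in>{-2..1}. (\<integral>z. indicator (cyl 1) z * (weight k z * dissipation p \<delta> (H z) (space_jacobian v' z)) \<partial>lborel)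
      + (\<integral>z. indicator (cyl s) z * (weight k z * dissipation p \<delta> (H z) (space_jacobian v' z)) \<partial>lborel) \<le> C0)"
    by (rule absorbed_energy_estimate[OF p q(1) m(1,2,3) gap' k' \<delta>(1) M]) (rule that)
  define c2 where "c2 = 2 * c1 + c0"
  \<comment> \<open>The maximum of the weight, as the cutoff is at most 9/4 and the elapsed time at most 3.\<close>
  define W where "W = (27/4::real) ^ k"
  have W: "0 \<le> W" by (simp add: W_def)
  have c2: "0 \<le> c2" using c by (simp add: c2_def)
  define C where "C = (max C0 0 + 2 * W * c2) / c0"
  show ?thesis
  proof (rule that[of C])
    show "0 \<le> C" using c W c2 by (simp add: C_def)
    show "\<forall>(U :: (real^'n) \<times> real \<Rightarrow> real^'m) D G f. unit_flow p q c0 c1 M U D G f \<longrightarrow>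
      (\<integral>z. indicator (std_cylinder 1) z * norm (D z) powr p \<partial>lborel) \<le> C * (1 + (\<integral>z. f z powr p \<partial>lborel))"
    proof (intro allI impI)
      fix U :: "(real^'n) \<times> real \<Rightarrow> real^'m" and D G f
      assume uf: "unit_flow p q c0 c1 M U D G f"
      have U: "integrable lborel U" and D: "integrable lborel D" and G: "integrable lborel G"
        and Dp: "integrable lborel (\<lambda>z. norm (D z) powr p)" and Dq: "integrable lborel (\<lambda>z. norm (D z) powr q)"
        and Gp: "integrable lborel (\<lambda>z. norm (G z) powr (p / (p - 1)))" and fp: "integrable lborel (\<lambda>z. f z powr p)"
        and co: "AE z in lborel. c0 * norm (D z) powr p \<le> G z \<bullet> D z + c1 * f z powr p"
        and gr: "AE z in lborel. norm (G z) powr (p / (p - 1)) \<le> c1 * (norm (D z) powr p + f z powr p)"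
        and grad: "distributional_gradient (std_cylinder 2) U D" and flux: "distributional_flux (std_cylinder 2) U G"
        and Mb: "(\<integral>z. norm (D z) powr q \<partial>lborel) \<le> M"
        using uf unfolding unit_flow_def by blast+
      let ?p' = "p / (p - 1)"
      have p'1: "1 \<le> ?p'" using p by simp
      define I where "I = (\<integral>z. indicator (std_cylinder 1) z * norm (D z) powr p \<partial>lborel)"
      define Fp where "Fp = (\<integral>z. f z powr p \<partial>lborel)"
      have Fp0: "0 \<le> Fp" by (simp add: Fp_def)
      have main: "c0 * I \<le> C0 + 2 * (W * c2 * Fp) + 2 * (W * ((2 + \<delta>) * e))" if e: "0 < e" for e
      proof -
        obtain \<epsilon> J where \<epsilon>: "0 < \<epsilon>" "\<epsilon> < 1/4" and J: "mollifier \<epsilon> J"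
          and Ai: "integrable lborel (\<lambda>z. \<bar>mollify J G z \<bullet> mollify J D z - G z \<bullet> D z\<bar>)"
          and A: "(\<integral>z. \<bar>mollify J G z \<bullet> mollify J D z - G z \<bullet> D z\<bar> \<partial>lborel) < e"
          and B: "(\<integral>z. \<bar>mollify J (\<lambda>z. norm (G z) powr ?p') z - norm (G z) powr ?p'\<bar> \<partial>lborel) < e"
          by (rule mollify_pairing_limit[OF p G Gp D Dp e, of "1/4"]) (simp, rule that)
        define g where "g z = norm (G z) powr ?p'" for z
        have gi: "integrable lborel g" using Gp by (simp add: g_def[abs_def])
        have B': "(\<integral>z. \<bar>mollify J g z - g z\<bar> \<partial>lborel) < e" using B by (simp add: g_def[abs_def])
        let ?V' = "\<lambda>z h. mollify (\<lambda>x. frechet_derivative J (at x) h) U z"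
        let ?H' = "\<lambda>z h. mollify (\<lambda>x. frechet_derivative J (at x) h) G z"
        have room: "cball z \<epsilon> \<subseteq> std_cylinder 2" if "z \<in> cyl 1" for z :: "(real^'n) \<times> real"
          by (rule cyl_room[OF that]) (use \<epsilon> in auto)
        note law = mollify_conservation_law(1)[OF J U D G grad flux room]
        have jac: "space_jacobian ?V' z = mollify J D z" if "z \<in> cyl 1" for z
          by (rule mollify_conservation_law(2)[OF J U D G grad flux room that])
        have cylm [measurable]: "cyl s \<in> sets (lborel :: ((real^'n) \<times> real) measure)" for s
          by (simp add: cyl_def closed_Times borel_closed)
        have cyl_mono: "cyl s \<subseteq> (cyl 1 :: ((real^'n) \<times> real) set)" if "s \<le> 1" for s using that by (auto simp: cyl_def)
        have mq: "(\<integral>z. indicator (cyl 1) z * norm (space_jacobian ?V' z) powr q \<partial>lborel) \<le> M"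
        proof -
          have mDq: "integrable lborel (mollify J (\<lambda>z. norm (D z) powr q))" by (rule mollify_L1(1)[OF J Dq])
          have nn: "0 \<le> mollify J (\<lambda>z. norm (D z) powr q) z" for z
            unfolding mollify_def using mollifierD(2)[OF J] by (intro integral_nonneg_AE) auto
          have "(\<integral>z. indicator (cyl 1) z * norm (space_jacobian ?V' z) powr q \<partial>lborel) \<le> (\<integral>z. mollify J (\<lambda>z. norm (D z) powr q) z \<partial>lborel)"
          proof (rule integral_mono'[OF mDq])
            fix z :: "(real^'n) \<times> real"
            show "indicator (cyl 1) z * norm (space_jacobian ?V' z) powr q \<le> mollify J (\<lambda>z. norm (D z) powr q) z"
            proof (cases "z \<in> cyl 1")
              case True
              then show ?thesis using mollify_Jensen[OF J _ D Dq, of z] q by (simp add: jac)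
            qed (use nn in simp)
          qed (use nn in auto)
          also have "\<dots> = (\<integral>z. norm (mollify J (\<lambda>z. norm (D z) powr q) z) \<partial>lborel)" using nn by simp
          also have "\<dots> \<le> (\<integral>z. norm (norm (D z) powr q) \<partial>lborel)" by (rule mollify_L1(2)[OF J Dq])
          also have "\<dots> \<le> M" using Mb by simp
          finally show ?thesis .
        qed
        obtain s where s: "s \<in> {-2..1}" and sum: "(\<integral>z. indicator (cyl 1) z * (weight k z * dissipation p \<delta> (mollify J G z) (space_jacobian ?V' z)) \<partial>lborel)
          + (\<integral>z. indicator (cyl s) z * (weight k z * dissipation p \<delta> (mollify J G z) (space_jacobian ?V' z)) \<partial>lborel) \<le> C0"
          using C0[rule_format, OF law mq] by blast
        \<comment> \<open>The error of the mollified dissipation. On every cylinder that ends by time 1, the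
            dissipation is at least \<open>c0 |D|^p\<close> minus the data and this error.\<close>
        define err where "err z = 2 * \<bar>mollify J G z \<bullet> mollify J D z - G z \<bullet> D z\<bar> + \<delta> * \<bar>mollify J g z - g z\<bar>" for z
        have erri: "integrable lborel err" unfolding err_def using Ai gi mollify_L1(1)[OF J gi] by auto
        have err0: "0 \<le> err z" for z using \<delta> by (simp add: err_def)
        have errI: "(\<integral>z. err z \<partial>lborel) \<le> (2 + \<delta>) * e"
        proof -
          have "(\<integral>z. err z \<partial>lborel) = 2 * (\<integral>z. \<bar>mollify J G z \<bullet> mollify J D z - G z \<bullet> D z\<bar> \<partial>lborel) + \<delta> * (\<integral>z. \<bar>mollify J g z - g z\<bar> \<partial>lborel)"
            unfolding err_def using Ai gi mollify_L1(1)[OF J gi] by simp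
          also have "\<dots> \<le> 2 * e + \<delta> * e" using A B' \<delta> by (intro add_mono mult_left_mono) auto
          finally show ?thesis by (simp add: algebra_simps)
        qed
        have wt: "0 \<le> weight k z" "weight k z \<le> W" if "z \<in> cyl s'" "s' \<le> 1" for z :: "(real^'n) \<times> real" and s'
        proof -
          have b: "0 \<le> snd z + 2" "snd z + 2 \<le> 3" using that by (auto simp: cyl_def)
          show "0 \<le> weight k z" unfolding weight_def using b cutoff_bounds(1)[of "fst z"] by (intro zero_le_power mult_nonneg_nonneg)
          show "weight k z \<le> W" unfolding weight_def W_def
            using b cutoff_bounds[of "fst z"] mult_mono[of "cutoff (fst z)" "9/4" "snd z + 2" 3] by (intro power_mono) auto
        qed
        have weightc: "continuous_on UNIV (weight k :: (real^'n) \<times> real \<Rightarrow> real)"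
        proof -
          have "continuous_on UNIV (\<lambda>z::(real^'n) \<times> real. cutoff (fst z))"
            by (rule continuous_on_compose2[OF continuous_cutoff]) (auto intro: continuous_intros)
          then show ?thesis unfolding weight_def[abs_def] by (intro continuous_intros)
        qed
        have lower: "(\<integral>z. indicator (cyl s') z * (weight k z * (c0 * norm (D z) powr p)) \<partial>lborel) - W * c2 * Fp - W * ((2 + \<delta>) * e)
            \<le> (\<integral>z. indicator (cyl s') z * (weight k z * dissipation p \<delta> (mollify J G z) (space_jacobian ?V' z)) \<partial>lborel)"
          (is "?L - _ - _ \<le> ?R") and lower0: "0 \<le> (\<integral>z. indicator (cyl s') z * (weight k z * (c0 * norm (D z) powr p)) \<partial>lborel)"
          and lowi: "integrable lborel (\<lambda>z. indicator (cyl s') z * (weight k z * (c0 * norm (D z) powr p)))"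
          if s': "s' \<in> {-2..1}" for s'
        proof -
          have s1: "s' \<le> 1" using s' by simp
          have [measurable]: "weight k \<in> borel_measurable (borel :: ((real^'n) \<times> real) measure)" using weightc by (rule borel_measurable_continuous_onI)
          show Li: "integrable lborel (\<lambda>z. indicator (cyl s') z * (weight k z * (c0 * norm (D z) powr p)))"
          proof (rule Bochner_Integration.integrable_bound[where f="\<lambda>z. W * (c0 * norm (D z) powr p)"])
            show "integrable lborel (\<lambda>z. W * (c0 * norm (D z) powr p))" using Dp by simp
            have "(\<lambda>z. norm (D z) powr p) \<in> borel_measurable lborel" using Dp by simp
            then show "(\<lambda>z. indicator (cyl s') z * (weight k z * (c0 * norm (D z) powr p))) \<in> borel_measurable lborel" by measurable
            show "AE z in lborel. norm (indicator (cyl s') z * (weight k z * (c0 * norm (D z) powr p))) \<le> norm (W * (c0 * norm (D z) powr p))"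
            proof (rule AE_I2)
              fix z :: "(real^'n) \<times> real"
              show "norm (indicator (cyl s') z * (weight k z * (c0 * norm (D z) powr p))) \<le> norm (W * (c0 * norm (D z) powr p))"
              proof (cases "z \<in> cyl s'")
                case True
                have "weight k z * (c0 * norm (D z) powr p) \<le> W * (c0 * norm (D z) powr p)" using wt[OF True s1] c by (intro mult_right_mono) auto
                then show ?thesis using True wt(1)[OF True s1] c W by (simp add: abs_mult)
              qed (use W in simp)
            qed
          qed
          show "0 \<le> ?L" using wt(1)[OF _ s1] c by (intro integral_nonneg_AE AE_I2) (auto simp: indicator_def)
          have Hc: "continuous_on UNIV (mollify J G)" "continuous_on UNIV (space_jacobian ?V')"
            using smooth_conservation_law.H_cont[OF law] smooth_conservation_law.grad_cont[OF law] by auto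
          have dc: "continuous_on UNIV (\<lambda>z. weight k z * dissipation p \<delta> (mollify J G z) (space_jacobian ?V' z))"
            unfolding dissipation_def by (intro continuous_intros weightc Hc continuous_on_powr_const) (use p in auto)
          have Ri: "integrable lborel (\<lambda>z. indicator (cyl s') z * (weight k z * dissipation p \<delta> (mollify J G z) (space_jacobian ?V' z)))"
            unfolding cyl_def by (rule cylinder_integrable[OF dc])
          have "?L - W * c2 * Fp - W * ((2 + \<delta>) * e) \<le> ?L - W * c2 * Fp - W * (\<integral>z. err z \<partial>lborel)"
            using errI W by (simp add: mult_left_mono)
          also have "\<dots> = (\<integral>z. indicator (cyl s') z * (weight k z * (c0 * norm (D z) powr p)) - W * c2 * f z powr p - W * err z \<partial>lborel)"
            using Li fp erri by (simp add: Fp_def)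
          also have "\<dots> \<le> ?R"
          proof (rule integral_mono_AE[OF _ Ri])
            show "integrable lborel (\<lambda>z. indicator (cyl s') z * (weight k z * (c0 * norm (D z) powr p)) - W * c2 * f z powr p - W * err z)"
              using Li fp erri by auto
            show "AE z in lborel. indicator (cyl s') z * (weight k z * (c0 * norm (D z) powr p)) - W * c2 * f z powr p - W * err z
                \<le> indicator (cyl s') z * (weight k z * dissipation p \<delta> (mollify J G z) (space_jacobian ?V' z))"
              using co gr
            proof eventually_elim
              case (elim z)
              show ?case
              proof (cases "z \<in> cyl s'")
                case True
                have zz: "z \<in> cyl 1" using True cyl_mono[OF s1] by blast
                let ?P = "norm (D z) powr p" and ?f = "f z powr p"
                have gJ: "norm (mollify J G z) powr ?p' \<le> mollify J g z"
                  using mollify_Jensen[OF J p'1 G Gp, of z] by (simp add: g_def[abs_def])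
                have x1: "\<delta> * norm (mollify J G z) powr ?p' \<le> \<delta> * (g z + \<bar>mollify J g z - g z\<bar>)"
                  using gJ \<delta> by (intro mult_left_mono) auto
                have x2: "\<delta> * g z \<le> \<delta> * (c1 * (?P + ?f))" using elim(2) \<delta> by (intro mult_left_mono) (auto simp: g_def)
                have x3: "\<delta> * (c1 * (?P + ?f)) \<le> c0 * (?P + ?f)"
                  unfolding mult.assoc[symmetric] using \<delta> by (intro mult_right_mono) auto
                have x4: "2 * (G z \<bullet> D z) - 2 * \<bar>mollify J G z \<bullet> mollify J D z - G z \<bullet> D z\<bar> \<le> 2 * (mollify J G z \<bullet> mollify J D z)"
                  using abs_ge_minus_self[of "mollify J G z \<bullet> mollify J D z - G z \<bullet> D z"] by argo
                have "c0 * ?P - c2 * ?f - err z \<le> dissipation p \<delta> (mollify J G z) (mollify J D z)"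
                  unfolding dissipation_def err_def c2_def
                  using x1 x2 x3 x4 elim(1) by (simp add: algebra_simps)
                then have "weight k z * (c0 * ?P - c2 * ?f - err z) \<le> weight k z * dissipation p \<delta> (mollify J G z) (space_jacobian ?V' z)"
                  using wt(1)[OF True s1] by (intro mult_left_mono) (simp_all add: jac[OF zz])
                moreover have "weight k z * (c2 * ?f + err z) \<le> W * (c2 * ?f + err z)"
                  using wt(2)[OF True s1] c2 err0[of z] by (intro mult_right_mono) auto
                ultimately have "weight k z * (c0 * ?P) - W * c2 * ?f - W * err z \<le> weight k z * dissipation p \<delta> (mollify J G z) (space_jacobian ?V' z)"
                  by (simp add: algebra_simps)
                then show ?thesis using True by simp
              next
                case False
                have "0 \<le> W * c2 * f z powr p" "0 \<le> W * err z" using W c2 err0 by auto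
                then show ?thesis using False by simp
              qed
            qed
          qed
          finally show "?L - W * c2 * Fp - W * ((2 + \<delta>) * e) \<le> ?R" .
        qed
        have "c0 * I = (\<integral>z. indicator (std_cylinder 1) z * (c0 * norm (D z) powr p) \<partial>lborel)"
          by (simp add: I_def mult_ac flip: Bochner_Integration.integral_mult_right_zero)
        also have "\<dots> \<le> (\<integral>z. indicator (cyl 1) z * (weight k z * (c0 * norm (D z) powr p)) \<partial>lborel)"
        proof (rule integral_mono')
          show "integrable lborel (\<lambda>z. indicator (cyl 1) z * (weight k z * (c0 * norm (D z) powr p)))" by (rule lowi) simp
          fix z :: "(real^'n) \<times> real"
          show "indicator (std_cylinder 1) z * (c0 * norm (D z) powr p) \<le> indicator (cyl 1) z * (weight k z * (c0 * norm (D z) powr p))"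
          proof (cases "z \<in> std_cylinder 1")
            case True
            then have zc: "z \<in> cyl 1" and nz: "norm (fst z) < 1" "-1 < snd z" by (auto simp: std_cylinder_def cyl_def)
            have "(norm (fst z))\<^sup>2 \<le> 1\<^sup>2" using nz by (intro power_mono) auto
            then have "1 \<le> cutoff (fst z)" by (simp add: cutoff_def dot_square_norm)
            then have "1 * 1 \<le> cutoff (fst z) * (snd z + 2)" using nz by (intro mult_mono) auto
            then have "1 \<le> weight k z" unfolding weight_def by (simp add: one_le_power)
            then have "1 * (c0 * norm (D z) powr p) \<le> weight k z * (c0 * norm (D z) powr p)" using c by (intro mult_right_mono) auto
            then show ?thesis using True zc by simp
          next
            case False
            then show ?thesis using wt(1)[of z 1] c by (auto simp: indicator_def)
          qed
          show "0 \<le> indicator (cyl 1) z * (weight k z * (c0 * norm (D z) powr p))" using wt(1)[of z 1] c by (auto simp: indicator_def)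
        qed
        finally have "c0 * I \<le> (\<integral>z. indicator (cyl 1) z * (weight k z * (c0 * norm (D z) powr p)) \<partial>lborel)" .
        then show ?thesis using lower[of 1] lower[OF s] lower0[OF s] sum by simp
      qed
      have "c0 * I \<le> C0 + 2 * (W * c2 * Fp)"
      proof (rule field_le_epsilon)
        fix e :: real assume e: "0 < e"
        let ?K = "2 * W * (2 + \<delta>) + 1"
        have K: "0 < ?K" using W \<delta> by (simp add: add_nonneg_pos)
        have "c0 * I \<le> C0 + 2 * (W * c2 * Fp) + 2 * (W * ((2 + \<delta>) * (e / ?K)))" using e K by (intro main) auto
        also have "2 * (W * ((2 + \<delta>) * (e / ?K))) = (2 * W * (2 + \<delta>)) / ?K * e" by simp
        also have "\<dots> \<le> 1 * e" using K e by (intro mult_right_mono) (auto simp: divide_le_eq)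
        finally show "c0 * I \<le> C0 + 2 * (W * c2 * Fp) + e" by simp
      qed
      also have "\<dots> \<le> (max C0 0 + 2 * W * c2) * (1 + Fp)"
      proof -
        have "C0 \<le> max C0 0" by simp
        moreover have "0 \<le> max C0 0 * Fp" "0 \<le> 2 * W * c2" using Fp0 W c2 by auto
        ultimately show ?thesis by (simp add: distrib_left distrib_right)
      qed
      finally have "c0 * I \<le> (max C0 0 + 2 * W * c2) * (1 + Fp)" .
      then show "(\<integral>z. indicator (std_cylinder 1) z * norm (D z) powr p \<partial>lborel) \<le> C * (1 + (\<integral>z. f z powr p \<partial>lborel))"
        using c by (simp add: C_def I_def Fp_def field_simps)
    qed
  qed
qed

section \<open>Measurability, time slices and distributional identities\<close>

text \<open>
  Integrals over Lebesgue measurable functions are transferred to Borel representatives, for which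
  Fubini's theorem and changes of variables are at hand.
\<close>

lemma integral_lebesgue_eq_lborel:
  fixes h k :: "'a::euclidean_space \<Rightarrow> 'b::euclidean_space"
  assumes k: "k \<in> borel_measurable borel" and ae: "AE x in lborel. h x = k x"
  shows "integral\<^sup>L lebesgue h = integral\<^sup>L lborel k" "integrable lebesgue h \<longleftrightarrow> integrable lborel k"
proof -
  have ae': "AE x in lebesgue. k x = h x" using ae by (intro AE_completion) (auto elim: eventually_mono)
  have km: "k \<in> borel_measurable lebesgue" using k by (intro measurable_completion) simp
  have hm: "h \<in> borel_measurable lebesgue" by (rule borel_measurable_AE[OF km ae'])
  have "integral\<^sup>L lebesgue h = integral\<^sup>L lebesgue k" by (rule integral_cong_AE[OF hm km]) (use ae' in \<open>auto elim: eventually_mono\<close>)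
  also have "\<dots> = integral\<^sup>L lborel k" by (rule integral_completion) (use k in simp)
  finally show "integral\<^sup>L lebesgue h = integral\<^sup>L lborel k" .
  have "integrable lebesgue h \<longleftrightarrow> integrable lebesgue k" by (rule integrable_cong_AE[OF hm km]) (use ae' in \<open>auto elim: eventually_mono\<close>)
  also have "\<dots> \<longleftrightarrow> integrable lborel k" by (rule integrable_completion) (use k in simp)
  finally show "integrable lebesgue h \<longleftrightarrow> integrable lborel k" .
qed

lemma borel_representative:
  fixes g :: "'a::euclidean_space \<Rightarrow> 'b::euclidean_space"
  assumes g: "g \<in> borel_measurable lebesgue"
  obtains g' where "g' \<in> borel_measurable borel" "AE z in lborel. g z = g' z"
proof -
  have "\<forall>b. \<exists>h. h \<in> borel_measurable lborel \<and> (AE z in lborel. g z \<bullet> b = h z)"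
  proof
    fix b
    have "(\<lambda>z. g z \<bullet> b) \<in> borel_measurable (completion lborel)" using g by (intro borel_measurable_inner) auto
    from completion_ex_borel_measurable_real[OF this] show "\<exists>h. h \<in> borel_measurable lborel \<and> (AE z in lborel. g z \<bullet> b = h z)"
      by blast
  qed
  from choice[OF this] obtain h where h: "\<And>b. h b \<in> borel_measurable lborel" "\<And>b. AE z in lborel. g z \<bullet> b = h b z" by blast
  have "AE z in lborel. \<forall>b\<in>Basis. g z \<bullet> b = h b z" using h(2) by (intro AE_finite_allI) auto
  then have "AE z in lborel. g z = (\<Sum>b\<in>Basis. h b z *\<^sub>R b)"
    by (rule eventually_mono) (metis (no_types, lifting) euclidean_representation sum.cong)
  moreover have "(\<lambda>z. \<Sum>b\<in>Basis. h b z *\<^sub>R b) \<in> borel_measurable borel" using h(1) by simp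
  ultimately show ?thesis using that by blast
qed

lemma borel_representative_on:
  fixes g :: "'a::euclidean_space \<Rightarrow> 'b::euclidean_space"
  assumes g: "g \<in> borel_measurable (lebesgue_on S)" and S: "S \<in> sets lebesgue" and Q: "Q \<in> sets lebesgue" "Q \<subseteq> S"
  obtains g' where "g' \<in> borel_measurable borel" "AE z in lborel. indicator Q z *\<^sub>R g z = g' z"
proof -
  have "(\<lambda>z. indicator S z *\<^sub>R g z) \<in> borel_measurable lebesgue"
    using g S by (subst (asm) borel_measurable_restrict_space_iff) auto
  from borel_measurable_scaleR[OF borel_measurable_indicator[OF Q(1)] this]
  have "(\<lambda>z. indicator Q z *\<^sub>R (indicator S z *\<^sub>R g z)) \<in> borel_measurable lebesgue" .
  moreover have "(\<lambda>z. indicator Q z *\<^sub>R (indicator S z *\<^sub>R g z)) = (\<lambda>z. indicator Q z *\<^sub>R g z)"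
    using Q by (auto simp: indicator_def fun_eq_iff)
  ultimately have "(\<lambda>z. indicator Q z *\<^sub>R g z) \<in> borel_measurable lebesgue" by simp
  then show ?thesis using borel_representative that by blast
qed

lemma AE_lebesgue_on_iff:
  "S \<in> sets lebesgue \<Longrightarrow> (AE z in lebesgue_on S. P z) \<longleftrightarrow> (AE z in lborel. z \<in> S \<longrightarrow> P z)"
  by (subst AE_restrict_space_iff) (auto simp: AE_completion_iff)

text \<open>
  Off a null set the field is continuous in the second argument. Thus the composition is a limit
  of compositions with simple functions, each of which is a finite sum of measurable functions.
\<close>

lemma caratheodory_composition:
  fixes A :: "'a::euclidean_space \<Rightarrow> 'b::euclidean_space \<Rightarrow> 'b" and w :: "'a \<Rightarrow> 'b"
  assumes A: "caratheodory S A" and S: "S \<in> sets lebesgue" and w: "w \<in> borel_measurable (lebesgue_on S)"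
  shows "(\<lambda>z. A z (w z)) \<in> borel_measurable (lebesgue_on S)"
proof -
  let ?M = "lebesgue_on S"
  have Am: "(\<lambda>z. A z \<xi>) \<in> borel_measurable ?M" for \<xi> using A by (simp add: caratheodory_def)
  have "AE z in ?M. continuous_on UNIV (A z)" using A by (simp add: caratheodory_def)
  then obtain N where N: "{z \<in> space ?M. \<not> continuous_on UNIV (A z)} \<subseteq> N" "emeasure ?M N = 0" "N \<in> sets ?M"
    by (rule AE_E)
  define A' where "A' z \<xi> = indicator (- N) z *\<^sub>R A z \<xi>" for z \<xi>
  have NS: "N \<in> sets lebesgue" using N(3) S by (simp add: sets_restrict_space_iff)
  have A'm: "(\<lambda>z. A' z \<xi>) \<in> borel_measurable ?M" for \<xi>
  proof -
    have "(\<lambda>z. indicator (- N) z *\<^sub>R A z \<xi>) = (\<lambda>z. (1 - indicator N z) *\<^sub>R A z \<xi>)"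
      by (auto simp: fun_eq_iff indicator_def)
    then show ?thesis unfolding A'_def using Am[of \<xi>] N(3) by (simp add: borel_measurable_indicator)
  qed
  have A'c: "isCont (A' z) \<xi>" if "z \<in> space ?M" for z \<xi>
  proof (cases "z \<in> N")
    case True
    then have "A' z = (\<lambda>_. 0)" by (simp add: A'_def fun_eq_iff)
    then show ?thesis by simp
  next
    case False
    then have "continuous_on UNIV (A z)" using N(1) that by blast
    moreover have "A' z = A z" using False by (simp add: A'_def fun_eq_iff)
    ultimately show ?thesis by (simp add: continuous_on_eq_continuous_at)
  qed
  obtain s where s: "\<And>i. simple_function ?M (s i)" "\<And>x. x \<in> space ?M \<Longrightarrow> (\<lambda>i. s i x) \<longlonglongrightarrow> w x"
    using borel_measurable_implies_sequence_metric[OF w] by blast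
  have "(\<lambda>z. A' z (w z)) \<in> borel_measurable ?M"
  proof (rule borel_measurable_LIMSEQ_metric)
    fix i
    have fin: "finite (s i ` space ?M)" using s(1) by (rule simple_functionD)
    have m1: "(\<lambda>z. \<Sum>\<xi>\<in>s i ` space ?M. indicator (s i -` {\<xi>} \<inter> space ?M) z *\<^sub>R A' z \<xi>) \<in> borel_measurable ?M"
      using simple_functionD(2)[OF s(1)] A'm by (intro borel_measurable_sum borel_measurable_scaleR borel_measurable_indicator) auto
    have eq: "(\<Sum>\<xi>\<in>s i ` space ?M. indicator (s i -` {\<xi>} \<inter> space ?M) z *\<^sub>R A' z \<xi>) = A' z (s i z)" if z: "z \<in> space ?M" for z
    proof -
      have "(\<Sum>\<xi>\<in>s i ` space ?M. indicator (s i -` {\<xi>} \<inter> space ?M) z *\<^sub>R A' z \<xi>) = (\<Sum>\<xi>\<in>s i ` space ?M. if s i z = \<xi> then A' z \<xi> else 0)"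
        using z by (intro sum.cong refl) (auto simp: indicator_def)
      also have "\<dots> = A' z (s i z)" using fin z by (subst sum.delta') auto
      finally show ?thesis .
    qed
    show "(\<lambda>z. A' z (s i z)) \<in> borel_measurable ?M" by (rule measurable_cong[THEN iffD1, OF eq m1])
  next
    fix z assume z: "z \<in> space ?M"
    show "(\<lambda>i. A' z (s i z)) \<longlonglongrightarrow> A' z (w z)" by (rule isCont_tendsto_compose[OF A'c[OF z] s(2)[OF z]])
  qed
  then have m: "(\<lambda>z. indicator S z *\<^sub>R A' z (w z)) \<in> borel_measurable lebesgue"
    using S by (subst (asm) borel_measurable_restrict_space_iff) auto
  have "AE z in lebesgue. z \<notin> N"
  proof -
    have "emeasure lebesgue N = 0" using N(2,3) S by (simp add: emeasure_restrict_space sets_restrict_space_iff)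
    then have "N \<in> null_sets lebesgue" using NS by auto
    then show ?thesis by (rule AE_not_in)
  qed
  then have "AE z in lebesgue. indicator S z *\<^sub>R A' z (w z) = indicator S z *\<^sub>R A z (w z)"
    by (rule eventually_mono) (simp add: A'_def)
  from borel_measurable_AE[OF m this] show ?thesis
    using S by (subst borel_measurable_restrict_space_iff) auto
qed

lemma test_function_facts:
  fixes \<psi> :: "'a::euclidean_space \<Rightarrow> real"
  assumes \<psi>: "\<psi> \<in> test_functions Q"
  shows "(\<psi> has_derivative frechet_derivative \<psi> (at z)) (at z)"
    and "continuous_on UNIV \<psi>" and "continuous_on UNIV (\<lambda>z. frechet_derivative \<psi> (at z) h)"
    and "z \<notin> Q \<Longrightarrow> \<psi> z = 0" and "z \<notin> Q \<Longrightarrow> frechet_derivative \<psi> (at z) h = 0"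
    and "\<exists>C. \<forall>z. \<bar>\<psi> z\<bar> \<le> C" and "\<exists>C. \<forall>z. \<bar>frechet_derivative \<psi> (at z) h\<bar> \<le> C"
proof -
  let ?S = "closure {z. \<psi> z \<noteq> 0}"
  have Ck: "Ck (Suc 0) \<psi>" and S: "compact ?S" "?S \<subseteq> Q"
    using \<psi> by (auto simp: test_functions_def compactly_contained_def)
  show d: "(\<psi> has_derivative frechet_derivative \<psi> (at z)) (at z)" for z using Ck by (simp add: frechet_derivative_works)
  show c: "continuous_on UNIV \<psi>" using d by (auto intro!: continuous_at_imp_continuous_on has_derivative_continuous)
  show c': "continuous_on UNIV (\<lambda>z. frechet_derivative \<psi> (at z) h)" for h using Ck by simp
  have z0: "\<psi> z = 0" if "z \<notin> ?S" for z using that closure_subset[of "{z. \<psi> z \<noteq> 0}"] by blast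
  have z1: "frechet_derivative \<psi> (at z) h = 0" if "z \<notin> ?S" for z h
  proof -
    have "(\<psi> has_derivative (\<lambda>v. 0)) (at z)"
    proof (rule has_derivative_transform_within_open[of "\<lambda>_. 0" _ z UNIV "- ?S"])
      show "0 = \<psi> y" if "y \<in> - ?S" for y using z0[of y] that by auto
    qed (use that in auto)
    then show ?thesis by (metis frechet_derivative_at)
  qed
  show "z \<notin> Q \<Longrightarrow> \<psi> z = 0" "z \<notin> Q \<Longrightarrow> frechet_derivative \<psi> (at z) h = 0" using S(2) z0[of z] z1[of z h] by blast+
  obtain R where R: "\<And>z. z \<in> ?S \<Longrightarrow> norm z \<le> R" using compact_imp_bounded[OF S(1)] unfolding bounded_iff by blast
  have s0: "norm z \<le> R" if "\<psi> z \<noteq> 0" for z using z0[of z] R[of z] that by argo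
  have s1: "norm z \<le> R" if "frechet_derivative \<psi> (at z) h \<noteq> 0" for z h using z1[of z h] R[of z] that by argo
  show "\<exists>C. \<forall>z. \<bar>\<psi> z\<bar> \<le> C" by (rule continuous_bounded_support_bounded[OF c s0]) auto
  show "\<exists>C. \<forall>z. \<bar>frechet_derivative \<psi> (at z) h\<bar> \<le> C" by (rule continuous_bounded_support_bounded[OF c' s1]) auto
qed

lemma integrable_mult_bounded_continuous:
  fixes f g :: "'a::euclidean_space \<Rightarrow> real"
  assumes f: "integrable lborel f" and g: "continuous_on UNIV g" "\<exists>C. \<forall>z. \<bar>g z\<bar> \<le> C"
  shows "integrable lborel (\<lambda>z. f z * g z)"
proof -
  obtain C where C: "\<And>z. \<bar>g z\<bar> \<le> C" using g(2) by blast
  have [measurable]: "g \<in> borel_measurable borel" using g(1) by (rule borel_measurable_continuous_onI)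
  have [measurable]: "f \<in> borel_measurable borel" using f by simp
  show ?thesis
  proof (rule Bochner_Integration.integrable_bound[where f="\<lambda>z. C * norm (f z)"])
    show "integrable lborel (\<lambda>z. C * norm (f z))" using f by simp
    show "AE z in lborel. norm (f z * g z) \<le> norm (C * norm (f z))"
    proof (rule AE_I2)
      fix z
      have "\<bar>g z\<bar> * \<bar>f z\<bar> \<le> C * \<bar>f z\<bar>" using C by (rule mult_right_mono) simp
      also have "\<dots> \<le> \<bar>C * \<bar>f z\<bar>\<bar>" by (rule abs_ge_self)
      finally show "norm (f z * g z) \<le> norm (C * norm (f z))" by (simp add: abs_mult mult.commute)
    qed
  qed simp
qed

text \<open>
  Fubini's theorem for null sets, with the time variable outside.
\<close>

lemma AE_lborel_slices:
  fixes P :: "'a::euclidean_space \<times> real \<Rightarrow> bool"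
  assumes "AE z in lborel. P z"
  shows "AE t in lborel. AE x in lborel. P (x, t)"
proof -
  obtain N where N: "{z \<in> space lborel. \<not> P z} \<subseteq> N" "emeasure lborel N = 0" "N \<in> sets lborel" using assms by (rule AE_E)
  have Np: "N \<in> sets (lborel \<Otimes>\<^sub>M lborel)" using N(3) unfolding lborel_prod .
  have Np' [measurable]: "N \<in> sets (borel \<Otimes>\<^sub>M borel)" using N(3) unfolding borel_prod sets_lborel .
  have "N \<in> null_sets (lborel \<Otimes>\<^sub>M lborel)" unfolding lborel_prod using N(2,3) by auto
  then have "AE z in lborel \<Otimes>\<^sub>M lborel. z \<notin> N" by (rule AE_not_in)
  then have "AE x in lborel. AE t in lborel. (x, t) \<notin> N" by (rule lborel_pair.AE_pair)
  moreover have "Measurable.pred (lborel \<Otimes>\<^sub>M lborel) (\<lambda>z. case z of (x, t) \<Rightarrow> (x, t) \<notin> N)"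
    using Np by simp
  then have "(AE x in lborel. AE t in lborel. (x, t) \<notin> N) \<longleftrightarrow> (AE t in lborel. AE x in lborel. (x, t) \<notin> N)"
    by (intro lborel_pair.AE_commute) (auto simp: split_def Measurable.pred_def)
  ultimately have "AE t in lborel. AE x in lborel. (x, t) \<notin> N" by simp
  then show ?thesis
    by (rule eventually_mono) (erule eventually_mono, use N(1) in auto)
qed

lemma test_function_slice:
  fixes \<psi> :: "(real^'n) \<times> real \<Rightarrow> real"
  assumes \<psi>: "\<psi> \<in> test_functions Q" and Q: "Q \<subseteq> \<Omega> \<times> I"
  shows "(\<lambda>x. \<psi> (x, t)) \<in> test_functions \<Omega>"
    and "frechet_derivative (\<lambda>x. \<psi> (x, t)) (at x) h = frechet_derivative \<psi> (at (x, t)) (h, 0)"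
proof -
  let ?S = "closure {z. \<psi> z \<noteq> 0}"
  have S: "compact ?S" "?S \<subseteq> Q" and Ck: "\<And>k. Ck k \<psi>"
    using \<psi> by (auto simp: test_functions_def compactly_contained_def)
  have bl: "bounded_linear (\<lambda>x::real^'n. (x, 0::real))"
    by (rule bounded_linear_Pair[OF bounded_linear_ident bounded_linear_zero])
  have "Ck k (\<lambda>x. \<psi> (x, t))" for k using Ck_affine[OF bl Ck, of k "(0, t)"] by simp
  moreover have cl: "closure {x. \<psi> (x, t) \<noteq> 0} \<subseteq> fst ` ?S"
  proof (rule closure_minimal)
    show "{x. \<psi> (x, t) \<noteq> 0} \<subseteq> fst ` ?S" using closure_subset[of "{z. \<psi> z \<noteq> 0}"] by force
    show "closed (fst ` ?S)" by (intro compact_imp_closed compact_continuous_image S(1)) (auto intro: continuous_intros)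
  qed
  moreover have "compact (closure {x. \<psi> (x, t) \<noteq> 0})"
  proof -
    have "compact (fst ` ?S)" by (intro compact_continuous_image S(1)) (auto intro: continuous_intros)
    then show ?thesis using cl by (meson bounded_subset closed_closure compact_eq_bounded_closed compact_imp_bounded)
  qed
  moreover have "fst ` ?S \<subseteq> \<Omega>" using S(2) Q by auto
  ultimately show "(\<lambda>x. \<psi> (x, t)) \<in> test_functions \<Omega>" by (auto simp: test_functions_def compactly_contained_def)
  have "((\<lambda>x. \<psi> (x, t)) has_derivative (\<lambda>h. frechet_derivative \<psi> (at (x, t)) (h, 0))) (at x)"
    by (rule has_derivative_compose[OF _ test_function_facts(1)[OF \<psi>]]) (auto intro!: derivative_eq_intros)
  then show "frechet_derivative (\<lambda>x. \<psi> (x, t)) (at x) h = frechet_derivative \<psi> (at (x, t)) (h, 0)"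
    by (metis frechet_derivative_at)
qed

lemma lborel_integral_slices:
  fixes f :: "'a::euclidean_space \<times> real \<Rightarrow> real"
  assumes f: "integrable lborel f"
  shows "integrable lborel (\<lambda>t. \<integral>x. f (x, t) \<partial>lborel)"
    and "(\<integral>t. (\<integral>x. f (x, t) \<partial>lborel) \<partial>lborel) = (\<integral>z. f z \<partial>lborel)"
proof -
  have i: "integrable (lborel \<Otimes>\<^sub>M lborel) (\<lambda>(x, t). f (x, t))" using f by (simp add: lborel_prod split_def)
  show "integrable lborel (\<lambda>t. \<integral>x. f (x, t) \<partial>lborel)" using lborel_pair.integrable_snd[OF i] .
  show "(\<integral>t. (\<integral>x. f (x, t) \<partial>lborel) \<partial>lborel) = (\<integral>z. f z \<partial>lborel)"
    using lborel_pair.integral_snd[OF i] by (simp add: lborel_prod split_def)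
qed

lemma integrable_vec_nth:
  fixes f :: "'a \<Rightarrow> real^'n::finite"
  assumes "integrable M f" shows "integrable M (\<lambda>z. f z $ i)"
  by (rule integrable_bounded_linear[OF bounded_linear_vec_nth assms])

lemma integrable_mat_nth:
  fixes f :: "'a \<Rightarrow> real^'n::finite^'m::finite"
  assumes "integrable M f" shows "integrable M (\<lambda>z. f z $ i $ j)"
  by (rule integrable_bounded_linear[OF bounded_linear_compose[OF bounded_linear_vec_nth bounded_linear_vec_nth] assms])

text \<open>
  For almost every time the weak gradient of the slice is tested with the slice of \<open>\<psi>\<close>, and the
  identities are integrated over time. A space-time null set meets almost every slice in a null
  set, so the representatives \<open>U\<close> and \<open>D\<close> may be inserted.
\<close>

lemma spatial_gradient_imp_distributional:
  fixes u U :: "(real^'n::finite) \<times> real \<Rightarrow> real^'m::finite"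
  assumes sg: "spatial_gradient \<Omega> T u Du" and Q: "Q \<subseteq> space_time \<Omega> T"
    and U: "integrable lborel U" "AE z in lborel. indicator Q z *\<^sub>R u z = U z"
    and D: "integrable lborel D" "AE z in lborel. indicator Q z *\<^sub>R Du z = D z"
  shows "distributional_gradient Q U D"
  unfolding distributional_gradient_def
proof (intro ballI allI)
  fix \<psi> :: "(real^'n) \<times> real \<Rightarrow> real" and i j assume \<psi>: "\<psi> \<in> test_functions Q"
  note tf = test_function_facts[OF \<psi>]
  note sl = test_function_slice[OF \<psi> Q]
  let ?d = "\<lambda>z. frechet_derivative \<psi> (at z) (axis j 1, 0)"
  have iU: "integrable lborel (\<lambda>z. U z $ i * ?d z)" by (rule integrable_mult_bounded_continuous[OF integrable_vec_nth[OF U(1)] tf(3) tf(7)])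
  have iD: "integrable lborel (\<lambda>z. D z $ i $ j * \<psi> z)" by (rule integrable_mult_bounded_continuous[OF integrable_mat_nth[OF D(1)] tf(2) tf(6)])
  have "AE t in lebesgue_on {0<..<T}. weak_gradient \<Omega> (\<lambda>x. u (x, t)) (\<lambda>x. Du (x, t))" using sg by (simp add: spatial_gradient_def)
  then have "AE t in lborel. t \<in> {0<..<T} \<longrightarrow> weak_gradient \<Omega> (\<lambda>x. u (x, t)) (\<lambda>x. Du (x, t))" by (subst (asm) AE_lebesgue_on_iff) auto
  then have "AE t in lborel. (\<integral>x. U (x, t) $ i * ?d (x, t) \<partial>lborel) = - (\<integral>x. D (x, t) $ i $ j * \<psi> (x, t) \<partial>lborel)"
    using AE_lborel_slices[OF U(2)] AE_lborel_slices[OF D(2)]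
  proof eventually_elim
    case (elim t)
    show ?case
    proof (cases "t \<in> {0<..<T}")
      case True
      have pair: "continuous_on UNIV (\<lambda>x::real^'n. (x, t))" by (intro continuous_intros)
      have pm [measurable]: "(\<lambda>x::real^'n. (x, t)) \<in> borel_measurable borel" using pair by (rule borel_measurable_continuous_onI)
      have dm: "?d \<in> borel_measurable borel" using tf(3) by (rule borel_measurable_continuous_onI)
      have pm': "\<psi> \<in> borel_measurable borel" using tf(2) by (rule borel_measurable_continuous_onI)
      have Um': "(\<lambda>z. U z $ i) \<in> borel_measurable borel" "(\<lambda>z. D z $ i $ j) \<in> borel_measurable borel"
        using integrable_vec_nth[OF U(1), of i] integrable_mat_nth[OF D(1), of i j] by auto
      have "weak_gradient \<Omega> (\<lambda>x. u (x, t)) (\<lambda>x. Du (x, t))" using elim True by simp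
      then have "(LINT x:\<Omega>|lebesgue. u (x, t) $ i * frechet_derivative (\<lambda>x. \<psi> (x, t)) (at x) (axis j 1))
          = - (LINT x:\<Omega>|lebesgue. Du (x, t) $ i $ j * \<psi> (x, t))"
        using sl(1)[of t] unfolding weak_gradient_def by blast
      moreover have "(LINT x:\<Omega>|lebesgue. u (x, t) $ i * frechet_derivative (\<lambda>x. \<psi> (x, t)) (at x) (axis j 1))
          = (\<integral>x. U (x, t) $ i * ?d (x, t) \<partial>lborel)"
        unfolding set_lebesgue_integral_def sl(2)
      proof (rule integral_lebesgue_eq_lborel(1))
        show "(\<lambda>x. U (x, t) $ i * ?d (x, t)) \<in> borel_measurable borel"
          using measurable_compose[OF pm Um'(1)] measurable_compose[OF pm dm] by (intro borel_measurable_times)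
        show "AE x in lborel. indicator \<Omega> x *\<^sub>R (u (x, t) $ i * ?d (x, t)) = U (x, t) $ i * ?d (x, t)"
          using elim(2)
        proof eventually_elim
          case (elim x)
          show ?case
          proof (cases "(x, t) \<in> Q")
            case True
            then have "x \<in> \<Omega>" "U (x, t) = u (x, t)" using Q elim by auto
            then show ?thesis by simp
          qed (simp add: tf(5))
        qed
      qed
      moreover have "(LINT x:\<Omega>|lebesgue. Du (x, t) $ i $ j * \<psi> (x, t)) = (\<integral>x. D (x, t) $ i $ j * \<psi> (x, t) \<partial>lborel)"
        unfolding set_lebesgue_integral_def
      proof (rule integral_lebesgue_eq_lborel(1))
        show "(\<lambda>x. D (x, t) $ i $ j * \<psi> (x, t)) \<in> borel_measurable borel"
          using measurable_compose[OF pm Um'(2)] measurable_compose[OF pm pm'] by (intro borel_measurable_times)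
        show "AE x in lborel. indicator \<Omega> x *\<^sub>R (Du (x, t) $ i $ j * \<psi> (x, t)) = D (x, t) $ i $ j * \<psi> (x, t)"
          using elim(3)
        proof eventually_elim
          case (elim x)
          show ?case
          proof (cases "(x, t) \<in> Q")
            case True
            then have "x \<in> \<Omega>" "D (x, t) = Du (x, t)" using Q elim by auto
            then show ?thesis by simp
          qed (simp add: tf(4))
        qed
      qed
      ultimately show ?thesis by simp
    next
      case False
      then have "(x, t) \<notin> Q" for x using Q by auto
      then have "?d (x, t) = 0" "\<psi> (x, t) = 0" for x using tf(4,5) by blast+
      then show ?thesis by simp
    qed
  qed
  then have "(\<integral>t. (\<integral>x. U (x, t) $ i * ?d (x, t) \<partial>lborel) \<partial>lborel) = (\<integral>t. - (\<integral>x. D (x, t) $ i $ j * \<psi> (x, t) \<partial>lborel) \<partial>lborel)"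
    using lborel_integral_slices(1)[OF iU] lborel_integral_slices(1)[OF iD] by (intro integral_cong_AE) auto
  then show "(\<integral>z. U z $ i * ?d z \<partial>lborel) = - (\<integral>z. D z $ i $ j * \<psi> z \<partial>lborel)"
    using lborel_integral_slices(2)[OF iU] lborel_integral_slices(2)[OF iD] by simp
qed

text \<open>
  The weak formulation is tested with \<open>\<psi>\<close> times a unit vector. This separates the rows of the
  system.
\<close>

lemma weak_solution_imp_distributional:
  fixes u U :: "(real^'n::finite) \<times> real \<Rightarrow> real^'m::finite"
  assumes ws: "weak_solution p \<Omega> T A F u Du" and Q: "Q \<subseteq> space_time \<Omega> T"
    and U: "integrable lborel U" "AE z in lborel. indicator Q z *\<^sub>R u z = U z"
    and A1: "integrable lborel A1" "AE z in lborel. indicator Q z *\<^sub>R A z (Du z) = A1 z"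
    and F1: "integrable lborel F1" "AE z in lborel. indicator Q z *\<^sub>R (norm (F z) powr (p - 2) *\<^sub>R F z) = F1 z"
  shows "distributional_flux Q U (\<lambda>z. A1 z - F1 z)"
  unfolding distributional_flux_def
proof (intro ballI allI)
  fix \<psi> :: "(real^'n) \<times> real \<Rightarrow> real" and i :: 'm assume \<psi>: "\<psi> \<in> test_functions Q"
  note tf = test_function_facts[OF \<psi>]
  let ?\<phi> = "\<lambda>z. \<psi> z *\<^sub>R (axis i 1 :: real^'m)"
  let ?d = "\<lambda>j z. frechet_derivative \<psi> (at z) (axis j 1, 0)"
  let ?t = "\<lambda>z. frechet_derivative \<psi> (at z) (0, 1)"
  have ax: "(axis i 1 :: real^'m) \<noteq> 0" by (simp add: axis_eq_0_iff)
  have "?\<phi> \<in> test_functions (space_time \<Omega> T)"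
    using \<psi> Q ax Ck_scaleR_const[of _ \<psi> "axis i 1 :: real^'m"] by (auto simp: test_functions_def compactly_contained_def)
  then have eq: "(LINT z:space_time \<Omega> T|lebesgue. - (u z \<bullet> time_deriv ?\<phi> z) + A z (Du z) \<bullet> space_grad ?\<phi> z)
       = (LINT z:space_time \<Omega> T|lebesgue. (norm (F z) powr (p - 2) *\<^sub>R F z) \<bullet> space_grad ?\<phi> z)"
    using ws unfolding weak_solution_def by blast
  have td: "w \<bullet> time_deriv ?\<phi> z = w $ i * ?t z" for w z
  proof -
    have "((\<lambda>s. \<psi> (fst z, s)) has_derivative (\<lambda>s. frechet_derivative \<psi> (at (fst z, snd z)) (0, s))) (at (snd z))"
      by (rule has_derivative_compose[OF _ tf(1)]) (auto intro!: derivative_eq_intros)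
    from has_derivative_scaleR_left[OF this, of "axis i 1 :: real^'m"]
    have "((\<lambda>s. ?\<phi> (fst z, s)) has_vector_derivative frechet_derivative \<psi> (at z) (0, 1) *\<^sub>R axis i 1) (at (snd z))"
      unfolding has_vector_derivative_def
    proof (rule has_derivative_eq_rhs)
      show "(\<lambda>s. frechet_derivative \<psi> (at (fst z, snd z)) (0, s) *\<^sub>R axis i 1) = (\<lambda>s. s *\<^sub>R (frechet_derivative \<psi> (at z) (0, 1) *\<^sub>R axis i 1))"
      proof
        fix s
        show "frechet_derivative \<psi> (at (fst z, snd z)) (0, s) *\<^sub>R axis i 1 = s *\<^sub>R (frechet_derivative \<psi> (at z) (0, 1) *\<^sub>R axis i 1)"
          using linear_scale[OF has_derivative_linear[OF tf(1)], of z s "(0, 1)"] by simp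
      qed
    qed
    then have "time_deriv ?\<phi> z = ?t z *\<^sub>R axis i 1" unfolding time_deriv_def by (rule vector_derivative_at)
    then show ?thesis by (simp add: inner_axis)
  qed
  have sg: "X \<bullet> space_grad ?\<phi> z = (\<Sum>j\<in>UNIV. X $ i $ j * ?d j z)" for X z
  proof -
    have "((\<lambda>y. \<psi> (y, snd z)) has_derivative (\<lambda>h. frechet_derivative \<psi> (at (fst z, snd z)) (h, 0))) (at (fst z))"
      by (rule has_derivative_compose[OF _ tf(1)]) (auto intro!: derivative_eq_intros)
    from has_derivative_scaleR_left[OF this, of "axis i 1 :: real^'m"]
    have "frechet_derivative (\<lambda>y. ?\<phi> (y, snd z)) (at (fst z)) = (\<lambda>h. frechet_derivative \<psi> (at z) (h, 0) *\<^sub>R axis i 1)"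
      by (simp add: frechet_derivative_at[symmetric])
    then have "space_grad ?\<phi> z $ i' $ j = ?d j z * (axis i 1 :: real^'m) $ i'" for i' j
      by (simp add: space_grad_def jacobian_def matrix_def)
    then have "X \<bullet> space_grad ?\<phi> z = (\<Sum>i'\<in>UNIV. \<Sum>j\<in>UNIV. X $ i' $ j * (?d j z * (axis i 1 :: real^'m) $ i'))"
      by (simp add: inner_vec_def)
    also have "\<dots> = (\<Sum>i'\<in>UNIV. if i' = i then (\<Sum>j\<in>UNIV. X $ i' $ j * ?d j z) else 0)"
      by (intro sum.cong refl) (auto simp: axis_def)
    finally show ?thesis by simp
  qed
  have iU: "integrable lborel (\<lambda>z. U z $ i * ?t z)" by (rule integrable_mult_bounded_continuous[OF integrable_vec_nth[OF U(1)] tf(3) tf(7)])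
  have iM: "integrable lborel (\<lambda>z. \<Sum>j\<in>UNIV. X z $ i $ j * ?d j z)" if "integrable lborel X" for X :: "(real^'n) \<times> real \<Rightarrow> real^'n^'m"
    by (intro Bochner_Integration.integrable_sum integrable_mult_bounded_continuous[OF integrable_mat_nth[OF that] tf(3) tf(7)])
  let ?k = "\<lambda>z. - (U z $ i * ?t z) + (\<Sum>j\<in>UNIV. A1 z $ i $ j * ?d j z)"
  have ki: "integrable lborel ?k" using iU iM[OF A1(1)] by auto
  have "(LINT z:space_time \<Omega> T|lebesgue. - (u z \<bullet> time_deriv ?\<phi> z) + A z (Du z) \<bullet> space_grad ?\<phi> z) = (\<integral>z. ?k z \<partial>lborel)"
    unfolding set_lebesgue_integral_def
  proof (rule integral_lebesgue_eq_lborel(1))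
    show "?k \<in> borel_measurable borel" using ki by simp
    show "AE z in lborel. indicator (space_time \<Omega> T) z *\<^sub>R (- (u z \<bullet> time_deriv ?\<phi> z) + A z (Du z) \<bullet> space_grad ?\<phi> z) = ?k z"
      using U(2) A1(2)
    proof eventually_elim
      case (elim z)
      show ?case
      proof (cases "z \<in> Q")
        case True
        then have "z \<in> space_time \<Omega> T" "u z = U z" "A z (Du z) = A1 z" using Q elim by auto
        then show ?thesis by (simp add: td sg)
      qed (simp add: td sg tf(5))
    qed
  qed
  moreover have "(LINT z:space_time \<Omega> T|lebesgue. (norm (F z) powr (p - 2) *\<^sub>R F z) \<bullet> space_grad ?\<phi> z) = (\<integral>z. (\<Sum>j\<in>UNIV. F1 z $ i $ j * ?d j z) \<partial>lborel)"
    unfolding set_lebesgue_integral_def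
  proof (rule integral_lebesgue_eq_lborel(1))
    show "(\<lambda>z. \<Sum>j\<in>UNIV. F1 z $ i $ j * ?d j z) \<in> borel_measurable borel" using iM[OF F1(1)] by simp
    show "AE z in lborel. indicator (space_time \<Omega> T) z *\<^sub>R ((norm (F z) powr (p - 2) *\<^sub>R F z) \<bullet> space_grad ?\<phi> z) = (\<Sum>j\<in>UNIV. F1 z $ i $ j * ?d j z)"
      using F1(2)
    proof eventually_elim
      case (elim z)
      show ?case
      proof (cases "z \<in> Q")
        case True
        then have "z \<in> space_time \<Omega> T" "norm (F z) powr (p - 2) *\<^sub>R F z = F1 z" using Q elim by auto
        then show ?thesis by (simp only: sg indicator_simps scaleR_one)
      qed (simp add: sg tf(5))
    qed
  qed
  ultimately have "(\<integral>z. ?k z \<partial>lborel) = (\<integral>z. (\<Sum>j\<in>UNIV. F1 z $ i $ j * ?d j z) \<partial>lborel)" using eq by simp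
  moreover have "(\<integral>z. ?k z \<partial>lborel) = - (\<integral>z. U z $ i * ?t z \<partial>lborel) + (\<integral>z. (\<Sum>j\<in>UNIV. A1 z $ i $ j * ?d j z) \<partial>lborel)"
    using iU iM[OF A1(1)] by simp
  moreover have "(\<integral>z. (\<Sum>j\<in>UNIV. (A1 z - F1 z) $ i $ j * ?d j z) \<partial>lborel)
      = (\<integral>z. (\<Sum>j\<in>UNIV. A1 z $ i $ j * ?d j z) \<partial>lborel) - (\<integral>z. (\<Sum>j\<in>UNIV. F1 z $ i $ j * ?d j z) \<partial>lborel)"
    using iM[OF A1(1)] iM[OF F1(1)]
    by (subst Bochner_Integration.integral_diff[symmetric]) (auto simp: left_diff_distrib sum_subtractf)
  ultimately show "(\<integral>z. U z $ i * ?t z \<partial>lborel) = (\<integral>z. (\<Sum>j\<in>UNIV. (A1 z - F1 z) $ i $ j * ?d j z) \<partial>lborel)" by simp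
qed

section \<open>Parabolic scaling\<close>

definition parabolic_scaling :: "'a \<Rightarrow> real \<Rightarrow> real \<Rightarrow> real \<Rightarrow> 'a \<times> real \<Rightarrow> 'a::euclidean_space \<times> real" where
  "parabolic_scaling x0 t0 \<rho> \<kappa> z = (x0 + \<rho> *\<^sub>R fst z, t0 + \<kappa> * snd z)"

text \<open>
  This is \<open>\<rho>^n \<kappa>\<close>. It cancels in averages and in homogeneous identities, so that only its
  positivity matters. The product over the basis is the form in which the change of variables
  formula for diagonal maps produces it.
\<close>

definition scaling_jacobian :: "'a::euclidean_space itself \<Rightarrow> real \<Rightarrow> real \<Rightarrow> real" where
  "scaling_jacobian _ \<rho> \<kappa> = (\<Prod>j\<in>(Basis :: ('a \<times> real) set). \<bar>if snd j = 0 then \<rho> else \<kappa>\<bar>)"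

lemma parabolic_scaling_measurable [measurable]: "parabolic_scaling x0 t0 \<rho> \<kappa> \<in> borel_measurable borel"
  unfolding parabolic_scaling_def[abs_def] by (intro borel_measurable_continuous_onI continuous_intros)

lemma lborel_parabolic_scaling:
  fixes x0 :: "'a::euclidean_space"
  assumes "0 < \<rho>" "0 < \<kappa>"
  shows "0 < scaling_jacobian TYPE('a) \<rho> \<kappa>"
    "lborel = density (distr lborel borel (parabolic_scaling x0 t0 \<rho> \<kappa>)) (\<lambda>_. ennreal (scaling_jacobian TYPE('a) \<rho> \<kappa>))"
proof -
  let ?c = "\<lambda>j::'a \<times> real. if snd j = 0 then \<rho> else \<kappa>"
  show "0 < scaling_jacobian TYPE('a) \<rho> \<kappa>" unfolding scaling_jacobian_def using assms by (intro prod_pos) auto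
  have "(x0, t0) + (\<Sum>j\<in>Basis. (?c j * (z \<bullet> j)) *\<^sub>R j) = parabolic_scaling x0 t0 \<rho> \<kappa> z" for z
  proof -
    have "(\<Sum>j\<in>Basis. (?c j * (z \<bullet> j)) *\<^sub>R j) = (\<Sum>i\<in>Basis. (\<rho> * (fst z \<bullet> i)) *\<^sub>R (i, 0)) + (\<Sum>i\<in>Basis. (\<kappa> * (snd z \<bullet> i)) *\<^sub>R (0, i))"
      by (subst sum_Basis_prod_eq) (simp add: inner_prod_def)
    also have "(\<Sum>i\<in>Basis. (\<rho> * (fst z \<bullet> i)) *\<^sub>R (i, 0::real)) = (\<rho> *\<^sub>R fst z, 0)"
    proof -
      have "(\<Sum>i\<in>Basis. (\<rho> * (fst z \<bullet> i)) *\<^sub>R (i, 0::real)) = (\<Sum>i\<in>Basis. (\<rho> * (fst z \<bullet> i)) *\<^sub>R i, 0)"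
        by (simp add: prod_eq_iff fst_sum snd_sum)
      also have "(\<Sum>i\<in>Basis. (\<rho> * (fst z \<bullet> i)) *\<^sub>R i) = \<rho> *\<^sub>R (\<Sum>i\<in>Basis. (fst z \<bullet> i) *\<^sub>R i)" by (simp add: scaleR_sum_right)
      finally show ?thesis by (simp add: euclidean_representation)
    qed
    finally show ?thesis by (simp add: parabolic_scaling_def)
  qed
  then show "lborel = density (distr lborel borel (parabolic_scaling x0 t0 \<rho> \<kappa>)) (\<lambda>_. ennreal (scaling_jacobian TYPE('a) \<rho> \<kappa>))"
    using lborel_affine_euclidean[of ?c "(x0, t0)"] assms by (simp add: scaling_jacobian_def)
qed

lemma parabolic_scaling_integral:
  fixes f :: "'a::euclidean_space \<times> real \<Rightarrow> 'b::{banach,second_countable_topology}"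
  assumes [measurable]: "f \<in> borel_measurable borel" and s: "0 < \<rho>" "0 < \<kappa>"
  shows "(\<integral>z. f z \<partial>lborel) = scaling_jacobian TYPE('a) \<rho> \<kappa> *\<^sub>R (\<integral>z. f (parabolic_scaling x0 t0 \<rho> \<kappa> z) \<partial>lborel)"
    and "integrable lborel (\<lambda>z. f (parabolic_scaling x0 t0 \<rho> \<kappa> z)) \<longleftrightarrow> integrable lborel f"
proof -
  let ?j = "scaling_jacobian TYPE('a) \<rho> \<kappa>" and ?S = "parabolic_scaling x0 t0 \<rho> \<kappa>"
  note P = lborel_parabolic_scaling[OF s, where ?'a='a]
  have "(\<integral>z. f z \<partial>lborel) = (\<integral>z. f z \<partial>density (distr lborel borel ?S) (\<lambda>_. ennreal ?j))" using P(2)[of x0 t0] by simp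
  also have "\<dots> = ?j *\<^sub>R (\<integral>z. f (?S z) \<partial>lborel)"
    using P(1) by (subst integral_density) (auto simp: integral_distr)
  finally show "(\<integral>z. f z \<partial>lborel) = ?j *\<^sub>R (\<integral>z. f (?S z) \<partial>lborel)" .
  have "integrable lborel f \<longleftrightarrow> integrable (density (distr lborel borel ?S) (\<lambda>_. ennreal ?j)) f" using P(2)[of x0 t0] by simp
  also have "\<dots> \<longleftrightarrow> integrable lborel (\<lambda>z. ?j *\<^sub>R f (?S z))"
    using P(1) by (subst integrable_density) (auto simp: integrable_distr_eq)
  also have "\<dots> \<longleftrightarrow> integrable lborel (\<lambda>z. f (?S z))"
  proof
    assume "integrable lborel (\<lambda>z. ?j *\<^sub>R f (?S z))"
    from integrable_scaleR_right[OF this, of "1 / ?j"] show "integrable lborel (\<lambda>z. f (?S z))" using P(1) by simp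
  qed auto
  finally show "integrable lborel (\<lambda>z. f (?S z)) \<longleftrightarrow> integrable lborel f" ..
qed

lemma AE_parabolic_scaling:
  fixes x0 :: "'a::euclidean_space"
  assumes s: "0 < \<rho>" "0 < \<kappa>" and ae: "AE z in lborel. P z"
  shows "AE z in lborel. P (parabolic_scaling x0 t0 \<rho> \<kappa> z)"
proof -
  have "AE z in density (distr lborel borel (parabolic_scaling x0 t0 \<rho> \<kappa>)) (\<lambda>_. ennreal (scaling_jacobian TYPE('a) \<rho> \<kappa>)). P z"
    using ae by (simp only: lborel_parabolic_scaling(2)[OF s, of x0 t0, symmetric])
  then have "AE z in distr lborel borel (parabolic_scaling x0 t0 \<rho> \<kappa>). P z"
    using lborel_parabolic_scaling(1)[OF s, where ?'a='a] by (subst (asm) AE_density) auto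
  then show ?thesis by (rule AE_distrD[rotated]) simp
qed

lemma test_function_scaling:
  fixes \<psi> :: "(real^'n) \<times> real \<Rightarrow> real"
  assumes \<psi>: "\<psi> \<in> test_functions Q0" and s: "0 < \<rho>" "0 < \<kappa>"
    and Q: "\<And>y. y \<in> Q0 \<Longrightarrow> parabolic_scaling x0 t0 \<rho> \<kappa> y \<in> Q"
  defines "\<psi>' \<equiv> \<lambda>z. \<psi> ((fst z - x0) /\<^sub>R \<rho>, (snd z - t0) / \<kappa>)"
  shows "\<psi>' \<in> test_functions Q"
    and "\<psi>' (parabolic_scaling x0 t0 \<rho> \<kappa> y) = \<psi> y"
    and "frechet_derivative \<psi>' (at (parabolic_scaling x0 t0 \<rho> \<kappa> y)) (h, r) = frechet_derivative \<psi> (at y) (h /\<^sub>R \<rho>, r / \<kappa>)"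
proof -
  let ?S = "parabolic_scaling x0 t0 \<rho> \<kappa>"
  let ?T = "\<lambda>z::(real^'n) \<times> real. ((fst z - x0) /\<^sub>R \<rho>, (snd z - t0) / \<kappa>)"
  have TS: "?T (?S y) = y" "?S (?T z) = z" for y z using s by (auto simp: parabolic_scaling_def prod_eq_iff)
  show v: "\<psi>' (?S y) = \<psi> y" for y using TS(1)[of y] by (simp add: \<psi>'_def)
  let ?l = "\<lambda>z::(real^'n) \<times> real. (fst z /\<^sub>R \<rho>, snd z / \<kappa>)"
  have bl: "bounded_linear ?l"
    by (intro bounded_linear_Pair bounded_linear_compose[OF bounded_linear_scaleR_right bounded_linear_fst]
        bounded_linear_compose[OF bounded_linear_divide bounded_linear_snd])
  have Te: "?T z = (- (x0 /\<^sub>R \<rho>), - (t0 / \<kappa>)) + ?l z" for z by (simp add: scaleR_diff_right diff_divide_distrib)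
  let ?K = "closure {z. \<psi> z \<noteq> 0}"
  have K: "compact ?K" "?K \<subseteq> Q0" and Ck: "\<And>k. Ck k \<psi>" using \<psi> by (auto simp: test_functions_def compactly_contained_def)
  have "Ck k \<psi>'" for k unfolding \<psi>'_def Te by (rule Ck_affine[OF bl Ck])
  moreover have Sc: "compact (?S ` ?K)"
    by (intro compact_continuous_image K(1)) (auto simp: parabolic_scaling_def[abs_def] intro!: continuous_intros)
  moreover have "{z. \<psi>' z \<noteq> 0} \<subseteq> ?S ` ?K"
  proof
    fix z assume "z \<in> {z. \<psi>' z \<noteq> 0}"
    then have "?T z \<in> ?K" using closure_subset[of "{z. \<psi> z \<noteq> 0}"] by (auto simp: \<psi>'_def)
    then show "z \<in> ?S ` ?K" using TS(2)[of z] by (metis image_eqI)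
  qed
  then have cl: "closure {z. \<psi>' z \<noteq> 0} \<subseteq> ?S ` ?K" by (rule closure_minimal) (rule compact_imp_closed[OF Sc])
  moreover have "compact (closure {z. \<psi>' z \<noteq> 0})"
    using cl Sc by (meson bounded_subset closed_closure compact_eq_bounded_closed compact_imp_bounded)
  moreover have "?S ` ?K \<subseteq> Q" using K(2) Q by auto
  ultimately show "\<psi>' \<in> test_functions Q" by (auto simp: test_functions_def compactly_contained_def)
  have "((\<lambda>z. (- (x0 /\<^sub>R \<rho>), - (t0 / \<kappa>)) + ?l z) has_derivative (\<lambda>h. 0 + ?l h)) (at z)" for z
    by (intro has_derivative_add has_derivative_const bounded_linear_imp_has_derivative bl)
  then have "(?T has_derivative ?l) (at z)" for z by (simp only: Te add_0)
  from has_derivative_compose[OF this test_function_facts(1)[OF \<psi>]]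
  have "(\<psi>' has_derivative (\<lambda>h. frechet_derivative \<psi> (at (?T z)) (?l h))) (at z)" for z unfolding \<psi>'_def .
  then have "frechet_derivative \<psi>' (at z) = (\<lambda>h. frechet_derivative \<psi> (at (?T z)) (?l h))" for z by (rule frechet_derivative_at[symmetric])
  from fun_cong[OF this, of "?S y" "(h, r)"]
  show "frechet_derivative \<psi>' (at (?S y)) (h, r) = frechet_derivative \<psi> (at y) (h /\<^sub>R \<rho>, r / \<kappa>)"
    using TS(1)[of y] by simp
qed

text \<open>
  If \<open>D\<close> is divided by \<open>a\<close> and \<open>U\<close> by \<open>\<rho> a\<close>, the gradient relation is preserved for every time
  scale. The equation prescribes how the flux has to be scaled: \<open>U_t\<close> acquires the factor
  \<open>\<kappa> / (\<rho> a)\<close> and \<open>div G\<close> the factor \<open>\<rho> / b\<close>. For \<open>a = \<lambda>\<close> and \<open>\<kappa> = \<lambda>^{2-p} \<rho>^2\<close> this means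
  \<open>b = \<lambda>^{p-1}\<close>, the natural scaling of a flux with growth \<open>p - 1\<close>. That is the purpose of the
  intrinsic cylinders.
\<close>

lemma distributional_scaling:
  fixes U :: "(real^'n::finite) \<times> real \<Rightarrow> real^'m::finite"
  assumes s: "0 < \<rho>" "0 < \<kappa>" "0 < a"
    and Q: "\<And>y. y \<in> Q0 \<Longrightarrow> parabolic_scaling x0 t0 \<rho> \<kappa> y \<in> Q"
    and U: "U \<in> borel_measurable borel" and D: "D \<in> borel_measurable borel" and G: "G \<in> borel_measurable borel"
  shows "distributional_gradient Q U D \<Longrightarrow>
      distributional_gradient Q0 (\<lambda>y. U (parabolic_scaling x0 t0 \<rho> \<kappa> y) /\<^sub>R (\<rho> * a)) (\<lambda>y. D (parabolic_scaling x0 t0 \<rho> \<kappa> y) /\<^sub>R a)"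
    and "distributional_flux Q U G \<Longrightarrow> b * \<kappa> = \<rho>\<^sup>2 * a \<Longrightarrow> 0 < b \<Longrightarrow>
      distributional_flux Q0 (\<lambda>y. U (parabolic_scaling x0 t0 \<rho> \<kappa> y) /\<^sub>R (\<rho> * a)) (\<lambda>y. G (parabolic_scaling x0 t0 \<rho> \<kappa> y) /\<^sub>R b)"
proof -
  let ?S = "parabolic_scaling x0 t0 \<rho> \<kappa>"
  let ?j = "scaling_jacobian TYPE(real^'n) \<rho> \<kappa>"
  have j: "0 < ?j" by (rule lborel_parabolic_scaling(1)[OF s(1,2)])
  have ch: "(\<integral>z. f z \<partial>lborel) = ?j * (\<integral>y. f (?S y) \<partial>lborel)" if "f \<in> borel_measurable borel" for f :: "(real^'n) \<times> real \<Rightarrow> real"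
    using parabolic_scaling_integral(1)[OF that s(1,2), of x0 t0] by simp
  have nth: "(\<lambda>z. U z $ i) \<in> borel_measurable borel" for i
    by (rule measurable_compose[OF U]) (intro borel_measurable_continuous_onI continuous_intros)
  have mth: "(\<lambda>z. X z $ i $ j) \<in> borel_measurable borel" if "X \<in> borel_measurable borel" for X :: "(real^'n) \<times> real \<Rightarrow> real^'n^'m" and i j
    by (rule measurable_compose[OF that]) (intro borel_measurable_continuous_onI continuous_intros)
  {
    fix \<psi> :: "(real^'n) \<times> real \<Rightarrow> real" assume \<psi>: "\<psi> \<in> test_functions Q0"
    define \<psi>' where "\<psi>' = (\<lambda>z. \<psi> ((fst z - x0) /\<^sub>R \<rho>, (snd z - t0) / \<kappa>))"
    note ts = test_function_scaling[OF \<psi> s(1,2) Q, folded \<psi>'_def]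
    note tf = test_function_facts[OF ts(1)]
    have lin: "linear (frechet_derivative \<psi> (at y))" for y using has_derivative_linear[OF test_function_facts(1)[OF \<psi>]] .
    have dx: "frechet_derivative \<psi>' (at (?S y)) (h, 0) = frechet_derivative \<psi> (at y) (h, 0) / \<rho>" for y h
      using ts(3)[of y h 0] linear_scale[OF lin, of y "inverse \<rho>" "(h, 0)"] by (simp add: divide_inverse mult.commute)
    have dt: "frechet_derivative \<psi>' (at (?S y)) (0, 1) = frechet_derivative \<psi> (at y) (0, 1) / \<kappa>" for y
      using ts(3)[of y 0 1] linear_scale[OF lin, of y "inverse \<kappa>" "(0, 1)"] by (simp add: divide_inverse mult.commute)
    have m: "(\<lambda>z. frechet_derivative \<psi>' (at z) h) \<in> borel_measurable borel" "\<psi>' \<in> borel_measurable borel" for h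
      using borel_measurable_continuous_onI[OF tf(3)] borel_measurable_continuous_onI[OF tf(2)] by auto
    note ts(1,2) dx dt m
  } note facts = this
  show "distributional_gradient Q0 (\<lambda>y. U (?S y) /\<^sub>R (\<rho> * a)) (\<lambda>y. D (?S y) /\<^sub>R a)" if dg: "distributional_gradient Q U D"
    unfolding distributional_gradient_def
  proof (intro ballI allI)
    fix \<psi> :: "(real^'n) \<times> real \<Rightarrow> real" and i j assume \<psi>: "\<psi> \<in> test_functions Q0"
    note f = facts[OF \<psi>]
    have "(\<integral>z. U z $ i * frechet_derivative (\<lambda>z. \<psi> ((fst z - x0) /\<^sub>R \<rho>, (snd z - t0) / \<kappa>)) (at z) (axis j 1, 0) \<partial>lborel)
        = - (\<integral>z. D z $ i $ j * \<psi> ((fst z - x0) /\<^sub>R \<rho>, (snd z - t0) / \<kappa>) \<partial>lborel)"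
      using dg f(1) unfolding distributional_gradient_def by blast
    also have "(\<integral>z. U z $ i * frechet_derivative (\<lambda>z. \<psi> ((fst z - x0) /\<^sub>R \<rho>, (snd z - t0) / \<kappa>)) (at z) (axis j 1, 0) \<partial>lborel)
        = ?j * (\<integral>y. U (?S y) $ i * (frechet_derivative \<psi> (at y) (axis j 1, 0) / \<rho>) \<partial>lborel)"
      by (subst ch) (auto intro!: borel_measurable_times nth f(5) simp: f(3))
    also have "(\<integral>z. D z $ i $ j * \<psi> ((fst z - x0) /\<^sub>R \<rho>, (snd z - t0) / \<kappa>) \<partial>lborel) = ?j * (\<integral>y. D (?S y) $ i $ j * \<psi> y \<partial>lborel)"
      using f(2) by (subst ch) (auto intro!: borel_measurable_times mth[OF D] f(6))
    finally have "?j * (\<integral>y. U (?S y) $ i * (frechet_derivative \<psi> (at y) (axis j 1, 0) / \<rho>) \<partial>lborel) = ?j * - (\<integral>y. D (?S y) $ i $ j * \<psi> y \<partial>lborel)"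
      by (simp only: mult_minus_right)
    then have E: "(\<integral>y. U (?S y) $ i * (frechet_derivative \<psi> (at y) (axis j 1, 0) / \<rho>) \<partial>lborel) = - (\<integral>y. D (?S y) $ i $ j * \<psi> y \<partial>lborel)"
      by (rule mult_left_cancel[OF less_imp_neq[OF j, symmetric], THEN iffD1])
    have "(\<integral>y. (U (?S y) /\<^sub>R (\<rho> * a)) $ i * frechet_derivative \<psi> (at y) (axis j 1, 0) \<partial>lborel)
        = (\<integral>y. U (?S y) $ i * (frechet_derivative \<psi> (at y) (axis j 1, 0) / \<rho>) \<partial>lborel) / a"
      using s by (subst integral_divide_zero[symmetric]) (auto intro!: Bochner_Integration.integral_cong simp: field_simps)
    also have "\<dots> = - (\<integral>y. (D (?S y) /\<^sub>R a) $ i $ j * \<psi> y \<partial>lborel)"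
      unfolding E using s by (simp add: divide_inverse mult_ac flip: Bochner_Integration.integral_mult_right_zero)
    finally show "(\<integral>y. (U (?S y) /\<^sub>R (\<rho> * a)) $ i * frechet_derivative \<psi> (at y) (axis j 1, 0) \<partial>lborel) = - (\<integral>y. (D (?S y) /\<^sub>R a) $ i $ j * \<psi> y \<partial>lborel)" .
  qed
  show "distributional_flux Q0 (\<lambda>y. U (?S y) /\<^sub>R (\<rho> * a)) (\<lambda>y. G (?S y) /\<^sub>R b)"
    if df: "distributional_flux Q U G" and b: "b * \<kappa> = \<rho>\<^sup>2 * a" "0 < b"
    unfolding distributional_flux_def
  proof (intro ballI allI)
    fix \<psi> :: "(real^'n) \<times> real \<Rightarrow> real" and i assume \<psi>: "\<psi> \<in> test_functions Q0"
    note f = facts[OF \<psi>]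
    let ?p = "\<lambda>z. \<psi> ((fst z - x0) /\<^sub>R \<rho>, (snd z - t0) / \<kappa>)"
    have "(\<integral>z. U z $ i * frechet_derivative ?p (at z) (0, 1) \<partial>lborel)
        = (\<integral>z. (\<Sum>j\<in>UNIV. G z $ i $ j * frechet_derivative ?p (at z) (axis j 1, 0)) \<partial>lborel)"
      using df f(1) unfolding distributional_flux_def by blast
    also have "(\<integral>z. U z $ i * frechet_derivative ?p (at z) (0, 1) \<partial>lborel)
        = ?j * (\<integral>y. U (?S y) $ i * (frechet_derivative \<psi> (at y) (0, 1) / \<kappa>) \<partial>lborel)"
      by (subst ch) (auto intro!: borel_measurable_times nth f(5) simp: f(4))
    also have "(\<integral>z. (\<Sum>j\<in>UNIV. G z $ i $ j * frechet_derivative ?p (at z) (axis j 1, 0)) \<partial>lborel)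
        = ?j * (\<integral>y. (\<Sum>j\<in>UNIV. G (?S y) $ i $ j * (frechet_derivative \<psi> (at y) (axis j 1, 0) / \<rho>)) \<partial>lborel)"
      by (subst ch) (auto intro!: borel_measurable_sum borel_measurable_times mth[OF G] f(5) simp: f(3))
    finally have E: "(\<integral>y. U (?S y) $ i * (frechet_derivative \<psi> (at y) (0, 1) / \<kappa>) \<partial>lborel)
        = (\<integral>y. (\<Sum>j\<in>UNIV. G (?S y) $ i $ j * (frechet_derivative \<psi> (at y) (axis j 1, 0) / \<rho>)) \<partial>lborel)"
      by (rule mult_left_cancel[OF less_imp_neq[OF j, symmetric], THEN iffD1])
    have k: "\<kappa> / (\<rho> * a) = \<rho> / b" using b s by (simp add: field_simps power2_eq_square)
    have "(\<integral>y. (U (?S y) /\<^sub>R (\<rho> * a)) $ i * frechet_derivative \<psi> (at y) (0, 1) \<partial>lborel)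
        = (\<integral>y. (\<kappa> / (\<rho> * a)) * (U (?S y) $ i * (frechet_derivative \<psi> (at y) (0, 1) / \<kappa>)) \<partial>lborel)"
      using s by (intro Bochner_Integration.integral_cong refl) (simp add: field_simps)
    also have "\<dots> = (\<rho> / b) * (\<integral>y. (\<Sum>j\<in>UNIV. G (?S y) $ i $ j * (frechet_derivative \<psi> (at y) (axis j 1, 0) / \<rho>)) \<partial>lborel)"
      by (simp only: Bochner_Integration.integral_mult_right_zero E k)
    also have "\<dots> = (\<integral>y. (\<rho> / b) * (\<Sum>j\<in>UNIV. G (?S y) $ i $ j * (frechet_derivative \<psi> (at y) (axis j 1, 0) / \<rho>)) \<partial>lborel)"
      by (simp only: Bochner_Integration.integral_mult_right_zero)
    also have "\<dots> = (\<integral>y. (\<Sum>j\<in>UNIV. (G (?S y) /\<^sub>R b) $ i $ j * frechet_derivative \<psi> (at y) (axis j 1, 0)) \<partial>lborel)"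
      unfolding sum_distrib_left using s b by (intro Bochner_Integration.integral_cong sum.cong refl) (simp add: field_simps)
    finally show "(\<integral>y. (U (?S y) /\<^sub>R (\<rho> * a)) $ i * frechet_derivative \<psi> (at y) (0, 1) \<partial>lborel)
        = (\<integral>y. (\<Sum>j\<in>UNIV. (G (?S y) /\<^sub>R b) $ i $ j * frechet_derivative \<psi> (at y) (axis j 1, 0)) \<partial>lborel)" .
  qed
qed

lemma std_cylinder_measure:
  assumes "0 < r"
  shows "std_cylinder r \<in> sets (lborel :: ((real^'n) \<times> real) measure)" "emeasure lborel (std_cylinder r :: ((real^'n) \<times> real) set) < \<infinity>"
    "0 < measure lborel (std_cylinder r :: ((real^'n) \<times> real) set)"
proof -
  let ?S = "std_cylinder r :: ((real^'n) \<times> real) set"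
  have o: "open ?S" unfolding std_cylinder_def by (intro open_Times open_ball open_greaterThanLessThan)
  have b: "bounded ?S" unfolding std_cylinder_def by (intro bounded_Times bounded_ball) (rule bounded_subset[OF bounded_closed_interval[of "-(r\<^sup>2)" "r\<^sup>2"]], auto)
  show "?S \<in> sets lborel" using o by simp
  show f: "emeasure lborel ?S < \<infinity>" using emeasure_bounded_finite[OF b] by simp
  have "(0, 0) \<in> ?S" using assms by (simp add: std_cylinder_def)
  then obtain e where e: "0 < e" "ball (0, 0) e \<subseteq> ?S" using o open_contains_ball by blast
  have "0 < measure lborel (ball ((0, 0) :: (real^'n) \<times> real) e)" using content_ball_pos[OF e(1)] .
  also have "\<dots> \<le> measure lborel ?S" using e f o by (intro measure_mono_fmeasurable) (auto simp: fmeasurable_def)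
  finally show "0 < measure lborel ?S" .
qed

lemma parabolic_scaling_cylinder:
  assumes "0 < \<rho>" "0 < lam"
  shows "parabolic_scaling x0 t0 \<rho> (lam powr (2 - p) * \<rho>\<^sup>2) y \<in> cylinder p lam x0 t0 (\<alpha> * \<rho>) \<longleftrightarrow> y \<in> std_cylinder \<alpha>"
proof -
  define k where "k = lam powr (2 - p) * \<rho>\<^sup>2"
  have k: "0 < k" using assms by (simp add: k_def)
  have e: "lam powr (2 - p) * (\<alpha> * \<rho>)\<^sup>2 = k * \<alpha>\<^sup>2" by (simp add: k_def power_mult_distrib)
  have "(t0 - k * \<alpha>\<^sup>2 < t0 + k * snd y) \<longleftrightarrow> k * (- (\<alpha>\<^sup>2)) < k * snd y"
    unfolding mult_minus_right by (intro iffI; linarith)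
  also have "\<dots> \<longleftrightarrow> - (\<alpha>\<^sup>2) < snd y" using k by (simp only: mult_less_cancel_left_pos)
  finally have 1: "(t0 - k * \<alpha>\<^sup>2 < t0 + k * snd y) \<longleftrightarrow> - (\<alpha>\<^sup>2) < snd y" .
  have "(t0 + k * snd y < t0 + k * \<alpha>\<^sup>2) \<longleftrightarrow> k * snd y < k * \<alpha>\<^sup>2" by simp
  also have "\<dots> \<longleftrightarrow> snd y < \<alpha>\<^sup>2" using k by (simp only: mult_less_cancel_left_pos)
  finally have 2: "(t0 + k * snd y < t0 + k * \<alpha>\<^sup>2) \<longleftrightarrow> snd y < \<alpha>\<^sup>2" .
  have 3: "x0 + \<rho> *\<^sub>R fst y \<in> ball x0 (\<alpha> * \<rho>) \<longleftrightarrow> norm (fst y) < \<alpha>"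
    using assms by (simp add: dist_norm mult.commute[of \<alpha>])
  show ?thesis unfolding k_def[symmetric] using 1 2 3
    by (cases y) (simp add: cylinder_def std_cylinder_def parabolic_scaling_def e)
qed

lemma avg_cylinder:
  fixes g :: "(real^'n) \<times> real \<Rightarrow> real"
  assumes s: "0 < \<rho>" "0 < lam" "0 < \<alpha>" and k: "k \<in> borel_measurable borel"
    and eq: "AE z in lborel. z \<in> cylinder p lam x0 t0 (\<alpha> * \<rho>) \<longrightarrow> g z = k z"
  shows "avg (cylinder p lam x0 t0 (\<alpha> * \<rho>)) g
    = (\<integral>y. indicator (std_cylinder \<alpha>) y * k (parabolic_scaling x0 t0 \<rho> (lam powr (2 - p) * \<rho>\<^sup>2) y) \<partial>lborel)
        / measure lborel (std_cylinder \<alpha> :: ((real^'n) \<times> real) set)"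
proof -
  let ?c = "cylinder p lam x0 t0 (\<alpha> * \<rho>)"
  let ?\<kappa> = "lam powr (2 - p) * \<rho>\<^sup>2"
  let ?j = "scaling_jacobian TYPE(real^'n) \<rho> ?\<kappa>"
  have \<kappa>: "0 < ?\<kappa>" using s by simp
  have j: "0 < ?j" by (rule lborel_parabolic_scaling(1)[OF s(1) \<kappa>])
  have o: "open ?c" unfolding cylinder_def by (intro open_Times open_ball open_greaterThanLessThan)
  have cb: "?c \<in> sets borel" using o by simp
  have im: "(\<lambda>z. indicator ?c z :: real) \<in> borel_measurable borel" using cb by simp
  have ind: "indicator ?c (parabolic_scaling x0 t0 \<rho> ?\<kappa> y) = (indicator (std_cylinder \<alpha>) y :: real)" for y
    using parabolic_scaling_cylinder[OF s(1,2), of x0 t0 p y \<alpha>] by (simp add: indicator_def)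
  have "measure lebesgue ?c = measure lborel ?c" using cb by (intro measure_completion) simp
  also have "\<dots> = (\<integral>z. indicator ?c z \<partial>lborel)" by simp
  also have "\<dots> = ?j * (\<integral>y. indicator (std_cylinder \<alpha> :: ((real^'n) \<times> real) set) y \<partial>lborel)"
    using parabolic_scaling_integral(1)[OF im s(1) \<kappa>, of x0 t0] by (simp only: ind real_scaleR_def)
  finally have m: "measure lebesgue ?c = ?j * measure lborel (std_cylinder \<alpha> :: ((real^'n) \<times> real) set)" by simp
  have km: "(\<lambda>z. indicator ?c z * k z) \<in> borel_measurable borel" using im k by (rule borel_measurable_times)
  have "(LINT z:?c|lebesgue. g z) = (\<integral>z. indicator ?c z * k z \<partial>lborel)"
    unfolding set_lebesgue_integral_def
    by (rule integral_lebesgue_eq_lborel(1)[OF km]) (use eq in \<open>auto elim!: eventually_mono simp: indicator_def\<close>)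
  also have "\<dots> = ?j * (\<integral>y. indicator (std_cylinder \<alpha>) y * k (parabolic_scaling x0 t0 \<rho> ?\<kappa> y) \<partial>lborel)"
    using parabolic_scaling_integral(1)[OF km s(1) \<kappa>, of x0 t0] by (simp only: ind real_scaleR_def)
  finally show ?thesis using j by (simp add: avg_def m)
qed

section \<open>Structure conditions and exponents\<close>

lemma powr_add_le:
  fixes x y s :: real
  assumes "0 \<le> x" "0 \<le> y" "0 \<le> s" "s \<le> 1"
  shows "(x + y) powr s \<le> 2 * (x powr s + y powr s)"
proof -
  have "(x + y) powr s \<le> (2 * max x y) powr s" using assms by (intro powr_mono2) auto
  also have "\<dots> = 2 powr s * max x y powr s" by (rule powr_mult)
  also have "\<dots> \<le> 2 powr 1 * max x y powr s" using assms by (intro mult_right_mono powr_mono) auto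
  also have "max x y powr s \<le> x powr s + y powr s" by (simp add: max_def)
  finally show ?thesis by simp
qed

lemma add_powr_le:
  fixes x y s :: real
  assumes "0 \<le> x" "0 \<le> y" "0 \<le> s"
  shows "(x + y) powr s \<le> 2 powr s * (x powr s + y powr s)"
proof -
  have "(x + y) powr s \<le> (2 * max x y) powr s" using assms by (intro powr_mono2) auto
  also have "\<dots> = 2 powr s * max x y powr s" by (rule powr_mult)
  also have "\<dots> \<le> 2 powr s * (x powr s + y powr s)" by (intro mult_left_mono) (auto simp: max_def)
  finally show ?thesis .
qed

text \<open>
  The total flux \<open>A - |F|^{p-2} F\<close> inherits coercivity and growth, with \<open>|F|^p\<close> as an additional
  term. Half of the coercivity pays, through Young's inequality, for the pairing of the data with
  the gradient.
\<close>

lemma structure_bounds: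
  fixes p \<nu> L :: real
  assumes p: "1 < p" and \<nu>: "0 < \<nu>" and L: "0 < L"
  obtains c1 where "0 \<le> c1"
    "\<forall>(a :: 'b::euclidean_space) \<xi> F. \<nu> * norm \<xi> powr p \<le> a \<bullet> \<xi> \<longrightarrow> norm a \<le> L * norm \<xi> powr (p - 1) \<longrightarrow>
      \<nu> / 2 * norm \<xi> powr p \<le> (a - norm F powr (p - 2) *\<^sub>R F) \<bullet> \<xi> + c1 * norm F powr p
      \<and> norm (a - norm F powr (p - 2) *\<^sub>R F) powr (p / (p - 1)) \<le> c1 * (norm \<xi> powr p + norm F powr p)"
proof -
  let ?p' = "p / (p - 1)"
  have p': "1 < ?p'" "1/?p' + 1/p = 1" "(p - 1) * ?p' = p" using p by (auto simp: field_simps)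
  \<comment> \<open>The parameter of Young's inequality for which the gradient term is exactly \<open>\<nu>/2 |\<xi>|^p\<close>.\<close>
  define e where "e = (\<nu> / 2) powr (1 / p)"
  have e: "0 < e" "e powr p = \<nu> / 2" using \<nu> p by (auto simp: e_def powr_powr)
  define ca where "ca = (1 / e) powr ?p'"
  define cb where "cb = (2::real) powr ?p' * (L powr ?p' + 1)"
  have cab: "0 \<le> ca" "0 \<le> cb" by (auto simp: ca_def cb_def)
  show ?thesis
  proof (rule that[of "max ca cb"], simp add: cab le_max_iff_disj, intro allI impI)
    fix a \<xi> F :: 'b
    assume co: "\<nu> * norm \<xi> powr p \<le> a \<bullet> \<xi>" and gr: "norm a \<le> L * norm \<xi> powr (p - 1)"
    let ?f = "norm F powr (p - 2) *\<^sub>R F"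
    have nf: "norm ?f = norm F powr (p - 1)"
    proof (cases "F = 0")
      case False
      then have "norm F powr (p - 2) * norm F powr 1 = norm F powr (p - 2 + 1)" by (simp only: powr_add)
      then show ?thesis by simp
    qed (use p in simp)
    have "\<bar>?f \<bullet> \<xi>\<bar> \<le> norm ?f * norm \<xi>" by (rule Cauchy_Schwarz_ineq2)
    also have "\<dots> = (norm F powr (p - 1) / e) * (e * norm \<xi>)" unfolding nf using e by simp
    also have "\<dots> \<le> (norm F powr (p - 1) / e) powr ?p' / ?p' + (e * norm \<xi>) powr p / p"
      by (rule Youngs_inequality) (use p p' e in auto)
    also have "\<dots> \<le> (norm F powr (p - 1) / e) powr ?p' + (e * norm \<xi>) powr p"
      using p p' frac_le[of "(norm F powr (p - 1) / e) powr ?p'" "(norm F powr (p - 1) / e) powr ?p'" 1 ?p']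
        frac_le[of "(e * norm \<xi>) powr p" "(e * norm \<xi>) powr p" 1 p]
      by (intro add_mono) auto
    also have "(e * norm \<xi>) powr p = \<nu> / 2 * norm \<xi> powr p" using e by (simp add: powr_mult)
    also have "(norm F powr (p - 1) / e) powr ?p' = ca * norm F powr p"
      using e p'(3) by (simp only: ca_def powr_divide powr_powr powr_one_eq_one) simp
    finally have y: "\<bar>?f \<bullet> \<xi>\<bar> \<le> ca * norm F powr p + \<nu> / 2 * norm \<xi> powr p" .
    have m1: "ca * norm F powr p \<le> max ca cb * norm F powr p" by (intro mult_right_mono) auto
    have s1: "\<nu> / 2 * norm \<xi> powr p \<le> (a - ?f) \<bullet> \<xi> + max ca cb * norm F powr p"
      using y m1 co abs_ge_self[of "?f \<bullet> \<xi>"] unfolding inner_diff_left by argo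
    have "norm (a - ?f) \<le> L * norm \<xi> powr (p - 1) + norm F powr (p - 1)"
      using norm_triangle_ineq4[of a ?f] gr nf by linarith
    then have "norm (a - ?f) powr ?p' \<le> (L * norm \<xi> powr (p - 1) + norm F powr (p - 1)) powr ?p'"
      using p' by (intro powr_mono2) auto
    also have "\<dots> \<le> 2 powr ?p' * ((L * norm \<xi> powr (p - 1)) powr ?p' + (norm F powr (p - 1)) powr ?p')"
      using L p' by (intro add_powr_le) auto
    also have "(L * norm \<xi> powr (p - 1)) powr ?p' = L powr ?p' * norm \<xi> powr p" by (simp only: powr_mult powr_powr p'(3))
    also have "(norm F powr (p - 1)) powr ?p' = norm F powr p" by (simp only: powr_powr p'(3))
    also have "2 powr ?p' * (L powr ?p' * norm \<xi> powr p + norm F powr p) \<le> cb * (norm \<xi> powr p + norm F powr p)"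
    proof -
      have "L powr ?p' * norm \<xi> powr p + norm F powr p \<le> (L powr ?p' + 1) * (norm \<xi> powr p + norm F powr p)"
        by (simp add: algebra_simps)
      from mult_left_mono[OF this, of "2 powr ?p'"] show ?thesis by (simp only: cb_def mult.assoc powr_ge_zero)
    qed
    also have "\<dots> \<le> max ca cb * (norm \<xi> powr p + norm F powr p)" by (intro mult_right_mono) auto
    finally show "\<nu> / 2 * norm \<xi> powr p \<le> (a - ?f) \<bullet> \<xi> + max ca cb * norm F powr p
      \<and> norm (a - ?f) powr ?p' \<le> max ca cb * (norm \<xi> powr p + norm F powr p)"
      using s1 by blast
  qed
qed

lemma integrable_lower_power:
  fixes g :: "'a \<Rightarrow> real"
  assumes g: "g \<in> borel_measurable M" and S: "S \<in> sets M" "emeasure M S < \<infinity>"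
    and supp: "AE z in M. z \<notin> S \<longrightarrow> g z = 0" and nn: "\<And>z. 0 \<le> g z"
    and p: "integrable M (\<lambda>z. g z powr p)" and r: "0 \<le> r" "r \<le> p"
  shows "integrable M (\<lambda>z. g z powr r)"
proof (rule Bochner_Integration.integrable_bound[where f="\<lambda>z. indicator S z + g z powr p"])
  show "integrable M (\<lambda>z. indicator S z + g z powr p)"
    using p S by (intro Bochner_Integration.integrable_add integrable_real_indicator) auto
  show "(\<lambda>z. g z powr r) \<in> borel_measurable M" using g by simp
  show "AE z in M. norm (g z powr r) \<le> norm (indicator S z + g z powr p)"
    using supp
  proof eventually_elim
    case (elim z)
    show ?case
    proof (cases "z \<in> S")
      case True
      then show ?thesis using powr_le_one_plus[OF nn r, of z] by simp
    next
      case False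
      then show ?thesis using elim by simp
    qed
  qed
qed

text \<open>
  Multiplied out, the hypothesis on \<open>q\<close> is \<open>m (n + p - q) < q (n + 2)\<close> with \<open>m = max 2 p\<close>. For
  \<open>p \<ge> 2\<close> it reads \<open>(p - q) (n + p) < 2 q\<close>, and both conclusions follow. For \<open>p < 2\<close> the second
  one uses \<open>q < p\<close>, and the first one is \<open>q > 0\<close>.
\<close>

lemma reverse_Holder_exponents:
  fixes p q n :: real
  assumes "1 \<le> n" "1 < p" "1 < q" "q < p" "max 2 p < q * (n + 2) / (n + p - q)"
  shows "max 2 p - q < 2" "n * (max 2 p - q) < 2 * q"
proof -
  have d: "0 < n + p - q" using assms by simp
  have h: "max 2 p * (n + p - q) < q * (n + 2)" using assms(5) unfolding pos_less_divide_eq[OF d] .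
  show 2: "n * (max 2 p - q) < 2 * q"
  proof (cases "2 \<le> p")
    case True
    then have "p * (n + p - q) < q * (n + 2)" using h by (simp add: max_def)
    moreover have "0 \<le> p * (p - q)" using assms by simp
    ultimately have "n * (p - q) < 2 * q" by (simp add: algebra_simps)
    then show ?thesis using True by (simp add: max_def)
  next
    case False
    then have "2 * (n + p - q) < q * (n + 2)" using h by (simp add: max_def)
    then have "n * (2 - q) < 2 * q" using assms by (simp add: algebra_simps)
    then show ?thesis using False by (simp add: max_def)
  qed
  show "max 2 p - q < 2"
  proof (cases "2 \<le> p")
    case True
    then have "p * (n + p - q) < q * (n + 2)" using h by (simp add: max_def)
    then have "(p - q) * (n + p) < 2 * q" by (simp add: algebra_simps)
    also have "\<dots> < 2 * (n + p)" using assms by simp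
    finally have "p - q < 2" by (rule mult_right_less_imp_less) (use assms in auto)
    then show ?thesis using True by (simp add: max_def)
  qed (use assms in auto)
qed

text \<open>
  The return from the rescaled estimate to averages. Here \<open>I\<close>, \<open>Dq\<close>, \<open>Fq\<close>, \<open>Fp\<close> and \<open>DF\<close> are the
  integrals, in the rescaled variables, of \<open>|Du|^p\<close>, \<open>|Du|^q\<close>, \<open>|F|^q\<close>, \<open>|F|^p\<close> and
  \<open>(|Du| + |F|)^q\<close>, and \<open>B1\<close>, \<open>B2\<close> are the measures of the two standard cylinders. The scaling
  factor enters the rescaled estimate as \<open>\<lambda>^p\<close>, and the lower intrinsic bound turns it into
  averages.
\<close>

lemma reverse_Holder_of_rescaled_bound:
  fixes p q C B1 B2 \<gamma> lam I Dq Fq Fp DF :: real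
  assumes p: "1 < p" and q: "1 < q" and C: "0 \<le> C" and B: "0 < B1" "0 < B2" and \<gamma>: "1 < \<gamma>" and lam: "0 < lam"
    and nn: "0 \<le> I" "0 \<le> Dq" "0 \<le> Fq" "0 \<le> Fp" "0 \<le> DF"
    and main: "I / lam powr p \<le> C * (1 + Fp / lam powr p)"
    and low: "inverse \<gamma> * lam \<le> (DF / B2) powr (1 / q)"
    and split: "DF \<le> 2 powr q * (Dq + Fq)"
    and jensen: "(Fq / B2) powr (1 / q) \<le> (Fp / B2) powr (1 / p)"
    and c: "c = (C / B1) powr (1 / p) * (2 * (4 * \<gamma> + B2 powr (1 / p))) + 1"
  shows "(I / B1) powr (1 / p) \<le> c * (Dq / B2) powr (1 / q) + c * (Fp / B2) powr (1 / p)"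
proof -
  define X where "X = (Dq / B2) powr (1 / q)"
  define Y where "Y = (Fp / B2) powr (1 / p)"
  have XY: "0 \<le> X" "0 \<le> Y" by (auto simp: X_def Y_def)
  have lp: "0 < lam powr p" using lam by simp
  have "lam \<le> \<gamma> * (DF / B2) powr (1 / q)" using low \<gamma> by (simp add: field_simps)
  also have "(DF / B2) powr (1 / q) \<le> (2 powr q * (Dq / B2 + Fq / B2)) powr (1 / q)"
    using nn B q split by (intro powr_mono2) (auto simp: field_simps)
  also have "\<dots> = 2 * (Dq / B2 + Fq / B2) powr (1 / q)" using q by (simp add: powr_mult powr_powr)
  also have "(Dq / B2 + Fq / B2) powr (1 / q) \<le> 2 * (X + (Fq / B2) powr (1 / q))"
    unfolding X_def using nn B q by (intro powr_add_le) auto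
  also have "(Fq / B2) powr (1 / q) \<le> Y" using jensen by (simp add: Y_def)
  finally have lamXY: "lam \<le> 4 * \<gamma> * (X + Y)" using \<gamma> by (simp add: algebra_simps)
  have "I \<le> C * (lam powr p + Fp)" using main lp by (simp add: field_simps)
  then have "I / B1 \<le> (C / B1) * (lam powr p + Fp)" using B by (simp add: divide_right_mono)
  then have "(I / B1) powr (1 / p) \<le> ((C / B1) * (lam powr p + Fp)) powr (1 / p)" using nn B p by (intro powr_mono2) auto
  also have "\<dots> = (C / B1) powr (1 / p) * (lam powr p + Fp) powr (1 / p)" by (rule powr_mult)
  also have "(lam powr p + Fp) powr (1 / p) \<le> 2 * ((lam powr p) powr (1 / p) + Fp powr (1 / p))"
    using nn p by (intro powr_add_le) auto
  also have "(lam powr p) powr (1 / p) = lam" using p lam by (simp add: powr_powr)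
  also have "Fp powr (1 / p) = B2 powr (1 / p) * Y"
    unfolding Y_def using B nn by (simp add: powr_divide)
  finally have 1: "(I / B1) powr (1 / p) \<le> (C / B1) powr (1 / p) * (2 * (lam + B2 powr (1 / p) * Y))" by (simp add: mult_left_mono)
  have "0 \<le> B2 powr (1 / p) * X" using XY by simp
  then have "lam + B2 powr (1 / p) * Y \<le> (4 * \<gamma> + B2 powr (1 / p)) * (X + Y)"
    using lamXY by (simp add: algebra_simps)
  then have "(C / B1) powr (1 / p) * (2 * (lam + B2 powr (1 / p) * Y)) \<le> (C / B1) powr (1 / p) * (2 * ((4 * \<gamma> + B2 powr (1 / p)) * (X + Y)))"
    by (intro mult_left_mono) auto
  also have "\<dots> = (c - 1) * (X + Y)" by (simp add: c mult_ac)
  also have "\<dots> \<le> c * X + c * Y" using XY by (simp add: algebra_simps)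
  finally show ?thesis using 1 by (simp add: X_def Y_def)
qed

section \<open>The reverse Hoelder inequality\<close>

text \<open>
  For a single solution and cylinder, with constants \<open>c1\<close> and \<open>C\<close> that are given in advance since
  they must not depend on either. The functions are replaced by Borel representatives that vanish
  off \<open>2Q\<close>, and these are rescaled to form a \<open>unit_flow\<close>. The upper intrinsic bound provides its
  bound for the integral of \<open>|D|^q\<close>, namely the measure of the standard cylinder.
\<close>

lemma reverse_Holder_cylinder:
  fixes p q \<nu> L \<gamma> c1 C :: real
    and u :: "(real^'n::finite) \<times> real \<Rightarrow> real^'m::finite"
  assumes p: "1 < p" and q: "1 < q" "q < p" and pos: "0 < \<nu>" "0 < L" "1 < \<gamma>"
    and c1: "0 \<le> c1" and st: "\<forall>(a :: real^'n^'m) \<xi> F. \<nu> * norm \<xi> powr p \<le> a \<bullet> \<xi> \<longrightarrow> norm a \<le> L * norm \<xi> powr (p - 1) \<longrightarrow>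
      \<nu> / 2 * norm \<xi> powr p \<le> (a - norm F powr (p - 2) *\<^sub>R F) \<bullet> \<xi> + c1 * norm F powr p
      \<and> norm (a - norm F powr (p - 2) *\<^sub>R F) powr (p / (p - 1)) \<le> c1 * (norm \<xi> powr p + norm F powr p)"
    and C: "0 \<le> C" "\<forall>(U :: (real^'n) \<times> real \<Rightarrow> real^'m) D G f.
        unit_flow p q (\<nu> / 2) c1 (measure lborel (std_cylinder 2 :: ((real^'n) \<times> real) set)) U D G f \<longrightarrow>
      (\<integral>z. indicator (std_cylinder 1) z * norm (D z) powr p \<partial>lborel) \<le> C * (1 + (\<integral>z. f z powr p \<partial>lborel))"
    and c: "c = (C / measure lborel (std_cylinder 1 :: ((real^'n) \<times> real) set)) powr (1 / p)
       * (2 * (4 * \<gamma> + measure lborel (std_cylinder 2 :: ((real^'n) \<times> real) set) powr (1 / p))) + 1"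
    and \<Omega>: "open \<Omega>" and T: "0 < T"
    and car: "caratheodory (space_time \<Omega> T) A" and gro: "p_growth p \<nu> L (space_time \<Omega> T) A"
    and Fm: "F \<in> borel_measurable (lebesgue_on (space_time \<Omega> T))"
    and Fp: "Lp_loc p (space_time \<Omega> T) (\<lambda>z. norm (F z))"
    and uW: "Lp_loc_W1p_loc p \<Omega> T u Du"
    and ws: "weak_solution p \<Omega> T A F u Du"
    and \<rho>: "0 < \<rho>" and lam: "0 < lam"
    and cc: "compactly_contained (cylinder p lam x0 t0 (2 * \<rho>)) (space_time \<Omega> T)"
    and low: "inverse \<gamma> * lam \<le> avg (cylinder p lam x0 t0 (2 * \<rho>)) (\<lambda>z. (norm (Du z) + norm (F z)) powr q) powr (1 / q)"
    and upp: "avg (cylinder p lam x0 t0 (2 * \<rho>)) (\<lambda>z. (norm (Du z) + norm (F z)) powr q) powr (1 / q) \<le> lam"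
  shows "avg (cylinder p lam x0 t0 \<rho>) (\<lambda>z. norm (Du z) powr p) powr (1 / p)
        \<le> c * avg (cylinder p lam x0 t0 (2 * \<rho>)) (\<lambda>z. norm (Du z) powr q) powr (1 / q)
          + c * avg (cylinder p lam x0 t0 (2 * \<rho>)) (\<lambda>z. norm (F z) powr p) powr (1 / p)"
proof -
  define Q where "Q = cylinder p lam x0 t0 (2 * \<rho>)"
  define \<kappa> where "\<kappa> = lam powr (2 - p) * \<rho>\<^sup>2"
  define S where "S = parabolic_scaling x0 t0 \<rho> \<kappa>"
  let ?\<Omega>T = "space_time \<Omega> T"
  let ?p' = "p / (p - 1)"
  let ?N = "std_cylinder 2 :: ((real^'n) \<times> real) set"
  define B1 where "B1 = measure lborel (std_cylinder 1 :: ((real^'n) \<times> real) set)"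
  define B2 where "B2 = measure lborel ?N"
  have B: "0 < B1" "0 < B2" using std_cylinder_measure(3)[where 'n='n] by (simp_all add: B1_def B2_def)
  note N = std_cylinder_measure(1,2)[where r=2, OF zero_less_numeral, where 'n='n]
  have \<kappa>: "0 < \<kappa>" using \<rho> lam by (simp add: \<kappa>_def)
  have SQ: "S y \<in> Q \<longleftrightarrow> y \<in> ?N" for y using parabolic_scaling_cylinder[OF \<rho> lam, of x0 t0 p y 2] by (simp add: S_def Q_def \<kappa>_def)
  have p'1: "1 < ?p'" "(p - 1) * ?p' = p" using p by (auto simp: field_simps)
  have Qo: "open Q" unfolding Q_def cylinder_def by (intro open_Times open_ball open_greaterThanLessThan)
  have "bounded {s<..<t}" for s t :: real using bounded_box[of s t] by (simp add: box_real)
  then have Qb: "bounded Q" unfolding Q_def cylinder_def by (intro bounded_Times bounded_ball)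
  have Qs: "Q \<in> sets borel" "Q \<in> sets lborel" "Q \<in> sets lebesgue" using Qo by auto
  have Qf: "emeasure lborel Q < \<infinity>" using emeasure_bounded_finite[OF Qb] by simp
  have clQ: "compact (closure Q)" "closure Q \<subseteq> ?\<Omega>T" using cc by (simp_all add: compactly_contained_def Q_def)
  have Qsub: "Q \<subseteq> ?\<Omega>T" using clQ(2) closure_subset by blast
  have \<Omega>Ts: "?\<Omega>T \<in> sets lebesgue" using open_Times[OF \<Omega> open_greaterThanLessThan[of 0 T]] by simp
  have um: "u \<in> borel_measurable (lebesgue_on ?\<Omega>T)" and sg: "spatial_gradient \<Omega> T u Du" and Dum: "Du \<in> borel_measurable (lebesgue_on ?\<Omega>T)"
    using uW by (auto simp: Lp_loc_W1p_loc_def spatial_gradient_def)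
  obtain U1 where U1: "U1 \<in> borel_measurable borel" "AE z in lborel. indicator Q z *\<^sub>R u z = U1 z"
    by (rule borel_representative_on[OF um \<Omega>Ts Qs(3) Qsub])
  obtain D1 where D1: "D1 \<in> borel_measurable borel" "AE z in lborel. indicator Q z *\<^sub>R Du z = D1 z"
    by (rule borel_representative_on[OF Dum \<Omega>Ts Qs(3) Qsub])
  obtain F1 where F1: "F1 \<in> borel_measurable borel" "AE z in lborel. indicator Q z *\<^sub>R F z = F1 z"
    by (rule borel_representative_on[OF Fm \<Omega>Ts Qs(3) Qsub])
  obtain A1 where A1: "A1 \<in> borel_measurable borel" "AE z in lborel. indicator Q z *\<^sub>R A z (Du z) = A1 z"
    by (rule borel_representative_on[OF caratheodory_composition[OF car \<Omega>Ts Dum] \<Omega>Ts Qs(3) Qsub])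
  define f1 where "f1 z = norm (F1 z) powr (p - 2) *\<^sub>R F1 z" for z
  have f1m: "f1 \<in> borel_measurable borel" unfolding f1_def using F1(1) by measurable
  have f1: "AE z in lborel. indicator Q z *\<^sub>R (norm (F z) powr (p - 2) *\<^sub>R F z) = f1 z"
    using F1(2) by eventually_elim (auto simp: f1_def indicator_def)
  have nf1: "norm (f1 z) = norm (F1 z) powr (p - 1)" for z
  proof (cases "F1 z = 0")
    case False
    have "norm (F1 z) powr (p - 2 + 1) = norm (F1 z) powr (p - 2) * norm (F1 z) powr 1" by (rule powr_add)
    then show ?thesis by (simp add: f1_def)
  qed (simp add: f1_def)
  define G1 where "G1 z = A1 z - f1 z" for z
  have G1m: "G1 \<in> borel_measurable borel" unfolding G1_def using A1(1) f1m by measurable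
  \<comment> \<open>Coercivity and growth for the representatives. Off Q all of them vanish, so that the
      estimates hold in the whole space.\<close>
  have "AE z in lborel. z \<in> ?\<Omega>T \<longrightarrow> (\<forall>\<xi>. \<nu> * norm \<xi> powr p \<le> A z \<xi> \<bullet> \<xi> \<and> norm (A z \<xi>) \<le> L * norm \<xi> powr (p - 1))"
    using gro unfolding p_growth_def by (subst (asm) AE_lebesgue_on_iff[OF \<Omega>Ts])
  then have str: "AE z in lborel. \<nu> / 2 * norm (D1 z) powr p \<le> G1 z \<bullet> D1 z + c1 * norm (F1 z) powr p
      \<and> norm (G1 z) powr ?p' \<le> c1 * (norm (D1 z) powr p + norm (F1 z) powr p)
      \<and> norm (A1 z) \<le> L * norm (D1 z) powr (p - 1) \<and> (z \<notin> Q \<longrightarrow> U1 z = 0 \<and> D1 z = 0 \<and> F1 z = 0)"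
    using U1(2) D1(2) F1(2) A1(2)
  proof eventually_elim
    case (elim z)
    show ?case
    proof (cases "z \<in> Q")
      case True
      then have "z \<in> ?\<Omega>T" and e: "Du z = D1 z" "F z = F1 z" "A z (Du z) = A1 z" using elim Qsub by auto
      then have "\<nu> * norm (D1 z) powr p \<le> A1 z \<bullet> D1 z \<and> norm (A1 z) \<le> L * norm (D1 z) powr (p - 1)" using elim(1) by metis
      then show ?thesis using st[rule_format, of "D1 z" "A1 z" "F1 z"] True by (simp add: G1_def f1_def)
    next
      case False
      then have "D1 z = 0" "F1 z = 0" "A1 z = 0" "U1 z = 0" using elim by auto
      then show ?thesis by (simp add: G1_def f1_def)
    qed
  qed
  have off: "AE z in lborel. z \<notin> Q \<longrightarrow> norm (U1 z) = 0" "AE z in lborel. z \<notin> Q \<longrightarrow> norm (D1 z) = 0" "AE z in lborel. z \<notin> Q \<longrightarrow> norm (F1 z) = 0"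
    by (rule eventually_mono[OF str], simp)+
  \<comment> \<open>The closure of Q is a product of a ball and an interval inside of space-time, as the local
      integrability of u and Du requires.\<close>
  have UDp: "integrable lborel (\<lambda>z. norm (U1 z) powr p + norm (D1 z) powr p)"
  proof -
    define t1 where "t1 = t0 - lam powr (2 - p) * (2 * \<rho>)\<^sup>2"
    define t2 where "t2 = t0 + lam powr (2 - p) * (2 * \<rho>)\<^sup>2"
    have t12: "t1 < t2" using \<rho> lam by (simp add: t1_def t2_def)
    have Qe: "Q = ball x0 (2 * \<rho>) \<times> {t1<..<t2}" by (simp add: Q_def cylinder_def t1_def t2_def)
    have "closure Q = cball x0 (2 * \<rho>) \<times> {t1..t2}" unfolding Qe closure_Times using \<rho> t12 by simp
    then have sub: "cball x0 (2 * \<rho>) \<times> {t1..t2} \<subseteq> \<Omega> \<times> {0<..<T}" using clQ(2) by simp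
    have "(x0, t1) \<in> cball x0 (2 * \<rho>) \<times> {t1..t2}" "(x0, t2) \<in> cball x0 (2 * \<rho>) \<times> {t1..t2}" using \<rho> t12 by auto
    then have "(x0, t1) \<in> \<Omega> \<times> {0<..<T}" "(x0, t2) \<in> \<Omega> \<times> {0<..<T}" using sub by blast+
    then have t: "0 < t1" "t2 < T" by auto
    have "cball x0 (2 * \<rho>) \<subseteq> \<Omega>"
    proof
      fix x assume "x \<in> cball x0 (2 * \<rho>)"
      then have "(x, t1) \<in> cball x0 (2 * \<rho>) \<times> {t1..t2}" using t12 by simp
      then show "x \<in> \<Omega>" using sub by blast
    qed
    then have "compactly_contained (ball x0 (2 * \<rho>)) \<Omega>" using \<rho> by (simp add: compactly_contained_def)
    then have "set_integrable lebesgue (ball x0 (2 * \<rho>) \<times> {t1<..<t2}) (\<lambda>z. norm (u z) powr p + norm (Du z) powr p)"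
      using uW t t12 unfolding Lp_loc_W1p_loc_def by blast
    then have "integrable lebesgue (\<lambda>z. indicator Q z *\<^sub>R (norm (u z) powr p + norm (Du z) powr p))"
      by (simp add: set_integrable_def Qe)
    moreover have "integrable lebesgue (\<lambda>z. indicator Q z *\<^sub>R (norm (u z) powr p + norm (Du z) powr p)) \<longleftrightarrow> integrable lborel (\<lambda>z. norm (U1 z) powr p + norm (D1 z) powr p)"
    proof (rule integral_lebesgue_eq_lborel(2))
      show "(\<lambda>z. norm (U1 z) powr p + norm (D1 z) powr p) \<in> borel_measurable borel" using U1(1) D1(1) by measurable
      show "AE z in lborel. indicator Q z *\<^sub>R (norm (u z) powr p + norm (Du z) powr p) = norm (U1 z) powr p + norm (D1 z) powr p"
        using U1(2) D1(2) by eventually_elim (auto simp: indicator_def)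
    qed
    ultimately show ?thesis by simp
  qed
  have Up: "integrable lborel (\<lambda>z. norm (U1 z) powr p)"
    by (rule Bochner_Integration.integrable_bound[OF UDp]) (use U1(1) in auto)
  have Dp: "integrable lborel (\<lambda>z. norm (D1 z) powr p)"
    by (rule Bochner_Integration.integrable_bound[OF UDp]) (use D1(1) in auto)
  have Fpi: "integrable lborel (\<lambda>z. norm (F1 z) powr p)"
  proof -
    have "set_integrable lebesgue (closure Q) (\<lambda>z. norm (norm (F z)) powr p)" using Fp clQ unfolding Lp_loc_def Lp_on_def by blast
    then have "set_integrable lebesgue Q (\<lambda>z. norm (norm (F z)) powr p)"
      by (rule set_integrable_subset) (use Qs closure_subset in auto)
    then have "integrable lebesgue (\<lambda>z. indicator Q z *\<^sub>R (norm (F z) powr p))" by (simp add: set_integrable_def)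
    moreover have "integrable lebesgue (\<lambda>z. indicator Q z *\<^sub>R (norm (F z) powr p)) \<longleftrightarrow> integrable lborel (\<lambda>z. norm (F1 z) powr p)"
    proof (rule integral_lebesgue_eq_lborel(2))
      show "(\<lambda>z. norm (F1 z) powr p) \<in> borel_measurable borel" using F1(1) by measurable
      show "AE z in lborel. indicator Q z *\<^sub>R (norm (F z) powr p) = norm (F1 z) powr p"
        using F1(2) by eventually_elim (auto simp: indicator_def)
    qed
    ultimately show ?thesis by simp
  qed
  have nm: "(\<lambda>z. norm (U1 z)) \<in> borel_measurable lborel" "(\<lambda>z. norm (D1 z)) \<in> borel_measurable lborel" "(\<lambda>z. norm (F1 z)) \<in> borel_measurable lborel"
    using U1(1) D1(1) F1(1) by auto
  note lowU = integrable_lower_power[OF nm(1) Qs(2) Qf off(1) norm_ge_zero Up]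
  note lowD = integrable_lower_power[OF nm(2) Qs(2) Qf off(2) norm_ge_zero Dp]
  note lowF = integrable_lower_power[OF nm(3) Qs(2) Qf off(3) norm_ge_zero Fpi]
  have U1i: "integrable lborel U1" using lowU[of 1] p U1(1) by (subst integrable_norm_iff[symmetric]) auto
  have D1i: "integrable lborel D1" using lowD[of 1] p D1(1) by (subst integrable_norm_iff[symmetric]) auto
  have f1i: "integrable lborel f1"
    using lowF[of "p - 1"] p f1m by (subst integrable_norm_iff[symmetric]) (auto simp: nf1)
  have A1i: "integrable lborel A1"
  proof (rule Bochner_Integration.integrable_bound[where f="\<lambda>z. L * norm (D1 z) powr (p - 1)"])
    show "integrable lborel (\<lambda>z. L * norm (D1 z) powr (p - 1))" using lowD[of "p - 1"] p by simp
    show "AE z in lborel. norm (A1 z) \<le> norm (L * norm (D1 z) powr (p - 1))"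
      using str by (rule eventually_mono) (use pos in auto)
  qed (use A1(1) in simp)
  have G1i: "integrable lborel G1" unfolding G1_def using A1i f1i by auto
  have Gp: "integrable lborel (\<lambda>z. norm (G1 z) powr ?p')"
  proof (rule Bochner_Integration.integrable_bound[where f="\<lambda>z. c1 * (norm (D1 z) powr p + norm (F1 z) powr p)"])
    show "integrable lborel (\<lambda>z. c1 * (norm (D1 z) powr p + norm (F1 z) powr p))" using Dp Fpi by simp
    show "AE z in lborel. norm (norm (G1 z) powr ?p') \<le> norm (c1 * (norm (D1 z) powr p + norm (F1 z) powr p))"
      using str by (rule eventually_mono) (use c1 in auto)
  qed (use G1m in simp)
  have gradQ: "distributional_gradient Q U1 D1"
    by (rule spatial_gradient_imp_distributional[OF sg Qsub U1i U1(2) D1i D1(2)])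
  have fluxQ: "distributional_flux Q U1 G1"
    using weak_solution_imp_distributional[OF ws Qsub U1i U1(2) A1i A1(2) f1i f1] by (simp add: G1_def[abs_def])
  \<comment> \<open>The scaling of the flux that fits to the intrinsic time scale \<open>\<kappa>\<close>.\<close>
  define b where "b = lam powr (p - 1)"
  have b: "0 < b" "b * lam = lam powr p" "b * \<kappa> = \<rho>\<^sup>2 * lam" "b powr ?p' = lam powr p"
  proof -
    show "0 < b" using lam by (simp add: b_def)
    have "lam powr (p - 1 + 1) = lam powr (p - 1) * lam powr 1" by (rule powr_add)
    then show "b * lam = lam powr p" using lam by (simp add: b_def)
    have "lam powr (p - 1) * lam powr (2 - p) = lam" using lam by (simp flip: powr_add)
    then show "b * \<kappa> = \<rho>\<^sup>2 * lam" by (simp add: b_def \<kappa>_def mult_ac)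
    show "b powr ?p' = lam powr p" by (simp only: b_def powr_powr p'1)
  qed
  define Us where "Us y = U1 (S y) /\<^sub>R (\<rho> * lam)" for y
  define Ds where "Ds y = D1 (S y) /\<^sub>R lam" for y
  define Gs where "Gs y = G1 (S y) /\<^sub>R b" for y
  define fs where "fs y = norm (F1 (S y)) / lam" for y
  have si: "integrable lborel (\<lambda>y. h (S y))" if "integrable lborel h" for h :: "(real^'n) \<times> real \<Rightarrow> 'z::euclidean_space"
    unfolding S_def using parabolic_scaling_integral(2)[OF _ \<rho> \<kappa>, of h x0 t0] that by simp
  have sAE: "AE y in lborel. P (S y)" if "AE z in lborel. P z" for P
    unfolding S_def by (rule AE_parabolic_scaling[OF \<rho> \<kappa> that])
  have nD: "norm (Ds y) powr r = norm (D1 (S y)) powr r / lam powr r" for y r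
    using lam by (simp add: Ds_def powr_divide flip: divide_inverse_commute)
  have nf: "fs y powr r = norm (F1 (S y)) powr r / lam powr r" for y r
    using lam by (simp add: fs_def powr_divide)
  have nG: "norm (Gs y) powr ?p' = norm (G1 (S y)) powr ?p' / lam powr p" for y
    using b by (simp add: Gs_def powr_divide flip: divide_inverse_commute)
  have strS: "AE y in lborel. \<nu> / 2 * norm (D1 (S y)) powr p \<le> G1 (S y) \<bullet> D1 (S y) + c1 * norm (F1 (S y)) powr p
      \<and> norm (G1 (S y)) powr ?p' \<le> c1 * (norm (D1 (S y)) powr p + norm (F1 (S y)) powr p)
      \<and> (y \<notin> ?N \<longrightarrow> D1 (S y) = 0 \<and> F1 (S y) = 0)"
    using sAE[OF str] by (rule eventually_mono) (simp add: SQ)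
  have Dqi: "integrable lborel (\<lambda>y. norm (D1 (S y)) powr q)" and Fqi: "integrable lborel (\<lambda>y. norm (F1 (S y)) powr q)"
    and Fps: "integrable lborel (\<lambda>y. norm (F1 (S y)) powr p)"
    using si[OF lowD[of q]] si[OF lowF[of q]] si[OF Fpi] q by auto
  define Dq where "Dq = (\<integral>y. norm (D1 (S y)) powr q \<partial>lborel)"
  define Fq where "Fq = (\<integral>y. norm (F1 (S y)) powr q \<partial>lborel)"
  define FP where "FP = (\<integral>y. norm (F1 (S y)) powr p \<partial>lborel)"
  define I where "I = (\<integral>y. indicator (std_cylinder 1) y * norm (D1 (S y)) powr p \<partial>lborel)"
  define DF where "DF = (\<integral>y. (norm (D1 (S y)) + norm (F1 (S y))) powr q \<partial>lborel)"
  have Sm: "S \<in> borel_measurable borel" by (simp add: S_def)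
  have Dm: "(\<lambda>y. D1 (S y)) \<in> borel_measurable borel" "(\<lambda>y. F1 (S y)) \<in> borel_measurable borel"
    using measurable_compose[OF Sm D1(1)] measurable_compose[OF Sm F1(1)] by auto
  have DFle: "(norm (D1 (S y)) + norm (F1 (S y))) powr q \<le> 2 powr q * (norm (D1 (S y)) powr q + norm (F1 (S y)) powr q)" for y
    using q by (intro add_powr_le) auto
  have DFi: "integrable lborel (\<lambda>y. (norm (D1 (S y)) + norm (F1 (S y))) powr q)"
  proof (rule Bochner_Integration.integrable_bound[where f="\<lambda>y. 2 powr q * (norm (D1 (S y)) powr q + norm (F1 (S y)) powr q)"])
    show "AE y in lborel. norm ((norm (D1 (S y)) + norm (F1 (S y))) powr q) \<le> norm (2 powr q * (norm (D1 (S y)) powr q + norm (F1 (S y)) powr q))"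
      using DFle by (intro AE_I2) (auto intro: order_trans[OF _ abs_ge_self])
  qed (use Dqi Fqi Dm in auto)
  \<comment> \<open>Averages over the original cylinders are averages of the rescaled functions over standard
      ones.\<close>
  have av2: "avg Q g = (\<integral>y. k (S y) \<partial>lborel) / B2"
    if "k \<in> borel_measurable borel" "AE z in lborel. z \<in> Q \<longrightarrow> g z = k z" "AE y in lborel. y \<notin> ?N \<longrightarrow> k (S y) = 0"
    for g k :: "(real^'n) \<times> real \<Rightarrow> real"
  proof -
    have "avg Q g = (\<integral>y. indicator ?N y * k (S y) \<partial>lborel) / B2"
      using avg_cylinder[OF \<rho> lam, of 2 k p x0 t0 g] that(1,2) by (simp add: Q_def S_def \<kappa>_def B2_def)
    also have "(\<integral>y. indicator ?N y * k (S y) \<partial>lborel) = (\<integral>y. k (S y) \<partial>lborel)"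
    proof (rule integral_cong_AE)
      have km: "(\<lambda>y. k (S y)) \<in> borel_measurable lborel" using measurable_compose[OF Sm that(1)] by simp
      show "(\<lambda>y. k (S y)) \<in> borel_measurable lborel" by (rule km)
      show "(\<lambda>y. indicator ?N y * k (S y)) \<in> borel_measurable lborel"
        by (rule borel_measurable_times[OF borel_measurable_indicator[OF N(1)] km])
      show "AE y in lborel. indicator ?N y * k (S y) = k (S y)"
        using that(3) by (rule eventually_mono) (auto simp: indicator_def)
    qed
    finally show ?thesis .
  qed
  have avDF: "avg Q (\<lambda>z. (norm (Du z) + norm (F z)) powr q) = DF / B2"
    unfolding DF_def
  proof (rule av2)
    show "(\<lambda>z. (norm (D1 z) + norm (F1 z)) powr q) \<in> borel_measurable borel" using D1(1) F1(1) by measurable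
    show "AE z in lborel. z \<in> Q \<longrightarrow> (norm (Du z) + norm (F z)) powr q = (norm (D1 z) + norm (F1 z)) powr q"
      using D1(2) F1(2) by eventually_elim auto
    show "AE y in lborel. y \<notin> ?N \<longrightarrow> (norm (D1 (S y)) + norm (F1 (S y))) powr q = 0"
      using strS by (rule eventually_mono) auto
  qed
  have avD: "avg Q (\<lambda>z. norm (Du z) powr q) = Dq / B2"
    unfolding Dq_def
  proof (rule av2)
    show "(\<lambda>z. norm (D1 z) powr q) \<in> borel_measurable borel" using D1(1) by measurable
    show "AE z in lborel. z \<in> Q \<longrightarrow> norm (Du z) powr q = norm (D1 z) powr q" using D1(2) by eventually_elim auto
    show "AE y in lborel. y \<notin> ?N \<longrightarrow> norm (D1 (S y)) powr q = 0" using strS by (rule eventually_mono) auto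
  qed
  have avF: "avg Q (\<lambda>z. norm (F z) powr p) = FP / B2"
    unfolding FP_def
  proof (rule av2)
    show "(\<lambda>z. norm (F1 z) powr p) \<in> borel_measurable borel" using F1(1) by measurable
    show "AE z in lborel. z \<in> Q \<longrightarrow> norm (F z) powr p = norm (F1 z) powr p" using F1(2) by eventually_elim auto
    show "AE y in lborel. y \<notin> ?N \<longrightarrow> norm (F1 (S y)) powr p = 0" using strS by (rule eventually_mono) auto
  qed
  have av1: "avg (cylinder p lam x0 t0 \<rho>) (\<lambda>z. norm (Du z) powr p) = I / B1"
  proof -
    have sub: "cylinder p lam x0 t0 (1 * \<rho>) \<subseteq> Q"
    proof -
      have "\<rho>\<^sup>2 \<le> (2 * \<rho>)\<^sup>2" using \<rho> by (intro power_mono) auto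
      then have "lam powr (2 - p) * \<rho>\<^sup>2 \<le> lam powr (2 - p) * (2 * \<rho>)\<^sup>2" by (intro mult_left_mono) auto
      then show ?thesis using \<rho> unfolding Q_def cylinder_def by (intro Sigma_mono) auto
    qed
    have "avg (cylinder p lam x0 t0 (1 * \<rho>)) (\<lambda>z. norm (Du z) powr p) = (\<integral>y. indicator (std_cylinder 1) y * norm (D1 (parabolic_scaling x0 t0 \<rho> (lam powr (2 - p) * \<rho>\<^sup>2) y)) powr p \<partial>lborel)
        / measure lborel (std_cylinder 1 :: ((real^'n) \<times> real) set)"
    proof (rule avg_cylinder[OF \<rho> lam])
      show "(\<lambda>z. norm (D1 z) powr p) \<in> borel_measurable borel" using D1(1) by measurable
      show "AE z in lborel. z \<in> cylinder p lam x0 t0 (1 * \<rho>) \<longrightarrow> norm (Du z) powr p = norm (D1 z) powr p"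
        using D1(2)
      proof eventually_elim
        case (elim z)
        then show ?case using sub by (auto simp: indicator_def split: if_splits)
      qed
    qed simp
    then show ?thesis by (simp add: I_def B1_def S_def \<kappa>_def)
  qed
  have DF0: "0 \<le> DF" by (simp add: DF_def)
  have DFlam: "DF / B2 \<le> lam powr q"
  proof -
    have "(DF / B2) powr (1 / q) \<le> lam" using upp avDF by (simp add: Q_def)
    then have "((DF / B2) powr (1 / q)) powr q \<le> lam powr q" using q by (intro powr_mono2) auto
    then show ?thesis using q DF0 B by (simp add: powr_powr)
  qed
  have Mb: "(\<integral>y. norm (Ds y) powr q \<partial>lborel) \<le> B2"
  proof -
    have "Dq \<le> DF" unfolding Dq_def DF_def using Dqi DFi q by (intro integral_mono powr_mono2) auto
    also have "\<dots> \<le> B2 * lam powr q" using DFlam B by (simp add: pos_divide_le_eq mult.commute)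
    finally have "Dq / lam powr q \<le> B2" using lam by (simp add: pos_divide_le_eq)
    then show ?thesis by (simp add: nD Dq_def)
  qed
  have "unit_flow p q (\<nu> / 2) c1 B2 Us Ds Gs fs"
    unfolding unit_flow_def
  proof (intro conjI)
    show "integrable lborel Us" unfolding Us_def by (intro integrable_scaleR_right si U1i)
    show "integrable lborel Ds" unfolding Ds_def by (intro integrable_scaleR_right si D1i)
    show "integrable lborel Gs" unfolding Gs_def by (intro integrable_scaleR_right si G1i)
    show "integrable lborel (\<lambda>z. norm (Ds z) powr p)" unfolding nD using si[OF Dp] by simp
    show "integrable lborel (\<lambda>z. norm (Ds z) powr q)" unfolding nD using Dqi by simp
    show "integrable lborel (\<lambda>z. norm (Gs z) powr ?p')" unfolding nG using si[OF Gp] by simp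
    show "integrable lborel (\<lambda>z. fs z powr p)" unfolding nf using Fps by simp
    have lp: "0 < lam powr p" using lam by simp
    have bl: "inverse b * inverse lam = inverse (lam powr p)" using b by (metis inverse_mult_distrib)
    show "AE z in lborel. \<nu> / 2 * norm (Ds z) powr p \<le> Gs z \<bullet> Ds z + c1 * fs z powr p"
      using strS
    proof eventually_elim
      case (elim z)
      from conjunct1[OF elim] have "(\<nu> / 2 * norm (D1 (S z)) powr p) / lam powr p \<le> (G1 (S z) \<bullet> D1 (S z) + c1 * norm (F1 (S z)) powr p) / lam powr p"
        using lp by (intro divide_right_mono) auto
      moreover have "Gs z \<bullet> Ds z = (G1 (S z) \<bullet> D1 (S z)) / lam powr p"
        using bl by (simp add: Gs_def Ds_def divide_inverse mult_ac)
      ultimately show ?case by (simp add: nD nf add_divide_distrib)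
    qed
    show "AE z in lborel. norm (Gs z) powr ?p' \<le> c1 * (norm (Ds z) powr p + fs z powr p)"
      using strS
    proof eventually_elim
      case (elim z)
      then have "norm (G1 (S z)) powr ?p' / lam powr p \<le> (c1 * (norm (D1 (S z)) powr p + norm (F1 (S z)) powr p)) / lam powr p"
        using lp by (intro divide_right_mono) auto
      then show ?case by (simp add: nD nf nG add_divide_distrib distrib_left)
    qed
    show "distributional_gradient ?N Us Ds"
      unfolding Us_def[abs_def] Ds_def[abs_def] S_def
      by (rule distributional_scaling(1)[OF \<rho> \<kappa> lam _ U1(1) D1(1) G1m gradQ]) (use SQ in \<open>simp add: S_def\<close>)
    show "distributional_flux ?N Us Gs"
      unfolding Us_def[abs_def] Gs_def[abs_def] S_def
      by (rule distributional_scaling(2)[OF \<rho> \<kappa> lam _ U1(1) D1(1) G1m fluxQ b(3,1)]) (use SQ in \<open>simp add: S_def\<close>)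
    show "(\<integral>z. norm (Ds z) powr q \<partial>lborel) \<le> B2" by (rule Mb)
  qed
  then have "(\<integral>z. indicator (std_cylinder 1) z * norm (Ds z) powr p \<partial>lborel) \<le> C * (1 + (\<integral>z. fs z powr p \<partial>lborel))"
    using C(2) unfolding B2_def by blast
  then have main: "I / lam powr p \<le> C * (1 + FP / lam powr p)"
    by (simp add: nD nf I_def FP_def)
  have split: "DF \<le> 2 powr q * (Dq + Fq)"
  proof -
    have "DF \<le> (\<integral>y. 2 powr q * (norm (D1 (S y)) powr q + norm (F1 (S y)) powr q) \<partial>lborel)"
      unfolding DF_def using DFi Dqi Fqi by (intro integral_mono DFle) auto
    also have "\<dots> = 2 powr q * (Dq + Fq)" using Dqi Fqi by (simp add: Dq_def Fq_def)
    finally show ?thesis .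
  qed
  have jensen: "(Fq / B2) powr (1 / q) \<le> (FP / B2) powr (1 / p)"
  proof -
    have Fs0: "AE y in lborel. indicator ?N y * norm (F1 (S y)) powr r = norm (F1 (S y)) powr r" for r
      using strS by (rule eventually_mono) (auto simp: indicator_def)
    have Nm: "(indicator ?N :: _ \<Rightarrow> real) \<in> borel_measurable lborel" by (rule borel_measurable_indicator[OF N(1)])
    have nFm: "(\<lambda>y. norm (F1 (S y)) powr r) \<in> borel_measurable lborel" for r using Dm(2) by simp
    have eqr: "(\<integral>y. indicator ?N y * norm (F1 (S y)) powr r \<partial>lborel) = (\<integral>y. norm (F1 (S y)) powr r \<partial>lborel)" for r
      by (rule integral_cong_AE[OF borel_measurable_times[OF Nm nFm] nFm Fs0])
    have ii: "integrable lborel (\<lambda>y. indicator ?N y * norm (F1 (S y)) powr p)"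
      by (rule integrable_cong_AE[THEN iffD2, OF borel_measurable_times[OF Nm nFm] nFm Fs0 Fps])
    have pq: "1 \<le> p / q" using q by simp
    have e: "(norm (F1 (S y)) powr q) powr (p / q) = norm (F1 (S y)) powr p" for y using q by (simp add: powr_powr)
    have "(\<integral>y. indicator ?N y * norm (F1 (S y)) powr q \<partial>lborel) powr (p / q)
        \<le> (\<integral>y. indicator ?N y \<partial>lborel) powr (p / q - 1) * (\<integral>y. indicator ?N y * (norm (F1 (S y)) powr q) powr (p / q) \<partial>lborel)"
    proof (rule Jensen_powr(2)[OF pq])
      show "integrable lborel (indicator ?N :: _ \<Rightarrow> real)" using N by (intro integrable_real_indicator) auto
      show "integrable lborel (\<lambda>y. indicator ?N y * (norm (F1 (S y)) powr q) powr (p / q))" unfolding e by (rule ii)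
    qed auto
    then have J: "Fq powr (p / q) \<le> B2 powr (p / q - 1) * FP"
      unfolding e eqr by (simp add: Fq_def FP_def B2_def)
    have Fq0: "0 \<le> Fq" and FP0: "0 \<le> FP" by (simp_all add: Fq_def FP_def)
    have "(Fq / B2) powr (p / q) = Fq powr (p / q) / B2 powr (p / q)" by (rule powr_divide)
    also have "\<dots> \<le> B2 powr (p / q - 1) * FP / B2 powr (p / q)" using J by (intro divide_right_mono) auto
    also have "\<dots> = FP / B2" using B by (simp add: powr_diff)
    finally have "((Fq / B2) powr (p / q)) powr (1 / p) \<le> (FP / B2) powr (1 / p)" using p by (intro powr_mono2) auto
    then show ?thesis using p by (simp add: powr_powr)
  qed
  have nn: "0 \<le> I" "0 \<le> Dq" "0 \<le> Fq" "0 \<le> FP" by (simp_all add: I_def Dq_def Fq_def FP_def)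
  have low': "inverse \<gamma> * lam \<le> (DF / B2) powr (1 / q)" using low avDF by (simp add: Q_def)
  have "(I / B1) powr (1 / p) \<le> c * (Dq / B2) powr (1 / q) + c * (FP / B2) powr (1 / p)"
    by (rule reverse_Holder_of_rescaled_bound[OF p q(1) C(1) B pos(3) lam nn DF0 main low' split jensen]) (simp add: c B1_def B2_def)
  then show ?thesis using av1 avD avF by (simp add: Q_def)
qed

theorem theorem7p6:
  fixes p q \<nu> L \<gamma> :: real
  assumes "1 < p" and "2 * real CARD('n::finite) / (real CARD('n) + 2) < p"
    and "1 < q" and "q < p"
    and "max 2 p < q * (real CARD('n) + 2) / (real CARD('n) + p - q)"
    and "0 < \<nu>" and "\<nu> < L" and "1 < \<gamma>"
  shows "\<exists>c>0. \<forall>(\<Omega> :: (real^'n) set) (T :: real)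
      (A :: (real^'n) \<times> real \<Rightarrow> real^'n^'m::finite \<Rightarrow> real^'n^'m)
      (F :: (real^'n) \<times> real \<Rightarrow> real^'n^'m)
      (u :: (real^'n) \<times> real \<Rightarrow> real^'m) (Du :: (real^'n) \<times> real \<Rightarrow> real^'n^'m)
      (x\<^sub>0 :: real^'n) (t\<^sub>0 :: real) (\<rho> :: real) (lam :: real).
    open \<Omega> \<and> connected \<Omega> \<and> bounded \<Omega> \<and> \<Omega> \<noteq> {} \<and> 0 < T
    \<and> caratheodory (space_time \<Omega> T) A \<and> p_growth p \<nu> L (space_time \<Omega> T) A
    \<and> F \<in> borel_measurable (lebesgue_on (space_time \<Omega> T))
    \<and> Lp_loc p (space_time \<Omega> T) (\<lambda>z. norm (F z))
    \<and> Lp_loc_W1p_loc p \<Omega> T u Du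
    \<and> weak_solution p \<Omega> T A F u Du
    \<and> 0 < \<rho> \<and> 0 < lam
    \<and> compactly_contained (cylinder p lam x\<^sub>0 t\<^sub>0 (2 * \<rho>)) (space_time \<Omega> T)
    \<and> (\<forall>\<alpha>. 1 \<le> \<alpha> \<and> \<alpha> \<le> 2 \<longrightarrow>
         inverse \<gamma> * lam
           \<le> avg (cylinder p lam x\<^sub>0 t\<^sub>0 (\<alpha> * \<rho>)) (\<lambda>z. (norm (Du z) + norm (F z)) powr q) powr (1 / q)
         \<and> avg (cylinder p lam x\<^sub>0 t\<^sub>0 (\<alpha> * \<rho>)) (\<lambda>z. (norm (Du z) + norm (F z)) powr q) powr (1 / q)
           \<le> lam)
    \<longrightarrow> avg (cylinder p lam x\<^sub>0 t\<^sub>0 \<rho>) (\<lambda>z. norm (Du z) powr p) powr (1 / p)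
        \<le> c * avg (cylinder p lam x\<^sub>0 t\<^sub>0 (2 * \<rho>)) (\<lambda>z. norm (Du z) powr q) powr (1 / q)
          + c * avg (cylinder p lam x\<^sub>0 t\<^sub>0 (2 * \<rho>)) (\<lambda>z. norm (F z) powr p) powr (1 / p)"
proof -
  have L: "0 < L" using assms by simp
  have "1 \<le> real CARD('n)" using zero_less_card_finite[where 'a='n] by simp
  note gap = reverse_Holder_exponents[OF this assms(1,3,4,5)]
  obtain c1 where c1: "0 \<le> c1" and st: "\<forall>(a :: real^'n^'m) \<xi> F. \<nu> * norm \<xi> powr p \<le> a \<bullet> \<xi> \<longrightarrow> norm a \<le> L * norm \<xi> powr (p - 1) \<longrightarrow>
      \<nu> / 2 * norm \<xi> powr p \<le> (a - norm F powr (p - 2) *\<^sub>R F) \<bullet> \<xi> + c1 * norm F powr p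
      \<and> norm (a - norm F powr (p - 2) *\<^sub>R F) powr (p / (p - 1)) \<le> c1 * (norm \<xi> powr p + norm F powr p)"
    by (rule structure_bounds[OF assms(1,6) L]) (rule that)
  have \<nu>2: "0 < \<nu> / 2" using assms by simp
  obtain C where C: "0 \<le> C" "\<forall>(U :: (real^'n) \<times> real \<Rightarrow> real^'m) D G f.
        unit_flow p q (\<nu> / 2) c1 (measure lborel (std_cylinder 2 :: ((real^'n) \<times> real) set)) U D G f \<longrightarrow>
      (\<integral>z. indicator (std_cylinder 1) z * norm (D z) powr p \<partial>lborel) \<le> C * (1 + (\<integral>z. f z powr p \<partial>lborel))"
    by (rule unit_cylinder_estimate[OF assms(1,3,4) gap \<nu>2 c1 measure_nonneg]) (rule that)
  define c where "c = (C / measure lborel (std_cylinder 1 :: ((real^'n) \<times> real) set)) powr (1 / p)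
       * (2 * (4 * \<gamma> + measure lborel (std_cylinder 2 :: ((real^'n) \<times> real) set) powr (1 / p))) + 1"
  have c0: "0 < c"
    unfolding c_def using assms by (intro add_nonneg_pos mult_nonneg_nonneg add_nonneg_nonneg) auto
  show ?thesis
  proof (intro exI[of _ c] conjI c0 allI impI)
    fix \<Omega> :: "(real^'n) set" and T and A :: "(real^'n) \<times> real \<Rightarrow> real^'n^'m \<Rightarrow> real^'n^'m" and F
      and u :: "(real^'n) \<times> real \<Rightarrow> real^'m" and Du x0 t0 \<rho> lam
    assume H: "open \<Omega> \<and> connected \<Omega> \<and> bounded \<Omega> \<and> \<Omega> \<noteq> {} \<and> 0 < T
    \<and> caratheodory (space_time \<Omega> T) A \<and> p_growth p \<nu> L (space_time \<Omega> T) A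
    \<and> F \<in> borel_measurable (lebesgue_on (space_time \<Omega> T))
    \<and> Lp_loc p (space_time \<Omega> T) (\<lambda>z. norm (F z))
    \<and> Lp_loc_W1p_loc p \<Omega> T u Du
    \<and> weak_solution p \<Omega> T A F u Du
    \<and> 0 < \<rho> \<and> 0 < lam
    \<and> compactly_contained (cylinder p lam x0 t0 (2 * \<rho>)) (space_time \<Omega> T)
    \<and> (\<forall>\<alpha>. 1 \<le> \<alpha> \<and> \<alpha> \<le> 2 \<longrightarrow>
         inverse \<gamma> * lam
           \<le> avg (cylinder p lam x0 t0 (\<alpha> * \<rho>)) (\<lambda>z. (norm (Du z) + norm (F z)) powr q) powr (1 / q)
         \<and> avg (cylinder p lam x0 t0 (\<alpha> * \<rho>)) (\<lambda>z. (norm (Du z) + norm (F z)) powr q) powr (1 / q)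
           \<le> lam)"
    then have two: "inverse \<gamma> * lam \<le> avg (cylinder p lam x0 t0 (2 * \<rho>)) (\<lambda>z. (norm (Du z) + norm (F z)) powr q) powr (1 / q)"
      "avg (cylinder p lam x0 t0 (2 * \<rho>)) (\<lambda>z. (norm (Du z) + norm (F z)) powr q) powr (1 / q) \<le> lam"
      by (auto dest: spec[of _ 2])
    show "avg (cylinder p lam x0 t0 \<rho>) (\<lambda>z. norm (Du z) powr p) powr (1 / p)
        \<le> c * avg (cylinder p lam x0 t0 (2 * \<rho>)) (\<lambda>z. norm (Du z) powr q) powr (1 / q)
          + c * avg (cylinder p lam x0 t0 (2 * \<rho>)) (\<lambda>z. norm (F z) powr p) powr (1 / p)"
      by (rule reverse_Holder_cylinder[OF assms(1,3,4,6) L assms(8) c1 st C c_def, where \<Omega>=\<Omega> and T=T and A=A and u=u])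
         (use H two in blast)+
  qed
qed

end
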